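(* Let $U,V$ be real Banach spaces and let $\mathfrak{F}\in\mathcal{C}^1(\mathbb{R}\times U,V)$ satisfy: (F1) $\mathfrak{F}(\lambda,0)=0$ for all $\lambda\in\mathbb{R}$; (F2) $\mathfrak{F}$ is orientable; (F3) $D_u\mathfrak{F}(\lambda,u)\in\Phi_0(U,V)$ for all $\lambda\in\mathbb{R}$ and $u\in U$; (F4) $\mathfrak{F}$ is proper on closed and bounded subsets of $\mathbb{R}\times U$; (F5) $\lambda_0$ is an isolated eigenvalue of $\mathfrak{L}(\lambda):=D_u\mathfrak{F}(\lambda,0)$ such that $N[\mathfrak{L}(\lambda_0)]=\mathrm{span}[\varphi_0]$ for some $\varphi_0\in U$ with $\|\varphi_0\|=1$ and $\mathfrak{L}'(\lambda_0)\varphi_0\notin R[\mathfrak{L}(\lambda_0)]$, i.e., $\chi[\mathfrak{L},\lambda_0]=1$. Suppose, in addition, that $\psi$ is of class $\mathcal{C}^1$. Then the set of nontrivial solutions, $\mathcal{S}$, possesses a connected component $\mathfrak{C}$ such that $(\lambda_0,0)\in\mathfrak{C}$ and, choosing $\varepsilon>0$ and $\delta>0$ sufficiently small so that $[\mathcal{S}\setminus\{(\lambda_0,0)\}]\cap B_\delta(\lambda_0,0)\subset Q_{\varepsilon,\eta}$, there exist two closed connected subsets $\mathfrak{C}_\delta^+,\mathfrak{C}_\delta^-\subset\mathfrak{C}\cap B_\delta(\lambda_0,0)$ such that $\mathfrak{C}_\delta^+\subset Q_{\varepsilon,\eta}^+\cup\{(\lambda_0,0)\}$, $\mathfrak{C}_\delta^-\subset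 Q_{\varepsilon,\eta}^-\cup\{(\lambda_0,0)\}$ and $\mathfrak{C}_\delta^+\cap\mathfrak{C}_\delta^-=\{(\lambda_0,0)\}$. Moreover, $\mathfrak{C}_\delta^+$ and $\mathfrak{C}_\delta^-$ link $(\lambda_0,0)$ to $\partial B_\delta(\lambda_0,0)$. Furthermore, setting $\mathfrak{C}^+:=\mathscr{C}^+\cup\{(\lambda_0,0)\}$ and $\mathfrak{C}^-:=\mathscr{C}^-\cup\{(\lambda_0,0)\}$, where $\mathscr{C}^+$ (resp. $\mathscr{C}^-$) is the connected component of $\mathcal{S}\setminus\{(\lambda_0,0)\}$ containing $\mathfrak{C}_\delta^+\setminus\{(\lambda_0,0)\}$ (resp. $\mathfrak{C}_\delta^-\setminus\{(\lambda_0,0)\}$), then for every $\nu\in\{-,+\}$ some of the following alternatives hold: (i) $\mathfrak{C}^\nu$ is not compact in $\mathbb{R}\times U$. (ii) There exists $\lambda_1\neq\lambda_0$ such that $(\lambda_1,0)\in\mathfrak{C}^\nu$. (iii) There exist $\lambda\in\mathbb{R}$ and $z\in Z\setminus\{0\}$ such that $(\lambda,z)\in\mathfrak{C}^\nu$.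
   Context: $\Phi_0(U,V)$: bounded linear Fredholm operators of index zero; $GL(U,V)$: topological isomorphisms; $N[\cdot]$, $R[\cdot]$: kernel and range; $\Sigma(\mathfrak{L})=\{\lambda:\mathfrak{L}(\lambda)\notin GL(U,V)\}$. $\mathcal{T}=\{(\lambda,0):\lambda\in\mathbb{R}\}$ and the set of nontrivial solutions is $\mathcal{S}=[\mathfrak{F}^{-1}(0)\setminus\mathcal{T}]\cup\{(\lambda,0):\lambda\in\Sigma(\mathfrak{L})\}$. $B_\delta(\lambda_0,0)$ is the ball of radius $\delta$ centred at $(\lambda_0,0)$ in $\mathbb{R}\times U$. $\chi[\mathfrak{L},\lambda_0]$ is the generalized algebraic multiplicity of $\mathfrak{L}$ at $\lambda_0$; when $\mathfrak{L}'(\lambda_0)(N[\mathfrak{L}(\lambda_0)])\oplus R[\mathfrak{L}(\lambda_0)]=V$, as in (F5), it equals $\dim\mathfrak{L}'(\lambda_0)(N[\mathfrak{L}(\lambda_0)])$, which is $1$ here. Orientability of $\mathfrak{F}$: for a continuous path $\mathfrak{M}:[a,b]\to\Phi_0(U,V)$ with invertible endpoints, the parity is $\sigma(\mathfrak{M},[a,b])=\deg_{LS}(\mathfrak{P}(a)\mathfrak{M}(a))\deg_{LS}(\mathfrak{P}(b)\mathfrak{M}(b))\in\{\pm1\}$, where $\mathfrak{P}:[a,b]\to GL(V,U)$ is continuous with $\mathfrak{P}(t)\mathfrak{M}(t)-I_U$ compact for all $t$, and $\deg_{LS}(T)$ is the Leray--Schauder degree of $T$ on a small ball centred at $0$. $\mathfrak{F}$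 is orientable if there is a map $\mathfrak{o}:\{(\lambda,u):D_u\mathfrak{F}(\lambda,u)\in GL(U,V)\}\to\{-1,1\}$ with $\sigma(D_u\mathfrak{F}\circ\gamma,[a,b])=\mathfrak{o}(\gamma(a))\,\mathfrak{o}(\gamma(b))$ for every continuous $\gamma:[a,b]\to\mathbb{R}\times U$ whose endpoints lie in that set. Cones: $Z\subset U$ is a fixed closed subspace with $U=N[\mathfrak{L}(\lambda_0)]\oplus Z$, and $\varphi_0^*\in U'$ satisfies $Z=N[\varphi_0^*]$ and $\langle\varphi_0^*,\varphi_0\rangle=1$. $\psi:U\to\mathbb{R}$ is a fixed continuous functional such that, for some constants $0<C_1<C_2$, $\psi(0)=0$ and $C_1\|u\|\leq\psi(u)\leq C_2\|u\|$ for all $u\in U$; $\eta\in(0,1/C_2)$ is fixed. For $\varepsilon>0$, $Q_{\varepsilon,\eta}=\{(\lambda,u)\in\mathbb{R}\times U:|\lambda-\lambda_0|<\varepsilon,\ |\langle\varphi_0^*,u\rangle|>\eta\psi(u)\}$, $Q_{\varepsilon,\eta}^+=\{(\lambda,u)\in\mathbb{R}\times U:|\lambda-\lambda_0|<\varepsilon,\ \langle\varphi_0^*,u\rangle>\eta\psi(u)\}$, $Q_{\varepsilon,\eta}^-=\{(\lambda,u)\in\mathbb{R}\times U:|\lambda-\lambda_0|<\varepsilon,\ \langle\varphi_0^*,u\rangle<-\eta\psi(u)\}$. Under (F1)--(F5), for sufficiently small $\varepsilon>0$ there is $\delta_0=\delta_0(\eta)>0$ such that, for every $\delta\in(0,\delta_0)$,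 $[\mathcal{S}\setminus\{(\lambda_0,0)\}]\cap B_\delta(\lambda_0,0)\subset Q_{\varepsilon,\eta}$; $\varepsilon$ and $\delta$ in the claim are chosen in this way.
   Formalization: ψ is required to be of class C¹ only on U∖{0}, since ψ(0)=0 and ψ(u) ≥ C₁‖u‖ rule out differentiability at 0; B_δ(λ₀,0) is read as the closed ball, so that the closed sets C_δ^± can lie in it and reach its boundary. *)

theory Defs
  imports "HOL-Analysis.Analysis" "HOL-Homology.Homology"
begin

definition null_space :: "('u::real_normed_vector \<Rightarrow>\<^sub>L 'v::real_normed_vector) \<Rightarrow> 'u set" where
  "null_space A = {x. blinfun_apply A x = 0}"

definition GL :: "('u::real_normed_vector \<Rightarrow>\<^sub>L 'v::real_normed_vector) set" where
  "GL = {A. \<exists>B. A o\<^sub>L B = id_blinfun \<and> B o\<^sub>L A = id_blinfun}"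

definition finite_dim :: "'u::real_vector set \<Rightarrow> bool" where
  "finite_dim S \<longleftrightarrow> (\<exists>B. finite B \<and> S \<subseteq> span B)"

definition finite_codim :: "'u::real_vector set \<Rightarrow> bool" where
  "finite_codim S \<longleftrightarrow> (\<exists>C. finite C \<and> span (S \<union> C) = UNIV)"

text \<open>Dimension of the quotient by a subspace \<open>S\<close> of finite codimension.\<close>

definition codim :: "'u::real_vector set \<Rightarrow> nat" where
  "codim S = (LEAST n. \<exists>C. finite C \<and> card C = n \<and> span (S \<union> C) = UNIV)"

definition fredholm :: "('u::real_normed_vector \<Rightarrow>\<^sub>L 'v::real_normed_vector) \<Rightarrow> bool" where
  "fredholm A \<longleftrightarrow> finite_dim (null_space A) \<and>
     closed (range (blinfun_apply A)) \<and> finite_codim (range (blinfun_apply A))"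

definition fredholm_index :: "('u::real_normed_vector \<Rightarrow>\<^sub>L 'v::real_normed_vector) \<Rightarrow> int" where
  "fredholm_index A = int (dim (null_space A)) - int (codim (range (blinfun_apply A)))"

definition Fredholm0 :: "('u::real_normed_vector \<Rightarrow>\<^sub>L 'v::real_normed_vector) set" where
  "Fredholm0 = {A. fredholm A \<and> fredholm_index A = 0}"

definition compact_operator :: "('u::real_normed_vector \<Rightarrow>\<^sub>L 'v::real_normed_vector) \<Rightarrow> bool" where
  "compact_operator K \<longleftrightarrow> (\<forall>S. bounded S \<longrightarrow> compact (closure (blinfun_apply K ` S)))"

definition direct_sum_decomposition :: "'u::real_vector set \<Rightarrow> 'u set \<Rightarrow> bool" where
  "direct_sum_decomposition M Z \<longleftrightarrow> subspace M \<and> subspace Z \<and> M \<inter> Z = {0} \<and>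
     (\<forall>x. \<exists>m\<in>M. \<exists>z\<in>Z. x = m + z)"

text \<open>
  The list \<open>bs\<close> is a basis of a finite-dimensional subspace \<open>E\<close>; vectors of \<open>E\<close> are described by
  their coordinates, which are elements of \<^term>\<open>topspace (Euclidean_space (length bs))\<close>.
\<close>

definition from_coords :: "'u::real_vector list \<Rightarrow> (nat \<Rightarrow> real) \<Rightarrow> 'u" where
  "from_coords bs x = (\<Sum>i<length bs. x i *\<^sub>R bs ! i)"

definition to_coords :: "'u::real_vector list \<Rightarrow> 'u \<Rightarrow> nat \<Rightarrow> real" where
  "to_coords bs v i = (if i < length bs then representation (set bs) v (bs ! i) else 0)"

definition normalize_coords :: "nat \<Rightarrow> (nat \<Rightarrow> real) \<Rightarrow> nat \<Rightarrow> real" where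
  "normalize_coords n y i = y i / sqrt (\<Sum>j<n. (y j)\<^sup>2)"

text \<open>
  Brouwer degree with respect to \<open>0\<close> of a continuous map \<open>f\<close> from the closed ball of radius \<open>r\<close>
  of \<open>E\<close> into \<open>E\<close> without zeros on the boundary sphere: the degree of the self-map of the
  Euclidean unit sphere that projects \<open>x\<close> radially to the sphere of radius \<open>r\<close> of \<open>E\<close>, applies
  \<open>f\<close>, and normalizes. If \<open>E\<close> is trivial, \<open>f\<close> is the map of a single point and has degree \<open>1\<close>.
\<close>

definition brouwer_degree_ball :: "'u::real_normed_vector list \<Rightarrow> ('u \<Rightarrow> 'u) \<Rightarrow> real \<Rightarrow> int" where
  "brouwer_degree_ball bs f r =
     (if bs = [] then 1
      else Brouwer_degree2 (length bs - 1)
             (\<lambda>x. normalize_coords (length bs)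
                (to_coords bs (f ((r / norm (from_coords bs x)) *\<^sub>R from_coords bs x)))))"

text \<open>
  Leray--Schauder degree with respect to \<open>0\<close> on the ball of radius \<open>r\<close>, for a compact
  perturbation \<open>f\<close> of the identity without zeros on the sphere: the common Brouwer degree of all
  sufficiently close approximations \<open>x \<mapsto> x - k x\<close> by (in general nonlinear) maps \<open>k\<close> with
  values in a finite-dimensional subspace, restricted to that subspace.
\<close>

definition leray_schauder_degree_ball :: "('u::real_normed_vector \<Rightarrow> 'u) \<Rightarrow> real \<Rightarrow> int" where
  "leray_schauder_degree_ball f r =
     (THE d. \<exists>e>0. \<forall>bs k.
        distinct bs \<and> independent (set bs) \<and>
        continuous_on (cball 0 r) k \<and> k ` cball 0 r \<subseteq> span (set bs) \<and>
        (\<forall>x\<in>cball 0 r. norm (f x - (x - k x)) < e)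
        \<longrightarrow> brouwer_degree_ball bs (\<lambda>x. x - k x) r = d)"

definition deg_LS :: "('u::real_normed_vector \<Rightarrow>\<^sub>L 'u) \<Rightarrow> int" where
  "deg_LS T = (THE d. \<forall>\<^sub>F r in at_right 0. leray_schauder_degree_ball (blinfun_apply T) r = d)"

definition parametrix ::
  "(real \<Rightarrow> 'v::real_normed_vector \<Rightarrow>\<^sub>L 'u::real_normed_vector) \<Rightarrow> (real \<Rightarrow> 'u \<Rightarrow>\<^sub>L 'v) \<Rightarrow> real \<Rightarrow> real \<Rightarrow> bool" where
  "parametrix P M a b \<longleftrightarrow> continuous_on {a..b} P \<and>
     (\<forall>t\<in>{a..b}. P t \<in> GL \<and> compact_operator ((P t o\<^sub>L M t) - id_blinfun))"

definition parity ::
  "(real \<Rightarrow> 'u::real_normed_vector \<Rightarrow>\<^sub>L 'v::real_normed_vector) \<Rightarrow> real \<Rightarrow> real \<Rightarrow> int" where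
  "parity M a b =
     (THE s. \<exists>P. parametrix P M a b \<and> s = deg_LS (P a o\<^sub>L M a) * deg_LS (P b o\<^sub>L M b))"

definition D_u ::
  "(real \<times> 'u::real_normed_vector \<Rightarrow> 'v::real_normed_vector) \<Rightarrow> real \<times> 'u \<Rightarrow> 'u \<Rightarrow>\<^sub>L 'v" where
  "D_u F p = Blinfun (frechet_derivative (\<lambda>w. F (fst p, w)) (at (snd p)))"

definition orientable ::
  "(real \<times> 'u::real_normed_vector \<Rightarrow> 'v::real_normed_vector) \<Rightarrow> bool" where
  "orientable F \<longleftrightarrow> (\<exists>or :: real \<times> 'u \<Rightarrow> int.
     (\<forall>p. D_u F p \<in> GL \<longrightarrow> or p \<in> {-1, 1}) \<and>
     (\<forall>a b \<gamma>. a < b \<and> continuous_on {a..b} \<gamma> \<and> D_u F (\<gamma> a) \<in> GL \<and> D_u F (\<gamma> b) \<in> GL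
        \<longrightarrow> parity (\<lambda>t. D_u F (\<gamma> t)) a b = or (\<gamma> a) * or (\<gamma> b)))"

text \<open>Class \<open>C\<^sup>1\<close> on an open set \<open>S\<close>.\<close>

definition C1_on ::
  "'a::real_normed_vector set \<Rightarrow> ('a \<Rightarrow> 'b::real_normed_vector) \<Rightarrow> bool" where
  "C1_on S f \<longleftrightarrow> (\<exists>f'. (\<forall>x\<in>S. (f has_derivative blinfun_apply (f' x)) (at x)) \<and> continuous_on S f')"

definition proper_on_closed_bounded ::
  "('a::metric_space \<Rightarrow> 'b::topological_space) \<Rightarrow> bool" where
  "proper_on_closed_bounded F \<longleftrightarrow>
     (\<forall>B K. closed B \<and> bounded B \<and> compact K \<longrightarrow> compact {p \<in> B. F p \<in> K})"

definition linearization ::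
  "(real \<times> 'u::real_normed_vector \<Rightarrow> 'v::real_normed_vector) \<Rightarrow> real \<Rightarrow> 'u \<Rightarrow>\<^sub>L 'v" where
  "linearization F l = D_u F (l, 0)"

definition gen_spectrum ::
  "(real \<Rightarrow> 'u::real_normed_vector \<Rightarrow>\<^sub>L 'v::real_normed_vector) \<Rightarrow> real set" where
  "gen_spectrum L = {l. L l \<notin> GL}"

definition trivial_branch :: "(real \<times> 'u::zero) set" where
  "trivial_branch = {(l, 0) | l. True}"

definition nontrivial_solutions ::
  "(real \<times> 'u::real_normed_vector \<Rightarrow> 'v::real_normed_vector) \<Rightarrow> (real \<times> 'u) set" where
  "nontrivial_solutions F =
     (F -` {0} - trivial_branch) \<union> {(l, 0) | l. l \<in> gen_spectrum (linearization F)}"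

definition cone_Q ::
  "real \<Rightarrow> ('u::real_normed_vector \<Rightarrow>\<^sub>L real) \<Rightarrow> ('u \<Rightarrow> real) \<Rightarrow> real \<Rightarrow> real \<Rightarrow> (real \<times> 'u) set" where
  "cone_Q l0 \<phi>s \<psi> \<epsilon> \<eta> = {(l, u). \<bar>l - l0\<bar> < \<epsilon> \<and> \<bar>blinfun_apply \<phi>s u\<bar> > \<eta> * \<psi> u}"

definition cone_Qplus ::
  "real \<Rightarrow> ('u::real_normed_vector \<Rightarrow>\<^sub>L real) \<Rightarrow> ('u \<Rightarrow> real) \<Rightarrow> real \<Rightarrow> real \<Rightarrow> (real \<times> 'u) set" where
  "cone_Qplus l0 \<phi>s \<psi> \<epsilon> \<eta> = {(l, u). \<bar>l - l0\<bar> < \<epsilon> \<and> blinfun_apply \<phi>s u > \<eta> * \<psi> u}"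

definition cone_Qminus ::
  "real \<Rightarrow> ('u::real_normed_vector \<Rightarrow>\<^sub>L real) \<Rightarrow> ('u \<Rightarrow> real) \<Rightarrow> real \<Rightarrow> real \<Rightarrow> (real \<times> 'u) set" where
  "cone_Qminus l0 \<phi>s \<psi> \<epsilon> \<eta> = {(l, u). \<bar>l - l0\<bar> < \<epsilon> \<and> blinfun_apply \<phi>s u < - (\<eta> * \<psi> u)}"

end

theory Submission
  imports Defs
begin

text \<open>
  Let \<open>S\<^sup>+\<close> be the part of the solution set in the half space \<open>\<phi>s \<ge> 0\<close>. The core is that every
  compact relatively open part \<open>B\<close> of \<open>S\<^sup>+\<close> around \<open>(l0, 0)\<close> meets \<open>{\<phi>s = 0}\<close> in another point.
  Otherwise, the equations \<open>F = 0\<close>, \<open>\<phi>s = s\<close> near \<open>B\<close> have, for small \<open>s > 0\<close>, an odd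
  number of solutions: a deformation along \<open>L' \<phi>0\<close> leads to a system with one nondegenerate zero,
  because \<open>\<langle>\<omega>, F\<rangle>\<close>, with \<open>\<omega>\<close> vanishing on the range of \<open>L(l0)\<close>, changes sign with \<open>l - l0\<close> by
  transversality. For large \<open>s\<close> there is no solution. Preimages of finite-dimensional subspaces
  under Fredholm maps reduce this to manifolds of finite dimension, where the parity of the number
  of zeros is preserved by a count of simplices of a triangulation.

  By Zorn's lemma there is a minimal closed subset of \<open>S\<^sup>+\<close> with the property just described. By
  minimality it becomes connected after removing \<open>(l0, 0)\<close> and the other points with \<open>\<phi>s = 0\<close>, and
  this connected set gives the branch in the positive cone. The negative branch follows by replacing
  \<open>\<phi>0\<close> and \<open>\<phi>s\<close> by their negatives.
\<close>

section \<open>The Hahn--Banach theorem\<close>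

lemma subspace_dist_line:
  fixes S :: "'a::real_normed_vector set"
  assumes S: "subspace S" "closed S" and b: "b \<notin> S"
  obtains d where "d > 0" "\<And>t s. s \<in> S \<Longrightarrow> \<bar>t\<bar> * d \<le> norm (t *\<^sub>R b + s)"
proof
  have ne: "S \<noteq> {}" using S(1) subspace_0 by blast
  show "infdist b S > 0"
    using in_closed_iff_infdist_zero[OF S(2) ne, of b] b infdist_nonneg[of b S] by linarith
  show "\<bar>t\<bar> * infdist b S \<le> norm (t *\<^sub>R b + s)" if s: "s \<in> S" for t s
  proof (cases "t = 0")
    case False
    have "- ((1/t) *\<^sub>R s) \<in> S"
      using S(1) s by (simp add: subspace_neg subspace_scale)
    then have "infdist b S \<le> dist b (- ((1/t) *\<^sub>R s))" by (rule infdist_le)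
    also have "\<dots> = norm ((1/t) *\<^sub>R (t *\<^sub>R b + s))"
      using False by (simp add: dist_norm scaleR_add_right)
    also have "\<dots> = norm (t *\<^sub>R b + s) / \<bar>t\<bar>" by simp
    finally show ?thesis using False by (simp add: field_simps)
  qed simp
qed

text \<open>
  A linear functional bounded by \<open>C * norm\<close> on a subspace is represented by its graph: a subspace
  \<open>G\<close> of the product in which \<open>(z, r) \<in> G\<close> implies \<open>r \<le> C * norm z\<close>.
\<close>

lemma graph_extension_value:
  fixes G :: "('a::real_normed_vector \<times> real) set"
  assumes G: "subspace G" "\<And>z r. (z, r) \<in> G \<Longrightarrow> r \<le> C * norm z" and C: "C \<ge> 0"
  obtains a where "\<And>z r. (z, r) \<in> G \<Longrightarrow> r - C * norm (z - y) \<le> a"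
    and "\<And>z r. (z, r) \<in> G \<Longrightarrow> a \<le> C * norm (z + y) - r"
proof -
  define A where "A = (\<lambda>(z, r). r - C * norm (z - y)) ` G"
  have ub: "r - C * norm (z - y) \<le> C * norm (z' + y) - r'" if "(z, r) \<in> G" "(z', r') \<in> G" for z r z' r'
  proof -
    have "(z + z', r + r') \<in> G" using subspace_add[OF G(1) that] by simp
    then have "r + r' \<le> C * norm (z + z')" by (rule G(2))
    also have "z + z' = (z - y) + (z' + y)" by simp
    also have "C * norm \<dots> \<le> C * (norm (z - y) + norm (z' + y))"
      by (intro mult_left_mono norm_triangle_ineq C)
    finally show ?thesis by (simp add: algebra_simps)
  qed
  have zero: "(0, 0) \<in> G" using subspace_0[OF G(1)] by (simp add: zero_prod_def)
  then have ne: "A \<noteq> {}" unfolding A_def by blast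
  have bdd: "bdd_above A" unfolding A_def bdd_above_def using ub[OF _ zero] by fastforce
  show ?thesis
  proof (rule that[of "Sup A"])
    show "r - C * norm (z - y) \<le> Sup A" if "(z, r) \<in> G" for z r
      by (rule cSup_upper) (use that bdd in \<open>auto simp: A_def\<close>)
    show "Sup A \<le> C * norm (z + y) - r" if "(z, r) \<in> G" for z r
      by (rule cSup_least[OF ne]) (use ub that in \<open>auto simp: A_def\<close>)
  qed
qed

lemma graph_extension_bound:
  fixes G :: "('a::real_normed_vector \<times> real) set"
  assumes G: "subspace G" "\<And>z r. (z, r) \<in> G \<Longrightarrow> r \<le> C * norm z"
    and lower: "\<And>z r. (z, r) \<in> G \<Longrightarrow> r - C * norm (z - y) \<le> a"
    and upper: "\<And>z r. (z, r) \<in> G \<Longrightarrow> a \<le> C * norm (z + y) - r"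
    and zr: "(z, r) \<in> G"
  shows "r + t * a \<le> C * norm (z + t *\<^sub>R y)"
proof -
  have scaled: "((1/u) *\<^sub>R z, r / u) \<in> G" for u
    using subspace_scale[OF G(1) zr, of "1/u"] by simp
  have norm_scaled: "u * norm ((1/u) *\<^sub>R z + w) = norm (z + u *\<^sub>R w)" if "u > 0" for u w
    using that norm_scaleR[of u "(1/u) *\<^sub>R z + w"] by (simp add: scaleR_add_right)
  consider "t = 0" | "t > 0" | u where "t = - u" "u > 0" by (metis linorder_neqE neg_0_less_iff_less minus_minus)
  then show ?thesis
  proof cases
    case 1 then show ?thesis using G(2)[OF zr] by simp
  next
    case 2
    have "t * a \<le> t * (C * norm ((1/t) *\<^sub>R z + y) - r / t)"
      using upper[OF scaled] 2 by (intro mult_left_mono) auto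
    also have "\<dots> = C * norm (z + t *\<^sub>R y) - r"
      using 2 by (simp add: right_diff_distrib norm_scaled[symmetric])
    finally show ?thesis by simp
  next
    case (3 u)
    have "u * (r / u - C * norm ((1/u) *\<^sub>R z - y)) \<le> u * a"
      using lower[OF scaled] 3 by (intro mult_left_mono) auto
    moreover have "u * norm ((1/u) *\<^sub>R z - y) = norm (z - u *\<^sub>R y)"
      using norm_scaled[OF 3(2), of "- y"] by simp
    ultimately have "r - C * norm (z - u *\<^sub>R y) \<le> u * a"
      using 3(2) by (simp add: right_diff_distrib mult.left_commute)
    then show ?thesis using 3(1) by simp
  qed
qed

lemma graph_extension_step:
  fixes G :: "('a::real_normed_vector \<times> real) set"
  assumes G: "subspace G" "\<And>z r. (z, r) \<in> G \<Longrightarrow> r \<le> C * norm z" and C: "C \<ge> 0"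
  shows "\<exists>G'. G \<subseteq> G' \<and> subspace G' \<and> (\<forall>z r. (z, r) \<in> G' \<longrightarrow> r \<le> C * norm z) \<and> y \<in> fst ` G'"
proof -
  obtain a where a: "\<And>z r. (z, r) \<in> G \<Longrightarrow> r - C * norm (z - y) \<le> a"
      "\<And>z r. (z, r) \<in> G \<Longrightarrow> a \<le> C * norm (z + y) - r"
    using graph_extension_value[OF assms, of y] by blast
  define G' where "G' = span (insert (y, a) G)"
  have "r \<le> C * norm z" if zr: "(z, r) \<in> G'" for z r
  proof -
    obtain t where "(z, r) - t *\<^sub>R (y, a) \<in> span G" using zr by (auto simp: G'_def span_insert)
    then have "(z - t *\<^sub>R y, r - t * a) \<in> G" using G(1) by (simp add: span_eq_iff[THEN iffD2])
    from graph_extension_bound[OF G a this, of t] show ?thesis by simp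
  qed
  moreover have "G \<subseteq> G'" "subspace G'" unfolding G'_def using span_superset[of "insert (y, a) G"] by auto
  moreover have "(y, a) \<in> G'" unfolding G'_def by (simp add: span_base)
  then have "y \<in> fst ` G'" by force
  ultimately show ?thesis by blast
qed

lemma subspace_Union_chain:
  assumes ne: "\<C> \<noteq> {}" and chain: "\<And>X Y. X \<in> \<C> \<Longrightarrow> Y \<in> \<C> \<Longrightarrow> X \<subseteq> Y \<or> Y \<subseteq> X"
    and sub: "\<And>X. X \<in> \<C> \<Longrightarrow> subspace X"
  shows "subspace (\<Union>\<C>)"
  unfolding subspace_def
proof (intro conjI ballI allI)
  show "0 \<in> \<Union>\<C>" using ne sub subspace_0 by blast
  show "p + q \<in> \<Union>\<C>" if pq: "p \<in> \<Union>\<C>" "q \<in> \<Union>\<C>" for p q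
  proof -
    obtain X Y where "X \<in> \<C>" "p \<in> X" "Y \<in> \<C>" "q \<in> Y" using pq by blast
    then obtain W where "W \<in> \<C>" "p \<in> W" "q \<in> W" using chain by (metis subsetD)
    then show ?thesis using sub subspace_add by blast
  qed
  show "c *\<^sub>R p \<in> \<Union>\<C>" if "p \<in> \<Union>\<C>" for c p using that sub subspace_scale by blast
qed

lemma maximal_bounded_graph:
  fixes G0 :: "('a::real_normed_vector \<times> real) set"
  assumes G0: "subspace G0" "\<And>z r. (z, r) \<in> G0 \<Longrightarrow> r \<le> C * norm z" and C: "C \<ge> 0"
  obtains M where "G0 \<subseteq> M" "subspace M" "\<And>z r. (z, r) \<in> M \<Longrightarrow> r \<le> C * norm z" "fst ` M = UNIV"
proof -
  define \<A> where "\<A> = {G. G0 \<subseteq> G \<and> subspace G \<and> (\<forall>z r. (z, r) \<in> G \<longrightarrow> r \<le> C * norm z)}"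
  have "\<exists>M\<in>\<A>. \<forall>X\<in>\<A>. M \<subseteq> X \<longrightarrow> X = M"
  proof (rule subset_Zorn_nonempty)
    show "\<A> \<noteq> {}" using G0 by (auto simp: \<A>_def)
    fix \<C> assume ne: "\<C> \<noteq> {}" and chain: "subset.chain \<A> \<C>"
    then have sub: "\<C> \<subseteq> \<A>" by (simp add: subset.chain_def)
    have "subspace (\<Union>\<C>)"
      proof (rule subspace_Union_chain[OF ne])
      show "X \<subseteq> Y \<or> Y \<subseteq> X" if "X \<in> \<C>" "Y \<in> \<C>" for X Y
        using chain that by (simp add: subset_chain_def)
    qed (use sub in \<open>auto simp: \<A>_def\<close>)
    moreover have "G0 \<subseteq> \<Union>\<C>" using ne sub unfolding \<A>_def by blast
    moreover have "r \<le> C * norm z" if "(z, r) \<in> \<Union>\<C>" for z r using that sub by (auto simp: \<A>_def)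
    ultimately show "\<Union>\<C> \<in> \<A>" by (simp add: \<A>_def)
  qed
  then obtain M where M: "M \<in> \<A>" and max: "\<And>X. X \<in> \<A> \<Longrightarrow> M \<subseteq> X \<Longrightarrow> X = M" by auto
  have "y \<in> fst ` M" for y
  proof -
    obtain G' where G': "M \<subseteq> G'" "subspace G'" "\<forall>z r. (z, r) \<in> G' \<longrightarrow> r \<le> C * norm z" "y \<in> fst ` G'"
      using graph_extension_step[of M C y] M C by (auto simp: \<A>_def)
    then have "G' \<in> \<A>" using M by (auto simp: \<A>_def)
    then show ?thesis using max G'(1,4) by blast
  qed
  then have "fst ` M = UNIV" by blast
  with M show ?thesis by (intro that[of M]) (auto simp: \<A>_def)
qed

theorem hahn_banach_graph:
  fixes G :: "('a::real_normed_vector \<times> real) set"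
  assumes "subspace G" "\<And>z r. (z, r) \<in> G \<Longrightarrow> r \<le> C * norm z" "C \<ge> 0"
  obtains f :: "'a \<Rightarrow>\<^sub>L real" where "\<And>z r. (z, r) \<in> G \<Longrightarrow> f z = r"
proof -
  obtain M where M: "G \<subseteq> M" "subspace M" "\<And>z r. (z, r) \<in> M \<Longrightarrow> r \<le> C * norm z" "fst ` M = UNIV"
    using maximal_bounded_graph[OF assms] by blast
  have "\<exists>r. (y, r) \<in> M" for y using M(4) by (metis UNIV_I imageE prod.collapse)
  then obtain f where f: "\<And>y. (y, f y) \<in> M" by metis
  have f_eq: "f y = r" if "(y, r) \<in> M" for y r
    using M(3)[of 0 "f y - r"] M(3)[of 0 "r - f y"]
      subspace_diff[OF M(2) f[of y] that] subspace_diff[OF M(2) that f[of y]] by simp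
  have "bounded_linear f"
  proof (rule bounded_linear_intro[of _ C])
    show "f (y + z) = f y + f z" for y z
      by (rule f_eq) (use subspace_add[OF M(2) f f, of y z] in simp)
    show "f (t *\<^sub>R y) = t *\<^sub>R f y" for t y
      by (rule f_eq) (use subspace_scale[OF M(2) f, of t y] in simp)
    show "norm (f y) \<le> norm y * C" for y
      using M(3)[OF f, of y] M(3)[of "- y" "- f y"] subspace_neg[OF M(2) f, of y]
      by (simp add: abs_le_iff mult.commute)
  qed
  then have "Blinfun f z = f z" for z by (simp add: bounded_linear_Blinfun_apply)
  then show ?thesis using that[of "Blinfun f"] f_eq M(1) by auto
qed

corollary hahn_banach_separation:
  fixes S :: "'a::real_normed_vector set"
  assumes S: "subspace S" "closed S" and x: "x \<notin> S"
  obtains f :: "'a \<Rightarrow>\<^sub>L real" where "f x = 1" "\<And>s. s \<in> S \<Longrightarrow> f s = 0"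
proof -
  obtain d where d: "d > 0" "\<And>t s. s \<in> S \<Longrightarrow> \<bar>t\<bar> * d \<le> norm (t *\<^sub>R x + s)"
    using subspace_dist_line[OF S x] by blast
  define G where "G = {(z, t). z - t *\<^sub>R x \<in> S}"
  have "(\<lambda>(z, t). z - t *\<^sub>R x) -` S = G" by (auto simp: G_def)
  moreover have "linear (\<lambda>(z, t). z - t *\<^sub>R x)" by (rule linearI) (auto simp: algebra_simps)
  ultimately have "subspace G" using linear_subspace_vimage[OF _ S(1)] by metis
  moreover have "r \<le> 1 / d * norm z" if "(z, r) \<in> G" for z r
  proof -
    have "r * d \<le> \<bar>r\<bar> * d" using d(1) by (intro mult_right_mono) auto
    also have "\<dots> \<le> norm z" using d(2)[of "z - r *\<^sub>R x" r] that by (simp add: G_def)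
    finally show ?thesis using d(1) by (simp add: field_simps)
  qed
  ultimately obtain f :: "'a \<Rightarrow>\<^sub>L real" where f: "\<And>z r. (z, r) \<in> G \<Longrightarrow> f z = r"
    using hahn_banach_graph[of G "1 / d"] d(1) by auto
  show ?thesis
    by (rule that[of f]; rule f) (simp_all add: G_def subspace_0[OF S(1)])
qed

lemma closed_span_finite:
  fixes B :: "'a::real_normed_vector set"
  assumes "finite B"
  shows "closed (span B)"
  using assms
proof (induction B)
  case (insert b B)
  show ?case
  proof (cases "b \<in> span B")
    case True
    then show ?thesis using insert by (simp add: span_redundant)
  next
    case False
    obtain f :: "'a \<Rightarrow>\<^sub>L real" where f: "f b = 1" "\<And>s. s \<in> span B \<Longrightarrow> f s = 0"
      using hahn_banach_separation[OF subspace_span insert.IH False] by blast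
    have "y - k *\<^sub>R b \<in> span B \<Longrightarrow> k = f y" for y k
      using f(1) f(2)[of "y - k *\<^sub>R b"] by (simp add: blinfun.diff_right blinfun.scaleR_right)
    then have "span (insert b B) = (\<lambda>y. y - f y *\<^sub>R b) -` span B" by (auto simp: span_insert)
    then show ?thesis
      by (simp only:) (intro closed_vimage insert.IH continuous_intros)
  qed
qed simp

subsection \<open>Dual families\<close>

definition dual_family :: "nat \<Rightarrow> (nat \<Rightarrow> 'a::real_normed_vector \<Rightarrow>\<^sub>L real) \<Rightarrow> (nat \<Rightarrow> 'a) \<Rightarrow> bool" where
  "dual_family m \<pi> e \<longleftrightarrow> (\<forall>i<m. \<forall>j<m. \<pi> i (e j) = (if i = j then 1 else 0))"

definition dual_projection :: "nat \<Rightarrow> (nat \<Rightarrow> 'a::real_normed_vector \<Rightarrow>\<^sub>L real) \<Rightarrow> (nat \<Rightarrow> 'a) \<Rightarrow> 'a \<Rightarrow>\<^sub>L 'a" where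
  "dual_projection m \<pi> e = (\<Sum>i<m. blinfun_scaleR_left (e i) o\<^sub>L \<pi> i)"

lemma dual_projection_apply: "dual_projection m \<pi> e x = (\<Sum>i<m. \<pi> i x *\<^sub>R e i)"
  by (simp add: dual_projection_def blinfun.sum_left)

lemma dual_familyD:
  assumes "dual_family m \<pi> e" "i < m"
  shows "\<pi> i (\<Sum>j<m. t j *\<^sub>R e j) = t i"
proof -
  have "\<pi> i (\<Sum>j<m. t j *\<^sub>R e j) = (\<Sum>j<m. if j = i then t i else 0)"
    unfolding blinfun.sum_right
    by (intro sum.cong) (use assms in \<open>auto simp: dual_family_def blinfun.scaleR_right\<close>)
  then show ?thesis using assms(2) by simp
qed

lemma dual_projection_in_span: "dual_projection m \<pi> e x \<in> span (e ` {..<m})"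
  unfolding dual_projection_apply by (intro span_sum span_scale span_base) auto

lemma dual_projection_on_span:
  assumes dual: "dual_family m \<pi> e" and "x \<in> span (e ` {..<m})"
  shows "dual_projection m \<pi> e x = x"
  using assms(2)
proof (induction rule: span_induct_alt)
  case base
  then show ?case by simp
next
  case (step c x y)
  then obtain j where j: "j < m" "x = e j" by auto
  have "dual_projection m \<pi> e x = (\<Sum>i<m. if i = j then e i else 0)"
    unfolding dual_projection_apply j(2)
    by (intro sum.cong) (use dual j(1) in \<open>auto simp: dual_family_def\<close>)
  then show ?case using step j by (simp add: blinfun.add_right blinfun.scaleR_right)
qed

lemma dual_family_apply_projection:
  "dual_family m \<pi> e \<Longrightarrow> i < m \<Longrightarrow> \<pi> i (dual_projection m \<pi> e x) = \<pi> i x"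
  unfolding dual_projection_apply by (rule dual_familyD)

lemma dual_family_exists:
  fixes e :: "nat \<Rightarrow> 'a::real_normed_vector"
  assumes "inj_on e {..<m}" "independent (e ` {..<m})"
  obtains \<pi> :: "nat \<Rightarrow> 'a \<Rightarrow>\<^sub>L real" where "dual_family m \<pi> e"
proof -
  have "\<exists>f :: 'a \<Rightarrow>\<^sub>L real. \<forall>j<m. f (e j) = (if i = j then 1 else 0)" if i: "i < m" for i
  proof -
    have "e ` ({..<m} - {i}) = e ` {..<m} - {e i}"
      using assms(1) i by (auto simp: inj_on_def)
    then have "e i \<notin> span (e ` ({..<m} - {i}))"
      using assms(2) i by (auto simp: dependent_def)
    then obtain f :: "'a \<Rightarrow>\<^sub>L real" where f: "f (e i) = 1" "\<And>s. s \<in> span (e ` ({..<m} - {i})) \<Longrightarrow> f s = 0"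
      using hahn_banach_separation[OF subspace_span closed_span_finite]
      by (metis finite_Diff finite_imageI finite_lessThan)
    show ?thesis
      by (rule exI[of _ f]) (use f in \<open>auto intro!: f(2) span_base\<close>)
  qed
  then show ?thesis using that unfolding dual_family_def by metis
qed

lemma independent_family_lower_bound:
  fixes e :: "nat \<Rightarrow> 'a::real_normed_vector"
  assumes "inj_on e {..<m}" "independent (e ` {..<m})"
  obtains c where "c > 0" "\<And>t. c * (\<Sum>i<m. \<bar>t i\<bar>) \<le> norm (\<Sum>i<m. t i *\<^sub>R e i)"
proof -
  obtain \<pi> :: "nat \<Rightarrow> 'a \<Rightarrow>\<^sub>L real" where \<pi>: "dual_family m \<pi> e" using dual_family_exists[OF assms] .
  define C where "C = 1 + (\<Sum>i<m. norm (\<pi> i))"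
  have C: "C > 0" by (simp add: C_def add_pos_nonneg sum_nonneg)
  have "(\<Sum>i<m. \<bar>t i\<bar>) \<le> C * norm (\<Sum>i<m. t i *\<^sub>R e i)" for t
  proof -
    have "\<bar>t i\<bar> \<le> norm (\<pi> i) * norm (\<Sum>j<m. t j *\<^sub>R e j)" if "i < m" for i
      using norm_blinfun[of "\<pi> i" "\<Sum>j<m. t j *\<^sub>R e j"] dual_familyD[OF \<pi> that] by simp
    then have "(\<Sum>i<m. \<bar>t i\<bar>) \<le> (\<Sum>i<m. norm (\<pi> i) * norm (\<Sum>j<m. t j *\<^sub>R e j))"
      by (intro sum_mono) simp
    also have "\<dots> \<le> C * norm (\<Sum>i<m. t i *\<^sub>R e i)"
      unfolding sum_distrib_right[symmetric] C_def by (intro mult_right_mono) auto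
    finally show ?thesis .
  qed
  then show ?thesis using that[of "1 / C"] C by (simp add: field_simps)
qed

section \<open>Bounded operators between Banach spaces\<close>

subsection \<open>Perturbations of the identity\<close>

lemma perturbed_identity_zero:
  fixes f :: "'a::banach \<Rightarrow> 'a"
  assumes Z: "subspace Z" "closed Z" and q: "0 \<le> q" "q < 1" and \<rho>: "0 \<le> \<rho>"
    and f: "\<And>x. x \<in> Z \<inter> cball 0 \<rho> \<Longrightarrow> f x \<in> Z" "norm (f 0) \<le> (1 - q) * \<rho>"
    and near_id: "\<And>x y. x \<in> Z \<inter> cball 0 \<rho> \<Longrightarrow> y \<in> Z \<inter> cball 0 \<rho> \<Longrightarrow>
      norm (f x - f y - (x - y)) \<le> q * norm (x - y)"
  obtains x where "x \<in> Z" "norm x \<le> \<rho>" "f x = 0"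
proof -
  let ?S = "Z \<inter> cball 0 \<rho>" and ?g = "\<lambda>x. x - f x"
  have zero: "0 \<in> ?S" using subspace_0[OF Z(1)] \<rho> by simp
  have contraction: "norm (?g x - ?g y) \<le> q * norm (x - y)" if "x \<in> ?S" "y \<in> ?S" for x y
  proof -
    have "?g x - ?g y = - (f x - f y - (x - y))" by simp
    then show ?thesis using near_id[OF that] by (simp only: norm_minus_cancel)
  qed
  have "\<exists>!x\<in>?S. ?g x = x"
  proof (rule Banach_fix[OF _ _ q])
    show "complete ?S" unfolding complete_eq_closed by (intro closed_Int Z(2) closed_cball)
    show "?S \<noteq> {}" using zero by blast
    show "?g ` ?S \<subseteq> ?S"
    proof safe
      fix x assume x: "x \<in> Z" "x \<in> cball 0 \<rho>"
      show "?g x \<in> Z" using f(1) x by (intro subspace_diff[OF Z(1)]) auto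
      have "norm (?g x) \<le> norm (?g x - ?g 0) + norm (?g 0)"
        by (metis add.commute norm_triangle_sub)
      also have "\<dots> \<le> q * \<rho> + (1 - q) * \<rho>"
        using contraction[of x 0] zero x f(2) mult_left_mono[of "norm x" \<rho> q] q by fastforce
      finally show "?g x \<in> cball 0 \<rho>" by (simp add: algebra_simps)
    qed
    show "dist (?g x) (?g y) \<le> q * dist x y" if "x \<in> ?S" "y \<in> ?S" for x y
      using contraction[OF that] by (simp add: dist_norm)
  qed
  then obtain x where "x \<in> ?S" "?g x = x" by blast
  then show ?thesis using that by auto
qed

lemma near_identity_surj:
  fixes T :: "'a::banach \<Rightarrow>\<^sub>L 'a"
  assumes "norm (T - id_blinfun) \<le> q" "q < 1"
  obtains x where "T x = y"
proof -
  have q: "0 \<le> q" using assms(1) norm_ge_zero order_trans by blast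
  obtain x where "T x - y = 0"
  proof (rule perturbed_identity_zero[of UNIV q "norm y / (1 - q)" "\<lambda>x. T x - y"])
    show "norm (T x - y - (T x' - y) - (x - x')) \<le> q * norm (x - x')" for x x'
      using norm_blinfun[of "T - id_blinfun" "x - x'"] mult_right_mono[OF assms(1), of "norm (x - x')"]
      by (simp add: blinfun.diff_left blinfun.diff_right algebra_simps)
  qed (use assms(2) q that in auto)
  then show ?thesis using that by simp
qed

subsection \<open>The open mapping theorem\<close>

lemma closure_image_ball_interior:
  fixes T :: "'w::real_normed_vector \<Rightarrow>\<^sub>L 'v::banach"
  assumes onto: "T ` D = UNIV"
  obtains n :: nat where "interior (closure (T ` (D \<inter> cball 0 (real n)))) \<noteq> {}"
proof -
  define A where "A n = closure (T ` (D \<inter> cball 0 (real n)))" for n :: nat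
  have "v \<in> (\<Union>n. A n)" for v
  proof -
    obtain w where w: "w \<in> D" "v = T w" using onto by blast
    obtain n :: nat where "norm w \<le> real n" using real_arch_simple by blast
    then have "v \<in> A n" unfolding A_def using w by (intro closure_subset[THEN subsetD]) auto
    then show ?thesis by blast
  qed
  then have cover: "(\<Union>n. A n) = UNIV" by blast
  have "\<exists>n. interior (A n) \<noteq> {}"
  proof (rule ccontr)
    assume "\<not> ?thesis"
    then have "\<And>X. X \<in> range A \<Longrightarrow> closedin Met_TC.mtopology X \<and> Met_TC.mtopology interior_of X = {}"
      by (auto simp: A_def euclidean_interior_of)
    then have "Met_TC.mtopology interior_of (\<Union>(range A)) = {}"
      by (intro Met_TC.metric_Baire_category_alt) (auto simp: complete_UNIV)
    then show False using cover by (simp add: euclidean_interior_of)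
  qed
  then show ?thesis using that unfolding A_def by blast
qed

lemma approximate_preimage_in_ball:
  fixes T :: "'w::real_normed_vector \<Rightarrow>\<^sub>L 'v::banach"
  assumes D: "subspace D" and onto: "T ` D = UNIV"
  obtains \<rho> R where "\<rho> > 0" "R > 0"
    "\<And>y e. norm y < \<rho> \<Longrightarrow> e > 0 \<Longrightarrow> \<exists>w\<in>D. norm w \<le> R \<and> norm (y - T w) < e"
proof -
  obtain n where "interior (closure (T ` (D \<inter> cball 0 (real n)))) \<noteq> {}"
    using closure_image_ball_interior[OF onto] .
  then obtain v \<rho> where "\<rho> > 0" and ball: "ball v \<rho> \<subseteq> closure (T ` (D \<inter> cball 0 (real n)))"
    by (metis ex_in_conv mem_interior)
  have approx: "\<exists>w\<in>D. norm w \<le> n \<and> dist (T w) x < e" if "x \<in> ball v \<rho>" "e > 0" for x e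
    using subsetD[OF ball that(1)] that(2) unfolding closure_approachable by force
  have "\<exists>w\<in>D. norm w \<le> 2 * real n + 1 \<and> norm (y - T w) < e" if y: "norm y < \<rho>" and e: "e > 0" for y e
  proof -
    obtain w1 w2 where w: "w1 \<in> D" "norm w1 \<le> n" "dist (T w1) v < e/2"
       "w2 \<in> D" "norm w2 \<le> n" "dist (T w2) (v + y) < e/2"
      using approx[of v "e/2"] approx[of "v + y" "e/2"] \<open>\<rho> > 0\<close> y e by (auto simp: dist_norm)
    have "norm (w2 - w1) \<le> 2 * real n + 1" using norm_triangle_ineq4[of w2 w1] w by simp
    moreover have diff: "y - T (w2 - w1) = (v + y - T w2) + (T w1 - v)"
      by (simp add: blinfun.diff_right)
    have "norm (y - T (w2 - w1)) < e"
      unfolding diff using norm_triangle_ineq[of "v + y - T w2" "T w1 - v"] w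
      by (simp add: dist_norm norm_minus_commute)
    ultimately show ?thesis using subspace_diff[OF D w(4,1)] by blast
  qed
  then show ?thesis using \<open>\<rho> > 0\<close> that[of \<rho> "2 * real n + 1"] by simp
qed

lemma approximate_preimage:
  fixes T :: "'w::real_normed_vector \<Rightarrow>\<^sub>L 'v::banach"
  assumes D: "subspace D" and "T ` D = UNIV"
  obtains k where "k > 0" "\<And>y. \<exists>w\<in>D. norm w \<le> k * norm y \<and> norm (y - T w) \<le> norm y / 2"
proof -
  obtain \<rho> R where pos: "\<rho> > 0" "R > 0"
    and near: "\<And>y e. norm y < \<rho> \<Longrightarrow> e > 0 \<Longrightarrow> \<exists>w\<in>D. norm w \<le> R \<and> norm (y - T w) < e"
    using approximate_preimage_in_ball[OF assms] by blast
  define k where "k = 2 * R / \<rho>"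
  have "\<exists>w\<in>D. norm w \<le> k * norm y \<and> norm (y - T w) \<le> norm y / 2" for y
  proof (cases "y = 0")
    case True
    then show ?thesis using subspace_0[OF D] by (intro bexI[of _ 0]) auto
  next
    case False
    define s where "s = 2 * norm y / \<rho>"
    have s: "s > 0" using False pos by (simp add: s_def)
    have "norm ((1/s) *\<^sub>R y) < \<rho>" using False pos by (simp add: s_def)
    then obtain w where w: "w \<in> D" "norm w \<le> R" "norm ((1/s) *\<^sub>R y - T w) < \<rho> / 4"
      using near[of "(1/s) *\<^sub>R y" "\<rho>/4"] pos by auto
    have "norm (s *\<^sub>R w) \<le> s * R" using w(2) s by (simp add: mult_left_mono)
    also have "\<dots> = k * norm y" by (simp add: s_def k_def)
    finally have bound: "norm (s *\<^sub>R w) \<le> k * norm y" .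
    have "y - T (s *\<^sub>R w) = s *\<^sub>R ((1/s) *\<^sub>R y - T w)"
      using s by (simp add: blinfun.scaleR_right scaleR_diff_right)
    then have "norm (y - T (s *\<^sub>R w)) = s * norm ((1/s) *\<^sub>R y - T w)" using s by simp
    also have "\<dots> \<le> s * (\<rho> / 4)" using s w by (intro mult_left_mono) auto
    also have "\<dots> = norm y / 2" using pos by (simp add: s_def)
    finally show ?thesis using bound subspace_scale[OF D w(1)] by blast
  qed
  moreover have "k > 0" using pos by (simp add: k_def)
  ultimately show ?thesis using that by blast
qed

lemma preimage_by_iterated_approximation:
  fixes T :: "'w::banach \<Rightarrow>\<^sub>L 'v::banach"
  assumes D: "subspace D" "closed D" and "0 < k"
    and W: "\<And>y. W y \<in> D" "\<And>y. norm (W y) \<le> k * norm y" "\<And>y. norm (y - T (W y)) \<le> norm y / 2"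
  shows "\<exists>w\<in>D. T w = v \<and> norm w \<le> 2 * k * norm v"
proof -
  define y where "y n = ((\<lambda>y. y - T (W y)) ^^ n) v" for n
  have y: "y 0 = v" "\<And>n. y (Suc n) = y n - T (W (y n))" by (simp_all add: y_def)
  have y_bound: "norm (y n) \<le> norm v * (1/2)^n" for n
  proof (induction n)
    case (Suc n)
    then show ?case using W(3)[of "y n"] by (simp add: y)
  qed (simp add: y)
  have geometric: "(\<lambda>n. norm v * (1/2)^n) sums (2 * norm v)"
    using sums_mult[OF geometric_sums[of "1/2::real"], of "norm v"] by (simp add: mult.commute)
  have W_sums: "(\<lambda>n. k * (norm v * (1/2)^n)) sums (2 * k * norm v)"
    using sums_mult[OF geometric, of k] by (simp add: mult_ac)
  have W_bound: "norm (W (y n)) \<le> k * (norm v * (1/2)^n)" for n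
    using W(2)[of "y n"] mult_left_mono[OF y_bound[of n], of k] \<open>0 < k\<close> by linarith
  define w where "w = suminf (\<lambda>n. W (y n))"
  have w: "(\<lambda>n. W (y n)) sums w"
    unfolding w_def
    by (rule summable_sums, rule summable_comparison_test'[OF sums_summable[OF W_sums], of 0])
      (use W_bound in auto)
  have "norm w \<le> 2 * k * norm v"
    unfolding w_def sums_unique[OF W_sums] using W_bound sums_summable[OF W_sums] by (rule norm_suminf_le)
  moreover have "w \<in> D"
    by (rule closed_sequentially[OF D(2) _ w[unfolded sums_def]]) (intro subspace_sum D W(1))
  moreover have "T w = v"
  proof -
    have "y \<longlonglongrightarrow> 0"
      by (rule Lim_null_comparison[OF _ summable_LIMSEQ_zero[OF sums_summable[OF geometric]]]) (use y_bound in simp)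
    from telescope_sums'[OF this] have "(\<lambda>n. T (W (y n))) sums v" by (simp add: y)
    moreover have "(\<lambda>n. T (W (y n))) sums T w"
      by (rule bounded_linear.sums[OF blinfun.bounded_linear_right w])
    ultimately show ?thesis using sums_unique2 by blast
  qed
  ultimately show ?thesis by blast
qed

theorem open_mapping_closed_subspace:
  fixes T :: "'w::banach \<Rightarrow>\<^sub>L 'v::banach"
  assumes D: "subspace D" "closed D" and onto: "T ` D = UNIV"
  obtains C where "C > 0" "\<And>v. \<exists>w\<in>D. T w = v \<and> norm w \<le> C * norm v"
proof -
  obtain k where k: "0 < k" "\<And>y. \<exists>w\<in>D. norm w \<le> k * norm y \<and> norm (y - T w) \<le> norm y / 2"
    using approximate_preimage[OF D(1) onto] by blast
  then obtain W where "\<And>y. W y \<in> D" "\<And>y. norm (W y) \<le> k * norm y" "\<And>y. norm (y - T (W y)) \<le> norm y / 2"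
    by metis
  then have "\<exists>w\<in>D. T w = v \<and> norm w \<le> 2 * k * norm v" for v
    by (rule preimage_by_iterated_approximation[OF D k(1)])
  then show ?thesis using that[of "2 * k"] k(1) by simp
qed

subsection \<open>Inverses modulo a finite-dimensional subspace\<close>

definition onto_modulo :: "('u::real_normed_vector \<Rightarrow>\<^sub>L 'v::real_normed_vector) \<Rightarrow> 'v set \<Rightarrow> bool" where
  "onto_modulo T B \<longleftrightarrow> (\<forall>v. \<exists>x. v - T x \<in> span B)"

text \<open>\<open>J\<close> inverts \<open>T\<close> along the projection \<open>P\<close> onto the preimage of \<open>span B\<close>.\<close>

definition inverse_modulo ::
  "('u::real_normed_vector \<Rightarrow>\<^sub>L 'v::real_normed_vector) \<Rightarrow> 'v set \<Rightarrow> ('u \<Rightarrow>\<^sub>L 'u) \<Rightarrow> ('v \<Rightarrow>\<^sub>L 'u) \<Rightarrow> bool" where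
  "inverse_modulo T B P J \<longleftrightarrow> (\<forall>x. J (T x) = x - P x) \<and> (\<forall>v. J v = 0 \<longleftrightarrow> v \<in> span B) \<and> (\<forall>v. P (J v) = 0)"

lemma inverse_moduloD:
  assumes "inverse_modulo T B P J"
  shows "J (T x) = x - P x" "J v = 0 \<longleftrightarrow> v \<in> span B" "P (J v) = 0" "v - T (J v) \<in> span B"
proof -
  show J: "J (T x) = x - P x" "J v = 0 \<longleftrightarrow> v \<in> span B" "P (J v) = 0" for x v
    using assms by (simp_all add: inverse_modulo_def)
  have "J (v - T (J v)) = 0" by (simp add: blinfun.diff_right J(1,3))
  then show "v - T (J v) \<in> span B" by (simp only: J(2))
qed

lemma bounded_preimage_modulo:
  fixes T :: "'x::banach \<Rightarrow>\<^sub>L 'v::banach"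
  assumes B: "finite B" and onto: "onto_modulo T B"
  obtains C where "C > 0" "\<And>v. \<exists>x. v - T x \<in> span B \<and> norm x \<le> C * norm v"
proof -
  define T' where "T' = (T o\<^sub>L fst_blinfun) + snd_blinfun"
  have T': "T' w = T (fst w) + snd w" for w by (simp add: T'_def blinfun.add_left)
  have "v \<in> T' ` (UNIV \<times> span B)" for v
  proof -
    obtain x where "v - T x \<in> span B" using onto by (auto simp: onto_modulo_def)
    then show ?thesis by (intro image_eqI[of _ _ "(x, v - T x)"]) (auto simp: T')
  qed
  then have "T' ` (UNIV \<times> span B) = UNIV" by blast
  then obtain C where C: "C > 0" "\<And>v. \<exists>w\<in>UNIV \<times> span B. T' w = v \<and> norm w \<le> C * norm v"
    by (rule open_mapping_closed_subspace[rotated 2])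
      (auto intro!: subspace_Times closed_Times closed_span_finite B)
  have "\<exists>x. v - T x \<in> span B \<and> norm x \<le> C * norm v" for v
  proof -
    obtain x b where w: "b \<in> span B" "T' (x, b) = v" "norm (x, b) \<le> C * norm v" using C(2) by blast
    then have "v - T x = b" by (auto simp: T')
    then show ?thesis using w norm_fst_le[of x b] by (intro exI[of _ x]) auto
  qed
  then show ?thesis using C(1) that by blast
qed

theorem inverse_modulo_exists:
  fixes T :: "'x::banach \<Rightarrow>\<^sub>L 'v::banach" and P :: "'x \<Rightarrow>\<^sub>L 'x"
  assumes B: "finite B" and onto: "onto_modulo T B"
    and P: "\<And>x. T (P x) \<in> span B" "\<And>x. T x \<in> span B \<Longrightarrow> P x = x"
  obtains J where "inverse_modulo T B P J"
proof -
  obtain C where "C > 0" "\<And>v. \<exists>x. v - T x \<in> span B \<and> norm x \<le> C * norm v"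
    using bounded_preimage_modulo[OF B onto] by blast
  then obtain X where X: "\<And>v. v - T (X v) \<in> span B" "\<And>v. norm (X v) \<le> C * norm v" by metis
  define j where "j v = X v - P (X v)" for v
  have j_eq: "j v = x - P x" if x: "v - T x \<in> span B" for v x
  proof -
    have "T (X v - x) \<in> span B" using span_diff[OF x X(1)[of v]] by (simp add: blinfun.diff_right)
    from P(2)[OF this] show ?thesis by (simp add: j_def blinfun.diff_right algebra_simps)
  qed
  have "bounded_linear j"
  proof (rule bounded_linear_intro[of _ "(1 + norm P) * C"])
    show "j (v + w) = j v + j w" for v w
      using j_eq[of "v + w" "X v + X w"] span_add[OF X(1)[of v] X(1)[of w]]
      by (simp add: j_def blinfun.add_right algebra_simps)
    show "j (t *\<^sub>R v) = t *\<^sub>R j v" for t v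
      using j_eq[of "t *\<^sub>R v" "t *\<^sub>R X v"] span_scale[OF X(1)[of v], of t]
      by (simp add: j_def blinfun.scaleR_right algebra_simps)
    show "norm (j v) \<le> norm v * ((1 + norm P) * C)" for v
    proof -
      have "norm (j v) \<le> norm (X v) + norm P * norm (X v)"
        unfolding j_def using norm_triangle_ineq4[of "X v" "P (X v)"] norm_blinfun[of P "X v"] by linarith
      also have "\<dots> = (1 + norm P) * norm (X v)" by (simp add: algebra_simps)
      also have "\<dots> \<le> (1 + norm P) * (C * norm v)" using X(2) by (intro mult_left_mono) auto
      finally show ?thesis by (simp add: mult_ac)
    qed
  qed
  then have J: "Blinfun j v = j v" for v by (simp add: bounded_linear_Blinfun_apply)
  have "v \<in> span B" if "j v = 0" for v
  proof -
    have "T (X v) \<in> span B" using that P(1)[of "X v"] by (simp add: j_def)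
    then show ?thesis using span_add[OF X(1)[of v]] by fastforce
  qed
  moreover have "P (P x) = P x" for x by (rule P(2)[OF P(1)])
  ultimately have "inverse_modulo T B P (Blinfun j)"
    unfolding inverse_modulo_def J using j_eq[of _ 0]
    by (auto simp: j_eq[of "T x" x for x] span_zero) (simp add: j_def blinfun.diff_right)
  then show ?thesis using that by blast
qed

section \<open>Fredholm operators of index zero\<close>

lemma linear_blinfun: "linear (blinfun_apply T)"
  by (rule bounded_linear.linear[OF blinfun.bounded_linear_right])

lemma subspace_range_blinfun: "subspace (range (blinfun_apply T))"
  by (rule linear_subspace_image[OF linear_blinfun subspace_UNIV])

lemma codim_attained:
  assumes "finite_codim S"
  obtains C where "finite C" "card C = codim S" "span (S \<union> C) = UNIV"
proof -
  have "\<exists>n C. finite C \<and> card C = n \<and> span (S \<union> C) = UNIV" using assms by (auto simp: finite_codim_def)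
  then have "\<exists>C. finite C \<and> card C = codim S \<and> span (S \<union> C) = UNIV"
    unfolding codim_def by (rule LeastI_ex)
  then show ?thesis using that by blast
qed

subsection \<open>Dimension formulas\<close>

lemma finite_basis_of_subspace_span:
  assumes S: "subspace S" "S \<subseteq> span F" and F: "finite F"
  obtains B where "finite B" "independent B" "span B = S" "card B = dim S"
proof -
  obtain B where B: "B \<subseteq> S" "independent B" "S \<subseteq> span B" "card B = dim S" using basis_exists[of S] by blast
  have "finite B" using independent_span_bound[OF F B(2)] B(1) S(2) by blast
  moreover have "span B = S" using span_minimal[OF B(1) S(1)] B(3) by blast
  ultimately show ?thesis using B(2,4) that by blast
qed

lemma independent_extend_within_span:
  assumes B: "finite B" "independent B" and B0: "independent B0" "B0 \<subseteq> span B"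
  obtains B1 where "B0 \<inter> B1 = {}" "finite (B0 \<union> B1)" "independent (B0 \<union> B1)"
    "span (B0 \<union> B1) = span B" "card (B0 \<union> B1) = card B"
proof -
  obtain B2 where B2: "B0 \<subseteq> B2" "B2 \<subseteq> span B" "independent B2" "span B \<subseteq> span B2"
    using maximal_independent_subset_extend[OF B0(2,1)] by blast
  have "finite B2" "card B2 \<le> card B" using independent_span_bound[OF B(1) B2(3,2)] by auto
  moreover have "card B \<le> card B2"
    using independent_span_bound[OF \<open>finite B2\<close> B(2)] B2(4) span_superset[of B] by blast
  moreover have "span B2 = span B" using B2(4) span_minimal[OF B2(2) subspace_span] by blast
  moreover have "B0 \<union> (B2 - B0) = B2" using B2(1) by blast
  ultimately show ?thesis using that[of "B2 - B0"] B2(3) by auto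
qed

lemma linear_vimage_span_basis:
  assumes f: "linear f" and ker: "finite K" "independent K" "span K = {x. f x = 0}"
    and B: "finite B" "independent B" "B \<subseteq> range f"
  obtains E where "finite E" "independent E" "card E = card K + card B" "span E = {x. f x \<in> span B}"
proof -
  have "\<exists>E. finite E \<and> independent E \<and> card E = card K + card B \<and> span E = {x. f x \<in> span B}"
    using B
  proof (induction B)
    case empty
    then show ?case using ker by (intro exI[of _ K]) simp
  next
    case (insert b B)
    then obtain E where E: "finite E" "independent E" "card E = card K + card B" "span E = {x. f x \<in> span B}"
      by (auto simp: independent_insert)
    obtain x where x: "f x = b" using insert.prems(2) by auto
    have "x \<notin> span E" using insert.prems(1) insert.hyps(2) x E(4) by (simp add: independent_insert)
    then have "independent (insert x E)" "x \<notin> E" using E(2) by (auto simp: independent_insert span_base)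
    moreover have "span (insert x E) = {y. f y \<in> span (insert b B)}"
      unfolding span_insert E(4) x[symmetric] by (auto simp: linear_diff[OF f] linear_scale[OF f])
    ultimately show ?case using E insert.hyps by (intro exI[of _ "insert x E"]) auto
  qed
  then show ?thesis using that by blast
qed

lemma linear_projection_along:
  assumes R: "subspace R" and B: "finite B1" "independent (B0 \<union> B1)" "B0 \<inter> B1 = {}"
    and B0: "span B0 = R \<inter> span (B0 \<union> B1)"
  obtains \<phi> where "linear \<phi>" "\<And>r. r \<in> R \<Longrightarrow> \<phi> r = 0" "\<And>b. b \<in> B1 \<Longrightarrow> \<phi> b = b"
proof -
  have "B0 \<subseteq> R" using B0 span_superset[of B0] by blast
  then obtain C where C: "B0 \<subseteq> C" "C \<subseteq> R" "independent C" "R \<subseteq> span C"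
    using maximal_independent_subset_extend[of B0 R] independent_mono[OF B(2)] by blast
  have "independent (C \<union> D) \<and> C \<inter> D = {}" if "D \<subseteq> B1" for D
    using finite_subset[OF that B(1)] that
  proof (induction D)
    case (insert b D)
    have "b \<notin> span (C \<union> D)"
    proof
      assume "b \<in> span (C \<union> D)"
      then obtain r d where rd: "b = r + d" "r \<in> span C" "d \<in> span D" unfolding span_Un by blast
      then have "r \<in> R" using span_minimal[OF C(2) R] by blast
      moreover have "b - d \<in> span (B0 \<union> B1)"
        using rd(3) insert.prems span_mono[of D "B0 \<union> B1"] by (intro span_diff) (auto intro: span_base)
      ultimately have "r \<in> span B0" unfolding B0 using rd(1) by simp
      then have "b \<in> span (B0 \<union> D)" unfolding rd(1) span_Un using rd(3) by blast
      then have "b \<in> span (B0 \<union> B1 - {b})"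
        using span_mono[of "B0 \<union> D" "B0 \<union> B1 - {b}"] insert.hyps(2) insert.prems B(3) by blast
      then show False using B(2) insert.prems unfolding dependent_def by blast
    qed
    then show ?case using insert by (auto simp: independent_insert span_base)
  qed (simp add: C(3))
  from this[OF subset_refl] have "independent (C \<union> B1)" "C \<inter> B1 = {}" by auto
  then obtain \<phi> where \<phi>: "linear \<phi>" "\<And>x. x \<in> C \<union> B1 \<Longrightarrow> \<phi> x = (if x \<in> B1 then x else 0)"
    using linear_independent_extend[of "C \<union> B1" "\<lambda>x. if x \<in> B1 then x else 0"] by blast
  have "\<phi> r = 0" if "r \<in> R" for r
    using linear_eq_0_on_span[OF \<phi>(1), of C r] \<phi>(2) C(4) that \<open>C \<inter> B1 = {}\<close> by fastforce
  then show ?thesis using that[OF \<phi>(1)] \<phi>(2) by simp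
qed

lemma codim_plus_dim_Int:
  assumes R: "subspace R" and B: "finite B" "independent B" and all: "\<And>v. \<exists>b\<in>span B. v - b \<in> R"
    and B0: "independent B0" "span B0 = R \<inter> span B"
  shows "codim R + card B0 = card B"
proof -
  obtain B1 where B1: "B0 \<inter> B1 = {}" "finite (B0 \<union> B1)" "independent (B0 \<union> B1)"
      "span (B0 \<union> B1) = span B" "card (B0 \<union> B1) = card B"
    using independent_extend_within_span[OF B B0(1)] B0(2) span_superset[of B0] by blast
  obtain \<phi> where \<phi>: "linear \<phi>" "\<And>r. r \<in> R \<Longrightarrow> \<phi> r = 0" "\<And>b. b \<in> B1 \<Longrightarrow> \<phi> b = b"
    using linear_projection_along[OF R _ B1(3,1)] B1(2,4) B0(2) by auto
  have "codim R = card B1"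
    unfolding codim_def
  proof (rule Least_equality)
    have "v \<in> span (R \<union> B1)" for v
    proof -
      obtain b where b: "b \<in> span (B0 \<union> B1)" "v - b \<in> R" using all B1(4) by blast
      then obtain b0 b1 where "b = b0 + b1" "b0 \<in> span B0" "b1 \<in> span B1" unfolding span_Un by blast
      moreover have "v - b + b0 \<in> R" using subspace_add[OF R b(2)] B0(2) \<open>b0 \<in> span B0\<close> by blast
      ultimately have "v - b1 \<in> span (R \<union> B1)" "b1 \<in> span (R \<union> B1)"
        using span_mono[of B1 "R \<union> B1"] by (auto intro: span_base)
      from span_add[OF this] show ?thesis by simp
    qed
    then show "\<exists>C. finite C \<and> card C = card B1 \<and> span (R \<union> C) = UNIV" using B1(2) by auto
  next
    fix n assume "\<exists>C. finite C \<and> card C = n \<and> span (R \<union> C) = UNIV"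
    then obtain C where C: "finite C" "card C = n" "span (R \<union> C) = UNIV" by blast
    have "\<phi> ` (R \<union> C) \<subseteq> insert 0 (\<phi> ` C)" using \<phi>(2) by auto
    then have "range \<phi> \<subseteq> span (\<phi> ` C)"
      using linear_span_image[OF \<phi>(1), of "R \<union> C"] C(3) span_mono span_insert_0 by metis
    then have "card B1 \<le> card (\<phi> ` C)"
      using independent_span_bound[of "\<phi> ` C" B1] C(1) independent_mono[OF B1(3)] \<phi>(3)
      by (metis finite_imageI range_subsetD subsetI sup_ge2)
    then show "card B1 \<le> n" using card_image_le[OF C(1), of \<phi>] C(2) by simp
  qed
  then show ?thesis using card_Un_disjoint[of B0 B1] B1 by simp
qed

theorem Fredholm0_preimage_basis:
  fixes T :: "'u::real_normed_vector \<Rightarrow>\<^sub>L 'v::real_normed_vector"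
  assumes T: "T \<in> Fredholm0" and B: "finite B" "independent B" and onto: "onto_modulo T B"
  obtains E where "finite E" "independent E" "card E = card B" "span E = {x. T x \<in> span B}"
proof -
  have K: "subspace (null_space T)"
    using linear_subspace_vimage[OF linear_blinfun subspace_single_0] by (simp add: null_space_def vimage_def)
  obtain F where "finite F" "null_space T \<subseteq> span F"
    using T by (auto simp: Fredholm0_def fredholm_def finite_dim_def)
  then obtain E0 where E0: "finite E0" "independent E0" "span E0 = null_space T" "card E0 = dim (null_space T)"
    using finite_basis_of_subspace_span[OF K] by blast
  obtain B0 where B0: "finite B0" "independent B0" "span B0 = range T \<inter> span B"
    using finite_basis_of_subspace_span[OF subspace_inter[OF subspace_range_blinfun subspace_span] _ B(1)]
    by (metis inf_le2)
  have "\<exists>b\<in>span B. v - b \<in> range T" for v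
  proof -
    obtain x where "v - T x \<in> span B" using onto by (auto simp: onto_modulo_def)
    then show ?thesis by (intro bexI[of _ "v - T x"]) auto
  qed
  then have "codim (range T) + card B0 = card B"
    by (rule codim_plus_dim_Int[OF subspace_range_blinfun B _ B0(2,3)])
  moreover have "dim (null_space T) = codim (range T)" using T by (simp add: Fredholm0_def fredholm_index_def)
  moreover have "span E0 = {x. T x = 0}" "B0 \<subseteq> range T"
    using E0(3) B0(3) span_superset[of B0] by (auto simp: null_space_def)
  then obtain E where "finite E" "independent E" "card E = card E0 + card B0" "span E = {x. T x \<in> span B0}"
    using linear_vimage_span_basis[OF linear_blinfun E0(1,2) _ B0(1,2)] by metis
  ultimately show ?thesis using that[of E] E0(4) B0(3) by auto
qed

lemma span_insert_Pair:
  "span (insert (1::real, w) (Pair 0 ` E)) = {(t, v). v - t *\<^sub>R w \<in> span E}"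
proof -
  have "linear (Pair (0::real) :: 'a \<Rightarrow> real \<times> 'a)" by (intro linearI) auto
  from linear_span_image[OF this] have "span (Pair (0::real) ` E) = Pair 0 ` span E" .
  then show ?thesis by (auto simp: span_insert image_iff)
qed

lemma independent_insert_Pair:
  fixes E :: "'a::real_vector set"
  assumes "independent E"
  shows "independent (insert (1::real, w) (Pair 0 ` E))"
proof -
  have lin: "linear (Pair (0::real) :: 'a \<Rightarrow> real \<times> 'a)" by (intro linearI) auto
  have "independent (Pair (0::real) ` E)"
    by (rule linear_independent_injective_image[OF lin assms]) (simp add: inj_on_def)
  moreover have "span (Pair (0::real) ` E) = Pair 0 ` span E" by (rule linear_span_image[OF lin])
  ultimately show ?thesis by (auto simp: independent_insert)
qed

lemma card_insert_Pair:
  assumes "finite E"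
  shows "card (insert (1::real, w) (Pair 0 ` E)) = Suc (card E)"
proof -
  have "card (Pair (0::real) ` E) = card E" by (rule card_image) (simp add: inj_on_def)
  moreover have "(1, w) \<notin> Pair (0::real) ` E" by auto
  ultimately show ?thesis using assms by simp
qed

lemma Fredholm0_product_preimage_basis:
  fixes T :: "'u::real_normed_vector \<Rightarrow>\<^sub>L 'v::real_normed_vector" and A :: "(real \<times> 'u) \<Rightarrow>\<^sub>L 'v"
  assumes T: "T \<in> Fredholm0" and B: "finite B" "independent B"
    and onto: "onto_modulo T B" and A: "\<And>v. A (0, v) = T v"
  obtains E where "finite E" "independent E" "card E = Suc (card B)" "span E = {x. A x \<in> span B}"
proof -
  obtain E where E: "finite E" "independent E" "card E = card B" "span E = {x. T x \<in> span B}"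
    using Fredholm0_preimage_basis[OF T B onto] .
  obtain w where w: "A (1, 0) - T w \<in> span B" using onto by (auto simp: onto_modulo_def)
  have "A (t, v) \<in> span B \<longleftrightarrow> T (v + t *\<^sub>R w) \<in> span B" for t v
  proof -
    have "(t, v) = t *\<^sub>R (1, 0) + (0, v)" by simp
    then have "A (t, v) = t *\<^sub>R A (1, 0) + T v" using A by (metis blinfun.add_right blinfun.scaleR_right)
    then have "A (t, v) = t *\<^sub>R (A (1, 0) - T w) + T (v + t *\<^sub>R w)"
      by (simp add: blinfun.add_right blinfun.scaleR_right algebra_simps)
    then show ?thesis using span_add_eq[OF span_scale[OF w]] by simp
  qed
  then have "span (insert (1, - w) (Pair 0 ` E)) = {x. A x \<in> span B}"
    unfolding span_insert_Pair E(4) by auto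
  then show ?thesis
    using that[OF _ independent_insert_Pair[OF E(2)] card_insert_Pair[OF E(1), of "- w", unfolded E(3)]] E(1)
    by simp
qed

subsection \<open>Invertibility and stability\<close>

lemma Fredholm0_bounded_below_GL:
  fixes T :: "'u::banach \<Rightarrow>\<^sub>L 'v::banach"
  assumes T: "T \<in> Fredholm0" and c: "0 < c" "\<And>x. c * norm x \<le> norm (T x)"
  shows "T \<in> GL"
proof -
  have ker: "x = 0" if "T x = 0" for x
    using c(2)[of x] c(1) that by (simp add: mult_le_0_iff)
  then have "null_space T = {0}" by (auto simp: null_space_def)
  moreover have "dim {0 :: 'u} = 0" by (rule dim_unique[of "{}"]) (auto simp: independent_empty)
  ultimately have "codim (range T) = 0" "finite_codim (range T)"
    using T by (simp_all add: Fredholm0_def fredholm_def fredholm_index_def)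
  then obtain C where "finite C" "card C = 0" "span (range T \<union> C) = UNIV" using codim_attained by metis
  then have surj: "surj T" using span_eq_iff[THEN iffD2, OF subspace_range_blinfun[of T]] by simp
  have inj: "x = y" if "T x = T y" for x y
    using ker[of "x - y"] that by (simp add: blinfun.diff_right)
  obtain G where TG: "\<And>y. T (G y) = y" using surj by (metis surj_def)
  have "bounded_linear G"
  proof (rule bounded_linear_intro[where K = "1 / c"])
    show "G (x + y) = G x + G y" for x y by (rule inj) (simp add: TG blinfun.add_right)
    show "G (r *\<^sub>R x) = r *\<^sub>R G x" for r x by (rule inj) (simp add: TG blinfun.scaleR_right)
    show "norm (G x) \<le> norm x * (1 / c)" for x using c(2)[of "G x"] c(1) by (simp add: TG field_simps)
  qed
  then have "Blinfun G y = G y" for y by (simp add: bounded_linear_Blinfun_apply)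
  moreover have "G (T x) = x" for x by (rule inj) (rule TG)
  ultimately have "T o\<^sub>L Blinfun G = id_blinfun" "Blinfun G o\<^sub>L T = id_blinfun"
    by (auto intro!: blinfun_eqI simp: TG)
  then show ?thesis unfolding GL_def by blast
qed

lemma norm_blinfun_le_Suc:
  fixes T :: "'a::real_normed_vector \<Rightarrow>\<^sub>L 'b::real_normed_vector"
  shows "norm (T v) \<le> (norm T + 1) * norm v"
  using norm_blinfun[of T v] by (simp add: distrib_right add_increasing2)

lemma GL_bounded_below:
  assumes "T \<in> GL"
  obtains c where "c > 0" "\<And>x. c * norm x \<le> norm (T x)"
proof -
  obtain B where B: "B o\<^sub>L T = id_blinfun" using assms by (auto simp: GL_def)
  have "norm x \<le> (norm B + 1) * norm (T x)" for x
    using norm_blinfun_le_Suc[of B "T x"] B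
    by (metis blinfun_apply_blinfun_compose blinfun_apply_id_blinfun id_apply)
  moreover have "0 < norm B + 1" by (simp add: add_nonneg_pos)
  ultimately show ?thesis using that[of "1 / (norm B + 1)"] by (simp add: divide_le_eq mult.commute)
qed

lemma onto_modulo_mono:
  assumes "onto_modulo T B" "span B \<subseteq> span C"
  shows "onto_modulo T C"
  using assms unfolding onto_modulo_def by blast

lemma onto_modulo_open:
  fixes T :: "'u::banach \<Rightarrow>\<^sub>L 'v::banach"
  assumes J: "inverse_modulo T B P J"
  obtains \<delta> where "\<delta> > 0" "\<And>T'. norm (T' - T) < \<delta> \<Longrightarrow> onto_modulo T' B"
proof -
  define \<delta> where "\<delta> = 1 / (2 * (norm J + 1))"
  have pos: "0 < norm J + 1" by (simp add: add_nonneg_pos)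
  then have \<delta>: "0 < \<delta>" by (simp add: \<delta>_def)
  have "onto_modulo T' B" if T': "norm (T' - T) < \<delta>" for T'
    unfolding onto_modulo_def
  proof
    fix w
    have "norm ((T' - T) o\<^sub>L J) \<le> norm (T' - T) * norm J" by (rule norm_blinfun_compose)
    also have "\<dots> \<le> \<delta> * (norm J + 1)" using T' \<delta> by (intro mult_mono) auto
    also have "\<dots> = 1 / 2" using pos by (simp add: \<delta>_def)
    finally obtain v where "(id_blinfun + ((T' - T) o\<^sub>L J)) v = w"
      using near_identity_surj[of "id_blinfun + ((T' - T) o\<^sub>L J)" "1/2" w] by auto
    then have "w - T' (J v) = v - T (J v)" by (auto simp: blinfun.add_left blinfun.diff_left)
    then show "\<exists>x. w - T' x \<in> span B" using inverse_moduloD(4)[OF J, of v] by metis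
  qed
  then show ?thesis using that \<delta> by blast
qed

lemma projection_onto_finite_span:
  fixes E :: "'a::real_normed_vector set"
  assumes E: "finite E" "independent E"
  obtains e \<pi> where "e ` {..<card E} = E" "dual_family (card E) \<pi> e"
proof -
  obtain e where e: "bij_betw e {0..<card E} E" using ex_bij_betw_nat_finite[OF E(1)] by auto
  then have "e ` {..<card E} = E" "inj_on e {..<card E}" by (auto simp: bij_betw_def lessThan_atLeast0)
  moreover from this obtain \<pi> :: "nat \<Rightarrow> 'a \<Rightarrow>\<^sub>L real" where "dual_family (card E) \<pi> e"
    using dual_family_exists[of e "card E"] E(2) by metis
  ultimately show ?thesis using that by blast
qed

lemma Fredholm0_onto_modulo_open:
  fixes T :: "'u::banach \<Rightarrow>\<^sub>L 'v::banach"
  assumes T: "T \<in> Fredholm0"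
  obtains B \<delta> where "finite B" "\<delta> > 0" "\<And>T'. norm (T' - T) < \<delta> \<Longrightarrow> onto_modulo T' B"
proof -
  obtain C where C: "finite C" "span (range T \<union> C) = UNIV"
    using T by (auto simp: Fredholm0_def fredholm_def finite_codim_def)
  obtain B where B: "B \<subseteq> C" "independent B" "C \<subseteq> span B" using maximal_independent_subset[of C] by blast
  have fB: "finite B" using B(1) C(1) finite_subset by blast
  have onto: "onto_modulo T B"
    unfolding onto_modulo_def
  proof
    fix v
    have "v \<in> {x + y |x y. x \<in> span (range T) \<and> y \<in> span C}" using C(2) by (simp add: span_Un)
    then obtain x b where "v = T x + b" "b \<in> span C"
      using span_eq_iff[THEN iffD2, OF subspace_range_blinfun[of T]] by auto
    then show "\<exists>x. v - T x \<in> span B"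
      using span_minimal[OF B(3) subspace_span] by (intro exI[of _ x]) auto
  qed
  obtain E where E: "finite E" "independent E" "span E = {x. T x \<in> span B}"
    using Fredholm0_preimage_basis[OF T fB B(2) onto] by metis
  obtain e \<pi> where e: "e ` {..<card E} = E" "dual_family (card E) \<pi> e"
    using projection_onto_finite_span[OF E(1,2)] .
  let ?P = "dual_projection (card E) \<pi> e"
  have "T (?P x) \<in> span B" for x
    using dual_projection_in_span[of "card E" \<pi> e x] unfolding e(1) E(3) by simp
  moreover have "?P x = x" if "T x \<in> span B" for x
    using dual_projection_on_span[OF e(2), of x] that unfolding e(1) E(3) by simp
  ultimately obtain J where "inverse_modulo T B ?P J" by (rule inverse_modulo_exists[OF fB onto])
  then obtain \<delta> where "\<delta> > 0" "\<And>T'. norm (T' - T) < \<delta> \<Longrightarrow> onto_modulo T' B"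
    using onto_modulo_open by metis
  with fB show ?thesis by (rule that)
qed

theorem Fredholm0_family_common_complement:
  fixes T :: "'a::metric_space \<Rightarrow> 'u::banach \<Rightarrow>\<^sub>L 'v::banach"
  assumes K: "compact K" and T: "continuous_on UNIV T" "\<And>x. T x \<in> Fredholm0"
  obtains B where "finite B" "independent B" "c \<in> span B" "\<And>x. x \<in> K \<Longrightarrow> onto_modulo (T x) B"
proof -
  have "\<exists>B \<delta>. finite B \<and> 0 < \<delta> \<and> (\<forall>T'. norm (T' - T x) < \<delta> \<longrightarrow> onto_modulo T' B)" for x
    using Fredholm0_onto_modulo_open[OF T(2)[of x]] by metis
  then obtain B \<delta> where B: "\<And>x. finite (B x)" "\<And>x. 0 < \<delta> x"
      "\<And>x T'. norm (T' - T x) < \<delta> x \<Longrightarrow> onto_modulo T' (B x)" by metis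
  define U where "U x = T -` ball (T x) (\<delta> x)" for x
  have "open (U x)" for x unfolding U_def by (rule open_vimage[OF open_ball T(1)])
  moreover have "K \<subseteq> (\<Union>x\<in>K. U x)" using B(2) by (auto simp: U_def)
  ultimately obtain D where D: "D \<subseteq> K" "finite D" "K \<subseteq> (\<Union>x\<in>D. U x)"
    using compactE_image[OF K, of K U] by metis
  define C where "C = insert c (\<Union>x\<in>D. B x)"
  obtain B' where B': "B' \<subseteq> C" "independent B'" "C \<subseteq> span B'" using maximal_independent_subset[of C] by blast
  have "onto_modulo (T x) B'" if xK: "x \<in> K" for x
  proof -
    obtain d where d: "d \<in> D" "x \<in> U d" using D(3) xK by blast
    then have "onto_modulo (T x) (B d)" by (intro B(3)) (simp add: U_def dist_norm norm_minus_commute)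
    moreover have "span (B d) \<subseteq> span B'" using d(1) B'(3) by (intro span_minimal) (auto simp: C_def)
    ultimately show ?thesis by (rule onto_modulo_mono)
  qed
  moreover have "finite C" using D(2) B(1) by (simp add: C_def)
  then have "finite B'" using B'(1) finite_subset by blast
  moreover have "c \<in> span B'" using B'(3) by (auto simp: C_def)
  ultimately show ?thesis using B'(2) that by blast
qed

section \<open>Generic rays through a simplex\<close>

definition independent_family :: "('k \<Rightarrow> 'w::real_vector) \<Rightarrow> 'k set \<Rightarrow> bool" where
  "independent_family v t \<longleftrightarrow> (\<forall>c. (\<Sum>k\<in>t. c k *\<^sub>R v k) = 0 \<longrightarrow> (\<forall>k\<in>t. c k = 0))"

definition zero_in_hull :: "('k \<Rightarrow> 'w::real_vector) \<Rightarrow> 'k set \<Rightarrow> bool" where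
  "zero_in_hull v s \<longleftrightarrow> (\<exists>a. (\<forall>k\<in>s. 0 \<le> a k) \<and> sum a s = 1 \<and> (\<Sum>k\<in>s. a k *\<^sub>R v k) = 0)"

definition in_cone :: "('k \<Rightarrow> 'w::real_vector) \<Rightarrow> 'k set \<Rightarrow> 'w \<Rightarrow> bool" where
  "in_cone v f d \<longleftrightarrow> (\<exists>a. (\<forall>k\<in>f. 0 \<le> a k) \<and> (\<Sum>k\<in>f. a k *\<^sub>R v k) = d)"

subsection \<open>Independent families\<close>

lemma independent_familyD:
  "independent_family v t \<Longrightarrow> (\<Sum>k\<in>t. c k *\<^sub>R v k) = 0 \<Longrightarrow> k \<in> t \<Longrightarrow> c k = 0"
  by (auto simp: independent_family_def)

lemma independent_family_inj_on:
  assumes "independent_family v t" "finite t"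
  shows "inj_on v t"
proof (rule inj_onI, rule ccontr)
  fix x y assume xy: "x \<in> t" "y \<in> t" "v x = v y" "x \<noteq> y"
  define c where "c = (\<lambda>k. if k = x then 1 else if k = y then - 1 else (0::real))"
  have "(\<Sum>k\<in>t. c k *\<^sub>R v k) = (\<Sum>k\<in>{x, y}. c k *\<^sub>R v k)"
    using xy assms(2) by (intro sum.mono_neutral_right) (auto simp: c_def)
  also have "\<dots> = 0" using xy by (simp add: c_def)
  finally have "c x = 0" using independent_familyD[OF assms(1)] xy by blast
  then show False by (simp add: c_def)
qed

lemma independent_family_image:
  assumes "independent_family v t" "finite t"
  shows "independent (v ` t)"
proof -
  have "\<forall>x\<in>v ` t. u x = 0" if "(\<Sum>x\<in>v ` t. u x *\<^sub>R x) = 0" for u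
  proof -
    have "(\<Sum>k\<in>t. u (v k) *\<^sub>R v k) = 0"
      using that by (simp add: sum.reindex[OF independent_family_inj_on[OF assms]])
    then show ?thesis using independent_familyD[OF assms(1), of "\<lambda>k. u (v k)"] by auto
  qed
  then show ?thesis using assms(2) by (auto simp: dependent_finite)
qed

lemma independent_family_insert:
  assumes "independent_family v t" "finite t" "k \<notin> t" "v k \<notin> span (v ` t)"
  shows "independent_family v (insert k t)"
  unfolding independent_family_def
proof (intro allI impI)
  fix c assume "(\<Sum>j\<in>insert k t. c j *\<^sub>R v j) = 0"
  then have rel: "c k *\<^sub>R v k + (\<Sum>j\<in>t. c j *\<^sub>R v j) = 0" using assms by simp
  have "c k = 0"
  proof (rule ccontr)
    assume ck: "c k \<noteq> 0"
    have "v k = (1 / c k) *\<^sub>R (c k *\<^sub>R v k)" using ck by simp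
    also have "c k *\<^sub>R v k = - (\<Sum>j\<in>t. c j *\<^sub>R v j)" using rel by (simp add: eq_neg_iff_add_eq_0)
    also have "(1 / c k) *\<^sub>R \<dots> \<in> span (v ` t)"
      by (intro span_scale span_neg span_sum span_base) auto
    finally show False using assms(4) by blast
  qed
  then show "\<forall>j\<in>insert k t. c j = 0" using rel independent_familyD[OF assms(1)] by auto
qed

lemma dependent_family_relation:
  assumes "finite s" "finite B" "card B < card s" "v ` s \<subseteq> span B"
  obtains c where "(\<Sum>k\<in>s. c k *\<^sub>R v k) = 0" "\<exists>k\<in>s. c k \<noteq> 0"
proof -
  have "\<not> independent_family v s"
  proof
    assume indep: "independent_family v s"
    then have "card (v ` s) \<le> card B"
      using independent_span_bound[OF assms(2) independent_family_image[OF indep assms(1)] assms(4)] by simp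
    then show False using card_image[OF independent_family_inj_on[OF indep assms(1)]] assms(3) by simp
  qed
  then show ?thesis using that unfolding independent_family_def by blast
qed

lemma independent_family_spans:
  assumes "finite t" "finite B" "card B \<le> card t" "v ` t \<subseteq> span B" "independent_family v t" "d \<in> span B"
  obtains a where "(\<Sum>k\<in>t. a k *\<^sub>R v k) = d"
proof -
  have inj: "inj_on v t" and ind: "independent (v ` t)"
    using independent_family_inj_on independent_family_image assms by auto
  have "d \<in> span (v ` t)"
  proof (rule ccontr)
    assume d: "d \<notin> span (v ` t)"
    then have "independent (insert d (v ` t))" using ind by (simp add: independent_insert)
    then have "card (insert d (v ` t)) \<le> card B"
      using independent_span_bound[OF assms(2)] assms(4,6) by blast
    moreover have "d \<notin> v ` t" using d span_superset[of "v ` t"] by auto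
    ultimately show False using assms(1,3) card_image[OF inj] by simp
  qed
  then obtain u where "d = (\<Sum>x\<in>v ` t. u x *\<^sub>R x)" using span_finite[of "v ` t"] assms(1) by auto
  then have "(\<Sum>k\<in>t. u (v k) *\<^sub>R v k) = d" by (simp add: sum.reindex[OF inj])
  then show ?thesis using that[of "\<lambda>k. u (v k)"] by simp
qed

definition facets_independent :: "('k \<Rightarrow> 'w::real_vector) \<Rightarrow> 'k set \<Rightarrow> bool" where
  "facets_independent v s \<longleftrightarrow> finite s \<and> (\<forall>k\<in>s. independent_family v (s - {k}))"

lemma facets_independent_relation_zero:
  assumes v: "facets_independent v s" and b: "(\<Sum>k\<in>s. b k *\<^sub>R v k) = 0" "i \<in> s" "b i = 0" and k: "k \<in> s"
  shows "b k = 0"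
proof (cases "k = i")
  case False
  have "(\<Sum>k\<in>s - {i}. b k *\<^sub>R v k) = 0" using b v by (simp add: sum.remove facets_independent_def)
  moreover have "independent_family v (s - {i})" using v b(2) by (simp add: facets_independent_def)
  ultimately show ?thesis using independent_familyD[of v "s - {i}" b k] k False by simp
qed (use b in simp)

lemma facets_independent_proportional:
  assumes v: "facets_independent v s" and a: "(\<Sum>k\<in>s. a k *\<^sub>R v k) = 0" and b: "(\<Sum>k\<in>s. b k *\<^sub>R v k) = 0"
    and i: "i \<in> s" "a i \<noteq> 0" and k: "k \<in> s"
  shows "b k = b i / a i * a k"
proof -
  have "(\<Sum>k\<in>s. (b k - b i / a i * a k) *\<^sub>R v k)
      = (\<Sum>k\<in>s. b k *\<^sub>R v k) - (b i / a i) *\<^sub>R (\<Sum>k\<in>s. a k *\<^sub>R v k)"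
    by (simp add: scaleR_diff_left sum_subtractf scaleR_sum_right)
  then have "(\<Sum>k\<in>s. (b k - b i / a i * a k) *\<^sub>R v k) = 0" using a b by simp
  from facets_independent_relation_zero[OF v this i(1) _ k] show ?thesis using i(2) by simp
qed

lemma facets_independent_weights_pos:
  assumes v: "facets_independent v s"
    and a: "\<And>k. k \<in> s \<Longrightarrow> 0 \<le> a k" "sum a s = 1" "(\<Sum>k\<in>s. a k *\<^sub>R v k) = 0" and k: "k \<in> s"
  shows "0 < a k"
proof (rule ccontr)
  assume "\<not> ?thesis"
  then have "a k = 0" using a(1)[OF k] by simp
  then have "sum a s = 0" using facets_independent_relation_zero[OF v a(3) k] by (intro sum.neutral) simp
  then show False using a(2) by simp
qed

lemma facets_independent_weights_unique:
  assumes v: "facets_independent v s"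
    and a: "\<And>k. k \<in> s \<Longrightarrow> 0 \<le> a k" "sum a s = 1" "(\<Sum>k\<in>s. a k *\<^sub>R v k) = 0"
    and b: "sum b s = 1" "(\<Sum>k\<in>s. b k *\<^sub>R v k) = 0" and k: "k \<in> s"
  shows "b k = a k"
proof -
  have pos: "0 < a k" by (rule facets_independent_weights_pos[OF v a k])
  have "b j = b k / a k * a j" if "j \<in> s" for j
    by (rule facets_independent_proportional[OF v a(3) b(2) k]) (use pos that in auto)
  then have "sum b s = b k / a k * sum a s" by (simp add: sum_distrib_left)
  then show ?thesis using a(2) b(1) pos by simp
qed

subsection \<open>The facets hit by a ray\<close>

lemma ex1_maximum:
  fixes t :: "'k \<Rightarrow> 'b::linorder"
  assumes "finite P" "P \<noteq> {}" "inj_on t P"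
  obtains p where "p \<in> P" "\<And>i. i \<in> P \<Longrightarrow> t i \<le> t p" "\<And>k. k \<in> P \<Longrightarrow> (\<forall>i\<in>P. t i \<le> t k) \<longleftrightarrow> k = p"
proof -
  have "Max (t ` P) \<in> t ` P" using assms by (intro Max_in) auto
  then obtain p where p: "p \<in> P" "t p = Max (t ` P)" by (metis imageE)
  have max: "t i \<le> t p" if "i \<in> P" for i using that p assms by simp
  have "k = p" if "k \<in> P" "\<forall>i\<in>P. t i \<le> t k" for k
    using inj_onD[OF assms(3) _ that(1) p(1)] that max[of k] p(1) by (simp add: antisym)
  then show ?thesis using p(1) max that by metis
qed

lemma card_interval_endpoints:
  fixes t :: "'k \<Rightarrow> real"
  assumes fin: "finite P" "finite Q" and PQ: "P \<inter> Q = {}" and inj: "inj_on t (P \<union> Q)"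
  defines "X \<equiv> {k \<in> P \<union> Q. (\<forall>i\<in>P. t i \<le> t k) \<and> (\<forall>i\<in>Q. t k \<le> t i)}"
  shows "P \<noteq> {} \<Longrightarrow> Q = {} \<Longrightarrow> card X = 1" "P = {} \<Longrightarrow> Q \<noteq> {} \<Longrightarrow> card X = 1"
    "P \<noteq> {} \<Longrightarrow> Q \<noteq> {} \<Longrightarrow> card X = 0 \<or> card X = 2"
proof -
  have injP: "inj_on t P" and injQ: "inj_on (\<lambda>k. - t k) Q" using inj by (auto simp: inj_on_def)
  show "card X = 1" if ne: "P \<noteq> {}" "Q = {}"
  proof -
    obtain p where "p \<in> P" "\<And>k. k \<in> P \<Longrightarrow> (\<forall>i\<in>P. t i \<le> t k) \<longleftrightarrow> k = p"
      using ex1_maximum[OF fin(1) ne(1) injP] by metis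
    then have "X = {p}" using ne by (auto simp: X_def)
    then show ?thesis by simp
  qed
  show "card X = 1" if ne: "P = {}" "Q \<noteq> {}"
  proof -
    obtain q where "q \<in> Q" "\<And>k. k \<in> Q \<Longrightarrow> (\<forall>i\<in>Q. - t i \<le> - t k) \<longleftrightarrow> k = q"
      using ex1_maximum[OF fin(2) ne(2) injQ] by metis
    then have "X = {q}" using ne by (auto simp: X_def)
    then show ?thesis by simp
  qed
  show "card X = 0 \<or> card X = 2" if ne: "P \<noteq> {}" "Q \<noteq> {}"
  proof -
    obtain p where p: "p \<in> P" "\<And>i. i \<in> P \<Longrightarrow> t i \<le> t p" "\<And>k. k \<in> P \<Longrightarrow> (\<forall>i\<in>P. t i \<le> t k) \<longleftrightarrow> k = p"
      using ex1_maximum[OF fin(1) ne(1) injP] by metis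
    obtain q where q: "q \<in> Q" "\<And>i. i \<in> Q \<Longrightarrow> - t i \<le> - t q" "\<And>k. k \<in> Q \<Longrightarrow> (\<forall>i\<in>Q. - t i \<le> - t k) \<longleftrightarrow> k = q"
      using ex1_maximum[OF fin(2) ne(2) injQ] by metis
    have "(\<forall>i\<in>Q. x \<le> t i) \<longleftrightarrow> x \<le> t q" "(\<forall>i\<in>P. t i \<le> x) \<longleftrightarrow> t p \<le> x" for x
      using p(1,2) q(1,2) by force+
    then have "k \<in> P \<Longrightarrow> k \<in> X \<longleftrightarrow> k = p \<and> t p \<le> t q" "k \<in> Q \<Longrightarrow> k \<in> X \<longleftrightarrow> k = q \<and> t p \<le> t q" for k
      using p(3)[of k] q(3)[of k] by (auto simp: X_def)
    then have "X = (if t p \<le> t q then {p, q} else {})" using p(1) q(1) by (auto simp: X_def)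
    moreover have "p \<noteq> q" using p(1) q(1) PQ by blast
    ultimately show ?thesis by simp
  qed
qed

text \<open>
  A generic ray from the origin leaves a simplex through exactly one facet if the origin lies
  inside, and otherwise meets none or two facets: the representations of a point of the ray by the
  vertices form a line \<open>a + \<tau> c\<close>, whose feasible part is an interval.
\<close>

locale ray_through_simplex =
  fixes s :: "'k set" and v :: "'k \<Rightarrow> 'w::real_vector" and a c :: "'k \<Rightarrow> real" and d :: 'w
  assumes facets: "facets_independent v s" and nonempty: "s \<noteq> {}"
    and relation: "(\<Sum>k\<in>s. c k *\<^sub>R v k) = 0" and relation_nz: "\<And>k. k \<in> s \<Longrightarrow> c k \<noteq> 0"
    and representation: "(\<Sum>k\<in>s. a k *\<^sub>R v k) = d"
    and generic: "\<And>j k. j \<in> s \<Longrightarrow> k \<in> s \<Longrightarrow> j \<noteq> k \<Longrightarrow> d \<notin> span (v ` (s - {j, k}))"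
begin

definition exit_time :: "'k \<Rightarrow> real" where
  "exit_time k = - a k / c k"

lemma finite_s: "finite s"
  using facets by (simp add: facets_independent_def)

lemma line_representation: "(\<Sum>j\<in>s. (a j + r * c j) *\<^sub>R v j) = d"
proof -
  have "(\<Sum>j\<in>s. (a j + r * c j) *\<^sub>R v j) = (\<Sum>j\<in>s. a j *\<^sub>R v j) + r *\<^sub>R (\<Sum>j\<in>s. c j *\<^sub>R v j)"
    by (simp add: scaleR_add_left sum.distrib scaleR_sum_right)
  then show ?thesis using representation relation by simp
qed

lemma exit_time_vanish: "k \<in> s \<Longrightarrow> a k + exit_time k * c k = 0"
  using relation_nz by (simp add: exit_time_def)

lemma in_cone_facet_iff:
  assumes k: "k \<in> s"
  shows "in_cone v (s - {k}) d \<longleftrightarrow> (\<forall>j\<in>s. 0 \<le> a j + exit_time k * c j)"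
proof
  assume "in_cone v (s - {k}) d"
  then obtain b where b: "\<forall>j\<in>s - {k}. 0 \<le> b j" "(\<Sum>j\<in>s - {k}. b j *\<^sub>R v j) = d"
    by (auto simp: in_cone_def)
  define b' where "b' = b(k := 0)"
  have "(\<Sum>j\<in>s. b' j *\<^sub>R v j) = d" using b(2) finite_s k by (simp add: sum.remove[of s k] b'_def)
  then have "(\<Sum>j\<in>s. (b' j - (a j + exit_time k * c j)) *\<^sub>R v j) = 0"
    using line_representation[of "exit_time k"] by (simp add: scaleR_diff_left sum_subtractf)
  from facets_independent_relation_zero[OF facets this k]
  have "a j + exit_time k * c j = b' j" if "j \<in> s" for j
    using that exit_time_vanish[OF k] by (simp add: b'_def)
  then show "\<forall>j\<in>s. 0 \<le> a j + exit_time k * c j" using b(1) by (simp add: b'_def)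
next
  assume pos: "\<forall>j\<in>s. 0 \<le> a j + exit_time k * c j"
  have "(\<Sum>j\<in>s - {k}. (a j + exit_time k * c j) *\<^sub>R v j) = d"
    using line_representation[of "exit_time k"] finite_s k exit_time_vanish[OF k] by (simp add: sum.remove[of s k])
  then show "in_cone v (s - {k}) d"
    unfolding in_cone_def using pos by (intro exI[of _ "\<lambda>j. a j + exit_time k * c j"]) auto
qed

lemma exit_time_inj: "inj_on exit_time s"
proof (rule inj_onI, rule ccontr)
  fix j k assume jk: "j \<in> s" "k \<in> s" "exit_time j = exit_time k" "j \<noteq> k"
  have "(\<Sum>i\<in>s - {j, k}. (a i + exit_time k * c i) *\<^sub>R v i) = (\<Sum>i\<in>s. (a i + exit_time k * c i) *\<^sub>R v i)"
    using finite_s exit_time_vanish[OF jk(1)] exit_time_vanish[OF jk(2)] jk(3)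
    by (intro sum.mono_neutral_left) auto
  then have "d = (\<Sum>i\<in>s - {j, k}. (a i + exit_time k * c i) *\<^sub>R v i)" by (simp add: line_representation)
  also have "\<dots> \<in> span (v ` (s - {j, k}))" by (intro span_sum span_scale span_base) auto
  finally show False using generic[OF jk(1,2,4)] by blast
qed

definition "pos_vertices = {k\<in>s. c k > 0}"
definition "neg_vertices = {k\<in>s. c k < 0}"

lemma vertices_eq: "s = pos_vertices \<union> neg_vertices"
  using relation_nz by (force simp: pos_vertices_def neg_vertices_def)

lemma feasible_iff:
  "(\<forall>j\<in>s. 0 \<le> a j + r * c j) \<longleftrightarrow> (\<forall>i\<in>pos_vertices. exit_time i \<le> r) \<and> (\<forall>i\<in>neg_vertices. r \<le> exit_time i)"
proof -
  have "0 \<le> a j + r * c j \<longleftrightarrow> exit_time j \<le> r" if "j \<in> pos_vertices" for j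
    using that by (auto simp: pos_vertices_def exit_time_def field_simps)
  moreover have "0 \<le> a j + r * c j \<longleftrightarrow> r \<le> exit_time j" if "j \<in> neg_vertices" for j
    using that by (auto simp: neg_vertices_def exit_time_def field_simps)
  ultimately show ?thesis using vertices_eq by blast
qed

lemma zero_in_hull_iff: "zero_in_hull v s \<longleftrightarrow> pos_vertices = {} \<or> neg_vertices = {}"
proof
  assume "zero_in_hull v s"
  then obtain b where b: "\<And>k. k \<in> s \<Longrightarrow> 0 \<le> b k" "sum b s = 1" "(\<Sum>k\<in>s. b k *\<^sub>R v k) = 0"
    by (auto simp: zero_in_hull_def)
  have b_pos: "0 < b k" if "k \<in> s" for k using facets_independent_weights_pos[OF facets b that] .
  obtain i where i: "i \<in> s" using nonempty by blast
  have "c k = c i / b i * b k" if "k \<in> s" for k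
    using facets_independent_proportional[OF facets b(3) relation i _ that] b_pos[OF i] by simp
  then have "0 < c k \<longleftrightarrow> 0 < c i" if "k \<in> s" for k
    using b_pos[OF i] b_pos[OF that] that by (simp add: zero_less_mult_iff zero_less_divide_iff)
  then show "pos_vertices = {} \<or> neg_vertices = {}"
    by (force simp: pos_vertices_def neg_vertices_def)
next
  assume sign: "pos_vertices = {} \<or> neg_vertices = {}"
  define C where "C = sum c s"
  have "C \<noteq> 0 \<and> (\<forall>k\<in>s. 0 \<le> c k / C)"
  proof (cases "neg_vertices = {}")
    case True
    then have pos: "\<forall>k\<in>s. 0 < c k" using vertices_eq by (auto simp: pos_vertices_def)
    then have "C > 0" unfolding C_def using finite_s nonempty by (intro sum_pos) auto
    then show ?thesis using pos by (auto intro: less_imp_le)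
  next
    case False
    then have neg: "\<forall>k\<in>s. 0 < - c k" using vertices_eq sign by (auto simp: neg_vertices_def)
    then have "sum (\<lambda>k. - c k) s > 0" using finite_s nonempty by (intro sum_pos) auto
    then have "C < 0" unfolding C_def by (simp add: sum_negf)
    then show ?thesis using neg by (auto intro: divide_nonpos_neg less_imp_le)
  qed
  moreover have "(\<Sum>k\<in>s. (c k / C) *\<^sub>R v k) = (1 / C) *\<^sub>R (\<Sum>k\<in>s. c k *\<^sub>R v k)"
    by (simp add: scaleR_sum_right)
  ultimately show "zero_in_hull v s" unfolding zero_in_hull_def using relation
    by (intro exI[of _ "\<lambda>k. c k / C"]) (auto simp: sum_divide_distrib[symmetric] C_def)
qed

lemma card_facets_hit:
  "zero_in_hull v s \<Longrightarrow> card {k\<in>s. in_cone v (s - {k}) d} = 1"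
  "\<not> zero_in_hull v s \<Longrightarrow> card {k\<in>s. in_cone v (s - {k}) d} = 0 \<or> card {k\<in>s. in_cone v (s - {k}) d} = 2"
proof -
  have hit: "{k\<in>s. in_cone v (s - {k}) d} = {k \<in> pos_vertices \<union> neg_vertices.
      (\<forall>i\<in>pos_vertices. exit_time i \<le> exit_time k) \<and> (\<forall>i\<in>neg_vertices. exit_time k \<le> exit_time i)}"
    unfolding feasible_iff[symmetric] vertices_eq[symmetric] using in_cone_facet_iff by blast
  have fin: "finite pos_vertices" "finite neg_vertices"
    using finite_s by (simp_all add: pos_vertices_def neg_vertices_def)
  have disjoint: "pos_vertices \<inter> neg_vertices = {}"
    unfolding pos_vertices_def neg_vertices_def using less_asym by blast
  have inj: "inj_on exit_time (pos_vertices \<union> neg_vertices)"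
    by (simp only: vertices_eq[symmetric] exit_time_inj)
  note count = card_interval_endpoints[OF fin disjoint inj]
  show "card {k\<in>s. in_cone v (s - {k}) d} = 1" if "zero_in_hull v s"
    unfolding hit using count(1,2) that zero_in_hull_iff vertices_eq nonempty by blast
  show "card {k\<in>s. in_cone v (s - {k}) d} = 0 \<or> card {k\<in>s. in_cone v (s - {k}) d} = 2"
    if "\<not> zero_in_hull v s"
    unfolding hit using count(3) that zero_in_hull_iff by blast
qed

end

lemma card_facets_hit_by_generic_ray:
  fixes v :: "'k \<Rightarrow> 'w::real_vector"
  assumes s: "facets_independent v s" "card s = Suc m" and B: "finite B" "card B = m" and vB: "v ` s \<subseteq> span B"
    and d: "d \<in> span B" and generic: "\<And>t. t \<subseteq> s \<Longrightarrow> card t < m \<Longrightarrow> d \<notin> span (v ` t)"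
  shows "zero_in_hull v s \<Longrightarrow> card {k\<in>s. in_cone v (s - {k}) d} = 1"
    and "\<not> zero_in_hull v s \<Longrightarrow> card {k\<in>s. in_cone v (s - {k}) d} = 0 \<or> card {k\<in>s. in_cone v (s - {k}) d} = 2"
proof -
  have fin: "finite s" using s(1) by (simp add: facets_independent_def)
  obtain c where c: "(\<Sum>k\<in>s. c k *\<^sub>R v k) = 0" "\<exists>k\<in>s. c k \<noteq> 0"
    using dependent_family_relation[OF fin B(1) _ vB] B(2) s(2) by auto
  then obtain i where i: "i \<in> s" by blast
  obtain a where a: "(\<Sum>k\<in>s - {i}. a k *\<^sub>R v k) = d"
    by (rule independent_family_spans[of "s - {i}" B v d])
      (use fin B s vB i d in \<open>auto simp: facets_independent_def\<close>)
  have "ray_through_simplex s v (a(i := 0)) c d"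
  proof
    show "s \<noteq> {}" using i by blast
    show "c k \<noteq> 0" if "k \<in> s" for k using facets_independent_relation_zero[OF s(1) c(1) that] c(2) by blast
    show "(\<Sum>k\<in>s. (a(i := 0)) k *\<^sub>R v k) = d" using a fin i by (simp add: sum.remove[of s i])
    show "d \<notin> span (v ` (s - {j, k}))" if "j \<in> s" "k \<in> s" "j \<noteq> k" for j k
    proof (rule generic)
      have "card {j, k} \<le> card s" using fin that by (intro card_mono) auto
      then show "card (s - {j, k}) < m" using fin s(2) that by (simp add: card_Diff_subset)
    qed blast
  qed (rule s(1) c(1))+
  note count = ray_through_simplex.card_facets_hit[OF this]
  show "zero_in_hull v s \<Longrightarrow> card {k\<in>s. in_cone v (s - {k}) d} = 1"
    and "\<not> zero_in_hull v s \<Longrightarrow> card {k\<in>s. in_cone v (s - {k}) d} = 0 \<or> card {k\<in>s. in_cone v (s - {k}) d} = 2"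
    by (fact count)+
qed

subsection \<open>Generic perturbations\<close>

lemma line_meets_subspace_finite:
  fixes y z :: "'w::real_vector"
  assumes S: "subspace S" and "y \<notin> S \<or> z \<notin> S"
  shows "finite {\<tau>. y + \<tau> *\<^sub>R z \<in> S}"
proof (cases "z \<in> S")
  case True
  then have "y + \<tau> *\<^sub>R z \<notin> S" for \<tau>
    using assms subspace_diff[OF S, of "y + \<tau> *\<^sub>R z" "\<tau> *\<^sub>R z"] subspace_scale[OF S] by auto
  then show ?thesis by simp
next
  case False
  have "\<tau> = \<tau>'" if "y + \<tau> *\<^sub>R z \<in> S" "y + \<tau>' *\<^sub>R z \<in> S" for \<tau> \<tau>'
  proof (rule ccontr)
    assume "\<tau> \<noteq> \<tau>'"
    moreover have "(\<tau> - \<tau>') *\<^sub>R z \<in> S" using subspace_diff[OF S that] by (simp add: algebra_simps)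
    from subspace_scale[OF S this, of "1 / (\<tau> - \<tau>')"] have "\<tau> \<noteq> \<tau>' \<Longrightarrow> z \<in> S" by simp
    ultimately show False using False by blast
  qed
  then have "\<exists>\<tau>0. {\<tau>. y + \<tau> *\<^sub>R z \<in> S} \<subseteq> {\<tau>0}" by blast
  then show ?thesis using finite_subset by blast
qed

lemma perturbation_avoiding_subspaces:
  fixes Y :: "'w::real_normed_vector set"
  assumes fin: "finite \<P>" and Y: "subspace Y" and \<P>: "\<And>x S. (x, S) \<in> \<P> \<Longrightarrow> subspace S \<and> \<not> Y \<subseteq> S" and \<eta>: "\<eta> > 0"
  shows "\<exists>\<rho>\<in>Y. norm \<rho> < \<eta> \<and> (\<forall>x S. (x, S) \<in> \<P> \<longrightarrow> x + \<rho> \<notin> S)"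
  using fin \<P>
proof (induction \<P>)
  case empty
  then show ?case using subspace_0[OF Y] \<eta> by (intro bexI[of _ 0]) auto
next
  case (insert p \<P>)
  obtain x0 S0 where p: "p = (x0, S0)" by (cases p)
  obtain \<rho> where \<rho>: "\<rho> \<in> Y" "norm \<rho> < \<eta>" "\<And>x S. (x, S) \<in> \<P> \<Longrightarrow> x + \<rho> \<notin> S"
    using insert.IH insert.prems by fastforce
  obtain z where z: "z \<in> Y" "z \<notin> S0" using insert.prems[of x0 S0] p by auto
  have "finite {\<tau>. x + \<rho> + \<tau> *\<^sub>R z \<in> S}" if "(x, S) \<in> insert p \<P>" for x S
    using line_meets_subspace_finite[of S "x + \<rho>" z] insert.prems[OF that] \<rho>(3)[of x S] that z(2) p by auto
  then have "finite (\<Union>(x, S)\<in>insert p \<P>. {\<tau>. x + \<rho> + \<tau> *\<^sub>R z \<in> S})"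
    by (intro finite_UN_I) (use insert.hyps(1) in \<open>auto split: prod.split\<close>)
  moreover have "infinite {0<..<(\<eta> - norm \<rho>) / (norm z + 1)}"
    using \<rho>(2) by (intro infinite_Ioo divide_pos_pos) (auto simp: add_nonneg_pos)
  ultimately obtain \<tau> where \<tau>: "\<tau> \<in> {0<..<(\<eta> - norm \<rho>) / (norm z + 1)}"
      "\<tau> \<notin> (\<Union>(x, S)\<in>insert p \<P>. {\<tau>. x + \<rho> + \<tau> *\<^sub>R z \<in> S})"
    by (meson finite_subset subsetI)
  have "\<tau> * norm z \<le> \<tau> * (norm z + 1)" using \<tau>(1) by (intro mult_left_mono) auto
  also have "\<dots> < \<eta> - norm \<rho>" using \<tau>(1) by (simp add: pos_less_divide_eq add_nonneg_pos)
  finally have "norm (\<rho> + \<tau> *\<^sub>R z) < \<eta>" using norm_triangle_ineq[of \<rho> "\<tau> *\<^sub>R z"] \<tau>(1) by simp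
  moreover have "\<rho> + \<tau> *\<^sub>R z \<in> Y" using Y \<rho>(1) z(1) by (simp add: subspace_add subspace_scale)
  moreover have "\<forall>x S. (x, S) \<in> insert p \<P> \<longrightarrow> x + (\<rho> + \<tau> *\<^sub>R z) \<notin> S" using \<tau>(2) by (auto simp: add.assoc)
  ultimately show ?case by blast
qed

lemma small_span_not_superset:
  assumes "finite B" "independent B" "finite t" "card t < card B"
  shows "\<not> span B \<subseteq> span (v ` t)"
proof
  assume "span B \<subseteq> span (v ` t)"
  then have "B \<subseteq> span (v ` t)" using span_superset by blast
  then have "card B \<le> card (v ` t)" using independent_span_bound[OF _ assms(2)] assms(3) by blast
  then show False using card_image_le[OF assms(3), of v] assms(4) by linarith
qed

definition general_position :: "'w::real_vector set \<Rightarrow> ('k \<Rightarrow> 'w) \<Rightarrow> 'k set \<Rightarrow> bool" where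
  "general_position B v G \<longleftrightarrow> v ` G \<subseteq> span B \<and> (\<forall>t\<subseteq>G. card t \<le> card B \<longrightarrow> independent_family v t)"

lemma general_position_insert:
  assumes G: "finite G" and v: "general_position B v G" and vk: "v k \<in> span B"
    and avoid: "\<And>t. t \<subseteq> G \<Longrightarrow> card t < card B \<Longrightarrow> v k \<notin> span (v ` t)"
  shows "general_position B v (insert k G)"
  unfolding general_position_def
proof (intro conjI allI impI)
  show "v ` insert k G \<subseteq> span B" using v vk by (auto simp: general_position_def)
  fix t assume t: "t \<subseteq> insert k G" "card t \<le> card B"
  have fin: "finite t" using t(1) G finite_subset by blast
  have "card (t - {k}) \<le> card B" using fin t(2) card_Diff1_le[of t k] by linarith
  moreover have "t - {k} \<subseteq> G" using t(1) by blast
  ultimately have rest: "independent_family v (t - {k})" using v by (simp add: general_position_def)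
  show "independent_family v t"
  proof (cases "k \<in> t")
    case True
    have "card (t - {k}) < card B" using card_Diff1_less[OF fin True] t(2) by linarith
    then have "v k \<notin> span (v ` (t - {k}))" using t(1) by (intro avoid) auto
    then have "independent_family v (insert k (t - {k}))"
      by (intro independent_family_insert[OF rest]) (use fin in auto)
    then show ?thesis using True by (simp add: insert_absorb)
  qed (use rest in simp)
qed

lemma general_position_cong:
  assumes "\<And>k. k \<in> G \<Longrightarrow> v k = v' k"
  shows "general_position B v G \<longleftrightarrow> general_position B v' G"
proof -
  have "(\<Sum>k\<in>t. c k *\<^sub>R v k) = (\<Sum>k\<in>t. c k *\<^sub>R v' k)" if "t \<subseteq> G" for t c
    using assms that by (intro sum.cong) auto
  moreover have "v ` G = v' ` G" using assms by simp
  ultimately show ?thesis unfolding general_position_def independent_family_def by simp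
qed

lemma generic_perturbation:
  fixes b b' :: "'k \<Rightarrow> 'w::real_normed_vector"
  assumes "finite G" and B: "finite B" "independent B" and \<eta>: "\<eta> > 0"
    and "b ` G \<subseteq> span B" "b' ` G \<subseteq> span B"
  shows "\<exists>\<rho>. (\<forall>k\<in>G. \<rho> k \<in> span B \<and> norm (\<rho> k) < \<eta>) \<and>
    general_position B (\<lambda>k. b k + \<rho> k) G \<and> general_position B (\<lambda>k. b' k + \<rho> k) G"
  using assms(1,5,6)
proof (induction G)
  case empty
  then show ?case by (auto simp: independent_family_def general_position_def)
next
  case (insert k G)
  then obtain \<rho> where \<rho>: "\<forall>j\<in>G. \<rho> j \<in> span B \<and> norm (\<rho> j) < \<eta>"
    "general_position B (\<lambda>k. b k + \<rho> k) G" "general_position B (\<lambda>k. b' k + \<rho> k) G" by auto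
  define \<T> where "\<T> = {t. t \<subseteq> G \<and> card t < card B}"
  define \<P> where "\<P> = (\<lambda>t. (b k, span ((\<lambda>k. b k + \<rho> k) ` t))) ` \<T> \<union> (\<lambda>t. (b' k, span ((\<lambda>k. b' k + \<rho> k) ` t))) ` \<T>"
  have "finite \<P>" using insert.hyps(1) by (simp add: \<P>_def \<T>_def)
  moreover have "subspace S \<and> \<not> span B \<subseteq> S" if "(x, S) \<in> \<P>" for x S
    using that small_span_not_superset[OF B] finite_subset[OF _ insert.hyps(1)] by (auto simp: \<P>_def \<T>_def)
  ultimately obtain r where r: "r \<in> span B" "norm r < \<eta>" "\<And>x S. (x, S) \<in> \<P> \<Longrightarrow> x + r \<notin> S"
    using perturbation_avoiding_subspaces[OF _ subspace_span _ \<eta>, of \<P> B] by metis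
  define \<rho>' where "\<rho>' = \<rho>(k := r)"
  have "general_position B (\<lambda>j. \<beta> j + \<rho>' j) (insert k G)"
    if \<beta>: "general_position B (\<lambda>j. \<beta> j + \<rho> j) G" "\<beta> k \<in> span B"
      and avoid: "\<And>t. t \<in> \<T> \<Longrightarrow> \<beta> k + r \<notin> span ((\<lambda>k. \<beta> k + \<rho> k) ` t)" for \<beta>
  proof (rule general_position_insert[OF insert.hyps(1)])
    have same: "\<beta> j + \<rho>' j = \<beta> j + \<rho> j" if "j \<in> G" for j using that insert.hyps(2) by (auto simp: \<rho>'_def)
    show "general_position B (\<lambda>j. \<beta> j + \<rho>' j) G"       using \<beta>(1) by (simp only: general_position_cong[of G "\<lambda>j. \<beta> j + \<rho>' j" "\<lambda>j. \<beta> j + \<rho> j", OF same])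
    show "\<beta> k + \<rho>' k \<in> span B" using \<beta>(2) r(1) by (simp add: \<rho>'_def span_add)
    show "\<beta> k + \<rho>' k \<notin> span ((\<lambda>j. \<beta> j + \<rho>' j) ` t)" if "t \<subseteq> G" "card t < card B" for t
    proof -
      have "(\<lambda>j. \<beta> j + \<rho>' j) ` t = (\<lambda>j. \<beta> j + \<rho> j) ` t" using same that(1) by (intro image_cong) auto
      then show ?thesis using avoid[of t] that by (simp add: \<rho>'_def \<T>_def)
    qed
  qed
  then have "general_position B (\<lambda>j. b j + \<rho>' j) (insert k G)" "general_position B (\<lambda>j. b' j + \<rho>' j) (insert k G)"
    using \<rho>(2,3) r(3) insert.prems by (auto simp: \<P>_def)
  moreover have "\<forall>j\<in>insert k G. \<rho>' j \<in> span B \<and> norm (\<rho>' j) < \<eta>" using \<rho>(1) r by (auto simp: \<rho>'_def)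
  ultimately show ?case by blast
qed

section \<open>Parity of the number of simplices around the origin\<close>

lemma even_count_via_faces:
  fixes bnd compo compo' face S F
  defines "nF s \<equiv> card {f\<in>F. face f s \<and> compo' f}"
  assumes fin: "finite F" "finite S"
    and one: "\<And>f. f \<in> F \<Longrightarrow> bnd f \<Longrightarrow> card {s\<in>S. face f s} = 1"
    and two: "\<And>f. f \<in> F \<Longrightarrow> \<not> bnd f \<Longrightarrow> card {s\<in>S. face f s} = 2"
    and yes: "\<And>s. s \<in> S \<Longrightarrow> compo s \<Longrightarrow> nF s = 1"
    and no: "\<And>s. s \<in> S \<Longrightarrow> \<not> compo s \<Longrightarrow> nF s = 0 \<or> nF s = 2"
  shows "even (card {s\<in>S. compo s}) \<longleftrightarrow> even (card {f\<in>F. compo' f \<and> bnd f})"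
proof -
  let ?F = "{f\<in>F. compo' f}"
  have "(\<Sum>s\<in>S. nF s) = (\<Sum>s\<in>S. card {f\<in>?F. face f s})"
    by (intro sum.cong refl) (auto simp: nF_def intro!: arg_cong[where f=card])
  also have "\<dots> = (\<Sum>f\<in>?F. card {s\<in>S. face f s})"
    by (rule sum_multicount_gen) (use fin in auto)
  finally have double_count: "(\<Sum>s\<in>S. nF s) = (\<Sum>f\<in>?F. card {s\<in>S. face f s})" .
  have "{s\<in>S. odd (nF s)} = {s\<in>S. compo s}" using yes no by fastforce
  then have "even (\<Sum>s\<in>S. nF s) \<longleftrightarrow> even (card {s\<in>S. compo s})"
    using even_sum_iff[OF fin(2), of nF] by simp
  moreover have "{f\<in>?F. odd (card {s\<in>S. face f s})} = {f\<in>F. compo' f \<and> bnd f}" using one two by fastforce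
  then have "even (\<Sum>f\<in>?F. card {s\<in>S. face f s}) \<longleftrightarrow> even (card {f\<in>F. compo' f \<and> bnd f})"
    using even_sum_iff[of ?F "\<lambda>f. card {s\<in>S. face f s}"] fin(1) by simp
  ultimately show ?thesis using double_count by simp
qed

definition kuhn_grid :: "nat \<Rightarrow> nat \<Rightarrow> (nat \<Rightarrow> nat) set" where
  "kuhn_grid p m = {k. (\<forall>i<m. k i \<le> p) \<and> (\<forall>i\<ge>m. k i = p)}"

definition kuhn_facets :: "nat \<Rightarrow> nat \<Rightarrow> (nat \<Rightarrow> nat) set set" where
  "kuhn_facets p m = {f. \<exists>s. ksimplex p m s \<and> (\<exists>a\<in>s. f = s - {a})}"

definition boundary_facet :: "nat \<Rightarrow> nat \<Rightarrow> (nat \<Rightarrow> nat) set \<Rightarrow> bool" where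
  "boundary_facet p m f \<longleftrightarrow> (\<exists>j<m. \<forall>x\<in>f. x j = 0) \<or> (\<exists>j<m. \<forall>x\<in>f. x j = p)"

lemma finite_kuhn_grid: "finite (kuhn_grid p m)"
proof -
  have "finite {k::nat \<Rightarrow> nat. \<forall>i. (i \<in> {..<m} \<longrightarrow> k i \<in> {..p}) \<and> (i \<notin> {..<m} \<longrightarrow> k i = p)}"
    by (rule finite_set_of_finite_funs) auto
  then show ?thesis by (rule finite_subset[rotated]) (auto simp: kuhn_grid_def)
qed

lemma ksimplex_subset_grid: "ksimplex p m s \<Longrightarrow> s \<subseteq> kuhn_grid p m"
  unfolding kuhn_grid_def
  by (elim ksimplex.cases) (auto simp: kuhn_simplex.s_le_p kuhn_simplex.out_eq_p)

lemma ksimplex_finite: "ksimplex p m s \<Longrightarrow> finite s"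
  using ksimplex_subset_grid finite_kuhn_grid finite_subset by metis

lemma ksimplex_facets_independent:
  assumes v: "general_position B v (kuhn_grid p m)" "card B = m" and s: "ksimplex p m s"
  shows "facets_independent v s"
  unfolding facets_independent_def
proof (intro conjI ballI ksimplex_finite[OF s])
  fix k assume "k \<in> s"
  then have "card (s - {k}) = m" using ksimplex_card[OF s] ksimplex_finite[OF s] by simp
  then show "independent_family v (s - {k})"
    using v ksimplex_subset_grid[OF s] unfolding general_position_def by (metis Diff_subset order.trans order_refl)
qed

lemma card_simplices_containing_facet:
  assumes f: "f \<in> kuhn_facets p m" and m: "0 < m"
  shows "card {s\<in>{s. ksimplex p m s}. \<exists>a\<in>s. f = s - {a}} = (if boundary_facet p m f then 1 else 2)"
proof -
  obtain s a where s: "ksimplex p m s" "a \<in> s" "f = s - {a}" using f by (auto simp: kuhn_facets_def)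
  have eq: "{s\<in>{s. ksimplex p m s}. \<exists>a\<in>s. f = s - {a}} = {s'. ksimplex p m s' \<and> (\<exists>b\<in>s'. s' - {b} = s - {a})}"
    using s(3) by auto
  consider j where "j < m" "\<forall>x\<in>f. x j = 0" | j where "j < m" "\<forall>x\<in>f. x j = p" | "\<not> boundary_facet p m f"
    unfolding boundary_facet_def by blast
  then show ?thesis
  proof cases
    case (1 j)
    then show ?thesis
      unfolding eq using ksimplex_replace_0[OF s(1,2), of j] s(3) by (auto simp: boundary_facet_def)
  next
    case (2 j)
    then show ?thesis
      unfolding eq using ksimplex_replace_1[OF s(1,2), of j] s(3) by (auto simp: boundary_facet_def)
  next
    case 3
    then show ?thesis
      unfolding eq using ksimplex_replace_2[OF s(1,2)] m s(3) by (auto simp: boundary_facet_def)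
  qed
qed

lemma even_simplices_iff_even_boundary_hits:
  fixes v :: "(nat \<Rightarrow> nat) \<Rightarrow> 'w::real_normed_vector"
  assumes m: "0 < m" and B: "finite B" "card B = m" and v: "general_position B v (kuhn_grid p m)"
    and d: "d \<in> span B" "\<And>t. t \<subseteq> kuhn_grid p m \<Longrightarrow> card t < m \<Longrightarrow> d \<notin> span (v ` t)"
  shows "even (card {s. ksimplex p m s \<and> zero_in_hull v s}) \<longleftrightarrow>
    even (card {f\<in>kuhn_facets p m. in_cone v f d \<and> boundary_facet p m f})"
proof -
  let ?S = "{s. ksimplex p m s}" and ?F = "kuhn_facets p m" and ?face = "\<lambda>f s. \<exists>a\<in>s. f = s - {a}"
  have finS: "finite ?S" by (rule finite_ksimplexes)
  have F_eq: "?F = (\<Union>s\<in>?S. (\<lambda>a. s - {a}) ` s)" by (auto simp: kuhn_facets_def)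
  have finF: "finite ?F" unfolding F_eq using finS ksimplex_finite by auto
  have "even (card {s\<in>?S. zero_in_hull v s}) \<longleftrightarrow> even (card {f\<in>?F. in_cone v f d \<and> boundary_facet p m f})"
  proof (rule even_count_via_faces[OF finF finS, where face = ?face])
    fix s assume s: "s \<in> ?S"
    have "{f\<in>?F. ?face f s \<and> in_cone v f d} = (\<lambda>k. s - {k}) ` {k\<in>s. in_cone v (s - {k}) d}"
      using s by (auto simp: kuhn_facets_def)
    moreover have "inj_on (\<lambda>k. s - {k}) {k\<in>s. in_cone v (s - {k}) d}" by (auto simp: inj_on_def)
    ultimately have hits: "card {f\<in>?F. ?face f s \<and> in_cone v f d} = card {k\<in>s. in_cone v (s - {k}) d}"
      by (simp add: card_image)
    have sub: "s \<subseteq> kuhn_grid p m" and card: "card s = Suc m"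
      using s ksimplex_subset_grid ksimplex_card by (auto simp: subset_iff)
    have vB: "v ` s \<subseteq> span B" using v sub by (auto simp: general_position_def)
    have "d \<notin> span (v ` t)" if "t \<subseteq> s" "card t < m" for t using d(2) that sub by auto
    note count = card_facets_hit_by_generic_ray[OF ksimplex_facets_independent[OF v B(2)] card B vB d(1) this]
    show "card {f\<in>?F. ?face f s \<and> in_cone v f d} = 1" if "zero_in_hull v s"
      unfolding hits using s that by (intro count) auto
    show "card {f\<in>?F. ?face f s \<and> in_cone v f d} = 0 \<or> card {f\<in>?F. ?face f s \<and> in_cone v f d} = 2"
      if "\<not> zero_in_hull v s"
      unfolding hits using s that by (intro count) auto
  qed (simp_all only: card_simplices_containing_facet[OF _ m] if_True if_False)
  then show ?thesis by simp
qed

theorem kuhn_parity: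
  fixes v v' :: "(nat \<Rightarrow> nat) \<Rightarrow> 'w::real_normed_vector"
  assumes m: "0 < m" and B: "finite B" "independent B" "card B = m"
    and v: "general_position B v (kuhn_grid p m)" and v': "general_position B v' (kuhn_grid p m)"
    and boundary: "\<And>k i. k \<in> kuhn_grid p m \<Longrightarrow> i < m \<Longrightarrow> k i = 0 \<or> k i = p \<Longrightarrow> v k = v' k"
  shows "even (card {s. ksimplex p m s \<and> zero_in_hull v s}) \<longleftrightarrow> even (card {s. ksimplex p m s \<and> zero_in_hull v' s})"
proof -
  define \<T> where "\<T> = {t. t \<subseteq> kuhn_grid p m \<and> card t < m}"
  define \<P> where "\<P> = (\<lambda>t. (0::'w, span (v ` t))) ` \<T> \<union> (\<lambda>t. (0, span (v' ` t))) ` \<T>"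
  have "finite \<P>" using finite_kuhn_grid by (simp add: \<P>_def \<T>_def)
  moreover have "subspace S \<and> \<not> span B \<subseteq> S" if "(x, S) \<in> \<P>" for x S
    using that small_span_not_superset[OF B(1,2)] finite_subset[OF _ finite_kuhn_grid, of _ p m] B(3)
    by (auto simp: \<P>_def \<T>_def)
  ultimately obtain d where d: "d \<in> span B" "\<And>x S. (x, S) \<in> \<P> \<Longrightarrow> x + d \<notin> S"
    using perturbation_avoiding_subspaces[OF _ subspace_span _ zero_less_one, of \<P> B] by metis
  have generic: "d \<notin> span (v ` t)" "d \<notin> span (v' ` t)" if "t \<subseteq> kuhn_grid p m" "card t < m" for t
    using that d(2)[of 0] by (auto simp: \<P>_def \<T>_def)
  have "in_cone v f d = in_cone v' f d" if f: "f \<in> kuhn_facets p m" "boundary_facet p m f" for f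
  proof -
    have "f \<subseteq> kuhn_grid p m" using f(1) ksimplex_subset_grid by (auto simp: kuhn_facets_def)
    then have "v k = v' k" if "k \<in> f" for k using f(2) boundary[of k] that unfolding boundary_facet_def by blast
    then have "(\<Sum>k\<in>f. a k *\<^sub>R v k) = (\<Sum>k\<in>f. a k *\<^sub>R v' k)" for a by simp
    then show ?thesis by (simp add: in_cone_def)
  qed
  then have "{f\<in>kuhn_facets p m. in_cone v f d \<and> boundary_facet p m f}
      = {f\<in>kuhn_facets p m. in_cone v' f d \<and> boundary_facet p m f}" by blast
  then show ?thesis
    using even_simplices_iff_even_boundary_hits[OF m B(1,3) v d(1) generic(1)]
      even_simplices_iff_even_boundary_hits[OF m B(1,3) v' d(1) generic(2)] by simp
qed

section \<open>Piecewise affine interpolation\<close>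

lemma step_function_integral:
  fixes g :: "real \<Rightarrow> 'w::banach"
  assumes lam: "\<And>j. j < n \<Longrightarrow> 0 \<le> lam j"
    and g: "\<And>j t. j < n \<Longrightarrow> (\<Sum>i<j. lam i) \<le> t \<Longrightarrow> t < (\<Sum>i<Suc j. lam i) \<Longrightarrow> g t = w j"
  shows "(g has_integral (\<Sum>j<n. lam j *\<^sub>R w j)) {0..(\<Sum>i<n. lam i)}"
  using assms
proof (induction n)
  case 0
  show ?case using has_integral_refl(2)[of g "0::real"] by simp
next
  case (Suc n)
  let ?c = "\<lambda>j. \<Sum>i<j. lam i"
  have init: "(g has_integral (\<Sum>j<n. lam j *\<^sub>R w j)) {0..?c n}"
    by (rule Suc.IH) (use Suc.prems in auto)
  have incr: "0 \<le> ?c n" "?c n \<le> ?c (Suc n)" using Suc.prems(1) by (auto intro!: sum_nonneg)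
  have "((\<lambda>t. w n) has_integral (?c (Suc n) - ?c n) *\<^sub>R w n) {?c n..?c (Suc n)}"
    using has_integral_const_real[of "w n" "?c n" "?c (Suc n)"] incr(2) by simp
  then have "(g has_integral (?c (Suc n) - ?c n) *\<^sub>R w n) {?c n..?c (Suc n)}"
  proof (rule has_integral_spike_finite[of "{?c (Suc n)}", rotated 2])
    show "g t = w n" if "t \<in> {?c n..?c (Suc n)} - {?c (Suc n)}" for t
      using Suc.prems(2)[of n t] that by auto
  qed simp
  then have "(g has_integral lam n *\<^sub>R w n) {?c n..?c (Suc n)}" by simp
  from has_integral_combine[OF incr init this] show ?case by simp
qed

subsection \<open>Points of a Kuhn simplex\<close>

text \<open>
  The points \<open>\<lfloor>x + t\<rfloor>\<close>, \<open>0 \<le> t < 1\<close>, are the vertices of the simplex that contains \<open>x\<close>, and each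
  vertex is attained on an interval whose length is its barycentric coordinate. Hence averaging over
  \<open>t\<close> interpolates.
\<close>

definition grid_floor :: "nat \<Rightarrow> nat \<Rightarrow> (nat \<Rightarrow> real) \<Rightarrow> real \<Rightarrow> nat \<Rightarrow> nat" where
  "grid_floor p m x t = (\<lambda>i. if i < m then min p (nat \<lfloor>x i + t\<rfloor>) else p)"

lemma grid_floor_in_grid: "grid_floor p m x t \<in> kuhn_grid p m"
  by (auto simp: grid_floor_def kuhn_grid_def)

lemma grid_floor_near:
  assumes "0 \<le> x i" "x i \<le> real p" "i < m" "0 \<le> t" "t \<le> 1"
  shows "\<bar>real (grid_floor p m x t i) - x i\<bar> \<le> 1"
proof -
  have "real (nat \<lfloor>x i + t\<rfloor>) = of_int \<lfloor>x i + t\<rfloor>" using assms by simp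
  then have "x i + t - 1 < real (nat \<lfloor>x i + t\<rfloor>)" "real (nat \<lfloor>x i + t\<rfloor>) \<le> x i + t" by linarith+
  moreover have "grid_floor p m x t i = p \<and> real p \<le> real (nat \<lfloor>x i + t\<rfloor>) \<or> grid_floor p m x t i = nat \<lfloor>x i + t\<rfloor>"
    using assms(3) by (simp add: grid_floor_def min_def)
  ultimately show ?thesis using assms by linarith
qed

lemma grid_floor_mono: "x i \<le> y i \<Longrightarrow> grid_floor p m x t i \<le> grid_floor p m y t i"
  unfolding grid_floor_def
  by (simp add: min.coboundedI2 floor_mono nat_mono min.coboundedI1 min_le_iff_disj)

context kuhn_simplex
begin

lemma enum_upd: "l < n \<Longrightarrow> enum j (upd l) = base (upd l) + (if l < j then 1 else 0)"
proof -
  assume l: "l < n"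
  have "x = l" if "x < j" "upd l = upd x" "\<not> l < j" for x
    using upd_inj[of l x] l that by simp
  then have "upd l \<in> upd ` {..<j} \<longleftrightarrow> l < j" by fastforce
  then show ?thesis by (simp add: enum_def)
qed

lemma sum_vertices: "sum g S = (\<Sum>j\<le>n. g (enum j))"
  unfolding s_eq by (rule sum.reindex[OF inj_enum, unfolded o_def])

lemma barycentric_coordinate:
  assumes lam: "(\<Sum>j\<le>n. lam j) = 1" and l: "l < n"
  shows "(\<Sum>j\<le>n. lam j * real (enum j (upd l))) = real (base (upd l)) + (1 - (\<Sum>j<Suc l. lam j))"
proof -
  have "(\<Sum>j\<le>n. lam j * real (enum j (upd l)))
      = (\<Sum>j\<le>n. lam j) * real (base (upd l)) + (\<Sum>j\<le>n. lam j * (if l < j then 1 else 0))"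
    unfolding sum_distrib_right sum.distrib[symmetric] using l by (intro sum.cong) (auto simp: enum_upd algebra_simps)
  also have "(\<Sum>j\<le>n. lam j * (if l < j then 1 else 0)) = (\<Sum>j\<le>n. lam j) - (\<Sum>j\<le>n. if j < Suc l then lam j else 0)"
    unfolding sum_subtractf[symmetric] by (intro sum.cong) auto
  also have "(\<Sum>j\<le>n. if j < Suc l then lam j else 0) = (\<Sum>j<Suc l. lam j)"
    using l by (intro sum.mono_neutral_cong_right) auto
  finally show ?thesis using lam by simp
qed

lemma grid_floor_barycentric:
  assumes lam: "\<And>j. j \<le> n \<Longrightarrow> 0 \<le> lam j" "(\<Sum>j\<le>n. lam j) = 1"
    and x: "\<And>i. i < n \<Longrightarrow> x i = (\<Sum>j\<le>n. lam j * real (enum j i))"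
    and j: "j \<le> n" and t: "(\<Sum>i<j. lam i) \<le> t" "t < (\<Sum>i<Suc j. lam i)"
  shows "grid_floor p n x t = enum j"
proof
  fix i
  let ?c = "\<lambda>j. \<Sum>i<j. lam i"
  have c_mono: "?c a \<le> ?c b" if "a \<le> b" "b \<le> Suc n" for a b
    using that lam(1) by (intro sum_mono2) auto
  have c_last: "?c (Suc n) = 1" using lam(2) by (simp add: lessThan_Suc_atMost)
  show "grid_floor p n x t i = enum j i"
  proof (cases "i < n")
    case False
    then show ?thesis using enum_eq_p[OF j, of i] by (simp add: grid_floor_def)
  next
    case True
    then obtain l where l: "l < n" "i = upd l" using upd_surj by (metis imageE lessThan_iff)
    have xi: "x i = real (base i) + (1 - ?c (Suc l))"
      using x[OF True] barycentric_coordinate[OF lam(2) l(1)] l(2) by simp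
    have range: "0 \<le> ?c (Suc l)" "?c (Suc l) \<le> 1" "0 \<le> t" "t < 1"
      using c_mono[of 0 "Suc l"] c_mono[of "Suc l" "Suc n"] c_mono[of 0 j] c_mono[of "Suc j" "Suc n"] l(1) j t c_last by auto
    have "base i < p" using base True by auto
    moreover have "\<lfloor>x i + t\<rfloor> = int (base i) + (if l < j then 1 else 0)"
    proof (cases "l < j")
      case True
      then have "?c (Suc l) \<le> t" using c_mono[of "Suc l" j] j t(1) by simp
      then show ?thesis unfolding xi using True range by (intro floor_unique) auto
    next
      case False
      then have "t < ?c (Suc l)" using c_mono[of "Suc j" "Suc l"] l(1) t(2) by simp
      then show ?thesis unfolding xi using False range by (intro floor_unique) auto
    qed
    ultimately show ?thesis using True l by (auto simp: grid_floor_def enum_upd)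
  qed
qed

lemma grid_floor_integral:
  fixes v :: "(nat \<Rightarrow> nat) \<Rightarrow> 'w::banach"
  assumes lam: "\<And>j. j \<le> n \<Longrightarrow> 0 \<le> lam j" "(\<Sum>j\<le>n. lam j) = 1"
    and x: "\<And>i. i < n \<Longrightarrow> x i = (\<Sum>j\<le>n. lam j * real (enum j i))"
  shows "((\<lambda>t. v (grid_floor p n x t)) has_integral (\<Sum>j\<le>n. lam j *\<^sub>R v (enum j))) {0..1}"
proof -
  have "((\<lambda>t. v (grid_floor p n x t)) has_integral (\<Sum>j<Suc n. lam j *\<^sub>R v (enum j))) {0..(\<Sum>i<Suc n. lam i)}"
  proof (rule step_function_integral)
    fix j t assume j: "j < Suc n" "(\<Sum>i<j. lam i) \<le> t" "t < (\<Sum>i<Suc j. lam i)"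
    have "grid_floor p n x t = enum j"
      by (rule grid_floor_barycentric[OF lam x _ j(2,3)]) (use j(1) in auto)
    then show "v (grid_floor p n x t) = v (enum j)" by simp
  qed (use lam in simp)
  then show ?thesis using lam(2) by (simp add: lessThan_Suc_atMost)
qed

lemma grid_floor_image:
  assumes lam: "\<And>j. j \<le> n \<Longrightarrow> 0 < lam j" "(\<Sum>j\<le>n. lam j) = 1"
    and x: "\<And>i. i < n \<Longrightarrow> x i = (\<Sum>j\<le>n. lam j * real (enum j i))"
  shows "grid_floor p n x ` {0..<1} = S"
proof
  let ?c = "\<lambda>j. \<Sum>i<j. lam i"
  have nonneg: "\<And>j. j \<le> n \<Longrightarrow> 0 \<le> lam j" using lam(1) by (simp add: less_imp_le)
  have c_last: "?c (Suc n) = 1" using lam(2) by (simp add: lessThan_Suc_atMost)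
  show "grid_floor p n x ` {0..<1} \<subseteq> S"
  proof safe
    fix t :: real assume t: "t \<in> {0..<1}"
    define j where "j = (LEAST j. t < ?c (Suc j))"
    have "t < ?c (Suc n)" using t c_last by simp
    then have j: "t < ?c (Suc j)" "j \<le> n"
      unfolding j_def by (rule LeastI[of "\<lambda>j. t < ?c (Suc j)"], rule Least_le[of "\<lambda>j. t < ?c (Suc j)"])
    have "?c j \<le> t"
    proof (cases j)
      case (Suc i)
      then have "\<not> t < ?c (Suc i)" using not_less_Least[of i "\<lambda>j. t < ?c (Suc j)"] by (simp add: j_def)
      then show ?thesis using Suc by simp
    qed (use t in simp)
    then have "grid_floor p n x t = enum j" using grid_floor_barycentric[OF nonneg lam(2) x j(2)] j(1) by blast
    then show "grid_floor p n x t \<in> S" using enum_in j(2) by simp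
  qed
  show "S \<subseteq> grid_floor p n x ` {0..<1}"
  proof
    fix k assume "k \<in> S"
    then obtain j where j: "j \<le> n" "k = enum j" by (auto simp: s_eq)
    have less: "?c j < ?c (Suc j)" using lam(1)[OF j(1)] by simp
    have "grid_floor p n x (?c j) = enum j" by (rule grid_floor_barycentric[OF nonneg lam(2) x j(1) order_refl less])
    moreover have "0 \<le> ?c j" using nonneg j(1) by (intro sum_nonneg) auto
    moreover have "?c (Suc j) \<le> ?c (Suc n)" using nonneg j(1) by (intro sum_mono2) auto
    ultimately show "k \<in> grid_floor p n x ` {0..<1}"
      using j(2) less c_last by (intro image_eqI[of _ _ "?c j"]) auto
  qed
qed

text \<open>Barycentric coordinates of the point with fractional parts \<open>f\<close>.\<close>

definition bary :: "(nat \<Rightarrow> real) \<Rightarrow> nat \<Rightarrow> real" where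
  "bary f j = (if j = 0 then 1 else f (upd (j - 1))) - (if j = n then 0 else f (upd j))"

definition slope :: "(nat \<Rightarrow> 'w::real_vector) \<Rightarrow> nat \<Rightarrow> 'w" where
  "slope w i = w (Suc (inv_into {..<n} upd i)) - w (inv_into {..<n} upd i)"

lemma slope_upd: "l < n \<Longrightarrow> slope w (upd l) = w (Suc l) - w l"
  using inv_into_f_f[OF inj_upd, of l] by (simp add: slope_def)

lemma bary_sum:
  fixes w :: "nat \<Rightarrow> 'w::real_vector"
  shows "(\<Sum>j\<le>n. bary f j *\<^sub>R w j) = w 0 + (\<Sum>i<n. f i *\<^sub>R slope w i)"
proof -
  let ?g = "\<lambda>j. if j = 0 then 1 else f (upd (j - 1))"
  have "(\<Sum>j<k. (?g j - ?g (Suc j)) *\<^sub>R w j) + ?g k *\<^sub>R w k = w 0 + (\<Sum>l<k. f (upd l) *\<^sub>R (w (Suc l) - w l))" for k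
    by (induction k) (simp_all add: algebra_simps)
  from this[of n] have "(\<Sum>j\<le>n. bary f j *\<^sub>R w j) = w 0 + (\<Sum>l<n. f (upd l) *\<^sub>R slope w (upd l))"
    by (simp add: bary_def slope_upd atMost_Suc_eq_insert_0 lessThan_Suc_atMost[symmetric])
  also have "(\<Sum>l<n. f (upd l) *\<^sub>R slope w (upd l)) = (\<Sum>i<n. f i *\<^sub>R slope w i)"
    by (rule sum.reindex_bij_betw[OF upd])
  finally show ?thesis .
qed

lemma bary_total: "(\<Sum>j\<le>n. bary f j) = 1"
proof -
  have "(\<Sum>i<n. f i *\<^sub>R slope (\<lambda>_. 1::real) i) = 0" by (simp add: slope_def)
  then show ?thesis using bary_sum[of f "\<lambda>_. 1::real"] by simp
qed

lemma bary_point: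
  assumes "i < n"
  shows "(\<Sum>j\<le>n. bary f j * real (enum j i)) = real (base i) + f i"
proof -
  have "slope (\<lambda>j. real (enum j i)) k = (if k = i then 1 else 0)" if k: "k < n" for k
  proof -
    obtain l l' where "l < n" "k = upd l" "l' < n" "i = upd l'"
      using k assms upd_surj by (metis imageE lessThan_iff)
    then show ?thesis using upd_inj[of l l'] by (auto simp: slope_upd enum_upd)
  qed
  then have "(\<Sum>k<n. f k * slope (\<lambda>j. real (enum j i)) k) = (\<Sum>k<n. if k = i then f k else 0)"
    by (intro sum.cong) auto
  then show ?thesis using bary_sum[of f "\<lambda>j. real (enum j i)"] assms by (simp add: enum_0)
qed

lemma bary_close:
  assumes "\<And>i. i < n \<Longrightarrow> \<bar>g i - f i\<bar> \<le> e" "0 \<le> e" "j \<le> n"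
  shows "\<bar>bary g j - bary f j\<bar> \<le> 2 * e"
proof -
  have "\<bar>g (upd (j - 1)) - f (upd (j - 1))\<bar> \<le> e" if "j \<noteq> 0"
    by (intro assms(1) upd_space) (use that assms(3) in simp)
  moreover have "\<bar>g (upd j) - f (upd j)\<bar> \<le> e" if "j \<noteq> n" by (intro assms(1) upd_space) (use that assms(3) in simp)
  ultimately show ?thesis
    unfolding bary_def using assms(2) by (cases "j = 0"; cases "j = n") (simp; linarith)+
qed

lemma independent_slopes:
  fixes w :: "nat \<Rightarrow> 'w::real_vector"
  assumes w: "facets_independent w {..n}" and f: "\<And>j. j \<le> n \<Longrightarrow> 0 \<le> bary f j" "(\<Sum>j\<le>n. bary f j *\<^sub>R w j) = 0"
  shows "independent_family (slope w) {..<n}"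
  unfolding independent_family_def
proof (intro allI impI ballI)
  fix t i assume t: "(\<Sum>i<n. t i *\<^sub>R slope w i) = 0" and i: "i \<in> {..<n}"
  let ?g = "\<lambda>i. f i + t i"
  have "(\<Sum>j\<le>n. bary ?g j *\<^sub>R w j) = 0"
    using t f(2) unfolding bary_sum by (simp add: scaleR_add_left sum.distrib)
  then have "bary ?g j = bary f j" if "j \<le> n" for j
    using facets_independent_weights_unique[OF w _ bary_total f(2) bary_total, of ?g j] f(1) that by simp
  then have "(\<Sum>j\<le>n. bary ?g j * real (enum j i)) = (\<Sum>j\<le>n. bary f j * real (enum j i))" by (intro sum.cong) auto
  then show "t i = 0" using bary_point[of i ?g] bary_point[of i f] i by simp
qed

end

lemma decreasing_enumeration:
  fixes f :: "nat \<Rightarrow> real"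
  obtains upd where "bij_betw upd {..<m} {..<m}" "\<And>l. Suc l < m \<Longrightarrow> f (upd (Suc l)) \<le> f (upd l)"
proof
  define xs where "xs = sort_key (\<lambda>i. - f i) [0..<m]"
  have xs: "distinct xs" "set xs = {..<m}" "length xs = m" by (auto simp: xs_def)
  show "bij_betw (\<lambda>l. xs ! l) {..<m} {..<m}" by (rule bij_betw_nth[OF xs(1)]) (simp_all add: xs)
  have "sorted (map (\<lambda>i. - f i) xs)" unfolding xs_def by simp
  then show "f (xs ! Suc l) \<le> f (xs ! l)" if "Suc l < m" for l
    using sorted_nth_mono[of "map (\<lambda>i. - f i) xs" l "Suc l"] that xs(3) by simp
qed

lemma bounded_integer_part:
  assumes "0 < p" "0 \<le> x" "x \<le> real p"
  obtains b where "b < p" "real b \<le> x" "x \<le> real b + 1"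
proof (cases "nat \<lfloor>x\<rfloor> < p")
  case True
  have "real (nat \<lfloor>x\<rfloor>) = of_int \<lfloor>x\<rfloor>" using assms(2) by simp
  then have "real (nat \<lfloor>x\<rfloor>) \<le> x" "x \<le> real (nat \<lfloor>x\<rfloor>) + 1" by linarith+
  with True show ?thesis by (rule that)
next
  case False
  then have "real p \<le> x" using assms by linarith
  then show ?thesis using that[of "p - 1"] assms by auto
qed

lemma kuhn_simplex_cover:
  assumes p: "0 < p" and x: "\<And>i. i < m \<Longrightarrow> 0 \<le> x i \<and> x i \<le> real p"
  obtains base upd s where "kuhn_simplex p m base upd s"
    "\<forall>j\<le>m. 0 \<le> kuhn_simplex.bary m upd (\<lambda>i. x i - real (base i)) j"
proof -
  have "\<exists>b. b < p \<and> real b \<le> x i \<and> x i \<le> real b + 1" if "i < m" for i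
    using bounded_integer_part[OF p] x[OF that] by metis
  then obtain b where b: "\<And>i. i < m \<Longrightarrow> b i < p \<and> real (b i) \<le> x i \<and> x i \<le> real (b i) + 1" by metis
  define base where "base i = (if i < m then b i else p)" for i
  let ?f = "\<lambda>i. x i - real (base i)"
  obtain upd where upd: "bij_betw upd {..<m} {..<m}" "\<And>l. Suc l < m \<Longrightarrow> ?f (upd (Suc l)) \<le> ?f (upd l)"
    using decreasing_enumeration[of m ?f] by blast
  define s where "s = (\<lambda>i j. if j \<in> upd`{..< i} then Suc (base j) else base j) ` {.. m}"
  have ks: "kuhn_simplex p m base upd s"
    by standard (use b upd(1) in \<open>auto simp: base_def s_def\<close>)
  have range: "0 \<le> ?f (upd l) \<and> ?f (upd l) \<le> 1" if "l < m" for l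
    using bij_betwE[OF upd(1)] that b[of "upd l"] by (auto simp: base_def)
  have "0 \<le> kuhn_simplex.bary m upd ?f j" if j: "j \<le> m" for j
  proof (cases j)
    case 0
    then show ?thesis using range[of 0] by (auto simp: kuhn_simplex.bary_def[OF ks])
  next
    case (Suc l)
    then show ?thesis using range[of l] upd(2)[of l] j by (auto simp: kuhn_simplex.bary_def[OF ks])
  qed
  then show ?thesis using ks that by blast
qed

section \<open>Maps on coordinate cubes\<close>

text \<open>
  Points of \<open>\<real>\<^sup>m\<close> are functions \<open>nat \<Rightarrow> real\<close>, of which only the first \<open>m\<close> coordinates vary, so that
  \<open>m\<close> may be the cardinality of a basis found in the course of a proof.
\<close>

definition coord_box :: "nat \<Rightarrow> (nat \<Rightarrow> real) \<Rightarrow> real \<Rightarrow> (nat \<Rightarrow> real) set" where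
  "coord_box m z d = {\<xi>. (\<forall>i<m. \<bar>\<xi> i - z i\<bar> \<le> d) \<and> (\<forall>i\<ge>m. \<xi> i = z i)}"

abbreviation cube :: "nat \<Rightarrow> real \<Rightarrow> (nat \<Rightarrow> real) set" where
  "cube m \<equiv> coord_box m (\<lambda>_. 0)"

lemma coord_box_mono: "d \<le> e \<Longrightarrow> coord_box m z d \<subseteq> coord_box m z e"
  by (fastforce simp: coord_box_def)

lemma center_in_coord_box: "0 \<le> d \<Longrightarrow> z \<in> coord_box m z d"
  by (simp add: coord_box_def)

lemma compact_cube: "compact (cube m r)"
proof -
  have "compactin (product_topology (\<lambda>i. euclidean) (UNIV::nat set)) (PiE UNIV (\<lambda>i. if i < m then {-r..r} else {0}))"
    by (subst compactin_PiE) auto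
  moreover have "PiE UNIV (\<lambda>i. if i < m then {-r..r} else {0}) = cube m r"
  proof (rule Set.set_eqI)
    fix x :: "nat \<Rightarrow> real"
    have "x i \<in> (if i < m then {-r..r} else {0}) \<longleftrightarrow> (i < m \<longrightarrow> \<bar>x i - 0\<bar> \<le> r) \<and> (m \<le> i \<longrightarrow> x i = 0)" for i
      by (auto simp: abs_le_iff)
    then show "x \<in> PiE UNIV (\<lambda>i. if i < m then {-r..r} else {0}) \<longleftrightarrow> x \<in> cube m r"
      unfolding PiE_UNIV_domain coord_box_def Pi_iff mem_Collect_eq by (simp only: ball_UNIV) blast
  qed
  ultimately show ?thesis by (simp only: euclidean_product_topology compactin_euclidean_iff)
qed

lemma open_coords_less: "open {\<xi>::nat \<Rightarrow> real. \<forall>i<m. \<bar>\<xi> i - z i\<bar> < d}"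
proof -
  have "{\<xi>::nat \<Rightarrow> real. \<forall>i<m. \<bar>\<xi> i - z i\<bar> < d} = (\<Inter>i\<in>{..<m}. {\<xi>. \<bar>\<xi> i - z i\<bar> < d})" by auto
  moreover have "open (\<Inter>i\<in>{..<m}. {\<xi>::nat \<Rightarrow> real. \<bar>\<xi> i - z i\<bar> < d})"
    by (intro open_INT finite_lessThan ballI open_Collect_less continuous_intros continuous_on_product_coordinates)
  ultimately show ?thesis by simp
qed

lemma coord_box_subset_cube_small:
  assumes "z \<in> cube m r" "\<And>i. i < m \<Longrightarrow> \<bar>z i\<bar> < r"
  shows "\<forall>\<^sub>F d in at_right 0. coord_box m z d \<subseteq> cube m r"
proof -
  have "\<forall>\<^sub>F d in at_right 0. d < r - \<bar>z i\<bar>" if "i < m" for i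
    by (rule eventually_at_rightI[of 0 "r - \<bar>z i\<bar>"]) (use assms(2)[OF that] in auto)
  then have "\<forall>\<^sub>F d in at_right 0. \<forall>i\<in>{..<m}. d < r - \<bar>z i\<bar>" by (intro eventually_ball_finite) auto
  then show ?thesis
  proof eventually_elim
    case (elim d)
    have "\<bar>\<xi> i\<bar> \<le> r" if "\<xi> \<in> coord_box m z d" "i < m" for \<xi> i
    proof -
      have "\<bar>\<xi> i - z i\<bar> \<le> d" "d < r - \<bar>z i\<bar>" using that elim by (auto simp: coord_box_def)
      then show ?thesis by linarith
    qed
    then show ?case using assms(1) by (auto simp: coord_box_def)
  qed
qed

lemma coord_boxes_disjoint_small:
  assumes "z \<in> cube m r" "z' \<in> cube m r" "z \<noteq> z'"
  shows "\<forall>\<^sub>F d in at_right 0. coord_box m z d \<inter> coord_box m z' d = {}"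
proof -
  obtain i where i: "z i \<noteq> z' i" using assms(3) by (auto simp: fun_eq_iff)
  then have "i < m" using assms(1,2) by (cases "i < m") (auto simp: coord_box_def)
  have "coord_box m z d \<inter> coord_box m z' d = {}" if d: "d < \<bar>z i - z' i\<bar> / 2" for d
  proof (rule ccontr)
    assume "\<not> ?thesis"
    then obtain \<xi> where "\<bar>\<xi> i - z i\<bar> \<le> d" "\<bar>\<xi> i - z' i\<bar> \<le> d"
      using \<open>i < m\<close> by (auto simp: coord_box_def)
    then show False using d by (smt (verit) field_sum_of_halves)
  qed
  then show ?thesis using i by (intro eventually_at_rightI[of 0 "\<bar>z i - z' i\<bar> / 2"]) auto
qed

lemma dist_fun_le:
  fixes x y :: "nat \<Rightarrow> real"
  assumes "\<And>i. \<bar>x i - y i\<bar> \<le> d"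
  shows "dist x y \<le> 2 * d"
proof -
  have sums: "(\<lambda>n. (1/2)^n * d) sums (2 * d)"
    using sums_mult2[OF geometric_sums[of "1/2::real"], of d] by simp
  have bound: "(1/2)^n * min (dist (x (from_nat n)) (y (from_nat n))) 1 \<le> (1/2)^n * d" for n
    by (intro mult_left_mono) (use assms[of "from_nat n"] in \<open>auto simp: dist_real_def min_def\<close>)
  have "dist x y \<le> suminf (\<lambda>n. (1/2)^n * d)"
    unfolding dist_fun_def
  proof (rule suminf_le[OF bound])
    show "summable (\<lambda>n. (1/2)^n * min (dist (x (from_nat n)) (y (from_nat n))) 1)"
      by (rule summable_comparison_test'[OF sums_summable[OF sums], of 0]) (use bound in auto)
  qed (rule sums_summable[OF sums])
  then show ?thesis using sums_unique[OF sums] by simp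
qed

lemma cube_uniformly_continuous:
  fixes \<gamma> :: "(nat \<Rightarrow> real) \<Rightarrow> 'w::real_normed_vector"
  assumes "continuous_on (cube m r) \<gamma>" "0 < e"
  obtains d where "d > 0"
    "\<And>\<xi> \<zeta>. \<xi> \<in> cube m r \<Longrightarrow> \<zeta> \<in> cube m r \<Longrightarrow> \<xi> \<in> coord_box m \<zeta> d \<Longrightarrow> norm (\<gamma> \<xi> - \<gamma> \<zeta>) < e"
proof -
  have "uniformly_continuous_on (cube m r) \<gamma>"
    using compact_uniformly_continuous[OF assms(1) compact_cube] .
  then obtain d where d: "d > 0"
    "\<And>\<xi> \<zeta>. \<xi> \<in> cube m r \<Longrightarrow> \<zeta> \<in> cube m r \<Longrightarrow> dist \<zeta> \<xi> < d \<Longrightarrow> dist (\<gamma> \<zeta>) (\<gamma> \<xi>) < e"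
    using assms(2) unfolding uniformly_continuous_on_def by metis
  show ?thesis
  proof (rule that)
    fix \<xi> \<zeta> assume x: "\<xi> \<in> cube m r" "\<zeta> \<in> cube m r" "\<xi> \<in> coord_box m \<zeta> (d/4)"
    have "\<bar>\<xi> i - \<zeta> i\<bar> \<le> d/4" for i
      using x(3) d(1) by (cases "i < m") (auto simp: coord_box_def)
    then have "dist \<xi> \<zeta> \<le> 2 * (d/4)" by (rule dist_fun_le)
    then show "norm (\<gamma> \<xi> - \<gamma> \<zeta>) < e" using d(2)[OF x(2,1)] d(1) by (simp add: dist_norm)
  qed (use d in simp)
qed

lemma continuous_on_coordinate_lipschitz:
  fixes f :: "(nat \<Rightarrow> real) \<Rightarrow> 'w::real_normed_vector"
  assumes "\<And>\<xi> \<zeta>. \<xi> \<in> S \<Longrightarrow> \<zeta> \<in> S \<Longrightarrow> norm (f \<xi> - f \<zeta>) \<le> C * (\<Sum>i<m. \<bar>\<xi> i - \<zeta> i\<bar>)"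
  shows "continuous_on S f"
  unfolding continuous_on_def
proof
  fix \<xi> assume \<xi>: "\<xi> \<in> S"
  have "((\<lambda>\<zeta>. f \<zeta> - f \<xi>) \<longlongrightarrow> 0) (at \<xi> within S)"
  proof (rule Lim_null_comparison)
    show "\<forall>\<^sub>F \<zeta> in at \<xi> within S. norm (f \<zeta> - f \<xi>) \<le> C * (\<Sum>i<m. \<bar>\<zeta> i - \<xi> i\<bar>)"
      unfolding eventually_at_filter using assms \<xi> by (intro always_eventually) auto
    have "continuous_on UNIV (\<lambda>\<zeta>::nat \<Rightarrow> real. C * (\<Sum>i<m. \<bar>\<zeta> i - \<xi> i\<bar>))"
      by (intro continuous_intros continuous_on_product_coordinates)
    then have "((\<lambda>\<zeta>. C * (\<Sum>i<m. \<bar>\<zeta> i - \<xi> i\<bar>)) \<longlongrightarrow> C * (\<Sum>i<m. \<bar>\<xi> i - \<xi> i\<bar>)) (at \<xi> within S)"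
      by (meson UNIV_I continuous_on_def subset_UNIV tendsto_within_subset)
    then show "((\<lambda>\<zeta>. C * (\<Sum>i<m. \<bar>\<zeta> i - \<xi> i\<bar>)) \<longlongrightarrow> 0) (at \<xi> within S)" by simp
  qed
  then show "(f \<longlongrightarrow> f \<xi>) (at \<xi> within S)" by (simp add: LIM_zero_iff)
qed

lemma compact_norm_lower_bound:
  fixes \<gamma> :: "'a::topological_space \<Rightarrow> 'w::real_normed_vector"
  assumes "compact S" "continuous_on S \<gamma>" "\<And>x. x \<in> S \<Longrightarrow> \<gamma> x \<noteq> 0"
  obtains \<mu> where "\<mu> > 0" "\<And>x. x \<in> S \<Longrightarrow> \<mu> \<le> norm (\<gamma> x)"
proof (cases "S = {}")
  case True
  then show ?thesis using that[of 1] by simp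
next
  case False
  obtain x0 where "x0 \<in> S" "\<forall>x\<in>S. norm (\<gamma> x0) \<le> norm (\<gamma> x)"
    using continuous_attains_inf[OF assms(1) False continuous_on_norm[OF assms(2)]] by metis
  then show ?thesis using that[of "norm (\<gamma> x0)"] assms(3) by simp
qed

subsection \<open>Interpolation on the triangulated cube\<close>

lemma independent_family_reindex:
  assumes f: "inj_on f t" and v: "independent_family v (f ` t)"
  shows "independent_family (\<lambda>j. v (f j)) t"
  unfolding independent_family_def
proof (intro allI impI ballI)
  fix c j assume "(\<Sum>k\<in>t. c k *\<^sub>R v (f k)) = 0" and j: "j \<in> t"
  then have "(\<Sum>k\<in>f ` t. c (inv_into t f k) *\<^sub>R v k) = 0"
    by (simp add: sum.reindex[OF f] inv_into_f_f[OF f] cong: sum.cong)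
  then have "c (inv_into t f (f j)) = 0" using j by (intro independent_familyD[OF v]) auto
  then show "c j = 0" by (simp add: inv_into_f_f[OF f j])
qed

lemma independent_family_scale:
  assumes "independent_family v t" "c \<noteq> 0"
  shows "independent_family (\<lambda>k. c *\<^sub>R v k) t"
  unfolding independent_family_def
proof (intro allI impI ballI)
  fix b k assume "(\<Sum>k\<in>t. b k *\<^sub>R c *\<^sub>R v k) = 0" and k: "k \<in> t"
  then have "(\<Sum>k\<in>t. (b k * c) *\<^sub>R v k) = 0" by simp
  then have "b k * c = 0" using k by (rule independent_familyD[OF assms(1)])
  then show "b k = 0" using assms(2) by simp
qed

lemma facets_independent_reindex:
  assumes "finite t" "inj_on f t" "facets_independent v (f ` t)"
  shows "facets_independent (\<lambda>j. v (f j)) t"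
  unfolding facets_independent_def
proof (intro conjI ballI assms(1))
  fix k assume k: "k \<in> t"
  have "f ` (t - {k}) = f ` t - {f k}" using k inj_on_image_set_diff[OF assms(2), of t "{k}"] by simp
  then have "independent_family v (f ` (t - {k}))" using k assms(3) by (simp add: facets_independent_def)
  then show "independent_family (\<lambda>j. v (f j)) (t - {k})"
    by (rule independent_family_reindex[OF inj_on_subset[OF assms(2)], rotated]) auto
qed

locale kuhn_mesh =
  fixes m p :: nat and r :: real
  assumes p_pos: "0 < p" and r_pos: "0 < r"
begin

definition step :: real where
  "step = 2 * r / real p"

definition vertex :: "(nat \<Rightarrow> nat) \<Rightarrow> nat \<Rightarrow> real" where
  "vertex k i = (if i < m then step * real (k i) - r else 0)"

definition grid_coord :: "(nat \<Rightarrow> real) \<Rightarrow> nat \<Rightarrow> real" where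
  "grid_coord \<xi> i = (\<xi> i + r) / step"

definition cell_vertex :: "(nat \<Rightarrow> real) \<Rightarrow> real \<Rightarrow> nat \<Rightarrow> nat" where
  "cell_vertex \<xi> = grid_floor p m (grid_coord \<xi>)"

definition interpolant :: "((nat \<Rightarrow> nat) \<Rightarrow> 'w::real_normed_vector) \<Rightarrow> (nat \<Rightarrow> real) \<Rightarrow> 'w" where
  "interpolant v \<xi> = integral {0..1} (\<lambda>t. v (cell_vertex \<xi> t))"

definition barycentric :: "(nat \<Rightarrow> nat) set \<Rightarrow> ((nat \<Rightarrow> nat) \<Rightarrow> real) \<Rightarrow> (nat \<Rightarrow> real) \<Rightarrow> bool" where
  "barycentric s a \<xi> \<longleftrightarrow> ksimplex p m s \<and> (\<forall>k\<in>s. 0 \<le> a k) \<and> sum a s = 1 \<and>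
    (\<forall>i<m. \<xi> i = (\<Sum>k\<in>s. a k * vertex k i))"

lemma step_pos: "0 < step"
  using p_pos r_pos by (simp add: step_def)

lemma step_times_p: "step * real p = 2 * r"
  using p_pos by (simp add: step_def)

lemma grid_coord_vertex: "i < m \<Longrightarrow> grid_coord (vertex k) i = real (k i)"
  using step_pos by (simp add: grid_coord_def vertex_def)

lemma grid_coord_diff: "\<xi> i - \<zeta> i = step * (grid_coord \<xi> i - grid_coord \<zeta> i)"
  using step_pos by (simp add: grid_coord_def field_simps)

lemma vertex_diff: "i < m \<Longrightarrow> vertex k i - vertex k' i = step * (real (k i) - real (k' i))"
  by (simp add: grid_coord_diff grid_coord_vertex)

lemma grid_coord_range: "\<xi> \<in> cube m r \<Longrightarrow> i < m \<Longrightarrow> 0 \<le> grid_coord \<xi> i \<and> grid_coord \<xi> i \<le> real p"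
  using step_pos step_times_p
  by (auto simp: coord_box_def grid_coord_def pos_divide_le_eq mult.commute abs_le_iff)

lemma vertex_in_cube: "k \<in> kuhn_grid p m \<Longrightarrow> vertex k \<in> cube m r"
proof -
  assume k: "k \<in> kuhn_grid p m"
  have "0 \<le> step * real (k i)" "step * real (k i) \<le> step * real p" if "i < m" for i
    using k that step_pos by (auto simp: kuhn_grid_def intro!: mult_left_mono)
  then show ?thesis using step_times_p by (auto simp: coord_box_def vertex_def abs_le_iff)
qed

lemma boundary_vertex: "i < m \<Longrightarrow> k i = 0 \<or> k i = p \<Longrightarrow> \<bar>vertex k i\<bar> = r"
  using step_times_p r_pos by (auto simp: vertex_def)

lemma step_le_vertex_distance:
  assumes "k \<in> kuhn_grid p m" "k' \<in> kuhn_grid p m" "k \<noteq> k'"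
  shows "step \<le> (\<Sum>i<m. \<bar>vertex k i - vertex k' i\<bar>)"
proof -
  obtain i where ki: "k i \<noteq> k' i" using assms(3) by (auto simp: fun_eq_iff)
  then have i: "i < m" using assms by (cases "i < m") (auto simp: kuhn_grid_def)
  have "1 \<le> \<bar>real (k i) - real (k' i)\<bar>" using ki by linarith
  then have "step * 1 \<le> step * \<bar>real (k i) - real (k' i)\<bar>" using step_pos by (intro mult_left_mono) auto
  also have "\<dots> = \<bar>vertex k i - vertex k' i\<bar>" using step_pos i by (simp add: vertex_diff abs_mult)
  also have "\<dots> \<le> (\<Sum>i<m. \<bar>vertex k i - vertex k' i\<bar>)"
    using i by (intro member_le_sum) auto
  finally show ?thesis by simp
qed

lemma cell_vertex_in_grid: "cell_vertex \<xi> t \<in> kuhn_grid p m"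
  by (simp add: cell_vertex_def grid_floor_in_grid)

lemma cell_vertex_near:
  assumes "\<xi> \<in> cube m r" "0 \<le> t" "t \<le> 1"
  shows "vertex (cell_vertex \<xi> t) \<in> coord_box m \<xi> step"
proof -
  have "\<bar>vertex (cell_vertex \<xi> t) i - \<xi> i\<bar> \<le> step" if i: "i < m" for i
  proof -
    have "\<bar>real (cell_vertex \<xi> t i) - grid_coord \<xi> i\<bar> \<le> 1"
      unfolding cell_vertex_def using grid_floor_near grid_coord_range[OF assms(1) i] i assms(2,3) by blast
    then have "step * \<bar>real (cell_vertex \<xi> t i) - grid_coord \<xi> i\<bar> \<le> step * 1"
      using step_pos by (intro mult_left_mono) auto
    then show ?thesis
      using step_pos i by (simp add: grid_coord_diff[of _ i] grid_coord_vertex abs_mult)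
  qed
  then show ?thesis using assms(1) by (auto simp: coord_box_def vertex_def)
qed

lemma cell_vertex_mono: "\<xi> i \<le> \<zeta> i \<Longrightarrow> vertex (cell_vertex \<xi> t) i \<le> vertex (cell_vertex \<zeta> t) i"
  using step_pos unfolding vertex_def cell_vertex_def
  by (auto intro!: mult_left_mono grid_floor_mono divide_right_mono simp: grid_coord_def)

lemma barycentric_grid_coord:
  assumes "barycentric s a \<xi>" "i < m"
  shows "grid_coord \<xi> i = (\<Sum>k\<in>s. a k * real (k i))"
proof -
  have "\<xi> i = (\<Sum>k\<in>s. a k * vertex k i)" using assms by (simp add: barycentric_def)
  also have "\<dots> = (\<Sum>k\<in>s. step * (a k * real (k i)) - a k * r)"
    using assms(2) by (intro sum.cong) (simp_all add: vertex_def algebra_simps)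
  also have "\<dots> = step * (\<Sum>k\<in>s. a k * real (k i)) - r"
    using assms(1) by (simp add: sum_subtractf sum_distrib_left sum_distrib_right[symmetric] barycentric_def)
  finally show ?thesis using step_pos by (simp add: grid_coord_def)
qed

lemma barycentric_kuhn_simplex:
  assumes "barycentric s a \<xi>"
  obtains base upd where "kuhn_simplex p m base upd s"
    "\<forall>i<m. grid_coord \<xi> i = (\<Sum>j\<le>m. a (kuhn_simplex.enum base upd j) * real (kuhn_simplex.enum base upd j i))"
    "(\<Sum>j\<le>m. a (kuhn_simplex.enum base upd j)) = 1"
proof -
  obtain base upd where "kuhn_simplex p m base upd s"
    using assms by (auto simp: barycentric_def elim: ksimplex.cases)
  then interpret kuhn_simplex p m base upd s .
  show ?thesis
    using that[OF kuhn_simplex_axioms] barycentric_grid_coord[OF assms] assms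
    by (simp add: barycentric_def sum_vertices)
qed

lemma barycentric_integral:
  fixes v :: "(nat \<Rightarrow> nat) \<Rightarrow> 'w::banach"
  assumes "barycentric s a \<xi>"
  shows "((\<lambda>t. v (cell_vertex \<xi> t)) has_integral (\<Sum>k\<in>s. a k *\<^sub>R v k)) {0..1}"
proof -
  obtain base upd where ks: "kuhn_simplex p m base upd s"
    and enum: "\<forall>i<m. grid_coord \<xi> i = (\<Sum>j\<le>m. a (kuhn_simplex.enum base upd j) * real (kuhn_simplex.enum base upd j i))"
      "(\<Sum>j\<le>m. a (kuhn_simplex.enum base upd j)) = 1"
    using barycentric_kuhn_simplex[OF assms] .
  interpret kuhn_simplex p m base upd s by (rule ks)
  show ?thesis
    unfolding sum_vertices cell_vertex_def
    by (rule grid_floor_integral) (use enum enum_in assms in \<open>auto simp: barycentric_def\<close>)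
qed

lemma barycentric_interpolant:
  fixes v :: "(nat \<Rightarrow> nat) \<Rightarrow> 'w::banach"
  shows "barycentric s a \<xi> \<Longrightarrow> interpolant v \<xi> = (\<Sum>k\<in>s. a k *\<^sub>R v k)"
  unfolding interpolant_def by (rule integral_unique[OF barycentric_integral])

lemma barycentric_cell_vertices:
  assumes "barycentric s a \<xi>" "\<And>k. k \<in> s \<Longrightarrow> 0 < a k"
  shows "cell_vertex \<xi> ` {0..<1} = s"
proof -
  obtain base upd where ks: "kuhn_simplex p m base upd s"
    and enum: "\<forall>i<m. grid_coord \<xi> i = (\<Sum>j\<le>m. a (kuhn_simplex.enum base upd j) * real (kuhn_simplex.enum base upd j i))"
      "(\<Sum>j\<le>m. a (kuhn_simplex.enum base upd j)) = 1"
    using barycentric_kuhn_simplex[OF assms(1)] .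
  interpret kuhn_simplex p m base upd s by (rule ks)
  show ?thesis
    unfolding cell_vertex_def by (rule grid_floor_image) (use enum enum_in assms(2) in auto)
qed

lemma barycentric_in_cube:
  assumes "barycentric s a \<xi>" "\<And>i. m \<le> i \<Longrightarrow> \<xi> i = 0"
  shows "\<xi> \<in> cube m r"
proof -
  have "\<bar>\<xi> i\<bar> \<le> r" if i: "i < m" for i
  proof -
    have s: "s \<subseteq> kuhn_grid p m" "sum a s = 1" and a: "\<And>k. k \<in> s \<Longrightarrow> 0 \<le> a k"
      using assms(1) ksimplex_subset_grid by (auto simp: barycentric_def)
    have "\<bar>\<xi> i\<bar> \<le> (\<Sum>k\<in>s. \<bar>a k * vertex k i\<bar>)" using assms(1) i by (simp add: barycentric_def)
    also have "\<dots> \<le> (\<Sum>k\<in>s. a k * r)"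
      using s(1) a vertex_in_cube i
      by (intro sum_mono) (auto simp: abs_mult coord_box_def intro!: mult_left_mono)
    also have "\<dots> = r" using s(2) by (simp add: sum_distrib_right[symmetric])
    finally show ?thesis .
  qed
  then show ?thesis using assms(2) by (simp add: coord_box_def)
qed

lemma barycentric_exists:
  assumes "\<xi> \<in> cube m r"
  obtains s a where "barycentric s a \<xi>"
proof -
  obtain base upd s where ks: "kuhn_simplex p m base upd s"
    and nonneg: "\<forall>j\<le>m. 0 \<le> kuhn_simplex.bary m upd (\<lambda>i. grid_coord \<xi> i - real (base i)) j"
    using kuhn_simplex_cover[OF p_pos grid_coord_range[OF assms]] .
  interpret kuhn_simplex p m base upd s by (rule ks)
  let ?f = "\<lambda>i. grid_coord \<xi> i - real (base i)"
  define a where "a k = bary ?f (inv_into {..m} enum k)" for k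
  have a_enum: "a (enum j) = bary ?f j" if "j \<le> m" for j
    using inv_into_f_f[OF inj_enum, of j] that by (simp add: a_def)
  have total: "(\<Sum>j\<le>m. a (enum j)) = 1" using bary_total[of ?f] by (simp add: a_enum)
  have "\<xi> i = (\<Sum>k\<in>s. a k * vertex k i)" if i: "i < m" for i
  proof -
    have "(\<Sum>j\<le>m. a (enum j) * vertex (enum j) i) = step * (\<Sum>j\<le>m. bary ?f j * real (enum j i)) - (\<Sum>j\<le>m. a (enum j)) * r"
      unfolding sum_distrib_left sum_distrib_right sum_subtractf[symmetric]
      using i by (intro sum.cong) (simp_all add: a_enum vertex_def algebra_simps)
    also have "\<dots> = \<xi> i" using step_pos by (simp add: bary_point[OF i] total grid_coord_def)
    finally show ?thesis by (simp add: sum_vertices)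
  qed
  moreover have "0 \<le> a k" if "k \<in> s" for k using that nonneg a_enum by (auto simp: s_eq)
  moreover have "ksimplex p m s" using ks by (rule ksimplex.intros)
  ultimately have "barycentric s a \<xi>" using total by (simp add: barycentric_def sum_vertices)
  then show ?thesis by (rule that)
qed

lemma interpolant_has_integral:
  fixes v :: "(nat \<Rightarrow> nat) \<Rightarrow> 'w::banach"
  assumes "\<xi> \<in> cube m r"
  shows "((\<lambda>t. v (cell_vertex \<xi> t)) has_integral interpolant v \<xi>) {0..1}"
  using barycentric_exists[OF assms] barycentric_integral barycentric_interpolant by metis

lemma interpolant_vertex: "\<xi> \<in> cube m r \<Longrightarrow> i < m \<Longrightarrow> interpolant (\<lambda>k. vertex k i) \<xi> = \<xi> i"
  by (rule barycentric_exists, assumption)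
    (use barycentric_interpolant[where v = "\<lambda>k. vertex k i"] in \<open>simp add: barycentric_def\<close>)

lemma interpolant_in_subspace:
  fixes v :: "(nat \<Rightarrow> nat) \<Rightarrow> 'w::banach"
  assumes "\<xi> \<in> cube m r" "v ` kuhn_grid p m \<subseteq> Y" "subspace Y"
  shows "interpolant v \<xi> \<in> Y"
proof -
  obtain s a where s: "barycentric s a \<xi>" using barycentric_exists[OF assms(1)] .
  then have "s \<subseteq> kuhn_grid p m" using ksimplex_subset_grid by (simp add: barycentric_def)
  then show ?thesis
    unfolding barycentric_interpolant[OF s] using assms(2,3) by (intro subspace_sum subspace_scale) auto
qed

lemma interpolant_close:
  fixes v :: "(nat \<Rightarrow> nat) \<Rightarrow> 'w::banach"
  assumes \<xi>: "\<xi> \<in> cube m r"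
    and close: "\<And>k. k \<in> kuhn_grid p m \<Longrightarrow> vertex k \<in> coord_box m \<xi> step \<Longrightarrow> norm (v k - w) \<le> \<epsilon>"
  shows "norm (interpolant v \<xi> - w) \<le> \<epsilon>"
proof -
  have diff: "((\<lambda>t. v (cell_vertex \<xi> t) - w) has_integral interpolant v \<xi> - w) {0..1}"
    using has_integral_diff[OF interpolant_has_integral[OF \<xi>] has_integral_const_real[of w 0 1]] by simp
  have "norm (integral {0..1} (\<lambda>t. v (cell_vertex \<xi> t) - w)) \<le> integral {0..1} (\<lambda>t::real. \<epsilon>)"
    by (rule integral_norm_bound_integral)
      (use diff close cell_vertex_in_grid cell_vertex_near[OF \<xi>] in \<open>auto simp: integrable_on_def\<close>)
  then show ?thesis unfolding integral_unique[OF diff] by simp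
qed

lemma cell_vertex_diff_integral:
  assumes "\<xi> \<in> cube m r" "\<zeta> \<in> cube m r" "i < m"
  shows "((\<lambda>t. vertex (cell_vertex \<xi> t) i - vertex (cell_vertex \<zeta> t) i) has_integral \<xi> i - \<zeta> i) {0..1}"
proof -
  have "((\<lambda>t. vertex (cell_vertex \<eta> t) i) has_integral \<eta> i) {0..1}" if "\<eta> \<in> cube m r" for \<eta>
    using interpolant_has_integral[OF that, of "\<lambda>k. vertex k i"] interpolant_vertex[OF that assms(3)] by simp
  then show ?thesis using assms by (intro has_integral_diff)
qed

lemma cell_vertex_abs_diff_integral:
  assumes "\<xi> \<in> cube m r" "\<zeta> \<in> cube m r" "i < m"
  shows "((\<lambda>t. \<bar>vertex (cell_vertex \<xi> t) i - vertex (cell_vertex \<zeta> t) i\<bar>) has_integral \<bar>\<xi> i - \<zeta> i\<bar>) {0..1}"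
proof -
  have ordered: "((\<lambda>t. \<bar>vertex (cell_vertex \<xi> t) i - vertex (cell_vertex \<zeta> t) i\<bar>) has_integral \<bar>\<xi> i - \<zeta> i\<bar>) {0..1}"
    if "\<zeta> i \<le> \<xi> i" "\<xi> \<in> cube m r" "\<zeta> \<in> cube m r" for \<xi> \<zeta>
    using cell_vertex_diff_integral[OF that(2,3) assms(3)] cell_vertex_mono[of \<zeta> i \<xi>] that(1) by simp
  show ?thesis
    using ordered[of \<zeta> \<xi>] ordered[of \<xi> \<zeta>] assms linear[of "\<xi> i" "\<zeta> i"] by (auto simp: abs_minus_commute)
qed

end

definition almost_affine_on ::
  "nat \<Rightarrow> (nat \<Rightarrow> real) set \<Rightarrow> real \<Rightarrow> (nat \<Rightarrow> 'w::real_normed_vector) \<Rightarrow> ((nat \<Rightarrow> real) \<Rightarrow> 'w) \<Rightarrow> bool" where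
  "almost_affine_on m S \<kappa> a \<gamma> \<longleftrightarrow> (\<forall>\<xi>\<in>S. \<forall>\<zeta>\<in>S.
     norm (\<gamma> \<xi> - \<gamma> \<zeta> - (\<Sum>i<m. (\<xi> i - \<zeta> i) *\<^sub>R a i)) \<le> \<kappa> * (\<Sum>i<m. \<bar>\<xi> i - \<zeta> i\<bar>))"

lemma almost_affine_onD:
  "almost_affine_on m S \<kappa> a \<gamma> \<Longrightarrow> \<xi> \<in> S \<Longrightarrow> \<zeta> \<in> S \<Longrightarrow>
    norm (\<gamma> \<xi> - \<gamma> \<zeta> - (\<Sum>i<m. (\<xi> i - \<zeta> i) *\<^sub>R a i)) \<le> \<kappa> * (\<Sum>i<m. \<bar>\<xi> i - \<zeta> i\<bar>)"
  by (simp add: almost_affine_on_def)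

lemma almost_affine_on_subset:
  "almost_affine_on m S \<kappa> a \<gamma> \<Longrightarrow> T \<subseteq> S \<Longrightarrow> almost_affine_on m T \<kappa> a \<gamma>"
  unfolding almost_affine_on_def by (meson subsetD)

context kuhn_mesh
begin

lemma interpolant_almost_affine:
  fixes v :: "(nat \<Rightarrow> nat) \<Rightarrow> 'w::banach"
  assumes \<xi>: "\<xi> \<in> cube m r" and \<zeta>: "\<zeta> \<in> cube m r"
    and v: "\<And>k k'. k \<in> kuhn_grid p m \<Longrightarrow> k' \<in> kuhn_grid p m \<Longrightarrow>
      vertex k \<in> coord_box m \<xi> step \<Longrightarrow> vertex k' \<in> coord_box m \<zeta> step \<Longrightarrow>
      norm (v k - v k' - (\<Sum>i<m. (vertex k i - vertex k' i) *\<^sub>R a i)) \<le> \<kappa> * (\<Sum>i<m. \<bar>vertex k i - vertex k' i\<bar>)"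
  shows "norm (interpolant v \<xi> - interpolant v \<zeta> - (\<Sum>i<m. (\<xi> i - \<zeta> i) *\<^sub>R a i)) \<le> \<kappa> * (\<Sum>i<m. \<bar>\<xi> i - \<zeta> i\<bar>)"
proof -
  let ?k = "cell_vertex \<xi>" and ?k' = "cell_vertex \<zeta>"
  let ?F = "\<lambda>t. v (?k t) - v (?k' t) - (\<Sum>i<m. (vertex (?k t) i - vertex (?k' t) i) *\<^sub>R a i)"
  let ?G = "\<lambda>t. \<kappa> * (\<Sum>i<m. \<bar>vertex (?k t) i - vertex (?k' t) i\<bar>)"
  have F: "(?F has_integral (interpolant v \<xi> - interpolant v \<zeta> - (\<Sum>i<m. (\<xi> i - \<zeta> i) *\<^sub>R a i))) {0..1}"
    by (intro has_integral_diff has_integral_sum has_integral_scaleR_left interpolant_has_integral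
        cell_vertex_diff_integral \<xi> \<zeta>) auto
  have G: "(?G has_integral \<kappa> * (\<Sum>i<m. \<bar>\<xi> i - \<zeta> i\<bar>)) {0..1}"
    by (intro has_integral_mult_right has_integral_sum cell_vertex_abs_diff_integral \<xi> \<zeta>) auto
  have "norm (?F t) \<le> ?G t" if "t \<in> {0..1}" for t
    using v cell_vertex_in_grid cell_vertex_near[OF \<xi>] cell_vertex_near[OF \<zeta>] that by auto
  then have "norm (integral {0..1} ?F) \<le> integral {0..1} ?G"
    by (intro integral_norm_bound_integral) (use F G in \<open>auto simp: integrable_on_def\<close>)
  then show ?thesis unfolding integral_unique[OF F] integral_unique[OF G] .
qed

lemma interpolant_continuous:
  fixes v :: "(nat \<Rightarrow> nat) \<Rightarrow> 'w::banach"
  shows "continuous_on (cube m r) (interpolant v)"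
proof (rule continuous_on_coordinate_lipschitz)
  define C where "C = (\<Sum>k\<in>kuhn_grid p m. norm (v k))"
  have C: "norm (v k) \<le> C" if "k \<in> kuhn_grid p m" for k
    unfolding C_def using that finite_kuhn_grid by (intro member_le_sum) auto
  have C_nonneg: "0 \<le> C" unfolding C_def by (intro sum_nonneg) auto
  have vertices: "norm (v k - v k') \<le> 2 * C / step * (\<Sum>i<m. \<bar>vertex k i - vertex k' i\<bar>)"
    if k: "k \<in> kuhn_grid p m" "k' \<in> kuhn_grid p m" for k k'
  proof (cases "k = k'")
    case False
    have "norm (v k - v k') \<le> 2 * C" using norm_triangle_ineq4[of "v k" "v k'"] C[OF k(1)] C[OF k(2)] by linarith
    also have "\<dots> = 2 * C / step * step" using step_pos by simp
    also have "\<dots> \<le> 2 * C / step * (\<Sum>i<m. \<bar>vertex k i - vertex k' i\<bar>)"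
      using C_nonneg step_pos step_le_vertex_distance[OF k False] by (intro mult_left_mono) auto
    finally show ?thesis .
  qed simp
  show "norm (interpolant v \<xi> - interpolant v \<zeta>) \<le> 2 * C / step * (\<Sum>i<m. \<bar>\<xi> i - \<zeta> i\<bar>)"
    if "\<xi> \<in> cube m r" "\<zeta> \<in> cube m r" for \<xi> \<zeta>
    using interpolant_almost_affine[OF that, of v "\<lambda>_. 0" "2 * C / step"] vertices by simp
qed

lemma interpolant_zero_barycentric:
  fixes v :: "(nat \<Rightarrow> nat) \<Rightarrow> 'w::banach"
  assumes v: "general_position B v (kuhn_grid p m)" "card B = m" and \<xi>: "\<xi> \<in> cube m r" "interpolant v \<xi> = 0"
  obtains a where "barycentric (cell_vertex \<xi> ` {0..<1}) a \<xi>" "(\<Sum>k\<in>cell_vertex \<xi> ` {0..<1}. a k *\<^sub>R v k) = 0"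
proof -
  obtain s a where s: "barycentric s a \<xi>" using barycentric_exists[OF \<xi>(1)] .
  then have zero: "(\<Sum>k\<in>s. a k *\<^sub>R v k) = 0" using barycentric_interpolant[OF s, of v] \<xi>(2) by simp
  have "facets_independent v s" using ksimplex_facets_independent[OF v] s by (simp add: barycentric_def)
  then have "0 < a k" if "k \<in> s" for k
    using facets_independent_weights_pos[of v s a k] s zero that by (simp add: barycentric_def)
  then have "cell_vertex \<xi> ` {0..<1} = s" by (rule barycentric_cell_vertices[OF s])
  then show ?thesis using that s zero by simp
qed

lemma interpolant_zeros_bij:
  fixes v :: "(nat \<Rightarrow> nat) \<Rightarrow> 'w::banach"
  assumes v: "general_position B v (kuhn_grid p m)" "card B = m"
  shows "bij_betw (\<lambda>\<xi>. cell_vertex \<xi> ` {0..<1}) {\<xi>\<in>cube m r. interpolant v \<xi> = 0} {s. ksimplex p m s \<and> zero_in_hull v s}"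
  unfolding bij_betw_def
proof (intro conjI inj_onI subset_antisym subsetI)
  fix \<xi> \<zeta> assume \<xi>: "\<xi> \<in> {\<xi>\<in>cube m r. interpolant v \<xi> = 0}" and \<zeta>: "\<zeta> \<in> {\<xi>\<in>cube m r. interpolant v \<xi> = 0}"
    and same: "cell_vertex \<xi> ` {0..<1} = cell_vertex \<zeta> ` {0..<1}"
  define s where "s = cell_vertex \<zeta> ` {0..<1}"
  obtain a where a: "barycentric s a \<xi>" "(\<Sum>k\<in>s. a k *\<^sub>R v k) = 0"
    using interpolant_zero_barycentric[OF v, of \<xi>] \<xi> unfolding same s_def by blast
  obtain b where b: "barycentric s b \<zeta>" "(\<Sum>k\<in>s. b k *\<^sub>R v k) = 0"
    using interpolant_zero_barycentric[OF v, of \<zeta>] \<zeta> unfolding s_def by blast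
  have "facets_independent v s" using ksimplex_facets_independent[OF v] a(1) by (simp add: barycentric_def)
  then have "b k = a k" if "k \<in> s" for k
    using facets_independent_weights_unique[of v s a b k] a b that by (simp add: barycentric_def)
  then have "\<xi> i = \<zeta> i" if "i < m" for i using a(1) b(1) that by (simp add: barycentric_def)
  moreover have "\<xi> i = \<zeta> i" if "m \<le> i" for i using \<xi> \<zeta> that by (simp add: coord_box_def)
  ultimately show "\<xi> = \<zeta>" by (metis ext not_le)
next
  fix s assume "s \<in> (\<lambda>\<xi>. cell_vertex \<xi> ` {0..<1}) ` {\<xi>\<in>cube m r. interpolant v \<xi> = 0}"
  then obtain a \<xi> where "barycentric s a \<xi>" "(\<Sum>k\<in>s. a k *\<^sub>R v k) = 0"
    using interpolant_zero_barycentric[OF v] by (smt (verit) imageE mem_Collect_eq)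
  then show "s \<in> {s. ksimplex p m s \<and> zero_in_hull v s}" by (auto simp: barycentric_def zero_in_hull_def)
next
  fix s assume "s \<in> {s. ksimplex p m s \<and> zero_in_hull v s}"
  then obtain a where s: "ksimplex p m s" and a: "\<forall>k\<in>s. 0 \<le> a k" "sum a s = 1" "(\<Sum>k\<in>s. a k *\<^sub>R v k) = 0"
    by (auto simp: zero_in_hull_def)
  define \<xi> where "\<xi> i = (if i < m then \<Sum>k\<in>s. a k * vertex k i else 0)" for i
  have bary: "barycentric s a \<xi>" using s a by (simp add: barycentric_def \<xi>_def)
  have "0 < a k" if "k \<in> s" for k
    using facets_independent_weights_pos[OF ksimplex_facets_independent[OF v s] _ a(2,3) that] a(1) by blast
  then have "cell_vertex \<xi> ` {0..<1} = s" by (rule barycentric_cell_vertices[OF bary])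
  moreover have "\<xi> \<in> cube m r" by (rule barycentric_in_cube[OF bary]) (simp add: \<xi>_def)
  moreover have "interpolant v \<xi> = 0" using barycentric_interpolant[OF bary, of v] a(3) by simp
  ultimately show "s \<in> (\<lambda>\<xi>. cell_vertex \<xi> ` {0..<1}) ` {\<xi>\<in>cube m r. interpolant v \<xi> = 0}" by blast
qed

lemma finite_interpolant_zeros:
  fixes v :: "(nat \<Rightarrow> nat) \<Rightarrow> 'w::banach"
  assumes "general_position B v (kuhn_grid p m)" "card B = m"
  shows "finite {\<xi>\<in>cube m r. interpolant v \<xi> = 0}"
proof -
  have "finite {s. ksimplex p m s \<and> zero_in_hull v s}"
    by (rule finite_subset[OF _ finite_ksimplexes[of p m]]) auto
  then show ?thesis using bij_betw_finite[OF interpolant_zeros_bij[OF assms]] by simp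
qed

lemma interpolant_on_simplex:
  fixes v :: "(nat \<Rightarrow> nat) \<Rightarrow> 'w::banach"
  assumes ks: "kuhn_simplex p m base upd s"
    and nonneg: "\<forall>j\<le>m. 0 \<le> kuhn_simplex.bary m upd (\<lambda>i. grid_coord \<xi> i - real (base i)) j"
  shows "interpolant v \<xi> = (\<Sum>j\<le>m. kuhn_simplex.bary m upd (\<lambda>i. grid_coord \<xi> i - real (base i)) j *\<^sub>R v (kuhn_simplex.enum base upd j))"
proof -
  interpret kuhn_simplex p m base upd s by (rule ks)
  show ?thesis
    unfolding interpolant_def cell_vertex_def
    by (rule integral_unique, rule grid_floor_integral) (use nonneg bary_total bary_point in auto)
qed

lemma interpolant_zero_simplex:
  fixes v :: "(nat \<Rightarrow> nat) \<Rightarrow> 'w::banach"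
  assumes v: "general_position B v (kuhn_grid p m)" "card B = m" and z: "z \<in> cube m r" "interpolant v z = 0"
  obtains base upd s where "kuhn_simplex p m base upd s"
    "facets_independent (\<lambda>j. v (kuhn_simplex.enum base upd j)) {..m}"
    "\<And>j. j \<le> m \<Longrightarrow> 0 < kuhn_simplex.bary m upd (\<lambda>i. grid_coord z i - real (base i)) j"
proof -
  obtain base upd s where ks: "kuhn_simplex p m base upd s"
    and nonneg: "\<forall>j\<le>m. 0 \<le> kuhn_simplex.bary m upd (\<lambda>i. grid_coord z i - real (base i)) j"
    using kuhn_simplex_cover[OF p_pos grid_coord_range[OF z(1)]] .
  interpret kuhn_simplex p m base upd s by (rule ks)
  have "facets_independent v (enum ` {..m})"
    using ksimplex_facets_independent[OF v] ks s_eq by (metis ksimplex.intros)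
  then have independent: "facets_independent (\<lambda>j. v (enum j)) {..m}"
    using facets_independent_reindex[of "{..m}" enum v] inj_enum by simp
  moreover have "(\<Sum>j\<le>m. bary (\<lambda>i. grid_coord z i - real (base i)) j *\<^sub>R v (enum j)) = 0"
    using interpolant_on_simplex[OF ks nonneg, of v] z(2) by simp
  then have "0 < bary (\<lambda>i. grid_coord z i - real (base i)) j" if "j \<le> m" for j
    using facets_independent_weights_pos[OF independent] nonneg bary_total that by blast
  ultimately show ?thesis using that[OF ks] by blast
qed

text \<open>
  At a zero all barycentric coordinates are positive, so nearby points lie in the same simplex, on
  which the interpolant is affine.
\<close>

lemma interpolant_affine_near_zero:
  fixes v :: "(nat \<Rightarrow> nat) \<Rightarrow> 'w::banach"
  assumes v: "general_position B v (kuhn_grid p m)" "card B = m" and z: "z \<in> cube m r" "interpolant v z = 0"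
  obtains a e where "independent_family a {..<m}" "0 < e"
    "\<And>\<xi>. \<xi> \<in> coord_box m z e \<Longrightarrow> interpolant v \<xi> = (\<Sum>i<m. (\<xi> i - z i) *\<^sub>R a i)"
proof -
  obtain base upd s where ks: "kuhn_simplex p m base upd s"
    and independent: "facets_independent (\<lambda>j. v (kuhn_simplex.enum base upd j)) {..m}"
    and pos: "\<And>j. j \<le> m \<Longrightarrow> 0 < kuhn_simplex.bary m upd (\<lambda>i. grid_coord z i - real (base i)) j"
    using interpolant_zero_simplex[OF v z] by blast
  interpret kuhn_simplex p m base upd s by (rule ks)
  define f where "f \<xi> = (\<lambda>i. grid_coord \<xi> i - real (base i))" for \<xi>
  define w where "w j = v (enum j)" for j
  note on_simplex = interpolant_on_simplex[where v = v, OF ks, folded f_def w_def]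
  have zero: "(\<Sum>j\<le>m. bary (f z) j *\<^sub>R w j) = 0"
    using on_simplex[of z] pos[folded f_def] z(2) by (simp add: less_imp_le)
  define e where "e = Min (bary (f z) ` {..m}) / 2"
  have "Min (bary (f z) ` {..m}) \<in> bary (f z) ` {..m}" by (rule Min_in) auto
  then have e: "0 < e" "\<And>j. j \<le> m \<Longrightarrow> 2 * e \<le> bary (f z) j" using pos by (auto simp: e_def f_def)
  have affine: "interpolant v \<xi> = (\<Sum>i<m. (f \<xi> i - f z i) *\<^sub>R slope w i)" if \<xi>: "\<xi> \<in> coord_box m z (step * e)" for \<xi>
  proof -
    have "\<bar>f \<xi> i - f z i\<bar> \<le> e" if "i < m" for i
    proof -
      have "\<bar>step * (f \<xi> i - f z i)\<bar> \<le> step * e"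
        using \<xi> that unfolding coord_box_def by (simp add: grid_coord_diff[of \<xi> _ z] f_def)
      then show ?thesis using step_pos by (simp add: abs_mult)
    qed
    then have "\<bar>bary (f \<xi>) j - bary (f z) j\<bar> \<le> 2 * e" if "j \<le> m" for j using bary_close e(1) that by simp
    then have "0 \<le> bary (f \<xi>) j" if "j \<le> m" for j using e(2)[OF that] that by (smt (verit))
    then have "interpolant v \<xi> = w 0 + (\<Sum>i<m. f \<xi> i *\<^sub>R slope w i)"
      unfolding bary_sum[symmetric] using on_simplex[of \<xi>] by (simp add: f_def w_def)
    then show ?thesis
      using zero unfolding bary_sum by (simp add: scaleR_diff_left sum_subtractf add_eq_0_iff)
  qed
  have "independent_family (slope w) {..<m}"
    using independent_slopes[OF independent[folded w_def] _ zero] pos by (simp add: f_def less_imp_le)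
  then have "independent_family (\<lambda>i. (1 / step) *\<^sub>R slope w i) {..<m}"
    using step_pos by (simp add: independent_family_scale)
  moreover have "interpolant v \<xi> = (\<Sum>i<m. (\<xi> i - z i) *\<^sub>R (1 / step) *\<^sub>R slope w i)" if "\<xi> \<in> coord_box m z (step * e)" for \<xi>
    using affine[OF that] step_pos by (simp add: grid_coord_diff[of \<xi> _ z] f_def)
  ultimately show ?thesis by (rule that[OF _ mult_pos_pos[OF step_pos e(1)]])
qed

end

subsection \<open>Nondegenerate zeros\<close>

lemma eventually_at_right_antitone:
  fixes P :: "real \<Rightarrow> bool"
  assumes "\<And>d e. d \<le> e \<Longrightarrow> P e \<Longrightarrow> P d"
  shows "(\<forall>\<^sub>F d in at_right 0. P d) \<longleftrightarrow> (\<exists>d>0. P d)"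
proof
  assume "\<forall>\<^sub>F d in at_right 0. P d"
  then obtain b where "b > 0" "\<forall>y>0. y < b \<longrightarrow> P y" unfolding eventually_at_right_field by blast
  then show "\<exists>d>0. P d" by (intro exI[of _ "b / 2"]) simp
next
  assume "\<exists>d>0. P d"
  then obtain d where "d > 0" "P d" by blast
  then show "\<forall>\<^sub>F d in at_right 0. P d" by (intro eventually_at_rightI[of 0 d]) (auto intro: assms[of _ d])
qed

definition strict_partials :: "nat \<Rightarrow> ((nat \<Rightarrow> real) \<Rightarrow> 'w::real_normed_vector) \<Rightarrow> (nat \<Rightarrow> 'w) \<Rightarrow> (nat \<Rightarrow> real) \<Rightarrow> bool" where
  "strict_partials m \<gamma> a z \<longleftrightarrow> (\<forall>\<kappa>>0. \<forall>\<^sub>F d in at_right 0. almost_affine_on m (coord_box m z d) \<kappa> a \<gamma>)"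

definition nondegenerate :: "nat \<Rightarrow> 'w::real_normed_vector set \<Rightarrow> ((nat \<Rightarrow> real) \<Rightarrow> 'w) \<Rightarrow> (nat \<Rightarrow> real) \<Rightarrow> bool" where
  "nondegenerate m Y \<gamma> z \<longleftrightarrow>
    (\<exists>a. independent_family a {..<m} \<and> a ` {..<m} \<subseteq> Y \<and> strict_partials m \<gamma> a z)"

definition isolating_boxes ::
  "nat \<Rightarrow> (nat \<Rightarrow> real) set \<Rightarrow> ((nat \<Rightarrow> real) \<Rightarrow> 'w::real_normed_vector) \<Rightarrow> (nat \<Rightarrow> real) set \<Rightarrow>
    ((nat \<Rightarrow> real) \<Rightarrow> nat \<Rightarrow> 'w) \<Rightarrow> real \<Rightarrow> real \<Rightarrow> bool" where
  "isolating_boxes m S \<gamma> Z a c d \<longleftrightarrow> 0 < c \<and> 0 < d \<and> disjoint_family_on (\<lambda>z. coord_box m z d) Z \<and>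
    (\<forall>z\<in>Z. coord_box m z d \<subseteq> S \<and> almost_affine_on m (coord_box m z d) (c / 4) (a z) \<gamma> \<and>
      (\<forall>t. c * (\<Sum>i<m. \<bar>t i\<bar>) \<le> norm (\<Sum>i<m. t i *\<^sub>R a z i)))"

lemma strict_partials_iff:
  "strict_partials m \<gamma> a z \<longleftrightarrow> (\<forall>\<kappa>>0. \<exists>d>0. almost_affine_on m (coord_box m z d) \<kappa> a \<gamma>)"
  unfolding strict_partials_def
  by (subst eventually_at_right_antitone) (auto intro: almost_affine_on_subset[OF _ coord_box_mono])

lemma independent_partials_lower_bound:
  fixes a :: "nat \<Rightarrow> 'w::real_normed_vector"
  assumes "independent_family a {..<m}"
  obtains c where "c > 0" "\<And>t. c * (\<Sum>i<m. \<bar>t i\<bar>) \<le> norm (\<Sum>i<m. t i *\<^sub>R a i)"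
  using independent_family_lower_bound[OF independent_family_inj_on independent_family_image] assms by blast

lemma eventually_lower_bound:
  fixes a :: "nat \<Rightarrow> 'w::real_normed_vector"
  assumes "independent_family a {..<m}"
  shows "\<forall>\<^sub>F c in at_right 0. \<forall>t. c * (\<Sum>i<m. \<bar>t i\<bar>) \<le> norm (\<Sum>i<m. t i *\<^sub>R a i)"
proof (subst eventually_at_right_antitone)
  show "\<exists>c>0. \<forall>t. c * (\<Sum>i<m. \<bar>t i\<bar>) \<le> norm (\<Sum>i<m. t i *\<^sub>R a i)"
    using independent_partials_lower_bound[OF assms] by metis
  show "\<forall>t. d * (\<Sum>i<m. \<bar>t i\<bar>) \<le> norm (\<Sum>i<m. t i *\<^sub>R a i)"
    if "d \<le> e" "\<forall>t. e * (\<Sum>i<m. \<bar>t i\<bar>) \<le> norm (\<Sum>i<m. t i *\<^sub>R a i)" for d e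
    using that by (meson mult_right_mono order_trans sum_nonneg abs_ge_zero)
qed

lemma isolating_boxes_exist:
  assumes fin: "finite Z" and nondeg: "\<And>z. z \<in> Z \<Longrightarrow> nondegenerate m Y \<gamma> z"
    and Z: "Z \<subseteq> cube m r" "\<forall>z\<in>Z. \<forall>i<m. \<bar>z i\<bar> < r"
  obtains a c d where "\<forall>z\<in>Z. independent_family (a z) {..<m} \<and> a z ` {..<m} \<subseteq> Y"
    "isolating_boxes m (cube m r) \<gamma> Z a c d"
proof -
  obtain a where a: "\<forall>z\<in>Z. independent_family (a z) {..<m} \<and> a z ` {..<m} \<subseteq> Y"
    and partials: "\<And>z. z \<in> Z \<Longrightarrow> strict_partials m \<gamma> (a z) z"
    using nondeg unfolding nondegenerate_def by metis
  have "\<forall>\<^sub>F c in at_right 0. 0 < c \<and> (\<forall>z\<in>Z. \<forall>t. c * (\<Sum>i<m. \<bar>t i\<bar>) \<le> norm (\<Sum>i<m. t i *\<^sub>R a z i))"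
    using a by (intro eventually_conj eventually_at_right_less eventually_ball_finite fin ballI eventually_lower_bound) blast
  from eventually_happens'[OF trivial_limit_at_right_real this]
  obtain c where c: "0 < c" "\<forall>z\<in>Z. \<forall>t. c * (\<Sum>i<m. \<bar>t i\<bar>) \<le> norm (\<Sum>i<m. t i *\<^sub>R a z i)"
    by (elim exE conjE) (rule that)
  have disjoint: "\<forall>\<^sub>F d in at_right 0. z \<noteq> z' \<longrightarrow> coord_box m z d \<inter> coord_box m z' d = {}"
    if "z \<in> Z" "z' \<in> Z" for z z'
    using coord_boxes_disjoint_small[of z m r z'] Z(1) that by (cases "z = z'") auto
  have "\<forall>\<^sub>F d in at_right 0. 0 < d \<and> (\<forall>z\<in>Z. \<forall>z'\<in>Z. z \<noteq> z' \<longrightarrow> coord_box m z d \<inter> coord_box m z' d = {}) \<and>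
      (\<forall>z\<in>Z. coord_box m z d \<subseteq> cube m r \<and> almost_affine_on m (coord_box m z d) (c / 4) (a z) \<gamma>)"
    using partials c(1) Z
    by (intro eventually_conj eventually_at_right_less eventually_ball_finite fin ballI disjoint
        coord_box_subset_cube_small) (auto simp: strict_partials_def)
  from eventually_happens'[OF trivial_limit_at_right_real this]
  obtain d where "0 < d" "\<forall>z\<in>Z. \<forall>z'\<in>Z. z \<noteq> z' \<longrightarrow> coord_box m z d \<inter> coord_box m z' d = {}"
      "\<forall>z\<in>Z. coord_box m z d \<subseteq> cube m r \<and> almost_affine_on m (coord_box m z d) (c / 4) (a z) \<gamma>"
    by (elim exE conjE) (rule that)
  then have "isolating_boxes m (cube m r) \<gamma> Z a c d"
    using c by (simp add: isolating_boxes_def disjoint_family_on_def)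
  with a show ?thesis by (rule that)
qed

lemma coord_box_eqI:
  assumes "\<xi> \<in> coord_box m z d" "\<zeta> \<in> coord_box m z d" "(\<Sum>i<m. \<bar>\<xi> i - \<zeta> i\<bar>) \<le> 0"
  shows "\<xi> = \<zeta>"
proof
  fix i
  have "(\<Sum>i<m. \<bar>\<xi> i - \<zeta> i\<bar>) = 0" using assms(3) by (intro order_antisym sum_nonneg) auto
  then have "\<forall>i\<in>{..<m}. \<bar>\<xi> i - \<zeta> i\<bar> = 0" by (subst (asm) sum_nonneg_eq_0_iff) auto
  then show "\<xi> i = \<zeta> i" using assms(1,2) by (cases "i < m") (auto simp: coord_box_def)
qed

lemma almost_affine_zero_exists:
  fixes L :: "(nat \<Rightarrow> real) \<Rightarrow> 'w::banach"
  assumes B: "finite B" "card B = m" and a: "independent_family a {..<m}" "a ` {..<m} \<subseteq> span B"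
    and c: "0 < c" "\<And>t. c * (\<Sum>i<m. \<bar>t i\<bar>) \<le> norm (\<Sum>i<m. t i *\<^sub>R a i)" and d: "0 \<le> d"
    and L: "\<And>\<xi>. \<xi> \<in> coord_box m z d \<Longrightarrow> L \<xi> \<in> span B"
    and affine: "almost_affine_on m (coord_box m z d) (c / 2) a L" and Lz: "norm (L z) \<le> c * d / 2"
  obtains \<xi> where "\<xi> \<in> coord_box m z d" "L \<xi> = 0"
proof -
  have "\<exists>t. (\<Sum>i<m. t i *\<^sub>R a i) = y" if "y \<in> span B" for y
    using independent_family_spans[of "{..<m}" B a y] B a that by auto
  then obtain t where t: "\<And>y. y \<in> span B \<Longrightarrow> (\<Sum>i<m. t y i *\<^sub>R a i) = y" by metis
  define pt where "pt y = (\<lambda>i. z i + (if i < m then t y i else 0))" for y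
  have pt_diff: "(\<Sum>i<m. (pt y i - pt y' i) *\<^sub>R a i) = y - y'" if "y \<in> span B" "y' \<in> span B" for y y'
    using t that by (simp add: pt_def scaleR_diff_left sum_subtractf)
  have pt_box: "pt y \<in> coord_box m z d" if y: "y \<in> span B \<inter> cball 0 (c * d)" for y
  proof -
    have "c * (\<Sum>i<m. \<bar>t y i\<bar>) \<le> c * d" using c(2)[of "t y"] t[of y] y by simp
    then have "(\<Sum>i<m. \<bar>t y i\<bar>) \<le> d" using c(1) by simp
    then have "\<bar>t y i\<bar> \<le> d" if "i < m" for i using member_le_sum[of i "{..<m}" "\<lambda>i. \<bar>t y i\<bar>"] that by simp
    then show ?thesis by (simp add: coord_box_def pt_def)
  qed
  have "c * (\<Sum>i<m. \<bar>t 0 i\<bar>) \<le> 0" using c(2)[of "t 0"] t[OF span_zero] by simp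
  then have "(\<Sum>i<m. \<bar>pt 0 i - z i\<bar>) \<le> 0" using c(1) by (simp add: pt_def mult_le_0_iff)
  then have pt0: "pt 0 = z" using coord_box_eqI[OF pt_box center_in_coord_box[OF d]] c(1) d by (simp add: span_zero)
  obtain y where "y \<in> span B" "norm y \<le> c * d" "L (pt y) = 0"
  proof (rule perturbed_identity_zero[where Z = "span B" and q = "1 / 2" and \<rho> = "c * d" and f = "\<lambda>y. L (pt y)"])
    fix y y' assume y: "y \<in> span B \<inter> cball 0 (c * d)" and y': "y' \<in> span B \<inter> cball 0 (c * d)"
    have "norm (L (pt y) - L (pt y') - (y - y')) \<le> c / 2 * (\<Sum>i<m. \<bar>pt y i - pt y' i\<bar>)"
      using almost_affine_onD[OF affine pt_box[OF y] pt_box[OF y']] pt_diff[of y y'] y y' by simp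
    also have "\<dots> = 1 / 2 * (c * (\<Sum>i<m. \<bar>pt y i - pt y' i\<bar>))" by simp
    also have "\<dots> \<le> 1 / 2 * norm (y - y')"
      using c(2)[of "\<lambda>i. pt y i - pt y' i"] pt_diff[of y y'] y y' by simp
    finally show "norm (L (pt y) - L (pt y') - (y - y')) \<le> 1 / 2 * norm (y - y')" .
  qed (use L pt_box c(1) d Lz pt0 closed_span_finite[OF B(1)] in \<open>simp_all add: subspace_span\<close>)
  then show ?thesis using that[OF pt_box] by simp
qed

lemma almost_affine_zero_unique:
  fixes L :: "(nat \<Rightarrow> real) \<Rightarrow> 'w::real_normed_vector"
  assumes c: "0 < c" "\<And>t. c * (\<Sum>i<m. \<bar>t i\<bar>) \<le> norm (\<Sum>i<m. t i *\<^sub>R a i)"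
    and affine: "almost_affine_on m (coord_box m z d) (c / 2) a L"
    and \<xi>: "\<xi> \<in> coord_box m z d" "L \<xi> = 0" and \<zeta>: "\<zeta> \<in> coord_box m z d" "L \<zeta> = 0"
  shows "\<xi> = \<zeta>"
proof -
  have "c * (\<Sum>i<m. \<bar>\<xi> i - \<zeta> i\<bar>) \<le> c / 2 * (\<Sum>i<m. \<bar>\<xi> i - \<zeta> i\<bar>)"
    using almost_affine_onD[OF affine \<xi>(1) \<zeta>(1)] c(2)[of "\<lambda>i. \<xi> i - \<zeta> i"] \<xi>(2) \<zeta>(2) by simp
  then have "(\<Sum>i<m. \<bar>\<xi> i - \<zeta> i\<bar>) \<le> 0" using c(1) by (simp add: field_simps)
  then show ?thesis using \<xi>(1) \<zeta>(1) by (intro coord_box_eqI)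
qed

lemma card_eq_one_in_each:
  assumes "X \<subseteq> (\<Union>z\<in>Z. N z)" "disjoint_family_on N Z" "\<And>z. z \<in> Z \<Longrightarrow> \<exists>!x. x \<in> X \<inter> N z"
  shows "card X = card Z"
proof -
  obtain f where f: "\<And>z. z \<in> Z \<Longrightarrow> f z \<in> X \<inter> N z" using assms(3) by metis
  have "bij_betw f Z X"
    unfolding bij_betw_def
  proof (intro conjI inj_onI subset_antisym subsetI)
    show "z = z'" if "z \<in> Z" "z' \<in> Z" "f z = f z'" for z z'
      using f[OF that(1)] f[OF that(2)] that assms(2) by (auto simp: disjoint_family_on_def)
    show "x \<in> f ` Z" if x: "x \<in> X" for x
    proof -
      obtain z where "z \<in> Z" "x \<in> N z" using assms(1) x by blast
      then have "x = f z" using assms(3)[of z] f[of z] x by blast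
      then show ?thesis using \<open>z \<in> Z\<close> by blast
    qed
  qed (use f in auto)
  then show ?thesis by (simp add: bij_betw_same_card)
qed

lemma norm_bounded_below_off_zeros:
  fixes \<gamma> :: "(nat \<Rightarrow> real) \<Rightarrow> 'w::real_normed_vector"
  assumes cont: "continuous_on (cube m r) \<gamma>" and d: "0 < d"
  obtains \<mu> where "0 < \<mu>"
    "\<forall>\<xi>\<in>cube m r. norm (\<gamma> \<xi>) < \<mu> \<longrightarrow> (\<exists>z\<in>{z\<in>cube m r. \<gamma> z = 0}. \<xi> \<in> coord_box m z d)"
proof -
  define N where "N = (\<Union>z\<in>{z\<in>cube m r. \<gamma> z = 0}. {\<xi>. \<forall>i<m. \<bar>\<xi> i - z i\<bar> < d})"
  have "open N" unfolding N_def by (intro open_UN ballI open_coords_less)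
  then have "compact (cube m r - N)" by (intro compact_diff compact_cube)
  moreover have "continuous_on (cube m r - N) \<gamma>" by (rule continuous_on_subset[OF cont]) auto
  moreover have "\<gamma> \<xi> \<noteq> 0" if "\<xi> \<in> cube m r - N" for \<xi> using that d by (auto simp: N_def)
  ultimately obtain \<mu> where \<mu>: "0 < \<mu>" "\<And>\<xi>. \<xi> \<in> cube m r - N \<Longrightarrow> \<mu> \<le> norm (\<gamma> \<xi>)"
    using compact_norm_lower_bound[of "cube m r - N" \<gamma>] by auto
  show ?thesis
  proof (rule that[OF \<mu>(1)], intro ballI impI)
    fix \<xi> assume \<xi>: "\<xi> \<in> cube m r" "norm (\<gamma> \<xi>) < \<mu>"
    then have "\<xi> \<in> N" using \<mu>(2)[of \<xi>] by auto
    then obtain z where z: "z \<in> {z\<in>cube m r. \<gamma> z = 0}" "\<forall>i<m. \<bar>\<xi> i - z i\<bar> < d" unfolding N_def by blast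
    then have "\<xi> \<in> coord_box m z d" using \<xi>(1) by (auto simp: coord_box_def less_imp_le)
    with z(1) show "\<exists>z\<in>{z\<in>cube m r. \<gamma> z = 0}. \<xi> \<in> coord_box m z d" by blast
  qed
qed

subsection \<open>Zeros of generic piecewise affine approximations\<close>

context kuhn_mesh
begin

definition approximant :: "((nat \<Rightarrow> real) \<Rightarrow> 'w::real_normed_vector) \<Rightarrow> ((nat \<Rightarrow> nat) \<Rightarrow> 'w) \<Rightarrow> (nat \<Rightarrow> real) \<Rightarrow> 'w" where
  "approximant \<gamma> \<rho> = interpolant (\<lambda>k. \<gamma> (vertex k) + \<rho> k)"

lemma approximant_close:
  fixes \<gamma> :: "(nat \<Rightarrow> real) \<Rightarrow> 'w::banach"
  assumes osc: "\<And>\<xi> \<zeta>. \<xi> \<in> cube m r \<Longrightarrow> \<zeta> \<in> cube m r \<Longrightarrow> \<xi> \<in> coord_box m \<zeta> step \<Longrightarrow> norm (\<gamma> \<xi> - \<gamma> \<zeta>) < \<tau> / 2"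
    and \<rho>: "\<And>k. k \<in> kuhn_grid p m \<Longrightarrow> norm (\<rho> k) \<le> \<tau> / 2" and \<xi>: "\<xi> \<in> cube m r"
  shows "norm (approximant \<gamma> \<rho> \<xi> - \<gamma> \<xi>) \<le> \<tau>"
  unfolding approximant_def
proof (rule interpolant_close[OF \<xi>])
  fix k assume k: "k \<in> kuhn_grid p m" "vertex k \<in> coord_box m \<xi> step"
  have "norm (\<gamma> (vertex k) - \<gamma> \<xi>) < \<tau> / 2" by (rule osc[OF vertex_in_cube[OF k(1)] \<xi> k(2)])
  then have "norm ((\<gamma> (vertex k) - \<gamma> \<xi>) + \<rho> k) \<le> \<tau> / 2 + \<tau> / 2"
    using \<rho>[OF k(1)] by (intro norm_triangle_mono) auto
  then show "norm (\<gamma> (vertex k) + \<rho> k - \<gamma> \<xi>) \<le> \<tau>" by (simp add: algebra_simps)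
qed

lemma approximant_in_subspace:
  fixes \<gamma> :: "(nat \<Rightarrow> real) \<Rightarrow> 'w::banach"
  assumes "subspace Y" "\<And>\<xi>. \<xi> \<in> cube m r \<Longrightarrow> \<gamma> \<xi> \<in> Y" "\<And>k. k \<in> kuhn_grid p m \<Longrightarrow> \<rho> k \<in> Y" "\<xi> \<in> cube m r"
  shows "approximant \<gamma> \<rho> \<xi> \<in> Y"
  unfolding approximant_def
  by (rule interpolant_in_subspace) (use assms vertex_in_cube in \<open>auto intro: subspace_add\<close>)

lemma approximant_almost_affine:
  fixes \<gamma> :: "(nat \<Rightarrow> real) \<Rightarrow> 'w::banach"
  assumes d: "coord_box m z d \<subseteq> cube m r" "step \<le> d / 2"
    and \<gamma>: "almost_affine_on m (coord_box m z d) (\<kappa> / 2) a \<gamma>"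
    and \<rho>: "\<And>k. k \<in> kuhn_grid p m \<Longrightarrow> norm (\<rho> k) \<le> \<kappa> / 4 * step"
  shows "almost_affine_on m (coord_box m z (d / 2)) \<kappa> a (approximant \<gamma> \<rho>)"
  unfolding almost_affine_on_def approximant_def
proof (intro ballI interpolant_almost_affine)
  fix \<xi> \<zeta> assume \<xi>: "\<xi> \<in> coord_box m z (d / 2)" and \<zeta>: "\<zeta> \<in> coord_box m z (d / 2)"
  have "coord_box m z (d / 2) \<subseteq> cube m r" using d coord_box_mono[of "d / 2" d m z] step_pos by auto
  then show "\<xi> \<in> cube m r" "\<zeta> \<in> cube m r" using \<xi> \<zeta> by auto
  fix k k' assume k: "k \<in> kuhn_grid p m" "k' \<in> kuhn_grid p m"
    and near: "vertex k \<in> coord_box m \<xi> step" "vertex k' \<in> coord_box m \<zeta> step"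
  have in_box: "\<eta>' \<in> coord_box m z d" if \<eta>: "\<eta>' \<in> coord_box m \<eta> step" "\<eta> \<in> coord_box m z (d / 2)" for \<eta>' \<eta>
  proof -
    have "\<bar>\<eta>' i - z i\<bar> \<le> d" if "i < m" for i
    proof -
      have "\<bar>\<eta>' i - \<eta> i\<bar> \<le> step" "\<bar>\<eta> i - z i\<bar> \<le> d / 2" using \<eta> that by (auto simp: coord_box_def)
      then show ?thesis using d(2) by linarith
    qed
    then show ?thesis using \<eta> by (simp add: coord_box_def)
  qed
  let ?l1 = "\<Sum>i<m. \<bar>vertex k i - vertex k' i\<bar>"
  have "norm (\<rho> k - \<rho> k') \<le> \<kappa> / 2 * ?l1"
  proof (cases "k = k'")
    case False
    have \<kappa>: "0 \<le> \<kappa> / 4 * step" using \<rho>[OF k(1)] norm_ge_zero order_trans by blast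
    have "norm (\<rho> k - \<rho> k') \<le> \<kappa> / 4 * step + \<kappa> / 4 * step"
      using norm_triangle_ineq4[of "\<rho> k" "\<rho> k'"] \<rho>[OF k(1)] \<rho>[OF k(2)] by linarith
    also have "\<dots> = \<kappa> / 2 * step" by simp
    also have "\<dots> \<le> \<kappa> / 2 * ?l1"
      using \<kappa> step_pos step_le_vertex_distance[OF k False] by (intro mult_left_mono) (auto simp: zero_le_mult_iff)
    finally show ?thesis .
  qed simp
  moreover have "norm (\<gamma> (vertex k) - \<gamma> (vertex k') - (\<Sum>i<m. (vertex k i - vertex k' i) *\<^sub>R a i)) \<le> \<kappa> / 2 * ?l1"
    by (rule almost_affine_onD[OF \<gamma>]) (use in_box near \<xi> \<zeta> in auto)
  ultimately have "norm ((\<gamma> (vertex k) - \<gamma> (vertex k') - (\<Sum>i<m. (vertex k i - vertex k' i) *\<^sub>R a i)) + (\<rho> k - \<rho> k'))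
      \<le> \<kappa> / 2 * ?l1 + \<kappa> / 2 * ?l1" by (intro norm_triangle_mono)
  then show "norm (\<gamma> (vertex k) + \<rho> k - (\<gamma> (vertex k') + \<rho> k') - (\<Sum>i<m. (vertex k i - vertex k' i) *\<^sub>R a i)) \<le> \<kappa> * ?l1"
    by (simp add: algebra_simps)
qed

lemma approximant_zeros_card:
  fixes \<gamma> :: "(nat \<Rightarrow> real) \<Rightarrow> 'w::banach"
  assumes B: "finite B" "card B = m" and \<gamma>: "\<And>\<xi>. \<xi> \<in> cube m r \<Longrightarrow> \<gamma> \<xi> \<in> span B"
  defines "Z \<equiv> {\<xi>\<in>cube m r. \<gamma> \<xi> = 0}"
  assumes a: "\<And>z. z \<in> Z \<Longrightarrow> independent_family (a z) {..<m} \<and> a z ` {..<m} \<subseteq> span B"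
    and boxes: "isolating_boxes m (cube m r) \<gamma> Z a c d" and "step \<le> d / 2"
    and off_boxes: "\<And>\<xi>. \<xi> \<in> cube m r \<Longrightarrow> norm (\<gamma> \<xi>) < \<mu> \<Longrightarrow> \<exists>z\<in>Z. \<xi> \<in> coord_box m z (d / 2)"
    and \<rho>: "\<And>k. k \<in> kuhn_grid p m \<Longrightarrow> \<rho> k \<in> span B \<and> norm (\<rho> k) \<le> c / 8 * step"
    and close: "\<And>\<xi>. \<xi> \<in> cube m r \<Longrightarrow> norm (approximant \<gamma> \<rho> \<xi> - \<gamma> \<xi>) \<le> \<tau>" and \<tau>: "\<tau> < \<mu>" "\<tau> \<le> c * d / 4"
  shows "card {\<xi>\<in>cube m r. approximant \<gamma> \<rho> \<xi> = 0} = card Z"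
proof (rule card_eq_one_in_each)
  let ?L = "approximant \<gamma> \<rho>"
  note boxes = boxes[unfolded isolating_boxes_def]
  have half: "coord_box m z (d / 2) \<subseteq> coord_box m z d" for z using boxes by (intro coord_box_mono) simp
  show "disjoint_family_on (\<lambda>z. coord_box m z (d / 2)) Z"
    using boxes half unfolding disjoint_family_on_def by blast
  show "{\<xi>\<in>cube m r. ?L \<xi> = 0} \<subseteq> (\<Union>z\<in>Z. coord_box m z (d / 2))"
    using off_boxes close \<tau>(1) by fastforce
  show "\<exists>!\<xi>. \<xi> \<in> {\<xi>\<in>cube m r. ?L \<xi> = 0} \<inter> coord_box m z (d / 2)" if z: "z \<in> Z" for z
  proof -
    have in_cube: "coord_box m z (d / 2) \<subseteq> cube m r" using boxes half z by blast
    have lower: "0 < c" "\<And>t. c * (\<Sum>i<m. \<bar>t i\<bar>) \<le> norm (\<Sum>i<m. t i *\<^sub>R a z i)" using boxes z by auto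
    have affine: "almost_affine_on m (coord_box m z (d / 2)) (c / 2) (a z) ?L"
      using boxes z \<rho> \<open>step \<le> d / 2\<close> by (intro approximant_almost_affine) auto
    have small: "norm (?L z) \<le> c * (d / 2) / 2" using close[of z] z \<tau>(2) by (simp add: Z_def)
    have in_span: "?L \<xi> \<in> span B" if "\<xi> \<in> coord_box m z (d / 2)" for \<xi>
      using \<gamma> \<rho> that in_cube by (intro approximant_in_subspace) (auto simp: subspace_span)
    have "0 \<le> d / 2" and ind: "independent_family (a z) {..<m}" "a z ` {..<m} \<subseteq> span B" using boxes a[OF z] by auto
    from almost_affine_zero_exists[OF B ind lower this(1) in_span affine small]
    obtain \<xi> where "\<xi> \<in> coord_box m z (d / 2)" "?L \<xi> = 0" .
    then show ?thesis using almost_affine_zero_unique[OF lower affine] in_cube by blast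
  qed
qed

end

lemma eventually_mesh_oscillation:
  fixes \<gamma> :: "(nat \<Rightarrow> real) \<Rightarrow> 'w::real_normed_vector"
  assumes "continuous_on (cube m r) \<gamma>" "0 < e"
  shows "\<forall>\<^sub>F p in sequentially. \<forall>\<xi>\<in>cube m r. \<forall>\<zeta>\<in>cube m r.
    \<xi> \<in> coord_box m \<zeta> (2 * r / real p) \<longrightarrow> norm (\<gamma> \<xi> - \<gamma> \<zeta>) < e"
proof -
  obtain d where d: "d > 0"
    "\<And>\<xi> \<zeta>. \<xi> \<in> cube m r \<Longrightarrow> \<zeta> \<in> cube m r \<Longrightarrow> \<xi> \<in> coord_box m \<zeta> d \<Longrightarrow> norm (\<gamma> \<xi> - \<gamma> \<zeta>) < e"
    using cube_uniformly_continuous[OF assms] by metis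
  have "\<forall>\<^sub>F p in sequentially. 2 * r / real p < d" by (rule order_tendstoD(2)[OF lim_const_over_n d(1)])
  then show ?thesis
  proof eventually_elim
    case (elim p)
    then show ?case using d(2) coord_box_mono[of "2 * r / real p" d] by (meson less_imp_le subsetD)
  qed
qed

lemma nondegenerate_zeros_persist:
  fixes \<gamma> :: "(nat \<Rightarrow> real) \<Rightarrow> 'w::banach"
  assumes B: "finite B" "card B = m" and r: "0 < r"
    and cont: "continuous_on (cube m r) \<gamma>" and \<gamma>: "\<And>\<xi>. \<xi> \<in> cube m r \<Longrightarrow> \<gamma> \<xi> \<in> span B"
  defines "Z \<equiv> {\<xi>\<in>cube m r. \<gamma> \<xi> = 0}"
  assumes fin: "finite Z" and interior: "\<forall>z\<in>Z. \<forall>i<m. \<bar>z i\<bar> < r"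
    and nondeg: "\<And>z. z \<in> Z \<Longrightarrow> nondegenerate m (span B) \<gamma> z"
  shows "\<forall>\<^sub>F p in sequentially. \<exists>\<eta>>0. \<forall>\<rho>. (\<forall>k\<in>kuhn_grid p m. \<rho> k \<in> span B \<and> norm (\<rho> k) < \<eta>) \<longrightarrow>
    card {\<xi>\<in>cube m r. kuhn_mesh.approximant m p r \<gamma> \<rho> \<xi> = 0} = card Z"
proof -
  have in_cube: "Z \<subseteq> cube m r" by (auto simp: Z_def)
  obtain a c d where a: "\<forall>z\<in>Z. independent_family (a z) {..<m} \<and> a z ` {..<m} \<subseteq> span B"
    and boxes: "isolating_boxes m (cube m r) \<gamma> Z a c d"
    using isolating_boxes_exist[of Z m "span B" \<gamma> r, OF fin nondeg in_cube interior] .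
  have pos: "0 < c" "0 < d" using boxes by (auto simp: isolating_boxes_def)
  obtain \<mu> where \<mu>: "0 < \<mu>" "\<forall>\<xi>\<in>cube m r. norm (\<gamma> \<xi>) < \<mu> \<longrightarrow> (\<exists>z\<in>Z. \<xi> \<in> coord_box m z (d / 2))"
    using norm_bounded_below_off_zeros[OF cont half_gt_zero[OF pos(2)], folded Z_def] .
  define \<tau> where "\<tau> = min (\<mu> / 2) (c * d / 4)"
  have \<tau>: "0 < \<tau>" "\<tau> < \<mu>" "\<tau> \<le> c * d / 4" using \<mu>(1) pos by (auto simp: \<tau>_def)
  have "0 < d / 2" "0 < \<tau> / 2" using pos \<tau>(1) by auto
  have "\<forall>\<^sub>F p in sequentially. 2 * r / real p < d / 2" by (rule order_tendstoD(2)[OF lim_const_over_n \<open>0 < d / 2\<close>])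
  with eventually_gt_at_top[of 0] eventually_mesh_oscillation[OF cont \<open>0 < \<tau> / 2\<close>] show ?thesis
  proof eventually_elim
    case (elim p)
    interpret kuhn_mesh m p r by standard (use elim(1) r in auto)
    have "card {\<xi>\<in>cube m r. approximant \<gamma> \<rho> \<xi> = 0} = card Z"
      if \<rho>: "\<forall>k\<in>kuhn_grid p m. \<rho> k \<in> span B \<and> norm (\<rho> k) < min (\<tau> / 2) (c / 8 * step)" for \<rho>
    proof -
      have "norm (approximant \<gamma> \<rho> \<xi> - \<gamma> \<xi>) \<le> \<tau>" if "\<xi> \<in> cube m r" for \<xi>
        using elim(2) \<rho> that by (intro approximant_close) (auto simp: step_def less_imp_le)
      then show ?thesis
        unfolding Z_def using a boxes elim(3) \<mu>(2) \<rho> \<tau>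
        by (intro approximant_zeros_card[OF B \<gamma>, where a = a and c = c and d = d and \<mu> = \<mu> and \<tau> = \<tau>]) (auto simp: Z_def step_def less_imp_le)
    qed
    moreover have "0 < min (\<tau> / 2) (c / 8 * step)" using \<tau>(1) pos step_pos by simp
    ultimately show ?case by blast
  qed
qed

definition affine_zero :: "nat \<Rightarrow> ((nat \<Rightarrow> real) \<Rightarrow> 'w::real_vector) \<Rightarrow> (nat \<Rightarrow> real) \<Rightarrow> bool" where
  "affine_zero m \<gamma> z \<longleftrightarrow> (\<exists>a. independent_family a {..<m} \<and>
    (\<forall>\<^sub>F e in at_right 0. \<forall>\<xi>\<in>coord_box m z e. \<gamma> \<xi> = (\<Sum>i<m. (\<xi> i - z i) *\<^sub>R a i)))"

lemma affine_zero_iff: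
  "affine_zero m \<gamma> z \<longleftrightarrow> (\<exists>a. independent_family a {..<m} \<and>
    (\<exists>e>0. \<forall>\<xi>\<in>coord_box m z e. \<gamma> \<xi> = (\<Sum>i<m. (\<xi> i - z i) *\<^sub>R a i)))"
  unfolding affine_zero_def by (subst eventually_at_right_antitone) (auto dest: subsetD[OF coord_box_mono])

lemma affine_zero_cong:
  assumes z: "z \<in> cube m s" "\<And>i. i < m \<Longrightarrow> \<bar>z i\<bar> < s" and aff: "affine_zero m \<gamma> z"
    and eq: "\<And>\<xi>. \<xi> \<in> cube m s \<Longrightarrow> \<gamma>' \<xi> = \<gamma> \<xi>"
  shows "affine_zero m \<gamma>' z"
proof -
  obtain a where a: "independent_family a {..<m}"
    "\<forall>\<^sub>F e in at_right 0. \<forall>\<xi>\<in>coord_box m z e. \<gamma> \<xi> = (\<Sum>i<m. (\<xi> i - z i) *\<^sub>R a i)"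
    using aff unfolding affine_zero_def by blast
  have "\<forall>\<^sub>F e in at_right 0. coord_box m z e \<subseteq> cube m s" using z by (intro coord_box_subset_cube_small)
  with a(2) have "\<forall>\<^sub>F e in at_right 0. \<forall>\<xi>\<in>coord_box m z e. \<gamma>' \<xi> = (\<Sum>i<m. (\<xi> i - z i) *\<^sub>R a i)"
    by eventually_elim (use eq in auto)
  with a(1) show ?thesis unfolding affine_zero_def by blast
qed

context kuhn_mesh
begin

lemma approximant_parity:
  fixes \<gamma> \<gamma>' :: "(nat \<Rightarrow> real) \<Rightarrow> 'w::banach"
  assumes m: "0 < m" and B: "finite B" "independent B" "card B = m"
    and generic: "general_position B (\<lambda>k. \<gamma> (vertex k) + \<rho> k) (kuhn_grid p m)"
      "general_position B (\<lambda>k. \<gamma>' (vertex k) + \<rho> k) (kuhn_grid p m)"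
    and boundary: "\<And>\<xi> i. \<xi> \<in> cube m r \<Longrightarrow> i < m \<Longrightarrow> \<bar>\<xi> i\<bar> = r \<Longrightarrow> \<gamma>' \<xi> = \<gamma> \<xi>"
  shows "even (card {\<xi>\<in>cube m r. approximant \<gamma>' \<rho> \<xi> = 0}) \<longleftrightarrow> even (card {\<xi>\<in>cube m r. approximant \<gamma> \<rho> \<xi> = 0})"
proof -
  have "\<gamma> (vertex k) + \<rho> k = \<gamma>' (vertex k) + \<rho> k" if "k \<in> kuhn_grid p m" "i < m" "k i = 0 \<or> k i = p" for k i
    using boundary[OF vertex_in_cube[OF that(1)] that(2)] boundary_vertex[of i k] that(2,3) by simp
  then show ?thesis
    using kuhn_parity[OF m B generic] bij_betw_same_card[OF interpolant_zeros_bij[OF generic(1) B(3)]]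
      bij_betw_same_card[OF interpolant_zeros_bij[OF generic(2) B(3)]] by (simp add: approximant_def)
qed

lemma approximant_affine_zero:
  fixes \<gamma> :: "(nat \<Rightarrow> real) \<Rightarrow> 'w::banach"
  assumes "general_position B (\<lambda>k. \<gamma> (vertex k) + \<rho> k) (kuhn_grid p m)" "card B = m"
    and "z \<in> cube m r" "approximant \<gamma> \<rho> z = 0"
  shows "affine_zero m (approximant \<gamma> \<rho>) z"
proof -
  obtain a e where "independent_family a {..<m}" "0 < e"
    "\<And>\<xi>. \<xi> \<in> coord_box m z e \<Longrightarrow> approximant \<gamma> \<rho> \<xi> = (\<Sum>i<m. (\<xi> i - z i) *\<^sub>R a i)"
    using interpolant_affine_near_zero[OF assms(1-3)] assms(4) unfolding approximant_def by metis
  then show ?thesis unfolding affine_zero_iff by blast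
qed

end

text \<open>
  By Kuhn's parity lemma, the piecewise affine approximations of \<open>\<gamma>\<close> and \<open>\<gamma>'\<close> have the same number
  of zeros modulo two, and \<open>\<gamma>\<close> has as many zeros as its approximation.
\<close>

lemma generic_approximation_same_parity:
  fixes \<gamma> \<gamma>' :: "(nat \<Rightarrow> real) \<Rightarrow> 'w::banach"
  assumes m: "0 < m" and B: "finite B" "independent B" "card B = m" and r: "0 < r" and \<tau>: "0 < \<tau>"
    and cont: "continuous_on (cube m r) \<gamma>" "continuous_on (cube m r) \<gamma>'"
    and span: "\<And>\<xi>. \<xi> \<in> cube m r \<Longrightarrow> \<gamma> \<xi> \<in> span B" "\<And>\<xi>. \<xi> \<in> cube m r \<Longrightarrow> \<gamma>' \<xi> \<in> span B"
    and boundary: "\<And>\<xi> i. \<xi> \<in> cube m r \<Longrightarrow> i < m \<Longrightarrow> \<bar>\<xi> i\<bar> = r \<Longrightarrow> \<gamma>' \<xi> = \<gamma> \<xi> \<and> \<gamma> \<xi> \<noteq> 0"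
    and fin: "finite {\<xi>\<in>cube m r. \<gamma> \<xi> = 0}"
    and nondeg: "\<And>z. z \<in> cube m r \<Longrightarrow> \<gamma> z = 0 \<Longrightarrow> nondegenerate m (span B) \<gamma> z"
  obtains L where "continuous_on (cube m r) L" "\<forall>\<xi>\<in>cube m r. L \<xi> \<in> span B \<and> norm (L \<xi> - \<gamma>' \<xi>) \<le> \<tau>"
    "finite {\<xi>\<in>cube m r. L \<xi> = 0}" "even (card {\<xi>\<in>cube m r. L \<xi> = 0}) \<longleftrightarrow> even (card {\<xi>\<in>cube m r. \<gamma> \<xi> = 0})"
    "\<forall>z\<in>cube m r. L z = 0 \<longrightarrow> affine_zero m L z"
proof -
  have interior: "\<forall>z\<in>{\<xi>\<in>cube m r. \<gamma> \<xi> = 0}. \<forall>i<m. \<bar>z i\<bar> < r"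
    using boundary by (fastforce simp: coord_box_def order_less_le)
  have "\<forall>\<^sub>F p in sequentially. 0 < p \<and>
      (\<forall>\<xi>\<in>cube m r. \<forall>\<zeta>\<in>cube m r. \<xi> \<in> coord_box m \<zeta> (2 * r / real p) \<longrightarrow> norm (\<gamma>' \<xi> - \<gamma>' \<zeta>) < \<tau> / 2) \<and>
      (\<exists>\<eta>>0. \<forall>\<rho>. (\<forall>k\<in>kuhn_grid p m. \<rho> k \<in> span B \<and> norm (\<rho> k) < \<eta>) \<longrightarrow>
        card {\<xi>\<in>cube m r. kuhn_mesh.approximant m p r \<gamma> \<rho> \<xi> = 0} = card {\<xi>\<in>cube m r. \<gamma> \<xi> = 0})"
    using \<tau> span(1) fin interior nondeg
    by (intro eventually_conj eventually_gt_at_top eventually_mesh_oscillation cont(2)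
        nondegenerate_zeros_persist[OF B(1,3) r cont(1)]) auto
  from eventually_happens'[OF sequentially_bot this]
  obtain p \<eta> where p: "0 < p" and \<eta>: "0 < \<eta>"
    and osc: "\<forall>\<xi>\<in>cube m r. \<forall>\<zeta>\<in>cube m r. \<xi> \<in> coord_box m \<zeta> (2 * r / real p) \<longrightarrow> norm (\<gamma>' \<xi> - \<gamma>' \<zeta>) < \<tau> / 2"
    and count: "\<forall>\<rho>. (\<forall>k\<in>kuhn_grid p m. \<rho> k \<in> span B \<and> norm (\<rho> k) < \<eta>) \<longrightarrow>
        card {\<xi>\<in>cube m r. kuhn_mesh.approximant m p r \<gamma> \<rho> \<xi> = 0} = card {\<xi>\<in>cube m r. \<gamma> \<xi> = 0}"
    by (elim exE conjE) (rule that)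
  interpret kuhn_mesh m p r by standard (rule p r)+
  obtain \<rho> where \<rho>: "\<forall>k\<in>kuhn_grid p m. \<rho> k \<in> span B \<and> norm (\<rho> k) < min \<eta> (\<tau> / 2)"
    and generic: "general_position B (\<lambda>k. \<gamma> (vertex k) + \<rho> k) (kuhn_grid p m)"
      "general_position B (\<lambda>k. \<gamma>' (vertex k) + \<rho> k) (kuhn_grid p m)"
    using generic_perturbation[OF finite_kuhn_grid[of p m] B(1,2), of "min \<eta> (\<tau> / 2)" "\<lambda>k. \<gamma> (vertex k)" "\<lambda>k. \<gamma>' (vertex k)"]
      \<eta> \<tau> span vertex_in_cube by fastforce
  let ?L = "approximant \<gamma>' \<rho>"
  have "card {\<xi>\<in>cube m r. approximant \<gamma> \<rho> \<xi> = 0} = card {\<xi>\<in>cube m r. \<gamma> \<xi> = 0}"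
    using count \<rho> by simp
  then have parity: "even (card {\<xi>\<in>cube m r. ?L \<xi> = 0}) \<longleftrightarrow> even (card {\<xi>\<in>cube m r. \<gamma> \<xi> = 0})"
    using approximant_parity[OF m B generic] boundary by simp
  have "?L \<xi> \<in> span B \<and> norm (?L \<xi> - \<gamma>' \<xi>) \<le> \<tau>" if "\<xi> \<in> cube m r" for \<xi>
    using osc \<rho> span(2) that approximant_in_subspace[OF subspace_span, of \<gamma>' B \<rho> \<xi>]
    by (auto intro!: approximant_close simp: step_def less_imp_le)
  then show ?thesis
    using that[of ?L] approximant_affine_zero[OF generic(2) B(3)] interpolant_continuous[of "\<lambda>k. \<gamma>' (vertex k) + \<rho> k"] finite_interpolant_zeros[OF generic(2) B(3)] parity
    by (simp add: approximant_def)
qed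

subsection \<open>Modification inside a cube\<close>

definition cutoff :: "nat \<Rightarrow> real \<Rightarrow> real \<Rightarrow> (nat \<Rightarrow> real) \<Rightarrow> real" where
  "cutoff m s r \<xi> = (\<Prod>i<m. max 0 (min 1 ((r - \<bar>\<xi> i\<bar>) / (r - s))))"

lemma cutoff_range: "0 \<le> cutoff m s r \<xi>" "cutoff m s r \<xi> \<le> 1"
  unfolding cutoff_def by (intro prod_nonneg prod_le_1; simp)+

lemma cutoff_eq_0:
  assumes "s < r" "i < m" "r \<le> \<bar>\<xi> i\<bar>"
  shows "cutoff m s r \<xi> = 0"
proof -
  have "(r - \<bar>\<xi> i\<bar>) / (r - s) \<le> 0" using assms by (simp add: divide_nonpos_pos)
  then show ?thesis unfolding cutoff_def using assms(2) by (intro prod_zero bexI[of _ i]) auto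
qed

lemma cutoff_eq_1: "s < r \<Longrightarrow> (\<And>i. i < m \<Longrightarrow> \<bar>\<xi> i\<bar> \<le> s) \<Longrightarrow> cutoff m s r \<xi> = 1"
  unfolding cutoff_def by (intro prod.neutral) (auto simp: min_def max_def pos_le_divide_eq)

lemma continuous_on_cutoff: "s < r \<Longrightarrow> continuous_on S (cutoff m s r)"
  unfolding cutoff_def
  by (rule continuous_on_subset[OF _ subset_UNIV]) (intro continuous_intros continuous_on_product_coordinates, auto)

definition blend :: "nat \<Rightarrow> real \<Rightarrow> real \<Rightarrow> ((nat \<Rightarrow> real) \<Rightarrow> 'w::real_vector) \<Rightarrow> ((nat \<Rightarrow> real) \<Rightarrow> 'w) \<Rightarrow> (nat \<Rightarrow> real) \<Rightarrow> 'w" where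
  "blend m s r \<gamma> L \<xi> = \<gamma> \<xi> + cutoff m s r \<xi> *\<^sub>R (L \<xi> - \<gamma> \<xi>)"

lemma blend_close:
  fixes \<gamma> :: "(nat \<Rightarrow> real) \<Rightarrow> 'w::real_normed_vector"
  shows "norm (blend m s r \<gamma> L \<xi> - \<gamma> \<xi>) \<le> norm (L \<xi> - \<gamma> \<xi>)"
  using cutoff_range[of m s r \<xi>] by (simp add: blend_def mult_left_le_one_le)

lemma blend_inside: "s < r \<Longrightarrow> (\<And>i. i < m \<Longrightarrow> \<bar>\<xi> i\<bar> \<le> s) \<Longrightarrow> blend m s r \<gamma> L \<xi> = L \<xi>"
  by (simp add: blend_def cutoff_eq_1)

lemma blend_boundary: "s < r \<Longrightarrow> i < m \<Longrightarrow> r \<le> \<bar>\<xi> i\<bar> \<Longrightarrow> blend m s r \<gamma> L \<xi> = \<gamma> \<xi>"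
  by (simp add: blend_def cutoff_eq_0)

lemma blend_zero:
  fixes \<gamma> :: "(nat \<Rightarrow> real) \<Rightarrow> 'w::real_normed_vector"
  assumes s: "s < r" and near: "\<And>i. i < m \<Longrightarrow> s \<le> \<bar>\<xi> i\<bar> \<Longrightarrow> norm (L \<xi> - \<gamma> \<xi>) < norm (\<gamma> \<xi>)"
  shows "blend m s r \<gamma> L \<xi> = 0 \<longleftrightarrow> L \<xi> = 0" "blend m s r \<gamma> L \<xi> = 0 \<Longrightarrow> i < m \<Longrightarrow> \<bar>\<xi> i\<bar> < s"
proof -
  have "\<bar>\<xi> i\<bar> < s" if "norm (0 - \<gamma> \<xi>) \<le> norm (L \<xi> - \<gamma> \<xi>)" "i < m" for i
    using near[OF that(2)] that(1) by fastforce
  then have inside: "\<bar>\<xi> i\<bar> < s" if "blend m s r \<gamma> L \<xi> = 0 \<or> L \<xi> = 0" "i < m" for i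
    using blend_close[of m s r \<gamma> L \<xi>] that by fastforce
  then show "blend m s r \<gamma> L \<xi> = 0 \<longleftrightarrow> L \<xi> = 0" using blend_inside[OF s] by (metis less_imp_le)
  show "\<bar>\<xi> i\<bar> < s" if "blend m s r \<gamma> L \<xi> = 0" "i < m" using inside that by blast
qed

lemma compact_shell: "compact (cube m r \<inter> {\<xi>. \<exists>i<m. s \<le> \<bar>\<xi> i\<bar>})"
proof -
  have "cube m r \<inter> {\<xi>. \<exists>i<m. s \<le> \<bar>\<xi> i\<bar>} = cube m r - {\<xi>. \<forall>i<m. \<bar>\<xi> i - 0\<bar> < s}" by (auto simp: not_less)
  then show ?thesis using compact_diff[OF compact_cube open_coords_less, of m r m "\<lambda>_. 0" s] by simp
qed

lemma cube_modification:
  fixes \<gamma> \<gamma>' :: "(nat \<Rightarrow> real) \<Rightarrow> 'w::banach"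
  assumes m: "0 < m" and B: "finite B" "independent B" "card B = m" and s: "0 < s" "s < r"
    and cont: "continuous_on (cube m r) \<gamma>" "continuous_on (cube m r) \<gamma>'"
    and span: "\<And>\<xi>. \<xi> \<in> cube m r \<Longrightarrow> \<gamma> \<xi> \<in> span B" "\<And>\<xi>. \<xi> \<in> cube m r \<Longrightarrow> \<gamma>' \<xi> \<in> span B"
    and shell: "\<And>\<xi> i. \<xi> \<in> cube m r \<Longrightarrow> i < m \<Longrightarrow> s \<le> \<bar>\<xi> i\<bar> \<Longrightarrow> \<gamma>' \<xi> = \<gamma> \<xi> \<and> \<gamma> \<xi> \<noteq> 0"
    and fin: "finite {\<xi>\<in>cube m r. \<gamma> \<xi> = 0}"
    and nondeg: "\<And>z. z \<in> cube m r \<Longrightarrow> \<gamma> z = 0 \<Longrightarrow> nondegenerate m (span B) \<gamma> z" and \<epsilon>: "0 < \<epsilon>"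
  obtains \<gamma>'' where "continuous_on (cube m r) \<gamma>''" "\<forall>\<xi>\<in>cube m r. \<gamma>'' \<xi> \<in> span B \<and> norm (\<gamma>'' \<xi> - \<gamma>' \<xi>) < \<epsilon>"
    "\<forall>\<xi>\<in>cube m r. \<forall>i<m. \<bar>\<xi> i\<bar> = r \<longrightarrow> \<gamma>'' \<xi> = \<gamma>' \<xi>" "finite {\<xi>\<in>cube m r. \<gamma>'' \<xi> = 0}"
    "even (card {\<xi>\<in>cube m r. \<gamma>'' \<xi> = 0}) \<longleftrightarrow> even (card {\<xi>\<in>cube m r. \<gamma> \<xi> = 0})"
    "\<forall>z\<in>cube m r. \<gamma>'' z = 0 \<longrightarrow> (\<forall>i<m. \<bar>z i\<bar> < r) \<and> affine_zero m \<gamma>'' z"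
proof -
  let ?shell = "cube m r \<inter> {\<xi>. \<exists>i<m. s \<le> \<bar>\<xi> i\<bar>}"
  have "continuous_on ?shell \<gamma>'" by (rule continuous_on_subset[OF cont(2)]) simp
  moreover have "\<gamma>' \<xi> \<noteq> 0" if "\<xi> \<in> ?shell" for \<xi> using shell that by auto
  ultimately obtain \<mu> where \<mu>: "\<mu> > 0" "\<And>\<xi>. \<xi> \<in> ?shell \<Longrightarrow> \<mu> \<le> norm (\<gamma>' \<xi>)"
    using compact_norm_lower_bound[OF compact_shell, of m r s \<gamma>'] by auto
  define \<tau> where "\<tau> = min (\<epsilon> / 2) (\<mu> / 2)"
  have \<tau>: "0 < \<tau>" "\<tau> < \<epsilon>" "\<tau> < \<mu>" using \<epsilon> \<mu>(1) by (auto simp: \<tau>_def)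
  have r: "0 < r" using s by simp
  have boundary: "\<gamma>' \<xi> = \<gamma> \<xi> \<and> \<gamma> \<xi> \<noteq> 0" if "\<xi> \<in> cube m r" "i < m" "\<bar>\<xi> i\<bar> = r" for \<xi> i
    using shell[OF that(1,2)] that(3) s by simp
  obtain L where L: "continuous_on (cube m r) L" "\<forall>\<xi>\<in>cube m r. L \<xi> \<in> span B \<and> norm (L \<xi> - \<gamma>' \<xi>) \<le> \<tau>"
    "finite {\<xi>\<in>cube m r. L \<xi> = 0}" "even (card {\<xi>\<in>cube m r. L \<xi> = 0}) \<longleftrightarrow> even (card {\<xi>\<in>cube m r. \<gamma> \<xi> = 0})"
    "\<forall>z\<in>cube m r. L z = 0 \<longrightarrow> affine_zero m L z"
    using generic_approximation_same_parity[OF m B r \<tau>(1) cont span boundary fin nondeg] .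
  have near: "norm (L \<xi> - \<gamma>' \<xi>) < norm (\<gamma>' \<xi>)" if "\<xi> \<in> cube m r" "i < m" "s \<le> \<bar>\<xi> i\<bar>" for \<xi> i
    using \<mu>(2)[of \<xi>] L(2) \<tau>(3) that by fastforce
  let ?\<gamma>'' = "blend m s r \<gamma>' L"
  have zero_iff: "?\<gamma>'' \<xi> = 0 \<longleftrightarrow> L \<xi> = 0" if "\<xi> \<in> cube m r" for \<xi>
    by (rule blend_zero(1)[OF s(2)]) (rule near[OF that])
  have zero_inside: "\<bar>z i\<bar> < s" if "z \<in> cube m r" "?\<gamma>'' z = 0" "i < m" for z i
    by (rule blend_zero(2)[OF s(2) _ that(2,3)]) (rule near[OF that(1)])
  have affine: "affine_zero m ?\<gamma>'' z" if z: "z \<in> cube m r" "?\<gamma>'' z = 0" for z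
  proof (rule affine_zero_cong)
    show "\<bar>z i\<bar> < s" if "i < m" for i using zero_inside[OF z that] .
    then show "z \<in> cube m s" using z(1) by (auto simp: coord_box_def less_imp_le)
    show "affine_zero m L z" using L(5) z zero_iff by blast
    show "?\<gamma>'' \<xi> = L \<xi>" if "\<xi> \<in> cube m s" for \<xi> using that s(2) by (intro blend_inside) (auto simp: coord_box_def)
  qed
  show ?thesis
  proof (rule that[of ?\<gamma>''])
    show "continuous_on (cube m r) ?\<gamma>''"
      unfolding blend_def[abs_def] by (intro continuous_intros cont continuous_on_cutoff s L(1))
    show "\<forall>\<xi>\<in>cube m r. ?\<gamma>'' \<xi> \<in> span B \<and> norm (?\<gamma>'' \<xi> - \<gamma>' \<xi>) < \<epsilon>"
    proof (intro ballI conjI)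
      fix \<xi> assume "\<xi> \<in> cube m r"
      then have L_\<xi>: "L \<xi> \<in> span B" "norm (L \<xi> - \<gamma>' \<xi>) \<le> \<tau>" and "\<gamma>' \<xi> \<in> span B" using L(2) span(2) by auto
      then show "?\<gamma>'' \<xi> \<in> span B" unfolding blend_def by (intro span_add span_scale span_diff)
      show "norm (?\<gamma>'' \<xi> - \<gamma>' \<xi>) < \<epsilon>" using blend_close[of m s r \<gamma>' L \<xi>] L_\<xi>(2) \<tau>(2) by linarith
    qed
    show "\<forall>z\<in>cube m r. ?\<gamma>'' z = 0 \<longrightarrow> (\<forall>i<m. \<bar>z i\<bar> < r) \<and> affine_zero m ?\<gamma>'' z"
      using affine zero_inside s(2) by (metis less_trans)
    show "\<forall>\<xi>\<in>cube m r. \<forall>i<m. \<bar>\<xi> i\<bar> = r \<longrightarrow> ?\<gamma>'' \<xi> = \<gamma>' \<xi>"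
      by (intro ballI allI impI blend_boundary[OF s(2)]) auto
  qed (use L(3,4) zero_iff in \<open>auto cong: conj_cong\<close>)
qed

section \<open>Manifolds parametrized by cubes\<close>

subsection \<open>Regular zeros\<close>

definition strict_derivative_within ::
  "'x::real_normed_vector set \<Rightarrow> ('x \<Rightarrow> 'w::real_normed_vector) \<Rightarrow> ('x \<Rightarrow>\<^sub>L 'w) \<Rightarrow> 'x \<Rightarrow> bool" where
  "strict_derivative_within M g A z \<longleftrightarrow> (\<forall>\<kappa>>0. \<exists>\<delta>>0. \<forall>x\<in>M \<inter> ball z \<delta>. \<forall>y\<in>M \<inter> ball z \<delta>.
     norm (g x - g y - A (x - y)) \<le> \<kappa> * norm (x - y))"

definition bounded_below_near ::
  "'x::real_normed_vector set \<Rightarrow> ('x \<Rightarrow> 'w::real_normed_vector) \<Rightarrow> 'x \<Rightarrow> bool" where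
  "bounded_below_near M g z \<longleftrightarrow> (\<exists>c>0. \<exists>\<delta>>0. \<forall>x\<in>M \<inter> ball z \<delta>. \<forall>y\<in>M \<inter> ball z \<delta>.
     c * norm (x - y) \<le> norm (g x - g y))"

definition regular_zero :: "'x::real_normed_vector set \<Rightarrow> ('x \<Rightarrow> 'w::real_normed_vector) \<Rightarrow> 'x \<Rightarrow> bool" where
  "regular_zero M g z \<longleftrightarrow> (\<exists>A. strict_derivative_within M g A z) \<and> bounded_below_near M g z"

lemma regular_zero_cong:
  assumes reg: "regular_zero M g z" and W: "open W" "z \<in> W" and eq: "\<And>x. x \<in> M \<inter> W \<Longrightarrow> k x = g x"
  shows "regular_zero M k z"
proof -
  obtain \<delta>0 where \<delta>0: "\<delta>0 > 0" "ball z \<delta>0 \<subseteq> W" using W open_contains_ball by metis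
  have local: "\<exists>\<delta>>0. \<forall>x\<in>M \<inter> ball z \<delta>. \<forall>y\<in>M \<inter> ball z \<delta>. Q (k x) (k y) x y"
    if near: "\<exists>\<delta>>0. \<forall>x\<in>M \<inter> ball z \<delta>. \<forall>y\<in>M \<inter> ball z \<delta>. Q (g x) (g y) x y" for Q
  proof -
    obtain \<delta> where \<delta>: "\<delta> > 0" "\<forall>x\<in>M \<inter> ball z \<delta>. \<forall>y\<in>M \<inter> ball z \<delta>. Q (g x) (g y) x y" using near by auto
    have "M \<inter> ball z (min \<delta> \<delta>0) \<subseteq> M \<inter> ball z \<delta>" "M \<inter> ball z (min \<delta> \<delta>0) \<subseteq> M \<inter> W" using \<delta>0(2) by auto
    then have "\<forall>x\<in>M \<inter> ball z (min \<delta> \<delta>0). \<forall>y\<in>M \<inter> ball z (min \<delta> \<delta>0). Q (k x) (k y) x y"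
      using \<delta>(2) eq by (metis subsetD)
    then show ?thesis using \<delta>(1) \<delta>0(1) by (intro exI[of _ "min \<delta> \<delta>0"]) simp
  qed
  obtain A where "strict_derivative_within M g A z" using reg by (auto simp: regular_zero_def)
  then have "strict_derivative_within M k A z"
    unfolding strict_derivative_within_def
    by (intro allI impI local[of "\<lambda>gx gy x y. norm (gx - gy - A (x - y)) \<le> \<kappa> * norm (x - y)" for \<kappa>]) blast
  moreover obtain c where "c > 0" "\<exists>\<delta>>0. \<forall>x\<in>M \<inter> ball z \<delta>. \<forall>y\<in>M \<inter> ball z \<delta>. c * norm (x - y) \<le> norm (g x - g y)"
    using reg by (auto simp: regular_zero_def bounded_below_near_def)
  then have "bounded_below_near M k z"
    unfolding bounded_below_near_def using local[of "\<lambda>gx gy x y. c * norm (x - y) \<le> norm (gx - gy)"] by blast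
  ultimately show ?thesis by (auto simp: regular_zero_def)
qed

lemma strict_partials_directional:
  fixes \<gamma> :: "(nat \<Rightarrow> real) \<Rightarrow> 'w::real_normed_vector"
  assumes "strict_partials m \<gamma> a z"
  shows "((\<lambda>s. (\<gamma> (\<lambda>i. z i + (if i < m then s * t i else 0)) - \<gamma> z) /\<^sub>R s) \<longlongrightarrow> (\<Sum>i<m. t i *\<^sub>R a i)) (at_right 0)"
proof (rule tendstoI)
  fix e :: real assume e: "0 < e"
  define T where "T = 1 + (\<Sum>i<m. \<bar>t i\<bar>)"
  have T: "0 < T" "(\<Sum>i<m. \<bar>t i\<bar>) \<le> T" unfolding T_def by (auto intro: add_pos_nonneg sum_nonneg)
  obtain d where d: "0 < d" "almost_affine_on m (coord_box m z d) (e / (2 * T)) a \<gamma>"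
    using assms e T(1) unfolding strict_partials_iff by (meson divide_pos_pos mult_pos_pos zero_less_numeral)
  show "\<forall>\<^sub>F s in at_right 0. dist ((\<gamma> (\<lambda>i. z i + (if i < m then s * t i else 0)) - \<gamma> z) /\<^sub>R s) (\<Sum>i<m. t i *\<^sub>R a i) < e"
  proof (rule eventually_at_rightI[of 0 "d / T"])
    fix s assume s: "s \<in> {0<..<d / T}"
    let ?\<xi> = "\<lambda>i. z i + (if i < m then s * t i else 0)"
    have "\<bar>s * t i\<bar> \<le> d" if "i < m" for i
    proof -
      have "\<bar>t i\<bar> \<le> T" using member_le_sum[of i "{..<m}" "\<lambda>i. \<bar>t i\<bar>"] that T(2) by simp
      then have "\<bar>s * t i\<bar> \<le> d / T * T" unfolding abs_mult using s by (intro mult_mono) auto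
      then show ?thesis using T(1) by simp
    qed
    then have "norm (\<gamma> ?\<xi> - \<gamma> z - (\<Sum>i<m. (?\<xi> i - z i) *\<^sub>R a i)) \<le> e / (2 * T) * (\<Sum>i<m. \<bar>?\<xi> i - z i\<bar>)"
      using d(1) by (intro almost_affine_onD[OF d(2)]) (auto simp: coord_box_def)
    also have "(\<Sum>i<m. \<bar>?\<xi> i - z i\<bar>) = s * (\<Sum>i<m. \<bar>t i\<bar>)" using s by (simp add: abs_mult sum_distrib_left)
    also have "e / (2 * T) * (s * (\<Sum>i<m. \<bar>t i\<bar>)) \<le> e / (2 * T) * (s * T)"
      using e s T by (intro mult_left_mono) auto
    also have "\<dots> = s * (e / 2)" using T(1) by simp
    finally have "norm (\<gamma> ?\<xi> - \<gamma> z - s *\<^sub>R (\<Sum>i<m. t i *\<^sub>R a i)) \<le> s * (e / 2)" by (simp add: scaleR_sum_right)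
    moreover have "\<gamma> ?\<xi> - \<gamma> z - s *\<^sub>R (\<Sum>i<m. t i *\<^sub>R a i) = s *\<^sub>R ((\<gamma> ?\<xi> - \<gamma> z) /\<^sub>R s - (\<Sum>i<m. t i *\<^sub>R a i))"
      using s by (simp add: scaleR_diff_right)
    ultimately have "norm ((\<gamma> ?\<xi> - \<gamma> z) /\<^sub>R s - (\<Sum>i<m. t i *\<^sub>R a i)) \<le> e / 2"
      using s by (simp only: norm_scaleR abs_of_pos greaterThanLessThan_iff mult_le_cancel_left_pos)
    then show "dist ((\<gamma> ?\<xi> - \<gamma> z) /\<^sub>R s) (\<Sum>i<m. t i *\<^sub>R a i) < e" using e by (simp add: dist_norm)
  qed (use d(1) T(1) in simp)
qed

lemma eventually_direction_in_box:
  assumes "0 < d"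
  shows "\<forall>\<^sub>F s in at_right 0. (\<lambda>i. z i + (if i < m then s * t i else 0)) \<in> coord_box m z d"
proof -
  have "\<forall>\<^sub>F s in at_right 0. \<bar>s * t i\<bar> < d" for i
    by (rule order_tendstoD(2)[OF _ assms]) (auto intro!: tendsto_eq_intros)
  then have "\<forall>\<^sub>F s in at_right 0. \<forall>i\<in>{..<m}. \<bar>s * t i\<bar> < d" by (intro eventually_ball_finite) auto
  then show ?thesis by eventually_elim (auto simp: coord_box_def less_imp_le)
qed

lemma strict_partials_in_closed_subspace:
  fixes \<gamma> :: "(nat \<Rightarrow> real) \<Rightarrow> 'w::real_normed_vector"
  assumes a: "strict_partials m \<gamma> a z" and Y: "subspace Y" "closed Y"
    and \<gamma>: "0 < d" "\<And>\<xi>. \<xi> \<in> coord_box m z d \<Longrightarrow> \<gamma> \<xi> \<in> Y" and k: "k < m"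
  shows "a k \<in> Y"
proof -
  let ?t = "\<lambda>i. if i = k then 1 else 0 :: real" and ?\<xi> = "\<lambda>s i. z i + (if i < m then s * (if i = k then 1 else 0) else 0)"
  have "\<forall>\<^sub>F s in at_right 0. (\<gamma> (?\<xi> s) - \<gamma> z) /\<^sub>R s \<in> Y"
    using eventually_direction_in_box[OF \<gamma>(1), of z m ?t]
    by eventually_elim (intro subspace_scale subspace_diff Y(1) \<gamma>(2) center_in_coord_box, use \<gamma>(1) in auto)
  then have "(\<Sum>i<m. ?t i *\<^sub>R a i) \<in> Y"
    by (rule Lim_in_closed_set[OF Y(2) _ trivial_limit_at_right_real strict_partials_directional[OF a]])
  moreover have "(\<Sum>i<m. ?t i *\<^sub>R a i) = (\<Sum>i<m. if i = k then a i else 0)" by (intro sum.cong) auto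
  ultimately show ?thesis using k by simp
qed

lemma strict_partials_independent:
  fixes \<gamma> :: "(nat \<Rightarrow> real) \<Rightarrow> 'w::real_normed_vector"
  assumes a: "strict_partials m \<gamma> a z" and c: "0 < c" and d: "0 < d"
    and lower: "\<And>\<xi>. \<xi> \<in> coord_box m z d \<Longrightarrow> c * (\<Sum>i<m. \<bar>\<xi> i - z i\<bar>) \<le> norm (\<gamma> \<xi> - \<gamma> z)"
  shows "independent_family a {..<m}"
  unfolding independent_family_def
proof (intro allI impI)
  fix t assume t: "(\<Sum>i<m. t i *\<^sub>R a i) = 0"
  let ?\<xi> = "\<lambda>s i. z i + (if i < m then s * t i else 0)"
  have "\<forall>\<^sub>F s in at_right 0. c * (\<Sum>i<m. \<bar>t i\<bar>) \<le> norm ((\<gamma> (?\<xi> s) - \<gamma> z) /\<^sub>R s)"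
    using eventually_direction_in_box[OF d, of z m t] eventually_at_right_less
  proof eventually_elim
    case (elim s)
    have "(\<Sum>i<m. \<bar>?\<xi> s i - z i\<bar>) = s * (\<Sum>i<m. \<bar>t i\<bar>)"
      using elim(2) by (simp add: abs_mult sum_distrib_left)
    then have "c * (\<Sum>i<m. \<bar>t i\<bar>) * s \<le> norm (\<gamma> (?\<xi> s) - \<gamma> z)" using lower[OF elim(1)] by (simp only: mult_ac)
    then show ?case using elim(2) by (simp add: pos_le_divide_eq divide_inverse[symmetric] mult.commute[of "inverse s"])
  qed
  then have "c * (\<Sum>i<m. \<bar>t i\<bar>) \<le> norm (\<Sum>i<m. t i *\<^sub>R a i)"
    by (rule tendsto_lowerbound[OF tendsto_norm[OF strict_partials_directional[OF a]] _ trivial_limit_at_right_real])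
  then have "(\<Sum>i<m. \<bar>t i\<bar>) \<le> 0" using t c by (simp add: mult_le_0_iff)
  then have "(\<Sum>i<m. \<bar>t i\<bar>) = 0" by (intro order_antisym sum_nonneg) auto
  then show "\<forall>i\<in>{..<m}. t i = 0" by (subst (asm) sum_nonneg_eq_0_iff) auto
qed

subsection \<open>Charts\<close>

definition open_cube :: "nat \<Rightarrow> real \<Rightarrow> (nat \<Rightarrow> real) set" where
  "open_cube m r = {\<xi>\<in>cube m r. \<forall>i<m. \<bar>\<xi> i\<bar> < r}"

definition coords :: "nat \<Rightarrow> (nat \<Rightarrow> 'x::real_normed_vector \<Rightarrow>\<^sub>L real) \<Rightarrow> 'x \<Rightarrow> 'x \<Rightarrow> nat \<Rightarrow> real" where
  "coords m \<pi> p x = (\<lambda>i. if i < m then \<pi> i (x - p) else 0)"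

lemma continuous_on_coords: "continuous_on S (coords m \<pi> p)"
proof (rule continuous_on_coordinatewise_then_product)
  fix i show "continuous_on S (\<lambda>x. coords m \<pi> p x i)"
    unfolding coords_def by (cases "i < m") (auto intro!: continuous_intros)
qed

locale C1_chart =
  fixes m :: nat and M :: "'x::real_normed_vector set" and p :: 'x and \<pi> :: "nat \<Rightarrow> 'x \<Rightarrow>\<^sub>L real"
    and \<sigma> :: "(nat \<Rightarrow> real) \<Rightarrow> 'x" and r C :: real and U :: "'x set"
  assumes r_pos: "0 < r" and C_pos: "0 < C" and open_U: "open U" and p_in: "p \<in> M \<inter> U"
    and chart_in: "\<And>\<xi>. \<xi> \<in> cube m r \<Longrightarrow> \<sigma> \<xi> \<in> M"
    and coords_chart: "\<And>\<xi>. \<xi> \<in> cube m r \<Longrightarrow> coords m \<pi> p (\<sigma> \<xi>) = \<xi>"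
    and chart_lipschitz: "\<And>\<xi> \<zeta>. \<xi> \<in> cube m r \<Longrightarrow> \<zeta> \<in> cube m r \<Longrightarrow> norm (\<sigma> \<xi> - \<sigma> \<zeta>) \<le> C * (\<Sum>i<m. \<bar>\<xi> i - \<zeta> i\<bar>)"
    and image_open: "M \<inter> U = \<sigma> ` open_cube m r"
    and chart_strict: "\<And>\<xi>. \<xi> \<in> open_cube m r \<Longrightarrow> \<exists>D. strict_partials m \<sigma> D \<xi>"
begin

definition chart_nbhd :: "real \<Rightarrow> 'x set" where
  "chart_nbhd s = U \<inter> {x. \<forall>i<m. \<bar>coords m \<pi> p x i\<bar> < s}"

lemma chart_coords: "x \<in> \<sigma> ` cube m r \<Longrightarrow> \<sigma> (coords m \<pi> p x) = x"
  using coords_chart by auto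

lemma chart_inj: "inj_on \<sigma> (cube m r)"
  by (rule inj_on_inverseI[of _ "coords m \<pi> p"]) (rule coords_chart)

lemma chart_continuous: "continuous_on (cube m r) \<sigma>"
  using chart_lipschitz by (rule continuous_on_coordinate_lipschitz)

lemma image_subset: "s \<le> r \<Longrightarrow> \<sigma> ` cube m s \<subseteq> M"
  using chart_in coord_box_mono[of s r m] by auto

lemma image_compact: "s \<le> r \<Longrightarrow> compact (\<sigma> ` cube m s)"
  by (intro compact_continuous_image compact_cube continuous_on_subset[OF chart_continuous] coord_box_mono)

lemma image_open_cube:
  assumes "s \<le> r"
  shows "\<sigma> ` open_cube m s = M \<inter> chart_nbhd s"
proof (intro subset_antisym subsetI)
  have sub: "open_cube m s \<subseteq> open_cube m r" using assms coord_box_mono[of s r m] by (auto simp: open_cube_def)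
  show "x \<in> M \<inter> chart_nbhd s" if x: "x \<in> \<sigma> ` open_cube m s" for x
  proof -
    obtain \<xi> where \<xi>: "\<xi> \<in> open_cube m s" "x = \<sigma> \<xi>" using x by auto
    have "\<xi> \<in> cube m r" using \<xi>(1) sub by (auto simp: open_cube_def)
    then have "coords m \<pi> p x = \<xi>" using \<xi>(2) coords_chart by simp
    moreover have "x \<in> M \<inter> U" unfolding image_open using \<xi> sub by auto
    ultimately show ?thesis using \<xi>(1) by (auto simp: chart_nbhd_def open_cube_def)
  qed
  show "x \<in> \<sigma> ` open_cube m s" if x: "x \<in> M \<inter> chart_nbhd s" for x
  proof -
    have "x \<in> \<sigma> ` cube m r" using x image_open by (auto simp: chart_nbhd_def open_cube_def)
    moreover have "coords m \<pi> p x \<in> open_cube m s"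
      using x by (auto simp: chart_nbhd_def open_cube_def coord_box_def coords_def less_imp_le)
    ultimately show ?thesis using chart_coords by (metis imageI)
  qed
qed

lemma open_chart_nbhd: "open (chart_nbhd s)"
proof -
  have "{x. \<forall>i<m. \<bar>coords m \<pi> p x i\<bar> < s} = (\<Inter>i\<in>{..<m}. {x. \<bar>\<pi> i (x - p)\<bar> < s})" by (auto simp: coords_def)
  moreover have "open (\<Inter>i\<in>{..<m}. {x. \<bar>\<pi> i (x - p)\<bar> < s})"
    by (intro open_INT finite_lessThan ballI open_Collect_less continuous_intros)
  ultimately show ?thesis using open_U by (simp add: chart_nbhd_def open_Int)
qed

lemma center_in_chart_nbhd: "0 < s \<Longrightarrow> p \<in> chart_nbhd s"
  using p_in by (simp add: chart_nbhd_def coords_def blinfun.zero_right)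

lemma coords_lipschitz:
  obtains c where "0 < c" "\<forall>\<xi>\<in>cube m r. \<forall>\<zeta>\<in>cube m r. c * (\<Sum>i<m. \<bar>\<xi> i - \<zeta> i\<bar>) \<le> norm (\<sigma> \<xi> - \<sigma> \<zeta>)"
proof -
  define K where "K = 1 + (\<Sum>i<m. norm (\<pi> i))"
  have K: "0 < K" unfolding K_def by (intro add_pos_nonneg sum_nonneg) auto
  have bound: "(\<Sum>i<m. \<bar>\<xi> i - \<zeta> i\<bar>) \<le> K * norm (\<sigma> \<xi> - \<sigma> \<zeta>)" if x: "\<xi> \<in> cube m r" "\<zeta> \<in> cube m r" for \<xi> \<zeta>
  proof -
    have "\<bar>\<xi> i - \<zeta> i\<bar> \<le> norm (\<pi> i) * norm (\<sigma> \<xi> - \<sigma> \<zeta>)" if i: "i < m" for i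
    proof -
      have "\<xi> i - \<zeta> i = \<pi> i (\<sigma> \<xi> - \<sigma> \<zeta>)"
        using fun_cong[OF coords_chart[OF x(1)], of i] fun_cong[OF coords_chart[OF x(2)], of i] i
        by (simp add: coords_def blinfun.diff_right)
      then show ?thesis using norm_blinfun[of "\<pi> i" "\<sigma> \<xi> - \<sigma> \<zeta>"] by simp
    qed
    then have "(\<Sum>i<m. \<bar>\<xi> i - \<zeta> i\<bar>) \<le> (\<Sum>i<m. norm (\<pi> i)) * norm (\<sigma> \<xi> - \<sigma> \<zeta>)"
      unfolding sum_distrib_right by (intro sum_mono) auto
    also have "\<dots> \<le> K * norm (\<sigma> \<xi> - \<sigma> \<zeta>)" unfolding K_def by (intro mult_right_mono) auto
    finally show ?thesis .
  qed
  have "1 / K * (\<Sum>i<m. \<bar>\<xi> i - \<zeta> i\<bar>) \<le> norm (\<sigma> \<xi> - \<sigma> \<zeta>)" if "\<xi> \<in> cube m r" "\<zeta> \<in> cube m r" for \<xi> \<zeta>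
    using bound[OF that] K by (simp add: field_simps)
  then show ?thesis using that[of "1 / K"] K by simp
qed

lemma chart_maps_small_boxes:
  assumes z: "z \<in> open_cube m r" and \<delta>: "0 < \<delta>"
  shows "\<forall>\<^sub>F d in at_right 0. coord_box m z d \<subseteq> cube m r \<and> \<sigma> ` coord_box m z d \<subseteq> M \<inter> ball (\<sigma> z) \<delta>"
proof -
  have "\<forall>\<^sub>F d in at_right 0. C * (real m * d) < \<delta>"
    by (rule order_tendstoD(2)[OF _ \<delta>]) (auto intro!: tendsto_eq_intros)
  moreover have "\<forall>\<^sub>F d in at_right 0. coord_box m z d \<subseteq> cube m r"
    using z by (intro coord_box_subset_cube_small) (auto simp: open_cube_def)
  ultimately show ?thesis
  proof eventually_elim
    case (elim d)
    have "norm (\<sigma> \<xi> - \<sigma> z) < \<delta>" if \<xi>: "\<xi> \<in> coord_box m z d" for \<xi>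
    proof -
      have "norm (\<sigma> \<xi> - \<sigma> z) \<le> C * (\<Sum>i<m. \<bar>\<xi> i - z i\<bar>)"
        using elim(2) \<xi> z by (intro chart_lipschitz) (auto simp: open_cube_def)
      also have "\<dots> \<le> C * (\<Sum>i<m. d)" using C_pos \<xi> by (intro mult_left_mono sum_mono) (auto simp: coord_box_def)
      finally show ?thesis using elim(1) by simp
    qed
    then show ?case using elim(2) chart_in by (auto simp: dist_norm norm_minus_commute)
  qed
qed

lemma strict_partials_compose_chart:
  fixes g :: "'x \<Rightarrow> 'w::real_normed_vector"
  assumes z: "z \<in> open_cube m r" and g: "strict_derivative_within M g A (\<sigma> z)" and D: "strict_partials m \<sigma> D z"
  shows "strict_partials m (\<lambda>\<xi>. g (\<sigma> \<xi>)) (\<lambda>i. A (D i)) z"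
  unfolding strict_partials_def
proof (intro allI impI)
  fix \<kappa> :: real assume \<kappa>: "0 < \<kappa>"
  define N where "N = norm A + 1"
  have N: "0 < N" by (simp add: N_def add_nonneg_pos)
  have "0 < \<kappa> / (2 * C)" "0 < \<kappa> / (2 * N)" using \<kappa> C_pos N by simp_all
  then obtain \<delta> where \<delta>: "\<delta> > 0" "\<forall>x\<in>M \<inter> ball (\<sigma> z) \<delta>. \<forall>y\<in>M \<inter> ball (\<sigma> z) \<delta>.
      norm (g x - g y - A (x - y)) \<le> \<kappa> / (2 * C) * norm (x - y)"
    using g unfolding strict_derivative_within_def by metis
  have "\<forall>\<^sub>F d in at_right 0. almost_affine_on m (coord_box m z d) (\<kappa> / (2 * N)) D \<sigma>"
    using D \<open>0 < \<kappa> / (2 * N)\<close> by (simp add: strict_partials_def)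
  with chart_maps_small_boxes[OF z \<delta>(1)]
  show "\<forall>\<^sub>F d in at_right 0. almost_affine_on m (coord_box m z d) \<kappa> (\<lambda>i. A (D i)) (\<lambda>\<xi>. g (\<sigma> \<xi>))"
  proof eventually_elim
    case (elim d)
    show ?case
      unfolding almost_affine_on_def
    proof (intro ballI)
      fix \<xi> \<zeta> assume x: "\<xi> \<in> coord_box m z d" "\<zeta> \<in> coord_box m z d"
      let ?l1 = "\<Sum>i<m. \<bar>\<xi> i - \<zeta> i\<bar>" and ?e = "\<sigma> \<xi> - \<sigma> \<zeta> - (\<Sum>i<m. (\<xi> i - \<zeta> i) *\<^sub>R D i)"
      have "norm (g (\<sigma> \<xi>) - g (\<sigma> \<zeta>) - A (\<sigma> \<xi> - \<sigma> \<zeta>)) \<le> \<kappa> / (2 * C) * norm (\<sigma> \<xi> - \<sigma> \<zeta>)"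
        using \<delta>(2) elim(1) x by blast
      also have "\<dots> \<le> \<kappa> / (2 * C) * (C * ?l1)"
        using elim(1) x \<kappa> C_pos by (intro mult_left_mono chart_lipschitz) auto
      also have "\<dots> = \<kappa> / 2 * ?l1" using C_pos by simp
      finally have outer: "norm (g (\<sigma> \<xi>) - g (\<sigma> \<zeta>) - A (\<sigma> \<xi> - \<sigma> \<zeta>)) \<le> \<kappa> / 2 * ?l1" .
      have "norm (A ?e) \<le> N * (\<kappa> / (2 * N) * ?l1)"
        unfolding N_def
        by (rule order_trans[OF norm_blinfun_le_Suc mult_left_mono[OF almost_affine_onD[OF elim(2) x, unfolded N_def]]]) simp
      also have "\<dots> = \<kappa> / 2 * ?l1" using N by simp
      finally have "norm ((g (\<sigma> \<xi>) - g (\<sigma> \<zeta>) - A (\<sigma> \<xi> - \<sigma> \<zeta>)) + A ?e) \<le> \<kappa> / 2 * ?l1 + \<kappa> / 2 * ?l1"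
        using outer by (intro norm_triangle_mono)
      then show "norm (g (\<sigma> \<xi>) - g (\<sigma> \<zeta>) - (\<Sum>i<m. (\<xi> i - \<zeta> i) *\<^sub>R A (D i))) \<le> \<kappa> * ?l1"
        by (simp add: blinfun.diff_right blinfun.sum_right blinfun.scaleR_right)
    qed
  qed
qed

lemma regular_zero_nondegenerate:
  fixes g :: "'x \<Rightarrow> 'w::real_normed_vector"
  assumes g: "g ` M \<subseteq> Y" and Y: "subspace Y" "closed Y" and reg: "regular_zero M g (\<sigma> z)" and z: "z \<in> open_cube m r"
  shows "nondegenerate m Y (\<lambda>\<xi>. g (\<sigma> \<xi>)) z"
proof -
  obtain A where A: "strict_derivative_within M g A (\<sigma> z)" using reg by (auto simp: regular_zero_def)
  obtain c \<delta> where c: "c > 0" "\<delta> > 0" "\<forall>x\<in>M \<inter> ball (\<sigma> z) \<delta>. \<forall>y\<in>M \<inter> ball (\<sigma> z) \<delta>. c * norm (x - y) \<le> norm (g x - g y)"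
    using reg unfolding regular_zero_def bounded_below_near_def by blast
  obtain D where "strict_partials m \<sigma> D z" using chart_strict[OF z] by blast
  then have a: "strict_partials m (\<lambda>\<xi>. g (\<sigma> \<xi>)) (\<lambda>i. A (D i)) z" by (rule strict_partials_compose_chart[OF z A])
  obtain b where b: "0 < b" "\<forall>\<xi>\<in>cube m r. \<forall>\<zeta>\<in>cube m r. b * (\<Sum>i<m. \<bar>\<xi> i - \<zeta> i\<bar>) \<le> norm (\<sigma> \<xi> - \<sigma> \<zeta>)"
    using coords_lipschitz .
  obtain d where d: "0 < d" "coord_box m z d \<subseteq> cube m r" "\<sigma> ` coord_box m z d \<subseteq> M \<inter> ball (\<sigma> z) \<delta>"
    using eventually_happens'[OF trivial_limit_at_right_real
        eventually_conj[OF eventually_at_right_less chart_maps_small_boxes[OF z c(2)]]] by auto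
  have "c * b * (\<Sum>i<m. \<bar>\<xi> i - z i\<bar>) \<le> norm (g (\<sigma> \<xi>) - g (\<sigma> z))" if \<xi>: "\<xi> \<in> coord_box m z d" for \<xi>
  proof -
    have "c * (b * (\<Sum>i<m. \<bar>\<xi> i - z i\<bar>)) \<le> c * norm (\<sigma> \<xi> - \<sigma> z)"
      using b(2) \<xi> d(2) z c(1) by (intro mult_left_mono) (auto simp: open_cube_def)
    also have "\<dots> \<le> norm (g (\<sigma> \<xi>) - g (\<sigma> z))"
    proof -
      have "\<sigma> \<xi> \<in> M \<inter> ball (\<sigma> z) \<delta>" "\<sigma> z \<in> M \<inter> ball (\<sigma> z) \<delta>"
        using d(1,3) \<xi> center_in_coord_box[of d z m] by auto
      then show ?thesis using c(3) by simp
    qed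
    finally show ?thesis by (simp add: mult_ac)
  qed
  then have "independent_family (\<lambda>i. A (D i)) {..<m}"
    using strict_partials_independent[OF a, of "c * b" d] c(1) b(1) d(1) by simp
  moreover have "A (D i) \<in> Y" if "i < m" for i
    by (rule strict_partials_in_closed_subspace[OF a Y d(1) _ that]) (use g d(3) in auto)
  ultimately show ?thesis unfolding nondegenerate_def using a by (intro exI[of _ "\<lambda>i. A (D i)"]) auto
qed

end

context C1_chart
begin

lemma coords_diff: "i < m \<Longrightarrow> coords m \<pi> p x i - coords m \<pi> p y i = \<pi> i (x - y)"
  by (simp add: coords_def blinfun.diff_right)

lemma chart_near:
  assumes z: "z \<in> open_cube m r" and e: "0 < e"
  obtains \<delta> where "\<delta> > 0" "\<And>x. x \<in> M \<inter> ball (\<sigma> z) \<delta> \<Longrightarrow>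
    coords m \<pi> p x \<in> cube m r \<and> \<sigma> (coords m \<pi> p x) = x \<and> coords m \<pi> p x \<in> coord_box m z e"
proof -
  define N where "N = chart_nbhd r \<inter> coords m \<pi> p -` {\<xi>. \<forall>i<m. \<bar>\<xi> i - z i\<bar> < e}"
  have "open N" unfolding N_def by (intro open_Int open_chart_nbhd open_vimage open_coords_less continuous_on_coords)
  moreover have "\<sigma> z \<in> M \<inter> chart_nbhd r" unfolding image_open_cube[OF order_refl, symmetric] using z by blast
  then have "\<sigma> z \<in> N" using e z coords_chart[of z] by (simp add: N_def open_cube_def)
  ultimately obtain \<delta> where \<delta>: "\<delta> > 0" "ball (\<sigma> z) \<delta> \<subseteq> N" using open_contains_ball by metis
  have "coords m \<pi> p x \<in> cube m r \<and> \<sigma> (coords m \<pi> p x) = x \<and> coords m \<pi> p x \<in> coord_box m z e"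
    if x: "x \<in> M \<inter> ball (\<sigma> z) \<delta>" for x
  proof -
    have "x \<in> M \<inter> N" using x \<delta>(2) by auto
    then obtain \<xi> where \<xi>: "\<xi> \<in> cube m r" "x = \<sigma> \<xi>" and near: "\<forall>i<m. \<bar>coords m \<pi> p x i - z i\<bar> < e"
      using image_open_cube[OF order_refl] unfolding N_def open_cube_def by blast
    then have "coords m \<pi> p x = \<xi>" using coords_chart by simp
    then show ?thesis using \<xi> near z by (auto simp: coord_box_def open_cube_def less_imp_le)
  qed
  with \<delta>(1) show ?thesis by (rule that)
qed

lemma affine_zero_regular:
  fixes g :: "'x \<Rightarrow> 'w::real_normed_vector"
  assumes z: "z \<in> open_cube m r" and aff: "affine_zero m (\<lambda>\<xi>. g (\<sigma> \<xi>)) z"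
  shows "regular_zero M g (\<sigma> z)"
proof -
  obtain a e where a: "independent_family a {..<m}" and e: "0 < e"
    and affine: "\<forall>\<xi>\<in>coord_box m z e. g (\<sigma> \<xi>) = (\<Sum>i<m. (\<xi> i - z i) *\<^sub>R a i)"
    using aff unfolding affine_zero_iff by blast
  define A where "A = (\<Sum>i<m. blinfun_scaleR_left (a i) o\<^sub>L \<pi> i)"
  have A: "A x = (\<Sum>i<m. \<pi> i x *\<^sub>R a i)" for x
    by (simp add: A_def blinfun.sum_left)
  obtain c where c: "c > 0" "\<And>t. c * (\<Sum>i<m. \<bar>t i\<bar>) \<le> norm (\<Sum>i<m. t i *\<^sub>R a i)"
    using independent_partials_lower_bound[OF a] by metis
  let ?q = "coords m \<pi> p"
  obtain \<delta> where \<delta>: "\<delta> > 0" "\<And>x. x \<in> M \<inter> ball (\<sigma> z) \<delta> \<Longrightarrow> ?q x \<in> cube m r \<and> \<sigma> (?q x) = x \<and> ?q x \<in> coord_box m z e"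
    using chart_near[OF z e] by blast
  have chart: "?q x \<in> cube m r \<and> \<sigma> (?q x) = x \<and> g x = (\<Sum>i<m. (?q x i - z i) *\<^sub>R a i)" if "x \<in> M \<inter> ball (\<sigma> z) \<delta>" for x
    using \<delta>(2)[OF that] affine by metis
  have g_diff: "g x - g y = (\<Sum>i<m. (?q x i - ?q y i) *\<^sub>R a i)" if "x \<in> M \<inter> ball (\<sigma> z) \<delta>" "y \<in> M \<inter> ball (\<sigma> z) \<delta>" for x y
    using chart[OF that(1)] chart[OF that(2)] by (simp add: sum_subtractf[symmetric] scaleR_diff_left[symmetric])
  have "g x - g y = A (x - y)" if "x \<in> M \<inter> ball (\<sigma> z) \<delta>" "y \<in> M \<inter> ball (\<sigma> z) \<delta>" for x y
    unfolding g_diff[OF that] A by (intro sum.cong refl) (simp add: coords_diff)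
  then have "strict_derivative_within M g A (\<sigma> z)"
    unfolding strict_derivative_within_def using \<delta>(1) by (intro allI impI exI[of _ \<delta>]) simp
  moreover have "c / C * norm (x - y) \<le> norm (g x - g y)" if xy: "x \<in> M \<inter> ball (\<sigma> z) \<delta>" "y \<in> M \<inter> ball (\<sigma> z) \<delta>" for x y
  proof -
    have "norm (x - y) \<le> C * (\<Sum>i<m. \<bar>?q x i - ?q y i\<bar>)"
      using chart_lipschitz[of "?q x" "?q y"] chart[OF xy(1)] chart[OF xy(2)] by simp
    then have "c / C * norm (x - y) \<le> c * (\<Sum>i<m. \<bar>?q x i - ?q y i\<bar>)"
      using C_pos c(1) by (simp add: field_simps)
    also have "\<dots> \<le> norm (g x - g y)" unfolding g_diff[OF xy] by (rule c(2))
    finally show ?thesis .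
  qed
  then have "bounded_below_near M g (\<sigma> z)"
    unfolding bounded_below_near_def using \<delta>(1) c(1) C_pos by (intro exI[of _ "c / C"] exI[of _ \<delta>] conjI ballI) simp_all
  ultimately show ?thesis by (auto simp: regular_zero_def)
qed

end

subsection \<open>Replacing a map inside a chart\<close>

lemma avoid_finite_set:
  fixes a b :: real
  assumes "finite T" "a < b"
  obtains u v where "a < u" "u < v" "v < b" "{u..v} \<inter> T = {}"
proof -
  have "infinite {a<..<b}" using assms(2) by (simp add: infinite_Ioo)
  then obtain c where c: "c \<in> {a<..<b}" "c \<notin> T" using assms(1) by (meson finite_subset subsetI)
  have "open ({a<..<b} - T)" using assms(1) by (simp add: finite_imp_closed open_Diff)
  then obtain e where e: "e > 0" "cball c e \<subseteq> {a<..<b} - T" using c open_contains_cball by (metis DiffI)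
  have "{c - e..c + e} \<subseteq> {a<..<b} - T" using e(2) by (simp add: cball_eq_atLeastAtMost)
  moreover have "c - e \<in> {c - e..c + e}" "c + e \<in> {c - e..c + e}" using e(1) by auto
  ultimately have "c - e \<in> {a<..<b}" "c + e \<in> {a<..<b}" "{c - e..c + e} \<inter> T = {}" by blast+
  then show ?thesis using that[of "c - e" "c + e"] e(1) by simp
qed

definition zeros_on :: "'x set \<Rightarrow> ('x \<Rightarrow> 'w::zero) \<Rightarrow> 'x set" where
  "zeros_on M g = {x\<in>M. g x = 0}"

definition regular_map :: "'w set \<Rightarrow> 'x::real_normed_vector set \<Rightarrow> ('x \<Rightarrow> 'w::real_normed_vector) \<Rightarrow> bool" where
  "regular_map B M g \<longleftrightarrow> continuous_on M g \<and> g ` M \<subseteq> span B \<and> finite (zeros_on M g) \<and>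
    (\<forall>z\<in>zeros_on M g. regular_zero M g z)"

context C1_chart
begin

definition chart_update :: "real \<Rightarrow> ((nat \<Rightarrow> real) \<Rightarrow> 'w) \<Rightarrow> ('x \<Rightarrow> 'w) \<Rightarrow> 'x \<Rightarrow> 'w" where
  "chart_update s f g x = (if x \<in> \<sigma> ` cube m s then f (coords m \<pi> p x) else g x)"

lemma coords_subcube: "s \<le> r \<Longrightarrow> \<xi> \<in> cube m s \<Longrightarrow> coords m \<pi> p (\<sigma> \<xi>) = \<xi>"
  by (rule coords_chart) (rule subsetD[OF coord_box_mono])

lemma chart_update_chart: "s \<le> r \<Longrightarrow> \<xi> \<in> cube m s \<Longrightarrow> chart_update s f g (\<sigma> \<xi>) = f \<xi>"
  by (simp add: chart_update_def coords_subcube)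

lemma chart_update_outside: "x \<notin> \<sigma> ` cube m s \<Longrightarrow> chart_update s f g x = g x"
  by (simp add: chart_update_def)

lemma chart_update_same: "s \<le> r \<Longrightarrow> chart_update s (\<lambda>\<xi>. g (\<sigma> \<xi>)) g = g"
  by (auto simp: chart_update_def fun_eq_iff coords_subcube)

lemma continuous_on_chart_update:
  fixes f :: "(nat \<Rightarrow> real) \<Rightarrow> 'w::topological_space"
  assumes s: "s \<le> r" and f: "continuous_on (cube m s) f" and g: "continuous_on M g"
    and boundary: "\<And>\<xi> i. \<xi> \<in> cube m s \<Longrightarrow> i < m \<Longrightarrow> \<bar>\<xi> i\<bar> = s \<Longrightarrow> f \<xi> = g (\<sigma> \<xi>)"
  shows "continuous_on M (chart_update s f g)"
proof -
  let ?A = "\<sigma> ` cube m s" and ?O = "\<sigma> ` open_cube m s"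
  let ?B = "M - ?O"
  have un: "?A \<union> ?B = M" using image_subset[OF s] by (auto simp: open_cube_def)
  have "closedin (top_of_set M) ?A" using image_subset[OF s] image_compact[OF s] by (simp add: closed_subset compact_imp_closed)
  moreover have "openin (top_of_set M) ?O" unfolding image_open_cube[OF s] by (intro openin_open_Int open_chart_nbhd)
  then have "closedin (top_of_set M) ?B" by (simp add: closedin_diff)
  moreover have "coords m \<pi> p ` ?A \<subseteq> cube m s" by (auto simp: coords_subcube[OF s])
  then have "continuous_on ?A (\<lambda>x. f (coords m \<pi> p x))" by (rule continuous_on_compose2[OF f continuous_on_coords])
  moreover have "continuous_on ?B g" by (rule continuous_on_subset[OF g]) auto
  moreover have "f (coords m \<pi> p x) = g x" if x: "x \<in> ?A \<and> x \<notin> ?A \<or> x \<in> ?B \<and> x \<in> ?A" for x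
  proof -
    obtain \<xi> where \<xi>: "\<xi> \<in> cube m s" "x = \<sigma> \<xi>" "x \<notin> ?O" using x by auto
    then obtain i where "i < m" "\<not> \<bar>\<xi> i\<bar> < s" by (auto simp: open_cube_def)
    then have "f \<xi> = g x" using boundary[of \<xi> i] \<xi> by (auto simp: coord_box_def)
    then show ?thesis using \<xi> coords_subcube[OF s] by simp
  qed
  ultimately show ?thesis
    using continuous_on_cases_local[of ?A ?B "\<lambda>x. f (coords m \<pi> p x)" g "\<lambda>x. x \<in> ?A"]
    unfolding un chart_update_def[abs_def] by blast
qed

lemma zeros_on_chart_update:
  assumes "s \<le> r"
  shows "zeros_on M (chart_update s f g) = \<sigma> ` {\<xi>\<in>cube m s. f \<xi> = 0} \<union> (zeros_on M g - \<sigma> ` cube m s)"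
proof -
  have "x \<in> zeros_on M (chart_update s f g) \<longleftrightarrow> x \<in> \<sigma> ` {\<xi>\<in>cube m s. f \<xi> = 0} \<union> (zeros_on M g - \<sigma> ` cube m s)" for x
  proof (cases "x \<in> \<sigma> ` cube m s")
    case True
    then obtain \<xi> where \<xi>: "\<xi> \<in> cube m s" "x = \<sigma> \<xi>" by auto
    have "x \<in> zeros_on M (chart_update s f g) \<longleftrightarrow> f \<xi> = 0"
      using image_subset[OF assms] \<xi> by (auto simp: zeros_on_def chart_update_chart[OF assms])
    moreover have "x \<in> \<sigma> ` {\<xi>\<in>cube m s. f \<xi> = 0} \<longleftrightarrow> f \<xi> = 0"
      using inj_onD[OF chart_inj] \<xi> coord_box_mono[OF assms, of m "\<lambda>_. 0"] by blast
    ultimately show ?thesis using True by blast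
  qed (auto simp: zeros_on_def chart_update_outside)
  then show ?thesis by blast
qed

lemma card_zeros_on_chart_update:
  assumes s: "s \<le> r" and fin: "finite {\<xi>\<in>cube m s. f \<xi> = 0}" "finite (zeros_on M g - \<sigma> ` cube m s)"
  shows "card (zeros_on M (chart_update s f g)) = card {\<xi>\<in>cube m s. f \<xi> = 0} + card (zeros_on M g - \<sigma> ` cube m s)"
proof -
  have "inj_on \<sigma> {\<xi>\<in>cube m s. f \<xi> = 0}"
    by (rule inj_on_subset[OF chart_inj]) (use coord_box_mono[OF s] in auto)
  then have "card (\<sigma> ` {\<xi>\<in>cube m s. f \<xi> = 0}) = card {\<xi>\<in>cube m s. f \<xi> = 0}" by (rule card_image)
  moreover have "\<sigma> ` {\<xi>\<in>cube m s. f \<xi> = 0} \<inter> (zeros_on M g - \<sigma> ` cube m s) = {}" by auto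
  ultimately show ?thesis unfolding zeros_on_chart_update[OF s] using fin by (simp add: card_Un_disjoint)
qed

lemma regular_zero_nondegenerate_in_subcube:
  assumes g: "regular_map B M g" and B: "finite B" and s: "s < r" and z: "z \<in> cube m s" "g (\<sigma> z) = 0"
  shows "nondegenerate m (span B) (\<lambda>\<xi>. g (\<sigma> \<xi>)) z"
proof -
  have "z \<in> cube m r" using coord_box_mono[of s r m] z(1) s by auto
  then have "\<sigma> z \<in> zeros_on M g" using chart_in z(2) by (simp add: zeros_on_def)
  then show ?thesis
    using g z(1) s closed_span_finite[OF B]
    by (intro regular_zero_nondegenerate) (auto simp: regular_map_def subspace_span open_cube_def coord_box_def)
qed

lemma zero_free_shell:
  assumes g: "finite (zeros_on M g)" and r0: "r0 < r"
  obtains u s where "r0 < u" "u < s" "s < r"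
    "\<And>\<xi> i. \<xi> \<in> cube m s \<Longrightarrow> i < m \<Longrightarrow> u \<le> \<bar>\<xi> i\<bar> \<Longrightarrow> g (\<sigma> \<xi>) \<noteq> 0"
proof -
  define radii where "radii = (\<lambda>(x, i). \<bar>coords m \<pi> p x i\<bar>) ` (zeros_on M g \<times> {..<m})"
  have "finite radii" unfolding radii_def using g by simp
  then obtain u s where us: "r0 < u" "u < s" "s < r" "{u..s} \<inter> radii = {}" using avoid_finite_set[OF _ r0] by metis
  have "g (\<sigma> \<xi>) \<noteq> 0" if \<xi>: "\<xi> \<in> cube m s" "i < m" "u \<le> \<bar>\<xi> i\<bar>" for \<xi> i
  proof
    assume "g (\<sigma> \<xi>) = 0"
    then have "\<sigma> \<xi> \<in> zeros_on M g" using image_subset[of s] us(3) \<xi>(1) by (auto simp: zeros_on_def)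
    moreover have "coords m \<pi> p (\<sigma> \<xi>) = \<xi>" using coords_subcube[of s] us(3) \<xi>(1) by simp
    ultimately have "\<bar>\<xi> i\<bar> \<in> radii" using \<xi>(2) unfolding radii_def by force
    moreover have "\<bar>\<xi> i\<bar> \<in> {u..s}" using \<xi> by (auto simp: coord_box_def)
    ultimately show False using us(4) by blast
  qed
  with us(1-3) show ?thesis by (rule that)
qed

lemma regular_map_chart_update:
  fixes g g' :: "'x \<Rightarrow> 'w::banach"
  assumes s: "s < r" and g: "regular_map B M g" and g': "continuous_on M g'" "g' ` M \<subseteq> span B"
    and eq: "\<And>x. x \<in> M \<Longrightarrow> x \<notin> \<sigma> ` cube m s \<Longrightarrow> g' x = g x"
    and f: "continuous_on (cube m s) f" "f ` cube m s \<subseteq> span B" "finite {\<xi>\<in>cube m s. f \<xi> = 0}"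
    and boundary: "\<And>\<xi> i. \<xi> \<in> cube m s \<Longrightarrow> i < m \<Longrightarrow> \<bar>\<xi> i\<bar> = s \<Longrightarrow> f \<xi> = g' (\<sigma> \<xi>)"
    and zeros: "\<And>z. z \<in> cube m s \<Longrightarrow> f z = 0 \<Longrightarrow> (\<forall>i<m. \<bar>z i\<bar> < s) \<and> affine_zero m f z"
  shows "regular_map B M (chart_update s f g')"
  unfolding regular_map_def
proof (intro conjI ballI)
  let ?k = "chart_update s f g'"
  have s_le: "s \<le> r" using s by simp
  have outside: "zeros_on M g' - \<sigma> ` cube m s = zeros_on M g - \<sigma> ` cube m s" using eq by (auto simp: zeros_on_def)
  show "continuous_on M ?k" by (rule continuous_on_chart_update[OF s_le f(1) g'(1) boundary])
  show "?k ` M \<subseteq> span B" using f(2) g'(2) by (auto simp: chart_update_def coords_subcube[OF s_le])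
  show "finite (zeros_on M ?k)"
    unfolding zeros_on_chart_update[OF s_le] outside using f(3) g by (simp add: regular_map_def)
  show "regular_zero M ?k x" if x: "x \<in> zeros_on M ?k" for x
  proof (cases "x \<in> \<sigma> ` cube m s")
    case True
    then obtain z where z: "z \<in> cube m s" "x = \<sigma> z" by auto
    then have "f z = 0" using x chart_update_chart[OF s_le z(1), of f g'] by (simp add: zeros_on_def)
    then have inside: "\<forall>i<m. \<bar>z i\<bar> < s" "affine_zero m f z" using zeros z(1) by auto
    have "affine_zero m (\<lambda>\<xi>. ?k (\<sigma> \<xi>)) z"
      by (rule affine_zero_cong[OF z(1) _ inside(2)]) (use inside(1) in \<open>simp_all add: chart_update_chart[OF s_le]\<close>)
    then show ?thesis unfolding z(2)
      using inside(1) z(1) coord_box_mono[OF s_le] s by (intro affine_zero_regular) (auto simp: open_cube_def)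
  next
    case False
    then have "x \<in> zeros_on M g" using x outside by (auto simp: zeros_on_def chart_update_outside)
    then have "regular_zero M g x" using g by (simp add: regular_map_def)
    then show ?thesis
    proof (rule regular_zero_cong)
      show "open (- \<sigma> ` cube m s)" using image_compact[OF s_le] by (intro open_Compl compact_imp_closed)
      show "?k y = g y" if "y \<in> M \<inter> - \<sigma> ` cube m s" for y
        using that eq[of y] by (auto simp: chart_update_outside)
    qed (use False in simp)
  qed
qed

text \<open>
  A perturbation \<open>g'\<close> of \<open>g\<close> supported in a smaller cube becomes regular after a small change
  inside the chart, without a change of the parity of the number of zeros. The change takes place
  in a cube of radius \<open>s\<close> near whose boundary \<open>g\<close> has no zeros.
\<close>

lemma regular_map_modification:
  fixes g g' :: "'x \<Rightarrow> 'w::banach"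
  assumes m: "0 < m" and B: "finite B" "independent B" "card B = m" and r0: "0 \<le> r0" "r0 < r"
    and g: "regular_map B M g" and g': "continuous_on M g'" "g' ` M \<subseteq> span B"
    and eq: "\<And>x. x \<in> M \<Longrightarrow> x \<notin> \<sigma> ` cube m r0 \<Longrightarrow> g' x = g x" and \<epsilon>: "0 < \<epsilon>"
  obtains k where "regular_map B M k" "\<forall>x\<in>M. norm (k x - g' x) < \<epsilon>"
    "\<forall>x\<in>M - \<sigma> ` cube m r. k x = g' x" "even (card (zeros_on M k)) \<longleftrightarrow> even (card (zeros_on M g))"
proof -
  have fin_g: "finite (zeros_on M g)" using g by (simp add: regular_map_def)
  obtain u s where us: "r0 < u" "u < s" "s < r"
    and zero_free: "\<And>\<xi> i. \<xi> \<in> cube m s \<Longrightarrow> i < m \<Longrightarrow> u \<le> \<bar>\<xi> i\<bar> \<Longrightarrow> g (\<sigma> \<xi>) \<noteq> 0"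
    using zero_free_shell[OF fin_g r0(2)] by blast
  have s: "s \<le> r" "0 < u" using us r0 by auto
  have sub: "cube m s \<subseteq> cube m r" "cube m r0 \<subseteq> cube m s" using us by (auto intro!: coord_box_mono)
  note in_M = image_subset[OF s(1)]
  have shell: "g' (\<sigma> \<xi>) = g (\<sigma> \<xi>) \<and> g (\<sigma> \<xi>) \<noteq> 0" if \<xi>: "\<xi> \<in> cube m s" "i < m" "u \<le> \<bar>\<xi> i\<bar>" for \<xi> i
  proof -
    have "\<xi> \<notin> cube m r0" using \<xi>(2,3) us(1) by (auto simp: coord_box_def)
    then have "\<sigma> \<xi> \<notin> \<sigma> ` cube m r0" using inj_on_image_mem_iff[OF chart_inj, of \<xi> "cube m r0"] sub \<xi>(1) by auto
    then show ?thesis using eq in_M zero_free[OF \<xi>] \<xi>(1) by auto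
  qed
  have chart_s: "continuous_on (cube m s) \<sigma>" by (rule continuous_on_subset[OF chart_continuous sub(1)])
  have "\<sigma> ` {\<xi>\<in>cube m s. g (\<sigma> \<xi>) = 0} \<subseteq> zeros_on M g" using in_M by (auto simp: zeros_on_def)
  then have fin: "finite {\<xi>\<in>cube m s. g (\<sigma> \<xi>) = 0}"
    by (rule inj_on_finite[rotated]) (use fin_g sub(1) in \<open>auto intro: inj_on_subset[OF chart_inj]\<close>)
  obtain f where f: "continuous_on (cube m s) f" "\<forall>\<xi>\<in>cube m s. f \<xi> \<in> span B \<and> norm (f \<xi> - g' (\<sigma> \<xi>)) < \<epsilon>"
    "\<forall>\<xi>\<in>cube m s. \<forall>i<m. \<bar>\<xi> i\<bar> = s \<longrightarrow> f \<xi> = g' (\<sigma> \<xi>)" "finite {\<xi>\<in>cube m s. f \<xi> = 0}"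
    "even (card {\<xi>\<in>cube m s. f \<xi> = 0}) \<longleftrightarrow> even (card {\<xi>\<in>cube m s. g (\<sigma> \<xi>) = 0})"
    "\<forall>z\<in>cube m s. f z = 0 \<longrightarrow> (\<forall>i<m. \<bar>z i\<bar> < s) \<and> affine_zero m f z"
  proof (rule cube_modification[OF m B s(2) us(2) _ _ _ _ shell fin _ \<epsilon>])
    show "continuous_on (cube m s) (\<lambda>\<xi>. g (\<sigma> \<xi>))" "continuous_on (cube m s) (\<lambda>\<xi>. g' (\<sigma> \<xi>))"
      using g g'(1) by (auto simp: regular_map_def intro: continuous_on_compose2[OF _ chart_s in_M])
    show "nondegenerate m (span B) (\<lambda>\<xi>. g (\<sigma> \<xi>)) z" if "z \<in> cube m s" "g (\<sigma> z) = 0" for z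
      by (rule regular_zero_nondegenerate_in_subcube[OF g B(1) us(3) that])
    show "g (\<sigma> \<xi>) \<in> span B" "g' (\<sigma> \<xi>) \<in> span B" if "\<xi> \<in> cube m s" for \<xi>
      using g g'(2) in_M that by (auto simp: regular_map_def image_subset_iff)
  qed
  have eq_s: "g' x = g x" if "x \<in> M" "x \<notin> \<sigma> ` cube m s" for x using eq that sub(2) by blast
  show ?thesis
  proof (rule that[of "chart_update s f g'"])
    show "regular_map B M (chart_update s f g')"
      using f by (intro regular_map_chart_update[OF us(3) g g' eq_s]) auto
    show "\<forall>x\<in>M. norm (chart_update s f g' x - g' x) < \<epsilon>"
      using f(2) \<epsilon> by (auto simp: chart_update_def coords_subcube[OF s(1)])
    have "zeros_on M g' - \<sigma> ` cube m s = zeros_on M g - \<sigma> ` cube m s" using eq_s by (auto simp: zeros_on_def)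
    then show "even (card (zeros_on M (chart_update s f g'))) \<longleftrightarrow> even (card (zeros_on M g))"
      using card_zeros_on_chart_update[OF s(1) f(4), of g'] card_zeros_on_chart_update[OF s(1) fin, of g]
        fin_g f(5) unfolding chart_update_same[OF s(1)] by simp
  qed (use sub(1) in \<open>auto intro: chart_update_outside\<close>)
qed

definition bump :: "real \<Rightarrow> 'x \<Rightarrow> real" where
  "bump T = chart_update r (\<lambda>\<xi>. T * cutoff m (r / 2) (3 / 4 * r) \<xi>) (\<lambda>_. 0)"

lemma cutoff_radii: "r / 2 < 3 / 4 * r"
  using r_pos by simp

lemma continuous_on_bump: "continuous_on M (bump T)"
  unfolding bump_def
proof (rule continuous_on_chart_update)
  show "continuous_on (cube m r) (\<lambda>\<xi>. T * cutoff m (r / 2) (3 / 4 * r) \<xi>)"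
    by (intro continuous_intros continuous_on_cutoff cutoff_radii)
  show "T * cutoff m (r / 2) (3 / 4 * r) \<xi> = 0" if "i < m" "\<bar>\<xi> i\<bar> = r" for \<xi> i
    using cutoff_eq_0[OF cutoff_radii that(1), of \<xi>] that(2) r_pos by simp
qed auto

lemma bump_range: "0 \<le> T \<Longrightarrow> 0 \<le> bump T x \<and> bump T x \<le> T"
  using cutoff_range[of m "r / 2" "3 / 4 * r"] by (simp add: bump_def chart_update_def mult_left_le)

lemma bump_near_center:
  assumes "x \<in> M \<inter> chart_nbhd (r / 2)"
  shows "bump T x = T"
proof -
  have "x \<in> \<sigma> ` open_cube m (r / 2)" using assms image_open_cube[of "r / 2"] r_pos by simp
  then obtain \<xi> where \<xi>: "\<xi> \<in> open_cube m (r / 2)" "x = \<sigma> \<xi>" by auto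
  then have "\<xi> \<in> cube m r" using coord_box_mono[of "r / 2" r m] r_pos by (auto simp: open_cube_def)
  moreover have "cutoff m (r / 2) (3 / 4 * r) \<xi> = 1"
    using \<xi>(1) by (intro cutoff_eq_1 cutoff_radii) (auto simp: open_cube_def less_imp_le)
  ultimately show ?thesis unfolding bump_def \<xi>(2) by (simp add: chart_update_chart)
qed

lemma bump_outside:
  assumes "x \<notin> \<sigma> ` cube m (3 / 4 * r)"
  shows "bump T x = 0"
proof (cases "x \<in> \<sigma> ` cube m r")
  case True
  then obtain \<xi> where \<xi>: "\<xi> \<in> cube m r" "x = \<sigma> \<xi>" by auto
  then have "\<xi> \<notin> cube m (3 / 4 * r)" using assms by auto
  then obtain i where "i < m" "3 / 4 * r \<le> \<bar>\<xi> i\<bar>" using \<xi>(1) by (auto simp: coord_box_def not_le less_imp_le)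
  then have "cutoff m (r / 2) (3 / 4 * r) \<xi> = 0" by (rule cutoff_eq_0[OF cutoff_radii])
  then show ?thesis unfolding bump_def \<xi>(2) using \<xi>(1) by (simp add: chart_update_chart)
qed (simp add: bump_def chart_update_outside)

end

subsection \<open>Continuation of an odd number of zeros\<close>

definition has_C1_chart :: "nat \<Rightarrow> 'x::real_normed_vector set \<Rightarrow> 'x \<Rightarrow> bool" where
  "has_C1_chart m M p \<longleftrightarrow> (\<exists>\<pi> \<sigma> r C U. C1_chart m M p \<pi> \<sigma> r C U)"

locale span_homotopy =
  fixes B :: "'w::banach set" and M :: "'x::real_normed_vector set" and T :: real and h :: "real \<Rightarrow> 'x \<Rightarrow> 'w"
  assumes B: "finite B" "independent B" "B \<noteq> {}" and T_nonneg: "0 \<le> T"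
    and continuous: "continuous_on ({0..T} \<times> M) (\<lambda>(t, x). h t x)"
    and in_span: "\<And>t x. t \<in> {0..T} \<Longrightarrow> x \<in> M \<Longrightarrow> h t x \<in> span B"
begin

definition time :: "('x \<Rightarrow> real) \<Rightarrow> bool" where
  "time \<tau> \<longleftrightarrow> continuous_on M \<tau> \<and> \<tau> ` M \<subseteq> {0..T}"

definition odd_approximable :: "'x set \<Rightarrow> ('x \<Rightarrow> real) \<Rightarrow> bool" where
  "odd_approximable A \<tau> \<longleftrightarrow> (\<forall>\<epsilon>>0. \<exists>g. regular_map B M g \<and> odd (card (zeros_on M g)) \<and>
    (\<forall>x\<in>M. norm (g x - h (\<tau> x) x) < \<epsilon>) \<and> (\<forall>x\<in>M - A. g x = h (\<tau> x) x))"

lemma continuous_on_time: "time \<tau> \<Longrightarrow> continuous_on M (\<lambda>x. h (\<tau> x) x)"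
proof -
  assume "time \<tau>"
  then have "continuous_on M (\<lambda>x. (\<lambda>(t, x). h t x) (\<tau> x, x))"
    by (intro continuous_on_compose2[OF continuous]) (auto simp: time_def intro!: continuous_intros)
  then show ?thesis by simp
qed

lemma odd_approximable_step:
  assumes chart: "C1_chart (card B) M p \<pi> \<sigma> r C U" and \<tau>: "time \<tau>" and approx: "odd_approximable A \<tau>"
  defines "\<tau>' \<equiv> \<lambda>x. max (\<tau> x) (C1_chart.bump (card B) p \<pi> \<sigma> r T x)"
  shows "time \<tau>'" "odd_approximable (A \<union> \<sigma> ` cube (card B) r) \<tau>'"
proof -
  interpret C1_chart "card B" M p \<pi> \<sigma> r C U by (rule chart)
  show \<tau>': "time \<tau>'"
    using \<tau> bump_range[OF T_nonneg]
    by (auto simp: time_def \<tau>'_def image_subset_iff le_max_iff_disj intro!: continuous_on_max continuous_on_bump)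
  show "odd_approximable (A \<union> \<sigma> ` cube (card B) r) \<tau>'"
    unfolding odd_approximable_def
  proof (intro allI impI)
    fix \<epsilon> :: real assume "0 < \<epsilon>"
    then have \<epsilon>: "0 < \<epsilon> / 2" by simp
    then obtain g where g: "regular_map B M g" "odd (card (zeros_on M g))"
      "\<forall>x\<in>M. norm (g x - h (\<tau> x) x) < \<epsilon> / 2" "\<forall>x\<in>M - A. g x = h (\<tau> x) x"
      using approx unfolding odd_approximable_def by blast
    define g' where "g' x = g x + (h (\<tau>' x) x - h (\<tau> x) x)" for x
    have "continuous_on M g'"
      unfolding g'_def using g(1) \<tau> \<tau>' by (auto simp: regular_map_def intro!: continuous_intros continuous_on_time)
    moreover have "g' ` M \<subseteq> span B"
      unfolding g'_def using g(1) \<tau> \<tau>' in_span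
      by (auto simp: regular_map_def time_def image_subset_iff intro!: span_add span_diff)
    moreover have "g' x = g x" if "x \<in> M" "x \<notin> \<sigma> ` cube (card B) (3 / 4 * r)" for x
      using bump_outside[OF that(2)] \<tau> that(1) by (auto simp: g'_def \<tau>'_def time_def max_def image_subset_iff)
    moreover have "0 < card B" "0 \<le> 3 / 4 * r" "3 / 4 * r < r" using B r_pos by (auto simp: card_gt_0_iff)
    ultimately obtain k where k: "regular_map B M k" "\<forall>x\<in>M. norm (k x - g' x) < \<epsilon> / 2"
      "\<forall>x\<in>M - \<sigma> ` cube (card B) r. k x = g' x" "even (card (zeros_on M k)) \<longleftrightarrow> even (card (zeros_on M g))"
      using regular_map_modification[OF _ B(1,2) refl _ _ g(1) _ _ _ \<epsilon>] by metis
    have "norm (k x - h (\<tau>' x) x) < \<epsilon>" if "x \<in> M" for x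
    proof -
      have "norm ((k x - g' x) + (g x - h (\<tau> x) x)) < \<epsilon> / 2 + \<epsilon> / 2" using k(2) g(3) that by (intro norm_add_less) auto
      then show ?thesis by (simp add: g'_def)
    qed
    moreover have "k x = h (\<tau>' x) x" if "x \<in> M - (A \<union> \<sigma> ` cube (card B) r)" for x
      using k(3) g(4) that by (simp add: g'_def)
    ultimately show "\<exists>k. regular_map B M k \<and> odd (card (zeros_on M k)) \<and> (\<forall>x\<in>M. norm (k x - h (\<tau>' x) x) < \<epsilon>) \<and>
        (\<forall>x\<in>M - (A \<union> \<sigma> ` cube (card B) r). k x = h (\<tau>' x) x)"
      using k(1,4) g(2) by blast
  qed
qed

lemma odd_approximable_near_finite:
  assumes P: "finite P" "P \<subseteq> K" and charts: "\<And>p. p \<in> K \<Longrightarrow> C1_chart (card B) M p (\<pi> p) (\<sigma> p) (r p) (C p) (U p)"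
    and start: "regular_map B M (h 0)" "odd (card (zeros_on M (h 0)))"
  obtains \<tau> where "time \<tau>"
    "\<forall>p\<in>P. \<forall>x\<in>M \<inter> C1_chart.chart_nbhd (card B) p (\<pi> p) (U p) (r p / 2). \<tau> x = T"
    "odd_approximable (\<Union>p\<in>P. \<sigma> p ` cube (card B) (r p)) \<tau>"
  using P
proof (induction P arbitrary: thesis)
  case empty
  have "odd_approximable {} (\<lambda>_. 0)" unfolding odd_approximable_def using start by (intro allI impI exI[of _ "h 0"]) simp
  then show ?case using T_nonneg by (intro empty.prems(1)[of "\<lambda>_. 0"]) (auto simp: time_def)
next
  case (insert p P)
  obtain \<tau> where \<tau>: "time \<tau>"
    "\<forall>q\<in>P. \<forall>x\<in>M \<inter> C1_chart.chart_nbhd (card B) q (\<pi> q) (U q) (r q / 2). \<tau> x = T"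
    "odd_approximable (\<Union>p\<in>P. \<sigma> p ` cube (card B) (r p)) \<tau>"
    using insert.IH insert.prems(2) by blast
  interpret C1_chart "card B" M p "\<pi> p" "\<sigma> p" "r p" "C p" "U p" using charts insert.prems(2) by blast
  let ?\<tau>' = "\<lambda>x. max (\<tau> x) (bump T x)"
  note step = odd_approximable_step[OF C1_chart_axioms \<tau>(1,3)]
  show ?case
  proof (rule insert.prems(1)[OF step(1)], intro ballI)
    fix q x assume q: "q \<in> insert p P" "x \<in> M \<inter> C1_chart.chart_nbhd (card B) q (\<pi> q) (U q) (r q / 2)"
    have "\<tau> x = T \<or> bump T x = T" using \<tau>(2) bump_near_center q by auto
    moreover have "\<tau> x \<le> T" "bump T x \<le> T" using \<tau>(1) q(2) bump_range[OF T_nonneg] by (auto simp: time_def)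
    ultimately show "?\<tau>' x = T" by auto
  next
    show "odd_approximable (\<Union>p\<in>insert p P. \<sigma> p ` cube (card B) (r p)) ?\<tau>'" using step(2) by (simp add: Un_commute)
  qed
qed

text \<open>
  If all zeros lie in a compact set that is covered by charts, time is advanced from \<open>0\<close> to \<open>T\<close>
  in one chart after the other.
\<close>

lemma odd_zeros_continuation:
  assumes K: "compact K" "K \<subseteq> M" and charts: "\<And>p. p \<in> K \<Longrightarrow> has_C1_chart (card B) M p"
    and zeros: "\<And>t x. t \<in> {0..T} \<Longrightarrow> x \<in> M \<Longrightarrow> h t x = 0 \<Longrightarrow> x \<in> K"
    and start: "regular_map B M (h 0)" "odd (card (zeros_on M (h 0)))"
  shows "\<exists>x\<in>M. h T x = 0"
proof (rule ccontr)
  assume no_zero: "\<not> ?thesis"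
  obtain \<pi> \<sigma> r C U where charts: "\<And>p. p \<in> K \<Longrightarrow> C1_chart (card B) M p (\<pi> p) (\<sigma> p) (r p) (C p) (U p)"
    using charts unfolding has_C1_chart_def by metis
  define W where "W p = C1_chart.chart_nbhd (card B) p (\<pi> p) (U p) (r p / 2)" for p
  have W: "open (W p) \<and> p \<in> W p" if "p \<in> K" for p
    using C1_chart.open_chart_nbhd[OF charts[OF that]] C1_chart.center_in_chart_nbhd[OF charts[OF that]]
      C1_chart.r_pos[OF charts[OF that]] by (simp add: W_def)
  have "K \<subseteq> (\<Union>p\<in>K. W p)" using W by auto
  then obtain P where P: "P \<subseteq> K" "finite P" "K \<subseteq> (\<Union>p\<in>P. W p)"
    using compactE_image[OF K(1), of K W] W by metis
  define A where "A = (\<Union>p\<in>P. \<sigma> p ` cube (card B) (r p))"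
  obtain \<tau> where \<tau>: "time \<tau>" "\<forall>p\<in>P. \<forall>x\<in>M \<inter> W p. \<tau> x = T" "odd_approximable A \<tau>"
    using odd_approximable_near_finite[OF P(2,1) charts start, folded W_def A_def] .
  have nonzero: "h (\<tau> x) x \<noteq> 0" if x: "x \<in> M" for x
  proof
    assume zero: "h (\<tau> x) x = 0"
    then have "x \<in> K" using zeros[of "\<tau> x" x] \<tau>(1) x by (auto simp: time_def)
    then obtain p where "p \<in> P" "x \<in> W p" using P(3) by auto
    then have "\<tau> x = T" using \<tau>(2) x by auto
    then show False using zero no_zero x by auto
  qed
  have A: "A \<subseteq> M" "compact A"
    unfolding A_def using C1_chart.image_subset[OF charts] C1_chart.image_compact[OF charts] P(1,2)
    by (blast, intro compact_UN) auto
  have "continuous_on A (\<lambda>x. h (\<tau> x) x)" by (rule continuous_on_subset[OF continuous_on_time[OF \<tau>(1)] A(1)])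
  then obtain \<mu> where \<mu>: "\<mu> > 0" "\<And>x. x \<in> A \<Longrightarrow> \<mu> \<le> norm (h (\<tau> x) x)"
    using compact_norm_lower_bound[OF A(2), of "\<lambda>x. h (\<tau> x) x"] nonzero A(1) by auto
  obtain g where g: "odd (card (zeros_on M g))" "\<forall>x\<in>M. norm (g x - h (\<tau> x) x) < \<mu>" "\<forall>x\<in>M - A. g x = h (\<tau> x) x"
    using \<tau>(3) \<mu>(1) unfolding odd_approximable_def by blast
  have "g x \<noteq> 0" if "x \<in> M" for x
    using \<mu>(2)[of x] g(2,3) nonzero[OF that] that by (cases "x \<in> A") fastforce+
  then have "zeros_on M g = {}" by (auto simp: zeros_on_def)
  then show False using g(1) by simp
qed

end

section \<open>Charts of preimages under Fredholm maps\<close>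

locale C1_map =
  fixes F :: "'x::real_normed_vector \<Rightarrow> 'v::real_normed_vector" and F' :: "'x \<Rightarrow> 'x \<Rightarrow>\<^sub>L 'v"
  assumes deriv: "\<And>x. (F has_derivative F' x) (at x)" and continuous_deriv: "continuous_on UNIV F'"
begin

lemma continuous: "continuous_on S F"
  by (intro continuous_at_imp_continuous_on ballI has_derivative_continuous[OF deriv])

lemma deriv_near:
  assumes "0 < \<kappa>"
  obtains \<delta> where "\<delta> > 0" "\<And>x. x \<in> ball p \<delta> \<Longrightarrow> norm (F' x - F' p) \<le> \<kappa>"
proof -
  obtain \<delta> where "\<delta> > 0" "\<And>x. dist x p < \<delta> \<Longrightarrow> dist (F' x) (F' p) < \<kappa>"
    using continuous_deriv assms unfolding continuous_on_iff by (metis UNIV_I)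
  then show ?thesis using that by (simp add: dist_norm norm_minus_commute less_imp_le)
qed

lemma increment_bound:
  assumes near: "\<And>x. x \<in> ball p \<delta> \<Longrightarrow> norm (F' x - F' p) \<le> \<kappa>" and x: "x \<in> ball p \<delta>" "y \<in> ball p \<delta>"
  shows "norm (F x - F y - F' p (x - y)) \<le> \<kappa> * norm (x - y)"
proof -
  have "norm (F x - F y - F' p (x - y)) \<le> norm (x - y) * \<kappa>"
  proof (rule differentiable_bound_linearization[where S = "ball p \<delta>" and f' = "\<lambda>x. F' x"])
    show "y + t *\<^sub>R (x - y) \<in> ball p \<delta>" if t: "t \<in> {0..1}" for t
    proof -
      have "(1 - t) *\<^sub>R y + t *\<^sub>R x \<in> ball p \<delta>" using convexD_alt[OF convex_ball x(2,1)] t by auto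
      then show ?thesis by (simp add: algebra_simps)
    qed
    show "(F has_derivative F' z) (at z within ball p \<delta>)" if "z \<in> ball p \<delta>" for z
      using deriv has_derivative_at_withinI by blast
    show "onorm (blinfun_apply (F' z) - blinfun_apply (F' p)) \<le> \<kappa>" if "z \<in> ball p \<delta>" for z
      using near[OF that] by (simp add: norm_blinfun.rep_eq minus_blinfun.rep_eq fun_diff_def)
    show "p \<in> ball p \<delta>" using x zero_le_dist[of p x] unfolding mem_ball dist_self by linarith
  qed
  then show ?thesis by (simp add: mult.commute)
qed

lemma strict_derivative: "strict_derivative_within S F (F' p) p"
  unfolding strict_derivative_within_def
proof (intro allI impI)
  fix \<kappa> :: real assume "0 < \<kappa>"
  then obtain \<delta> where \<delta>: "\<delta> > 0" "\<And>x. x \<in> ball p \<delta> \<Longrightarrow> norm (F' x - F' p) \<le> \<kappa>" using deriv_near by blast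
  show "\<exists>\<delta>>0. \<forall>x\<in>S \<inter> ball p \<delta>. \<forall>y\<in>S \<inter> ball p \<delta>. norm (F x - F y - F' p (x - y)) \<le> \<kappa> * norm (x - y)"
    using increment_bound[OF \<delta>(2)] \<delta>(1) by blast
qed

end

locale near_identity = C1_map \<Phi> \<Phi>'
  for \<Phi> :: "'x::banach \<Rightarrow> 'x" and \<Phi>' :: "'x \<Rightarrow> 'x \<Rightarrow>\<^sub>L 'x" +
  fixes p :: 'x and \<delta> :: real
  assumes radius: "0 < \<delta>" and near_id: "\<And>x. x \<in> ball p \<delta> \<Longrightarrow> norm (\<Phi>' x - id_blinfun) \<le> 1 / 2"
    and deriv_center: "\<Phi>' p = id_blinfun" and zero_center: "\<Phi> p = 0"
begin

lemma increment_near_id: "x \<in> ball p \<delta> \<Longrightarrow> y \<in> ball p \<delta> \<Longrightarrow> norm (\<Phi> x - \<Phi> y - (x - y)) \<le> 1 / 2 * norm (x - y)"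
  using increment_bound[of p \<delta> "1 / 2"] near_id by (simp add: deriv_center)

lemma expansion:
  assumes "x \<in> ball p \<delta>" "y \<in> ball p \<delta>"
  shows "norm (x - y) \<le> 2 * norm (\<Phi> x - \<Phi> y)"
proof -
  have "norm (x - y) \<le> norm (\<Phi> x - \<Phi> y) + norm (\<Phi> x - \<Phi> y - (x - y))"
    using norm_triangle_sub[of "x - y" "\<Phi> x - \<Phi> y"] by (simp add: norm_minus_commute)
  then show ?thesis using increment_near_id[OF assms] by linarith
qed

lemma deriv_expansion:
  assumes "x \<in> ball p \<delta>"
  shows "norm w \<le> 2 * norm (\<Phi>' x w)"
proof -
  have "norm ((\<Phi>' x - id_blinfun) w) \<le> 1 / 2 * norm w"
    using norm_blinfun[of "\<Phi>' x - id_blinfun" w] mult_right_mono[OF near_id[OF assms], of "norm w"] by simp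
  moreover have "norm w \<le> norm (\<Phi>' x w) + norm ((\<Phi>' x - id_blinfun) w)"
    using norm_triangle_sub[of w "\<Phi>' x w"] by (simp add: blinfun.diff_left norm_minus_commute)
  ultimately show ?thesis by linarith
qed

lemma preimage:
  assumes "norm y \<le> \<delta> / 8"
  obtains x where "x \<in> ball p \<delta>" "\<Phi> x = y"
proof -
  have in_ball: "p + x \<in> ball p \<delta>" if "x \<in> UNIV \<inter> cball 0 (\<delta> / 2)" for x
    using that radius by (simp add: dist_norm)
  obtain x where "norm x \<le> \<delta> / 2" "\<Phi> (p + x) - y = 0"
  proof (rule perturbed_identity_zero[of UNIV "1 / 2" "\<delta> / 2" "\<lambda>x. \<Phi> (p + x) - y"])
    show "norm (\<Phi> (p + x) - y - (\<Phi> (p + x') - y) - (x - x')) \<le> 1 / 2 * norm (x - x')"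
      if "x \<in> UNIV \<inter> cball 0 (\<delta> / 2)" "x' \<in> UNIV \<inter> cball 0 (\<delta> / 2)" for x x'
      using increment_near_id[OF in_ball[OF that(1)] in_ball[OF that(2)]] by simp
  qed (use assms radius zero_center in auto)
  then show ?thesis using that[of "p + x"] in_ball[of x] by simp
qed

end

locale preimage_chart = C1_map F F'
  for F :: "'x::banach \<Rightarrow> 'v::banach" and F' :: "'x \<Rightarrow> 'x \<Rightarrow>\<^sub>L 'v" +
  fixes \<Omega> :: "'x set" and p :: 'x and B :: "'v set" and m :: nat
    and \<pi> :: "nat \<Rightarrow> 'x \<Rightarrow>\<^sub>L real" and e :: "nat \<Rightarrow> 'x" and J :: "'v \<Rightarrow>\<^sub>L 'x"
  assumes \<Omega>: "open \<Omega>" "p \<in> \<Omega>" and Fp: "F p \<in> span B"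
    and dual: "dual_family m \<pi> e" and J: "inverse_modulo (F' p) B (dual_projection m \<pi> e) J"
begin

text \<open>
  Near \<open>p\<close> the map \<open>straighten\<close> is a diffeomorphism that sends the preimage of \<open>span B\<close> to the span
  of the vectors \<open>e\<close>.
\<close>

definition straighten :: "'x \<Rightarrow> 'x" where
  "straighten x = dual_projection m \<pi> e (x - p) + J (F x)"

definition straighten' :: "'x \<Rightarrow> 'x \<Rightarrow>\<^sub>L 'x" where
  "straighten' x = dual_projection m \<pi> e + (J o\<^sub>L F' x)"

definition combine :: "(nat \<Rightarrow> real) \<Rightarrow> 'x" where
  "combine \<xi> = (\<Sum>i<m. \<xi> i *\<^sub>R e i)"

sublocale straightening: C1_map straighten straighten'
proof
  show "(straighten has_derivative straighten' x) (at x)" for x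
    unfolding straighten_def[abs_def] straighten'_def
    by (auto intro!: derivative_eq_intros deriv simp: blinfun.add_left fun_eq_iff)
  show "continuous_on UNIV straighten'"
    unfolding straighten'_def[abs_def] by (intro continuous_intros continuous_deriv)
qed

lemma straighten_center: "straighten p = 0" "straighten' p = id_blinfun"
  using inverse_moduloD(1,2)[OF J] Fp
  by (auto intro!: blinfun_eqI simp: straighten_def straighten'_def blinfun.add_left)

lemma coords_straighten: "i < m \<Longrightarrow> \<pi> i (straighten x) = \<pi> i (x - p)"
  using dual_family_apply_projection[OF dual, of i "J (F x)"] inverse_moduloD(3)[OF J]
  by (simp add: straighten_def blinfun.add_right dual_family_apply_projection[OF dual])

lemma straighten_preimage: "F x \<in> span B \<longleftrightarrow> straighten x = combine (coords m \<pi> p x)"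
proof -
  have "combine (coords m \<pi> p x) = dual_projection m \<pi> e (x - p)"
    by (simp add: combine_def coords_def dual_projection_apply)
  then show ?thesis using inverse_moduloD(2)[OF J, of "F x"] by (simp add: straighten_def)
qed

lemma combine_diff: "combine \<xi> - combine \<zeta> = (\<Sum>i<m. (\<xi> i - \<zeta> i) *\<^sub>R e i)"
  by (simp add: combine_def scaleR_diff_left sum_subtractf)

lemma norm_combine:
  obtains N where "0 < N" "\<And>t. norm (\<Sum>i<m. t i *\<^sub>R e i) \<le> N * (\<Sum>i<m. \<bar>t i\<bar>)"
proof
  let ?N = "1 + (\<Sum>i<m. norm (e i))"
  show "0 < ?N" by (intro add_pos_nonneg sum_nonneg) auto
  have "norm (e i) \<le> ?N" if "i < m" for i
    using member_le_sum[of i "{..<m}" "\<lambda>i. norm (e i)"] that by simp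
  then have "norm (t i *\<^sub>R e i) \<le> ?N * \<bar>t i\<bar>" if "i < m" for t i
    using that by (subst mult.commute) (simp add: mult_left_mono)
  then show "norm (\<Sum>i<m. t i *\<^sub>R e i) \<le> ?N * (\<Sum>i<m. \<bar>t i\<bar>)" for t
    unfolding sum_distrib_left by (intro sum_norm_le) simp
qed

lemma straightening_radius:
  obtains \<delta> where "0 < \<delta>" "ball p \<delta> \<subseteq> \<Omega>" "near_identity straighten straighten' p \<delta>"
proof -
  obtain \<delta>1 where \<delta>1: "\<delta>1 > 0" "\<And>x. x \<in> ball p \<delta>1 \<Longrightarrow> norm (straighten' x - straighten' p) \<le> 1 / 2"
    using straightening.deriv_near[of "1 / 2" p] by auto
  obtain \<delta>2 where \<delta>2: "\<delta>2 > 0" "ball p \<delta>2 \<subseteq> \<Omega>" using \<Omega> open_contains_ball by metis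
  have "near_identity straighten straighten' p (min \<delta>1 \<delta>2)"
    by unfold_locales (use \<delta>1 \<delta>2(1) straighten_center in auto)
  moreover have "ball p (min \<delta>1 \<delta>2) \<subseteq> \<Omega>" using subset_ball[of "min \<delta>1 \<delta>2" \<delta>2 p] \<delta>2(2) by auto
  ultimately show ?thesis using that[of "min \<delta>1 \<delta>2"] \<delta>1(1) \<delta>2(1) by simp
qed

lemma chart_inverse_exists:
  assumes "near_identity straighten straighten' p \<delta>" "ball p \<delta> \<subseteq> \<Omega>"
  obtains \<sigma> r where "0 < r" "\<forall>\<xi>\<in>cube m r. \<sigma> \<xi> \<in> ball p \<delta> \<and> straighten (\<sigma> \<xi>) = combine \<xi>"
    "\<forall>\<xi>\<in>cube m r. F (\<sigma> \<xi>) \<in> span B \<and> coords m \<pi> p (\<sigma> \<xi>) = \<xi>"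
proof -
  interpret near_identity straighten straighten' p \<delta> by (rule assms(1))
  obtain N where N: "0 < N" "\<And>t. norm (\<Sum>i<m. t i *\<^sub>R e i) \<le> N * (\<Sum>i<m. \<bar>t i\<bar>)" using norm_combine by blast
  define r where "r = \<delta> / (8 * N * (real m + 1))"
  have r: "0 < r" using radius N(1) by (simp add: r_def add_nonneg_pos)
  have small: "norm (combine \<xi>) \<le> \<delta> / 8" if \<xi>: "\<xi> \<in> cube m r" for \<xi>
  proof -
    have "(\<Sum>i<m. \<bar>\<xi> i\<bar>) \<le> (\<Sum>i<m. r)" using \<xi> by (intro sum_mono) (auto simp: coord_box_def)
    also have "\<dots> \<le> (real m + 1) * r" using r by simp
    finally have "norm (combine \<xi>) \<le> N * ((real m + 1) * r)"
      unfolding combine_def using N(1) by (intro order_trans[OF N(2) mult_left_mono]) auto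
    also have "\<dots> = \<delta> / 8" using N(1) by (simp add: r_def)
    finally show ?thesis .
  qed
  have "\<exists>x. x \<in> ball p \<delta> \<and> straighten x = combine \<xi>" if "\<xi> \<in> cube m r" for \<xi>
    using preimage[OF small[OF that]] by blast
  then obtain \<sigma> where \<sigma>: "\<And>\<xi>. \<xi> \<in> cube m r \<Longrightarrow> \<sigma> \<xi> \<in> ball p \<delta> \<and> straighten (\<sigma> \<xi>) = combine \<xi>" by metis
  have coords: "coords m \<pi> p (\<sigma> \<xi>) = \<xi>" if \<xi>: "\<xi> \<in> cube m r" for \<xi>
  proof
    have "\<pi> i (\<sigma> \<xi> - p) = \<xi> i" if i: "i < m" for i
      unfolding coords_straighten[OF i, symmetric] using \<sigma>[OF \<xi>] dual_familyD[OF dual i] by (simp add: combine_def)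
    then show "coords m \<pi> p (\<sigma> \<xi>) i = \<xi> i" for i using \<xi> by (auto simp: coords_def coord_box_def)
  qed
  then have "F (\<sigma> \<xi>) \<in> span B" if "\<xi> \<in> cube m r" for \<xi> using straighten_preimage \<sigma> that by simp
  then show ?thesis using that[OF r, of \<sigma>] \<sigma> coords by blast
qed

lemma eventually_lipschitz_image_small:
  fixes \<sigma> :: "(nat \<Rightarrow> real) \<Rightarrow> 'x"
  assumes lip: "0 < C" "\<And>\<xi> \<zeta>. \<xi> \<in> cube m r \<Longrightarrow> \<zeta> \<in> cube m r \<Longrightarrow> norm (\<sigma> \<xi> - \<sigma> \<zeta>) \<le> C * (\<Sum>i<m. \<bar>\<xi> i - \<zeta> i\<bar>)"
    and z: "z \<in> open_cube m r" and \<epsilon>: "0 < \<epsilon>"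
  shows "\<forall>\<^sub>F d in at_right 0. coord_box m z d \<subseteq> cube m r \<and> \<sigma> ` coord_box m z d \<subseteq> ball (\<sigma> z) \<epsilon>"
proof -
  have "\<forall>\<^sub>F d in at_right 0. C * (real m * d) < \<epsilon>"
    by (rule order_tendstoD(2)[OF _ \<epsilon>]) (auto intro!: tendsto_eq_intros)
  moreover have "\<forall>\<^sub>F d in at_right 0. coord_box m z d \<subseteq> cube m r"
    using z by (intro coord_box_subset_cube_small) (auto simp: open_cube_def)
  ultimately show ?thesis
  proof eventually_elim
    case (elim d)
    have "norm (\<sigma> z - \<sigma> \<xi>) < \<epsilon>" if "\<xi> \<in> coord_box m z d" for \<xi>
    proof -
      have "(\<Sum>i<m. \<bar>z i - \<xi> i\<bar>) \<le> (\<Sum>i<m. d)"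
        using that by (intro sum_mono) (auto simp: coord_box_def abs_minus_commute)
      then have "norm (\<sigma> z - \<sigma> \<xi>) \<le> C * (real m * d)"
        using lip(1) elim(2) that z by (intro order_trans[OF lip(2) mult_left_mono]) (auto simp: open_cube_def)
      then show ?thesis using elim(1) by simp
    qed
    then show ?case using elim(2) by (auto simp: dist_norm)
  qed
qed

lemma strict_partials_inverse:
  assumes "near_identity straighten straighten' p \<delta>"
    and \<sigma>: "\<forall>\<xi>\<in>cube m r. \<sigma> \<xi> \<in> ball p \<delta> \<and> straighten (\<sigma> \<xi>) = combine \<xi>"
    and lip: "0 < C" "\<And>\<xi> \<zeta>. \<xi> \<in> cube m r \<Longrightarrow> \<zeta> \<in> cube m r \<Longrightarrow> norm (\<sigma> \<xi> - \<sigma> \<zeta>) \<le> C * (\<Sum>i<m. \<bar>\<xi> i - \<zeta> i\<bar>)"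
    and z: "z \<in> open_cube m r"
  shows "\<exists>D. strict_partials m \<sigma> D z"
proof -
  interpret near_identity straighten straighten' p \<delta> by (rule assms(1))
  have center: "\<sigma> z \<in> ball p \<delta>" using \<sigma> z by (simp add: open_cube_def)
  have "\<exists>d. straighten' (\<sigma> z) d = e i" for i
    by (rule near_identity_surj[OF near_id[OF center], of "e i"]) auto
  then obtain D where D: "\<And>i. straighten' (\<sigma> z) (D i) = e i" by metis
  have "\<forall>\<^sub>F d in at_right 0. almost_affine_on m (coord_box m z d) \<kappa> D \<sigma>" if "0 < \<kappa>" for \<kappa>
  proof -
    have \<kappa>C: "0 < \<kappa> / (2 * C)" using lip(1) that by simp
    then obtain \<epsilon> where \<epsilon>: "\<epsilon> > 0" "\<forall>x\<in>ball (\<sigma> z) \<epsilon>. \<forall>y\<in>ball (\<sigma> z) \<epsilon>.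
        norm (straighten x - straighten y - straighten' (\<sigma> z) (x - y)) \<le> \<kappa> / (2 * C) * norm (x - y)"
      using straightening.strict_derivative[of UNIV "\<sigma> z"] unfolding strict_derivative_within_def by (metis Int_UNIV_left)
    have "\<forall>\<^sub>F d in at_right 0. coord_box m z d \<subseteq> cube m r \<and> \<sigma> ` coord_box m z d \<subseteq> ball (\<sigma> z) \<epsilon>"
      by (rule eventually_lipschitz_image_small[OF lip(1) _ z \<epsilon>(1)]) (rule lip(2))
    then show ?thesis
      unfolding almost_affine_on_def
    proof (eventually_elim, intro ballI)
      fix d \<xi> \<zeta> assume d: "coord_box m z d \<subseteq> cube m r \<and> \<sigma> ` coord_box m z d \<subseteq> ball (\<sigma> z) \<epsilon>"
        and x: "\<xi> \<in> coord_box m z d" "\<zeta> \<in> coord_box m z d"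
      let ?q = "\<sigma> \<xi> - \<sigma> \<zeta>" and ?t = "\<Sum>i<m. (\<xi> i - \<zeta> i) *\<^sub>R D i"
      have "straighten' (\<sigma> z) ?t = straighten (\<sigma> \<xi>) - straighten (\<sigma> \<zeta>)"
        using \<sigma> x d combine_diff[of \<xi> \<zeta>] by (simp add: subset_iff blinfun.sum_right blinfun.scaleR_right D)
      then have "norm (?q - ?t) \<le> 2 * norm (straighten (\<sigma> \<xi>) - straighten (\<sigma> \<zeta>) - straighten' (\<sigma> z) ?q)"
        using deriv_expansion[OF center, of "?q - ?t"] by (simp add: blinfun.diff_right norm_minus_commute)
      also have "\<dots> \<le> 2 * (\<kappa> / (2 * C) * norm ?q)"
        by (intro mult_left_mono bspec[OF bspec[OF \<epsilon>(2)]]) (use x d in auto)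
      also have "\<dots> \<le> 2 * (\<kappa> / (2 * C) * (C * (\<Sum>i<m. \<bar>\<xi> i - \<zeta> i\<bar>)))"
        using lip x d \<kappa>C by (intro mult_left_mono) auto
      also have "\<dots> = \<kappa> * (\<Sum>i<m. \<bar>\<xi> i - \<zeta> i\<bar>)" using lip(1) by simp
      finally show "norm (?q - ?t) \<le> \<kappa> * (\<Sum>i<m. \<bar>\<xi> i - \<zeta> i\<bar>)" .
    qed
  qed
  then show ?thesis unfolding strict_partials_def by blast
qed

lemma has_C1_chart_preimage: "has_C1_chart m {x\<in>\<Omega>. F x \<in> span B} p"
proof -
  let ?M = "{x\<in>\<Omega>. F x \<in> span B}"
  obtain \<delta> where "0 < \<delta>" and \<delta>: "ball p \<delta> \<subseteq> \<Omega>" and near: "near_identity straighten straighten' p \<delta>"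
    using straightening_radius .
  interpret near_identity straighten straighten' p \<delta> by (rule near)
  obtain \<sigma> r where r: "0 < r" and \<sigma>: "\<forall>\<xi>\<in>cube m r. \<sigma> \<xi> \<in> ball p \<delta> \<and> straighten (\<sigma> \<xi>) = combine \<xi>"
    and chart: "\<forall>\<xi>\<in>cube m r. F (\<sigma> \<xi>) \<in> span B \<and> coords m \<pi> p (\<sigma> \<xi>) = \<xi>"
    using chart_inverse_exists[OF near \<delta>] .
  obtain N where N: "0 < N" "\<And>t. norm (\<Sum>i<m. t i *\<^sub>R e i) \<le> N * (\<Sum>i<m. \<bar>t i\<bar>)" using norm_combine by blast
  have lip: "norm (\<sigma> \<xi> - \<sigma> \<zeta>) \<le> 2 * N * (\<Sum>i<m. \<bar>\<xi> i - \<zeta> i\<bar>)" if "\<xi> \<in> cube m r" "\<zeta> \<in> cube m r" for \<xi> \<zeta>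
    using expansion[of "\<sigma> \<xi>" "\<sigma> \<zeta>"] \<sigma> that N(2)[of "\<lambda>i. \<xi> i - \<zeta> i"] by (simp add: combine_diff)
  define U where "U = ball p \<delta> \<inter> coords m \<pi> p -` {\<xi>. \<forall>i<m. \<bar>\<xi> i - 0\<bar> < r}"
  have "C1_chart m ?M p \<pi> \<sigma> r (2 * N) U"
  proof
    show "open U" unfolding U_def by (intro open_Int open_ball open_vimage[OF open_coords_less continuous_on_coords])
    show "p \<in> ?M \<inter> U" using \<Omega>(2) Fp \<open>0 < \<delta>\<close> r by (simp add: U_def coords_def)
    show "?M \<inter> U = \<sigma> ` open_cube m r"
    proof (intro subset_antisym subsetI)
      fix x assume x: "x \<in> ?M \<inter> U"
      let ?c = "coords m \<pi> p x"
      have c: "?c \<in> open_cube m r" using x by (auto simp: U_def open_cube_def coord_box_def coords_def less_imp_le)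
      then have "straighten x = straighten (\<sigma> ?c)" using straighten_preimage[of x] x \<sigma> by (simp add: open_cube_def)
      then have "x = \<sigma> ?c" using expansion[of x "\<sigma> ?c"] x \<sigma> c by (simp add: U_def open_cube_def)
      then show "x \<in> \<sigma> ` open_cube m r" using c by blast
    qed (use \<sigma> chart \<delta> in \<open>auto simp: U_def open_cube_def\<close>)
    show "\<exists>D. strict_partials m \<sigma> D z" if "z \<in> open_cube m r" for z
      by (rule strict_partials_inverse[OF near \<sigma> _ lip that]) (use N(1) in simp)
  qed (use r N(1) \<sigma> chart \<delta> lip in auto)
  then show ?thesis unfolding has_C1_chart_def by blast
qed

end

lemma preimage_C1_chart:
  fixes F :: "'x::banach \<Rightarrow> 'v::banach"
  assumes F: "C1_map F F'" and "open \<Omega>" "p \<in> \<Omega>" and B: "finite B" and Fp: "F p \<in> span B" and onto: "onto_modulo (F' p) B"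
    and E: "finite E" "independent E" "card E = m" "span E = {x. F' p x \<in> span B}"
  shows "has_C1_chart m {x\<in>\<Omega>. F x \<in> span B} p"
proof -
  obtain e and \<pi> :: "nat \<Rightarrow> 'x \<Rightarrow>\<^sub>L real" where e: "e ` {..<m} = E" "dual_family m \<pi> e"
    using projection_onto_finite_span[OF E(1,2)] E(3) by blast
  let ?P = "dual_projection m \<pi> e"
  obtain J where "inverse_modulo (F' p) B ?P J"
  proof (rule inverse_modulo_exists[OF B onto])
    show "F' p (?P x) \<in> span B" for x using dual_projection_in_span[of m \<pi> e x] E(4) e(1) by auto
    show "?P x = x" if "F' p x \<in> span B" for x using dual_projection_on_span[OF e(2)] that E(4) e(1) by auto
  qed
  then interpret preimage_chart F F' \<Omega> p B m \<pi> e J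
    using assms(2,3) Fp e(2) by (intro preimage_chart.intro F preimage_chart_axioms.intro)
  show ?thesis by (rule has_C1_chart_preimage)
qed

lemma regular_zero_subset:
  assumes "regular_zero M g z" "N \<subseteq> M"
  shows "regular_zero N g z"
proof -
  have "N \<inter> ball z \<delta> \<subseteq> M \<inter> ball z \<delta>" for \<delta> using assms(2) by blast
  then show ?thesis
    using assms(1) unfolding regular_zero_def strict_derivative_within_def bounded_below_near_def by (meson subsetD)
qed

section \<open>Nonlinear Fredholm maps with a parameter\<close>

locale Fredholm_family = C1_map F F'
  for F :: "real \<times> 'u::banach \<Rightarrow> 'v::banach" and F' :: "real \<times> 'u \<Rightarrow> (real \<times> 'u) \<Rightarrow>\<^sub>L 'v" +
  assumes Fredholm: "\<And>x. D_u F x \<in> Fredholm0"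
begin

lemma D_u_apply: "D_u F x v = F' x (0, v)"
proof -
  have "((\<lambda>w. (fst x, w)) has_derivative (\<lambda>v. (0, v))) (at (snd x))"
    by (rule has_derivative_Pair[OF has_derivative_const has_derivative_ident])
  from has_derivative_compose[OF this, of F "F' x"] deriv[of x]
  have partial: "((\<lambda>w. F (fst x, w)) has_derivative (\<lambda>v. F' x (0, v))) (at (snd x))" by simp
  show ?thesis unfolding D_u_def frechet_derivative_at[OF partial, symmetric]
    by (simp add: bounded_linear_Blinfun_apply has_derivative_bounded_linear[OF partial])
qed

lemma continuous_D_u: "continuous_on UNIV (D_u F)"
proof -
  define I :: "'u \<Rightarrow>\<^sub>L (real \<times> 'u)" where "I = Blinfun (Pair 0)"
  have "bounded_linear (Pair 0 :: 'u \<Rightarrow> real \<times> 'u)"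
    by (rule bounded_linear_Pair[OF bounded_linear_zero bounded_linear_ident])
  then have "D_u F = (\<lambda>x. F' x o\<^sub>L I)"
    by (intro ext blinfun_eqI) (simp add: D_u_apply I_def bounded_linear_Blinfun_apply)
  then show ?thesis
    using bounded_bilinear.continuous_on[OF bounded_bilinear_blinfun_compose continuous_deriv continuous_on_const] by simp
qed

lemma has_C1_chart_preimage_span:
  assumes \<Omega>: "open \<Omega>" "p \<in> \<Omega>" and N: "finite N" "independent N" "F p \<in> span N" and onto: "onto_modulo (D_u F p) N"
  shows "has_C1_chart (Suc (card N)) {x\<in>\<Omega>. F x \<in> span N} p"
proof -
  obtain E where E: "finite E" "independent E" "card E = Suc (card N)" "span E = {x. F' p x \<in> span N}"
    using Fredholm0_product_preimage_basis[OF Fredholm N(1,2) onto] D_u_apply[of p] by metis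
  moreover have "onto_modulo (F' p) N" using onto unfolding onto_modulo_def D_u_apply by blast
  ultimately show ?thesis using preimage_C1_chart[OF C1_map_axioms \<Omega> N(1,3)] by blast
qed

lemma real_times_span_basis:
  fixes N :: "'w::real_vector set"
  assumes "finite N" "independent N"
  obtains E :: "(real \<times> 'w) set" where "finite E" "independent E" "card E = Suc (card N)" "span E = {x. snd x \<in> span N}"
proof (rule that[of "insert (1, 0) (Pair 0 ` N)"])
  show "span (insert (1, 0) (Pair (0::real) ` N)) = {x. snd x \<in> span N}" by (auto simp: span_insert_Pair)
qed (use assms independent_insert_Pair card_insert_Pair in auto)

theorem homotopy_along_vector_zero:
  fixes f k :: "real \<Rightarrow> real \<times> 'u \<Rightarrow> real" and c :: 'v
  defines "h t x \<equiv> (f t x, F x + k t x *\<^sub>R c)"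
  assumes \<Omega>: "open \<Omega>" and K: "compact K" "K \<subseteq> \<Omega>" and T: "0 \<le> T"
    and cont: "continuous_on ({0..T} \<times> \<Omega>) (\<lambda>(t, x). f t x)" "continuous_on ({0..T} \<times> \<Omega>) (\<lambda>(t, x). k t x)"
    and zeros: "\<And>t x. t \<in> {0..T} \<Longrightarrow> x \<in> \<Omega> \<Longrightarrow> h t x = 0 \<Longrightarrow> x \<in> K"
    and start: "zeros_on \<Omega> (h 0) = {z}" "regular_zero \<Omega> (h 0) z"
  shows "\<exists>x\<in>\<Omega>. h T x = 0"
proof -
  let ?K = "K \<inter> F -` span {c}"
  have compact: "compact ?K"
    by (intro compact_Int_closed K(1) closed_vimage closed_span_finite continuous) simp
  obtain N where N: "finite N" "independent N" "c \<in> span N" "\<And>x. x \<in> ?K \<Longrightarrow> onto_modulo (D_u F x) N"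
    using Fredholm0_family_common_complement[OF compact continuous_D_u Fredholm, of c] by blast
  define M where "M = {x\<in>\<Omega>. F x \<in> span N}"
  obtain E :: "(real \<times> 'v) set" where E: "finite E" "independent E" "card E = Suc (card N)" "span E = {x. snd x \<in> span N}"
    using real_times_span_basis[OF N(1,2)] .
  have span_c: "span {c} \<subseteq> span N" using N(3) by (intro span_minimal) auto
  have zero_in_line: "F x \<in> span {c}" if "h t x = 0" for t x
  proof -
    have "F x = (- k t x) *\<^sub>R c" using that by (simp add: h_def zero_prod_def eq_neg_iff_add_eq_0)
    then show ?thesis by (simp add: span_neg span_scale span_base)
  qed
  interpret span_homotopy E M T h
  proof
    show "finite E" "independent E" "E \<noteq> {}" "0 \<le> T" using E T by auto
    show "continuous_on ({0..T} \<times> M) (\<lambda>(t, x). h t x)"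
      unfolding h_def split_beta
      by (intro continuous_intros continuous_on_compose2[OF continuous]
        continuous_on_subset[OF cont(1)[unfolded split_beta]] continuous_on_subset[OF cont(2)[unfolded split_beta]])
        (auto simp: M_def)
    show "h t x \<in> span E" if "x \<in> M" for t x
      using that N(3) by (auto simp: h_def M_def E(4) intro: span_add span_scale)
  qed
  have "zeros_on M (h 0) = {z}" using start(1) zero_in_line[of 0] span_c by (auto simp: zeros_on_def M_def)
  moreover have "regular_zero M (h 0) z"
    by (rule regular_zero_subset[OF start(2)]) (auto simp: M_def)
  moreover have "continuous_on M (h 0)"
    by (rule continuous_on_compose2[OF continuous, of M "Pair 0", simplified])
      (use T in \<open>auto intro!: continuous_intros\<close>)
  ultimately have "regular_map E M (h 0)" "odd (card (zeros_on M (h 0)))"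
    using in_span[of 0] T by (auto simp: regular_map_def)
  moreover have "has_C1_chart (card E) M p" if "p \<in> ?K" for p
    unfolding E(3) M_def using that K(2) span_c by (intro has_C1_chart_preimage_span \<Omega> N) auto
  moreover have "?K \<subseteq> M" using K(2) span_c by (auto simp: M_def)
  ultimately have "\<exists>x\<in>M. h T x = 0"
    using zeros zero_in_line by (intro odd_zeros_continuation[OF compact]) (auto simp: M_def)
  then show ?thesis by (auto simp: M_def)
qed

end

section \<open>Solutions near a simple eigenvalue\<close>

locale simple_eigenvalue = Fredholm_family F F'
  for F :: "real \<times> 'u::banach \<Rightarrow> 'v::banach" and F' :: "real \<times> 'u \<Rightarrow> (real \<times> 'u) \<Rightarrow>\<^sub>L 'v" +
  fixes l0 :: real and \<phi>0 :: 'u and L' :: "'u \<Rightarrow>\<^sub>L 'v" and \<phi>s :: "'u \<Rightarrow>\<^sub>L real"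
  assumes trivial: "\<And>l. F (l, 0) = 0"
    and proper: "proper_on_closed_bounded F"
    and isolated: "l0 isolated_in gen_spectrum (linearization F)"
    and ker: "null_space (linearization F l0) = span {\<phi>0}"
    and norm_\<phi>0: "norm \<phi>0 = 1"
    and deriv_L: "(linearization F has_vector_derivative L') (at l0)"
    and transversal: "L' \<phi>0 \<notin> range (linearization F l0)"
    and \<phi>s_\<phi>0: "\<phi>s \<phi>0 = 1"
begin

abbreviation "p0 \<equiv> (l0, 0 :: 'u)"
abbreviation "solutions \<equiv> nontrivial_solutions F"
abbreviation "L0 \<equiv> linearization F l0"

lemma derivative_at_trivial: "F' (l, 0) x = linearization F l (snd x)"
proof -
  have "((\<lambda>l. (l, 0 :: 'u)) has_derivative (\<lambda>a. (a, 0))) (at l)"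
    by (rule has_derivative_Pair[OF has_derivative_ident has_derivative_const])
  from has_derivative_compose[OF this, of F "F' (l, 0)"] deriv[of "(l, 0)"]
  have "((\<lambda>l. F (l, 0)) has_derivative (\<lambda>a. F' (l, 0) (a, 0))) (at l)" by simp
  moreover have "((\<lambda>l. F (l, 0)) has_derivative (\<lambda>a. 0)) (at l)" unfolding trivial by (rule has_derivative_const)
  ultimately have "(\<lambda>a. F' (l, 0) (a, 0)) = (\<lambda>a. 0)" by (rule has_derivative_unique)
  then have "F' (l, 0) (fst x, 0) = 0" by meson
  moreover have "x = (fst x, 0) + (0, snd x)" by (cases x) simp
  ultimately show ?thesis by (metis D_u_apply add_0 blinfun.add_right linearization_def fst_conv)
qed

lemma increment_near_trivial:
  fixes A :: "'v \<Rightarrow>\<^sub>L 'w::real_normed_vector"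
  assumes "0 < \<kappa>"
  obtains \<delta> where "\<delta> > 0" "\<And>x y. x \<in> ball (l, 0) \<delta> \<Longrightarrow> y \<in> ball (l, 0) \<delta> \<Longrightarrow>
    norm (A (F x - F y) - A (linearization F l (snd x - snd y))) \<le> \<kappa> * norm (x - y)"
proof -
  interpret A: C1_map "\<lambda>x. A (F x)" "\<lambda>x. A o\<^sub>L F' x"
  proof
    show "((\<lambda>x. A (F x)) has_derivative (A o\<^sub>L F' x)) (at x)" for x
      using bounded_linear.has_derivative[OF blinfun.bounded_linear_right deriv] by (simp add: blinfun_compose.rep_eq comp_def)
    show "continuous_on UNIV (\<lambda>x. A o\<^sub>L F' x)" by (intro continuous_intros continuous_deriv)
  qed
  obtain \<delta> where "\<delta> > 0" "\<forall>x\<in>ball (l, 0) \<delta>. \<forall>y\<in>ball (l, 0) \<delta>.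
      norm (A (F x) - A (F y) - A (F' (l, 0) (x - y))) \<le> \<kappa> * norm (x - y)"
    using A.strict_derivative[of UNIV "(l, 0)"] assms by (auto simp: strict_derivative_within_def)
  then show ?thesis by (intro that[of \<delta>]) (simp_all add: derivative_at_trivial blinfun.diff_right)
qed

lemma linearization_near_trivial:
  fixes A :: "'v \<Rightarrow>\<^sub>L 'w::real_normed_vector"
  assumes "0 < \<kappa>"
  obtains \<delta> where "\<delta> > 0" "\<And>l' u. (l', u) \<in> ball (l, 0) \<delta> \<Longrightarrow>
    norm (A (F (l', u)) - A (linearization F l u)) \<le> \<kappa> * norm u"
proof -
  obtain \<delta> where \<delta>: "\<delta> > 0" "\<And>x y. x \<in> ball (l, 0) \<delta> \<Longrightarrow> y \<in> ball (l, 0) \<delta> \<Longrightarrow>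
      norm (A (F x - F y) - A (linearization F l (snd x - snd y))) \<le> \<kappa> * norm (x - y)"
    using increment_near_trivial[OF assms, of l A] by blast
  have "norm (A (F (l', u)) - A (linearization F l u)) \<le> \<kappa> * norm u" if "(l', u) \<in> ball (l, 0) \<delta>" for l' u
  proof -
    have "dist (l, 0 :: 'u) (l', 0) \<le> dist (l, 0) (l', u)"
      using dist_fst_le[of "(l, 0)" "(l', u)"] by (simp add: dist_Pair_Pair)
    then have "(l', 0) \<in> ball (l, 0 :: 'u) \<delta>" using that by simp
    from \<delta>(2)[OF that this] show ?thesis by (simp add: trivial norm_Pair)
  qed
  with \<delta>(1) show ?thesis by (rule that)
qed

lemma solution_zero: "x \<in> solutions \<Longrightarrow> F x = 0"
  using trivial by (auto simp: nontrivial_solutions_def)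

lemma zero_solution: "F x = 0 \<Longrightarrow> snd x \<noteq> 0 \<Longrightarrow> x \<in> solutions"
  by (cases x) (auto simp: nontrivial_solutions_def trivial_branch_def)

lemma trivial_solution_iff: "(l, 0) \<in> solutions \<longleftrightarrow> linearization F l \<notin> GL"
  by (auto simp: nontrivial_solutions_def trivial_branch_def gen_spectrum_def)

lemma eigenvalue_solution: "p0 \<in> solutions"
  using isolated by (auto simp: trivial_solution_iff isolated_in_def gen_spectrum_def)

lemma bounded_below_D_u_near:
  assumes below: "\<And>v. c * norm v \<le> norm (linearization F l v)" and near: "norm (D_u F x - linearization F l) \<le> c / 2"
    and c: "0 < c"
  shows "D_u F x \<in> GL"
proof (rule Fredholm0_bounded_below_GL[OF Fredholm])
  show "c / 2 * norm v \<le> norm (D_u F x v)" for v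
  proof -
    have "norm (linearization F l v - D_u F x v) \<le> c / 2 * norm v"
      using norm_blinfun[of "D_u F x - linearization F l" v] mult_right_mono[OF near norm_ge_zero[of v]]
      by (simp add: blinfun.diff_left norm_minus_commute)
    then show ?thesis
      using below[of v] norm_triangle_ineq2[of "linearization F l v" "D_u F x v"] by simp
  qed
qed (use c in simp)

lemma no_solutions_near_regular:
  assumes "linearization F l \<in> GL"
  obtains \<delta> where "\<delta> > 0" "ball (l, 0) \<delta> \<inter> solutions = {}"
proof -
  obtain c where c: "c > 0" "\<And>v. c * norm v \<le> norm (linearization F l v)" using GL_bounded_below[OF assms] by blast
  obtain \<delta>1 where \<delta>1: "\<delta>1 > 0" "\<And>l' u. (l', u) \<in> ball (l, 0) \<delta>1 \<Longrightarrow> norm (F (l', u) - linearization F l u) \<le> c / 2 * norm u"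
    using linearization_near_trivial[of "c / 2" l id_blinfun] c(1) by auto
  obtain \<delta>2 where \<delta>2: "\<delta>2 > 0" "\<And>x. dist x (l, 0) < \<delta>2 \<Longrightarrow> dist (D_u F x) (linearization F l) < c / 2"
    using continuous_D_u c(1) unfolding continuous_on_iff linearization_def by (metis UNIV_I half_gt_zero)
  have "x \<notin> solutions" if near: "x \<in> ball (l, 0) (min \<delta>1 \<delta>2)" for x
  proof
    assume solution: "x \<in> solutions"
    obtain l' u where x: "x = (l', u)" by (cases x)
    have "c * norm u \<le> c / 2 * norm u"
      using \<delta>1(2)[of l' u] c(2)[of u] near solution_zero[OF solution] x by simp
    then have "u = 0" using c(1) by (simp add: field_simps mult_le_0_iff)
    moreover have "D_u F x \<in> GL"
      using bounded_below_D_u_near[OF c(2) _ c(1)] \<delta>2(2)[of x] near by (simp add: dist_norm norm_minus_commute less_imp_le)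
    ultimately show False using solution x trivial_solution_iff[of l'] by (simp add: linearization_def)
  qed
  then show ?thesis using \<delta>1(1) \<delta>2(1) by (intro that[of "min \<delta>1 \<delta>2"]) (simp, blast)
qed

lemma closed_solutions: "closed solutions"
  unfolding closed_def open_contains_ball
proof
  fix x assume x: "x \<in> - solutions"
  show "\<exists>\<delta>>0. ball x \<delta> \<subseteq> - solutions"
  proof (cases "F x = 0")
    case True
    then obtain l where "x = (l, 0)" using x zero_solution by (cases x) fastforce
    then show ?thesis using x no_solutions_near_regular trivial_solution_iff by (metis Compl_iff disjoint_eq_subset_Compl)
  next
    case False
    have "open (F -` (- {0}))" by (rule open_vimage[OF _ continuous]) auto
    then obtain \<delta> where "\<delta> > 0" "ball x \<delta> \<subseteq> F -` (- {0})"
      using open_contains_ball[THEN iffD1, rule_format, of "F -` (- {0})" x] False by auto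
    then show ?thesis using solution_zero by blast
  qed
qed

lemma compact_solutions:
  assumes "closed A" "bounded A" "A \<subseteq> solutions"
  shows "compact A"
proof -
  have "A = {p \<in> A. F p \<in> {0}}" using assms(3) solution_zero by auto
  then show ?thesis
    using proper[unfolded proper_on_closed_bounded_def] assms(1,2) by (metis finite.emptyI finite.insertI finite_imp_compact)
qed

end

lemma codim_one_onto_modulo:
  fixes T :: "'u::real_normed_vector \<Rightarrow>\<^sub>L 'v::real_normed_vector"
  assumes codim: "codim (range T) = 1" "finite_codim (range T)" and w: "w \<notin> range T"
  shows "onto_modulo T {w}"
proof -
  obtain C where "finite C" "card C = 1" "span (range T \<union> C) = UNIV" using codim_attained[OF codim(2)] codim(1) by metis
  then obtain c where c: "span (range T \<union> {c}) = UNIV" by (auto simp: card_1_singleton_iff)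
  have decomposition: "\<exists>x a. v = T x + a *\<^sub>R c" for v
  proof -
    have "v \<in> span (insert c (range T))" using c by simp
    then obtain a where "v - a *\<^sub>R c \<in> range T"
      using span_eq_iff[THEN iffD2, OF subspace_range_blinfun[of T]] by (auto simp: span_insert)
    then have "\<exists>x. v = T x + a *\<^sub>R c" by (auto simp: diff_eq_eq)
    then show ?thesis by blast
  qed
  obtain x0 a0 where w_eq: "w = T x0 + a0 *\<^sub>R c" using decomposition by blast
  then have "a0 \<noteq> 0" using w by auto
  then have c_eq: "c = (1 / a0) *\<^sub>R (w - T x0)" using w_eq by simp
  show ?thesis unfolding onto_modulo_def
  proof
    fix v
    obtain x a where "v = T x + a *\<^sub>R c" using decomposition by blast
    then have "v - T (x - (a / a0) *\<^sub>R x0) = (a / a0) *\<^sub>R w"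
      by (simp add: c_eq blinfun.diff_right blinfun.scaleR_right scaleR_diff_right)
    then show "\<exists>x. v - T x \<in> span {w}" by (metis span_scale span_base insertI1)
  qed
qed

locale transversal_splitting = simple_eigenvalue F F' l0 \<phi>0 L' \<phi>s
  for F :: "real \<times> 'u::banach \<Rightarrow> 'v::banach" and F' l0 \<phi>0 L' \<phi>s +
  fixes J :: "'v \<Rightarrow>\<^sub>L 'u" and \<omega> :: "'v \<Rightarrow>\<^sub>L real"
  assumes J: "inverse_modulo L0 {L' \<phi>0} (blinfun_scaleR_left \<phi>0 o\<^sub>L \<phi>s) J"
    and \<omega>_L': "\<omega> (L' \<phi>0) = 1" and \<omega>_L0: "\<And>u. \<omega> (L0 u) = 0"
begin

lemma J_L0: "J (L0 u) = u - \<phi>s u *\<^sub>R \<phi>0"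
  using inverse_moduloD(1)[OF J] by simp

lemma \<phi>s_J: "\<phi>s (J v) = 0"
  using inverse_moduloD(3)[OF J, of v] norm_\<phi>0 by auto

lemma J_L': "J (L' \<phi>0) = 0"
  using inverse_moduloD(2)[OF J] by (simp add: span_base)

lemma in_complement:
  assumes "J v = 0"
  shows "v = \<omega> v *\<^sub>R L' \<phi>0"
proof -
  obtain a where "v = a *\<^sub>R L' \<phi>0" using assms inverse_moduloD(2)[OF J] by (auto simp: span_singleton)
  then show ?thesis using \<omega>_L' by (simp add: blinfun.scaleR_right)
qed

end

context simple_eigenvalue
begin

lemma transversal_splitting_exists:
  obtains J \<omega> where "transversal_splitting F F' l0 \<phi>0 L' \<phi>s J \<omega>"
proof -
  let ?R = "range L0" and ?P = "blinfun_scaleR_left \<phi>0 o\<^sub>L \<phi>s"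
  have L0: "L0 \<in> Fredholm0" using Fredholm by (simp add: linearization_def)
  obtain \<omega> :: "'v \<Rightarrow>\<^sub>L real" where \<omega>: "\<omega> (L' \<phi>0) = 1" "\<And>r. r \<in> ?R \<Longrightarrow> \<omega> r = 0"
    using hahn_banach_separation[OF subspace_range_blinfun _ transversal] L0 by (auto simp: Fredholm0_def fredholm_def)
  have "\<phi>0 \<noteq> 0" using norm_\<phi>0 by auto
  then have "dim (null_space L0) = 1" unfolding ker by (intro dim_unique[of "{\<phi>0}"]) (auto simp: span_base)
  then have onto: "onto_modulo L0 {L' \<phi>0}"
    using L0 transversal by (intro codim_one_onto_modulo) (auto simp: Fredholm0_def fredholm_def fredholm_index_def)
  have ker_iff: "L0 x = 0 \<longleftrightarrow> x \<in> span {\<phi>0}" for x using ker by (auto simp: null_space_def)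
  obtain J where J: "inverse_modulo L0 {L' \<phi>0} ?P J"
  proof (rule inverse_modulo_exists[OF _ onto])
    show "L0 (?P x) \<in> span {L' \<phi>0}" for x using ker_iff[of "?P x"] by (simp add: span_zero span_scale span_base)
    show "?P x = x" if L0x: "L0 x \<in> span {L' \<phi>0}" for x
    proof -
      obtain a where a: "L0 x = a *\<^sub>R L' \<phi>0" using L0x by (auto simp: span_singleton)
      have "\<omega> (L0 x) = 0" by (rule \<omega>(2)) simp
      then have "L0 x = 0" using \<omega>(1) a by (simp add: blinfun.scaleR_right)
      then obtain b where "x = b *\<^sub>R \<phi>0" using ker_iff by (auto simp: span_singleton)
      then show ?thesis by (simp add: blinfun.scaleR_right \<phi>s_\<phi>0)
    qed
  qed simp
  with \<omega> have "transversal_splitting F F' l0 \<phi>0 L' \<phi>s J \<omega>" by unfold_locales auto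
  then show ?thesis by (rule that)
qed

lemma solutions_in_cone:
  assumes "\<theta> < 1"
  obtains \<delta> where "\<delta> > 0" "\<And>x. x \<in> solutions \<Longrightarrow> x \<noteq> p0 \<Longrightarrow> dist p0 x < \<delta> \<Longrightarrow> \<theta> * norm (snd x) < \<bar>\<phi>s (snd x)\<bar>"
proof -
  obtain J \<omega> where "transversal_splitting F F' l0 \<phi>0 L' \<phi>s J \<omega>" using transversal_splitting_exists .
  then interpret transversal_splitting F F' l0 \<phi>0 L' \<phi>s J \<omega> .
  obtain \<delta>1 where \<delta>1: "\<delta>1 > 0" "\<And>l u. (l, u) \<in> ball p0 \<delta>1 \<Longrightarrow> norm (J (F (l, u)) - J (L0 u)) \<le> (1 - \<theta>) / 2 * norm u"
    using linearization_near_trivial[of "(1 - \<theta>) / 2" l0 J] assms by auto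
  obtain \<delta>2 where \<delta>2: "\<delta>2 > 0" "\<And>l. l \<in> gen_spectrum (linearization F) \<Longrightarrow> dist l0 l < \<delta>2 \<Longrightarrow> l = l0"
    using isolated by (auto simp: isolated_in_dist_Ex_iff dist_commute)
  have "\<theta> * norm (snd x) < \<bar>\<phi>s (snd x)\<bar>" if x: "x \<in> solutions" "x \<noteq> p0" "dist p0 x < min \<delta>1 \<delta>2" for x
  proof -
    obtain l u where lu: "x = (l, u)" by (cases x)
    have "u \<noteq> 0"
    proof
      assume u: "u = 0"
      then have "l \<in> gen_spectrum (linearization F)" using x(1) lu trivial_solution_iff by (simp add: gen_spectrum_def)
      then show False using \<delta>2(2)[of l] x(2,3) lu u dist_fst_le[of p0 x] by simp
    qed
    then have "(1 - \<theta>) / 2 * norm u < (1 - \<theta>) * norm u" using assms by simp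
    moreover have "norm (u - \<phi>s u *\<^sub>R \<phi>0) \<le> (1 - \<theta>) / 2 * norm u"
      using \<delta>1(2)[of l u] x(3) lu solution_zero[OF x(1)] by (simp add: J_L0 norm_minus_commute)
    moreover have "norm u \<le> norm (u - \<phi>s u *\<^sub>R \<phi>0) + \<bar>\<phi>s u\<bar>"
      using norm_triangle_sub[of u "\<phi>s u *\<^sub>R \<phi>0"] norm_\<phi>0 by simp
    ultimately show ?thesis using lu by (simp add: left_diff_distrib)
  qed
  then show ?thesis using that[of "min \<delta>1 \<delta>2"] \<delta>1(1) \<delta>2(1) by auto
qed

definition box :: "real \<Rightarrow> real \<Rightarrow> (real \<times> 'u) set" where
  "box \<alpha> \<rho> = cball l0 \<alpha> \<times> cball 0 \<rho>"

lemma mem_box: "(l, u) \<in> box \<alpha> \<rho> \<longleftrightarrow> \<bar>l - l0\<bar> \<le> \<alpha> \<and> norm u \<le> \<rho>"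
  by (simp add: box_def dist_real_def abs_minus_commute)

lemma box_subset_ball:
  assumes "\<alpha> + \<rho> < \<delta>"
  shows "box \<alpha> \<rho> \<subseteq> ball p0 \<delta>"
proof clarify
  fix l u assume "(l, u) \<in> box \<alpha> \<rho>"
  moreover have "dist p0 (l, u) \<le> \<bar>l - l0\<bar> + norm u"
    using norm_Pair_le[of "l0 - l" "0 - u"] by (simp add: dist_norm abs_minus_commute)
  ultimately show "(l, u) \<in> ball p0 \<delta>" using assms by (simp add: mem_box)
qed

end

context transversal_splitting
begin

definition split_within :: "real \<Rightarrow> (real \<times> 'u) set \<Rightarrow> bool" where
  "split_within q X \<longleftrightarrow> (\<forall>x\<in>X. \<forall>y\<in>X.
     norm (J (F x - F y) - (snd x - snd y - \<phi>s (snd x - snd y) *\<^sub>R \<phi>0)) \<le> q * norm (x - y))"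

lemma split_within_near:
  assumes "0 < q"
  obtains \<delta> where "\<delta> > 0" "split_within q (ball p0 \<delta>)"
  using increment_near_trivial[OF assms, of l0 J] unfolding J_L0 split_within_def by metis

lemma split_within_subset: "split_within q X \<Longrightarrow> Y \<subseteq> X \<Longrightarrow> split_within q Y"
  unfolding split_within_def by blast

lemma split_within_complement:
  assumes split: "split_within q (box \<alpha> \<rho>)" and lu: "(l, u) \<in> box \<alpha> \<rho>" and J0: "J (F (l, u)) = 0"
  shows "norm (u - \<phi>s u *\<^sub>R \<phi>0) \<le> q * norm u"
proof -
  have "(l, 0) \<in> box \<alpha> \<rho>" using lu order_trans[OF norm_ge_zero, of u \<rho>] by (simp add: mem_box)
  then have "norm (J (F (l, u) - F (l, 0)) - (u - 0 - \<phi>s (u - 0) *\<^sub>R \<phi>0)) \<le> q * norm ((l, u) - (l, 0))"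
    using split lu unfolding split_within_def by fastforce
  then show ?thesis by (simp add: J0 trivial norm_Pair norm_minus_commute)
qed

lemma norm_le_level:
  assumes "norm (u - \<phi>s u *\<^sub>R \<phi>0) \<le> q * norm u" "q \<le> 1 / 8" "0 < \<phi>s u"
  shows "norm u \<le> 2 * \<phi>s u"
proof -
  have "norm u \<le> norm (u - \<phi>s u *\<^sub>R \<phi>0) + \<phi>s u"
    using norm_triangle_sub[of u "\<phi>s u *\<^sub>R \<phi>0"] norm_\<phi>0 assms(3) by simp
  moreover have "q * norm u \<le> 1 / 8 * norm u" using assms(2) by (rule mult_right_mono) simp
  ultimately show ?thesis using assms(1) norm_ge_zero[of u] by linarith
qed

lemma crossing_sign:
  assumes l: "\<bar>l - l0\<bar> = \<alpha>" "0 < \<alpha>" and u: "norm (u - \<phi>s u *\<^sub>R \<phi>0) \<le> q * norm u" "0 < \<phi>s u"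
    and q: "q \<le> 1 / 8" "norm (\<omega> o\<^sub>L L') * q \<le> 1 / 8"
    and F_near: "\<bar>\<omega> (F (l, u)) - \<omega> (linearization F l u)\<bar> \<le> \<alpha> / 16 * norm u"
    and L_near: "norm ((\<omega> o\<^sub>L linearization F l) - (l - l0) *\<^sub>R (\<omega> o\<^sub>L L')) \<le> \<alpha> / 16"
  shows "0 < \<omega> (F (l, u)) * (l - l0)"
proof -
  let ?s = "\<phi>s u" and ?T = "\<omega> o\<^sub>L L'"
  have u_le: "norm u \<le> 2 * ?s" using u q(1) by (intro norm_le_level)
  have "norm (?T (u - ?s *\<^sub>R \<phi>0)) \<le> norm ?T * (q * norm u)"
    using norm_blinfun[of ?T "u - ?s *\<^sub>R \<phi>0"] mult_left_mono[OF u(1) norm_ge_zero[of ?T]] by linarith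
  also have "\<dots> \<le> 1 / 8 * norm u"
    using mult_right_mono[OF q(2) norm_ge_zero[of u]] by (simp add: mult.assoc)
  finally have "\<bar>?T u - ?s\<bar> \<le> ?s / 4"
    using u_le by (simp add: blinfun.diff_right blinfun.scaleR_right \<omega>_L')
  then have "\<alpha> * \<bar>?T u - ?s\<bar> \<le> \<alpha> * (?s / 4)" using l(2) by (intro mult_left_mono) auto
  moreover have "\<bar>(l - l0) * ?T u - (l - l0) * ?s\<bar> = \<alpha> * \<bar>?T u - ?s\<bar>"
    by (simp add: l(1)[symmetric] abs_mult flip: right_diff_distrib)
  moreover have "norm (((\<omega> o\<^sub>L linearization F l) - (l - l0) *\<^sub>R ?T) u) \<le> \<alpha> / 16 * norm u"
    using norm_blinfun[of "(\<omega> o\<^sub>L linearization F l) - (l - l0) *\<^sub>R ?T" u] mult_right_mono[OF L_near norm_ge_zero[of u]]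
    by linarith
  then have "\<bar>\<omega> (linearization F l u) - (l - l0) * ?T u\<bar> \<le> \<alpha> / 16 * norm u"
    by (simp add: blinfun.diff_left blinfun.scaleR_left)
  moreover have "\<alpha> / 8 * norm u \<le> \<alpha> / 8 * (2 * ?s)" using u_le l(2) by (intro mult_left_mono) auto
  ultimately have near: "\<bar>\<omega> (F (l, u)) - (l - l0) * ?s\<bar> \<le> \<alpha> * ?s / 2" using F_near by linarith
  have pos: "0 < \<alpha> * ?s" using l(2) u(2) by simp
  consider "l - l0 = \<alpha>" | "l - l0 = - \<alpha>" using l(1) by linarith
  then show ?thesis
  proof cases
    case 1
    have "0 < \<omega> (F (l, u))" using near pos unfolding 1 by linarith
    then show ?thesis using 1 l(2) by simp
  next
    case 2
    have "\<omega> (F (l, u)) < 0" using near pos unfolding 2 by linarith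
    then show ?thesis using 2 l(2) by (simp add: mult_neg_pos)
  qed
qed

lemma \<omega>_linearization_near:
  assumes "0 < \<kappa>"
  obtains d where "d > 0"
    "\<And>l. \<bar>l - l0\<bar> < d \<Longrightarrow> norm ((\<omega> o\<^sub>L linearization F l) - (l - l0) *\<^sub>R (\<omega> o\<^sub>L L')) \<le> \<kappa> * \<bar>l - l0\<bar>"
proof -
  have "bounded_linear (\<lambda>A. \<omega> o\<^sub>L A)"
    by (rule bounded_bilinear.bounded_linear_right[OF bounded_bilinear_blinfun_compose])
  from bounded_linear.has_vector_derivative[OF this deriv_L]
  obtain d where "d > 0" "\<forall>l. norm (l - l0) < d \<longrightarrow>
      norm ((\<omega> o\<^sub>L linearization F l) - (\<omega> o\<^sub>L L0) - (l - l0) *\<^sub>R (\<omega> o\<^sub>L L')) \<le> \<kappa> * norm (l - l0)"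
    using assms unfolding has_vector_derivative_def has_derivative_at_alt by blast
  moreover have "\<omega> o\<^sub>L L0 = 0" by (rule blinfun_eqI) (simp add: \<omega>_L0)
  ultimately show ?thesis using that by simp
qed

lemma \<omega>_F_near_sides:
  assumes "0 < \<alpha>"
  obtains \<rho> where "\<rho> > 0"
    "\<And>l u. \<bar>l - l0\<bar> = \<alpha> \<Longrightarrow> norm u < \<rho> \<Longrightarrow> \<bar>\<omega> (F (l, u)) - \<omega> (linearization F l u)\<bar> \<le> \<alpha> / 16 * norm u"
proof -
  have "\<exists>r>0. \<forall>u. norm u < r \<longrightarrow> \<bar>\<omega> (F (l, u)) - \<omega> (linearization F l u)\<bar> \<le> \<alpha> / 16 * norm u" for l
  proof -
    obtain r where "r > 0" "\<And>l' u. (l', u) \<in> ball (l, 0) r \<Longrightarrow> norm (\<omega> (F (l', u)) - \<omega> (linearization F l u)) \<le> \<alpha> / 16 * norm u"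
      using linearization_near_trivial[of "\<alpha> / 16" l \<omega>] assms by auto
    then show ?thesis by (intro exI[of _ r]) (auto simp: dist_Pair_Pair)
  qed
  then obtain r where r: "\<And>l. r l > 0"
      "\<And>l u. norm u < r l \<Longrightarrow> \<bar>\<omega> (F (l, u)) - \<omega> (linearization F l u)\<bar> \<le> \<alpha> / 16 * norm u" by metis
  show ?thesis
  proof (rule that[of "min (r (l0 + \<alpha>)) (r (l0 - \<alpha>))"])
    fix l and u :: 'u assume "\<bar>l - l0\<bar> = \<alpha>" "norm u < min (r (l0 + \<alpha>)) (r (l0 - \<alpha>))"
    moreover from this have "l = l0 + \<alpha> \<or> l = l0 - \<alpha>" by linarith
    ultimately show "\<bar>\<omega> (F (l, u)) - \<omega> (linearization F l u)\<bar> \<le> \<alpha> / 16 * norm u" by (intro r(2)) auto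
  qed (simp add: r(1))
qed

end

locale crossing_box = transversal_splitting F F' l0 \<phi>0 L' \<phi>s J \<omega>
  for F :: "real \<times> 'u::banach \<Rightarrow> 'v::banach" and F' l0 \<phi>0 L' \<phi>s J \<omega> +
  fixes \<alpha> \<rho> :: real
  assumes size: "0 < \<alpha>" "0 < \<rho>"
    and bounded_on_box: "\<And>x. x \<in> box \<alpha> \<rho> \<Longrightarrow> norm (F x) \<le> 1"
    and split_on_box: "split_within (1 / 8) (box \<alpha> \<rho>)"
    and sign_on_box: "\<And>l u. \<bar>l - l0\<bar> = \<alpha> \<Longrightarrow> norm u \<le> \<rho> \<Longrightarrow> J (F (l, u)) = 0 \<Longrightarrow> 0 < \<phi>s u \<Longrightarrow>
      0 < \<omega> (F (l, u)) * (l - l0)"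

context transversal_splitting
begin

lemma crossing_box_exists:
  assumes "0 < \<delta>"
  obtains \<alpha> \<rho> where "crossing_box F F' l0 \<phi>0 L' \<phi>s J \<omega> \<alpha> \<rho>" "box \<alpha> \<rho> \<subseteq> ball p0 \<delta>"
proof -
  define q where "q = 1 / 8 / (norm (\<omega> o\<^sub>L L') + 1)"
  have "0 < norm (\<omega> o\<^sub>L L') + 1" by (simp add: add_nonneg_pos)
  then have q: "0 < q" "q \<le> 1 / 8" "norm (\<omega> o\<^sub>L L') * q \<le> 1 / 8" by (simp_all add: q_def divide_le_eq)
  obtain \<delta>1 where \<delta>1: "\<delta>1 > 0" "split_within q (ball p0 \<delta>1)" using split_within_near[OF q(1)] .
  have "open (F -` ball 0 1)" by (rule open_vimage[OF open_ball continuous])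
  then obtain \<delta>2 where \<delta>2: "\<delta>2 > 0" "ball p0 \<delta>2 \<subseteq> F -` ball 0 1"
    using open_contains_ball[THEN iffD1, rule_format, of "F -` ball 0 1" p0] trivial by auto
  obtain d where d: "d > 0"
      "\<And>l. \<bar>l - l0\<bar> < d \<Longrightarrow> norm ((\<omega> o\<^sub>L linearization F l) - (l - l0) *\<^sub>R (\<omega> o\<^sub>L L')) \<le> 1 / 16 * \<bar>l - l0\<bar>"
    using \<omega>_linearization_near[of "1 / 16"] by auto
  define \<epsilon> where "\<epsilon> = min \<delta> (min \<delta>1 \<delta>2)"
  have \<epsilon>: "0 < \<epsilon>" "\<epsilon> \<le> \<delta>" "\<epsilon> \<le> \<delta>1" "\<epsilon> \<le> \<delta>2" using assms \<delta>1(1) \<delta>2(1) by (auto simp: \<epsilon>_def)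
  define \<alpha> where "\<alpha> = min (\<epsilon> / 3) (d / 2)"
  have \<alpha>: "0 < \<alpha>" "\<alpha> \<le> \<epsilon> / 3" "\<alpha> < d" using \<epsilon>(1) d(1) by (auto simp: \<alpha>_def)
  obtain r where r: "r > 0"
      "\<And>l u. \<bar>l - l0\<bar> = \<alpha> \<Longrightarrow> norm u < r \<Longrightarrow> \<bar>\<omega> (F (l, u)) - \<omega> (linearization F l u)\<bar> \<le> \<alpha> / 16 * norm u"
    using \<omega>_F_near_sides[OF \<alpha>(1)] by blast
  define \<rho> where "\<rho> = min (\<epsilon> / 3) (r / 2)"
  have \<rho>: "0 < \<rho>" "\<rho> \<le> \<epsilon> / 3" "\<rho> < r" using \<epsilon>(1) r(1) by (auto simp: \<rho>_def)
  have "box \<alpha> \<rho> \<subseteq> ball p0 \<epsilon>" using \<alpha>(2) \<rho>(2) \<epsilon>(1) by (intro box_subset_ball) simp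
  then have subset: "box \<alpha> \<rho> \<subseteq> ball p0 \<delta>" "box \<alpha> \<rho> \<subseteq> ball p0 \<delta>1" "box \<alpha> \<rho> \<subseteq> ball p0 \<delta>2" using \<epsilon>(2-) by auto
  have split: "split_within q (box \<alpha> \<rho>)" using split_within_subset[OF \<delta>1(2) subset(2)] .
  have "crossing_box F F' l0 \<phi>0 L' \<phi>s J \<omega> \<alpha> \<rho>"
  proof unfold_locales
    show "0 < \<alpha>" "0 < \<rho>" by fact+
    show "norm (F x) \<le> 1" if "x \<in> box \<alpha> \<rho>" for x
    proof -
      have "F x \<in> ball 0 1" using subset(3) \<delta>2(2) that by blast
      then show ?thesis by simp
    qed
    show "split_within (1 / 8) (box \<alpha> \<rho>)"
      using split mult_right_mono[OF q(2) norm_ge_zero] unfolding split_within_def by (meson order_trans)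
    show "0 < \<omega> (F (l, u)) * (l - l0)"
      if l: "\<bar>l - l0\<bar> = \<alpha>" and u: "norm u \<le> \<rho>" "J (F (l, u)) = 0" "0 < \<phi>s u" for l u
    proof (rule crossing_sign[OF l \<alpha>(1) _ u(3) q(2,3)])
      show "norm (u - \<phi>s u *\<^sub>R \<phi>0) \<le> q * norm u"
        using l u(1) by (intro split_within_complement[OF split _ u(2)]) (simp add: mem_box)
      show "\<bar>\<omega> (F (l, u)) - \<omega> (linearization F l u)\<bar> \<le> \<alpha> / 16 * norm u"
        using l u(1) \<rho>(3) by (intro r(2)) auto
      show "norm ((\<omega> o\<^sub>L linearization F l) - (l - l0) *\<^sub>R (\<omega> o\<^sub>L L')) \<le> \<alpha> / 16"
        using d(2)[of l] l \<alpha>(3) by simp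
    qed
  qed
  then show ?thesis using subset(1) by (rule that)
qed

end

locale continuation_domain = crossing_box F F' l0 \<phi>0 L' \<phi>s J \<omega> \<alpha> \<rho>
  for F :: "real \<times> 'u::banach \<Rightarrow> 'v::banach" and F' l0 \<phi>0 L' \<phi>s J \<omega> \<alpha> \<rho> +
  fixes W B :: "(real \<times> 'u) set" and s0 s1 :: real
  assumes W: "open W" "box \<alpha> \<rho> \<subseteq> W" and B: "compact B" "B \<subseteq> W"
    and zeros_in_B: "\<And>x. x \<in> W \<Longrightarrow> F x = 0 \<Longrightarrow> s0 \<le> \<phi>s (snd x) \<Longrightarrow> \<phi>s (snd x) \<le> s1 \<Longrightarrow> x \<in> B"
    and low_level: "\<And>x. x \<in> B \<Longrightarrow> s0 \<le> \<phi>s (snd x) \<Longrightarrow> \<phi>s (snd x) \<le> 2 * s0 \<Longrightarrow> x \<in> ball l0 \<alpha> \<times> ball 0 \<rho>"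
    and levels: "0 < s0" "3 * s0 \<le> \<rho>" "s0 \<le> s1"
begin

definition domain :: "(real \<times> 'u) set" where
  "domain = W \<inter> {x. s0 / 2 < \<phi>s (snd x)} \<inter> ({x. 2 * s0 < \<phi>s (snd x)} \<union> ball l0 \<alpha> \<times> ball 0 \<rho>)"

definition level :: "real \<Rightarrow> real \<times> 'u \<Rightarrow> real" where
  "level t x = \<phi>s (snd x) - (s0 + max 0 (t - 1) * (s1 - s0))"

definition shift :: "real \<Rightarrow> real \<times> 'u \<Rightarrow> real" where
  "shift t x = max 0 (1 - t) * ((fst x - l0) * s0 - \<omega> (F x))"

text \<open>
  For \<open>t \<le> 1\<close> the homotopy replaces \<open>\<langle>\<omega>, F\<rangle>\<close> by the model \<open>(l - l0) s0\<close>; for \<open>t \<ge> 1\<close> it raises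
  the level of \<open>\<phi>s\<close> from \<open>s0\<close> to \<open>s1\<close>.
\<close>

definition homotopy :: "real \<Rightarrow> real \<times> 'u \<Rightarrow> real \<times> 'v" where
  "homotopy t x = (level t x, F x + shift t x *\<^sub>R L' \<phi>0)"

definition crossing_zeros :: "(real \<times> 'u) set" where
  "crossing_zeros = {x\<in>box \<alpha> \<rho>. F x \<in> (\<lambda>a. a *\<^sub>R L' \<phi>0) ` {- norm \<omega>..norm \<omega>}} \<inter>
     {x. \<phi>s (snd x) = s0} \<inter> {x. \<omega> (F x) * (fst x - l0) \<le> 0}"

definition raised_zeros :: "(real \<times> 'u) set" where
  "raised_zeros = B \<inter> {x. s0 \<le> \<phi>s (snd x)}"

lemma open_domain: "open domain"
  unfolding domain_def
  by (intro open_Int open_Un W(1) open_Collect_less open_Times open_ball continuous_intros)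

lemma compact_crossing_zeros: "compact crossing_zeros"
proof -
  have "closed (box \<alpha> \<rho>)" "bounded (box \<alpha> \<rho>)"
    by (simp_all add: box_def closed_Times bounded_Times)
  moreover have "compact ((\<lambda>a. a *\<^sub>R L' \<phi>0) ` {- norm \<omega>..norm \<omega>})"
    by (intro compact_continuous_image continuous_intros compact_Icc)
  ultimately have "compact {x\<in>box \<alpha> \<rho>. F x \<in> (\<lambda>a. a *\<^sub>R L' \<phi>0) ` {- norm \<omega>..norm \<omega>}}"
    using proper unfolding proper_on_closed_bounded_def by blast
  then show ?thesis unfolding crossing_zeros_def
    by (intro compact_Int_closed closed_Collect_eq closed_Collect_le continuous_intros continuous)
qed

lemma compact_raised_zeros: "compact raised_zeros"
  unfolding raised_zeros_def by (intro compact_Int_closed B closed_Collect_le continuous_intros)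

lemma crossing_zeros_in_domain: "crossing_zeros \<subseteq> domain"
proof clarify
  fix l u assume crossing: "(l, u) \<in> crossing_zeros"
  then obtain a where "F (l, u) = a *\<^sub>R L' \<phi>0" by (auto simp: crossing_zeros_def)
  then have J0: "J (F (l, u)) = 0" by (simp add: J_L' blinfun.scaleR_right)
  have box: "(l, u) \<in> box \<alpha> \<rho>" and s: "\<phi>s u = s0" and sign: "\<omega> (F (l, u)) * (l - l0) \<le> 0"
    using crossing by (auto simp: crossing_zeros_def)
  have "norm u \<le> 2 * \<phi>s u"
    using split_within_complement[OF split_on_box box J0] levels(1) s by (intro norm_le_level[of _ "1 / 8"]) auto
  then have norm_u: "norm u < \<rho>" using s levels by simp
  then have "\<bar>l - l0\<bar> \<noteq> \<alpha>" using sign_on_box[of l u] J0 s sign levels(1) by force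
  then have "(l, u) \<in> ball l0 \<alpha> \<times> ball 0 \<rho>" using box norm_u by (simp add: mem_box dist_real_def abs_minus_commute)
  then show "(l, u) \<in> domain" using box W(2) s levels(1) by (auto simp: domain_def)
qed

lemma raised_zeros_in_domain: "raised_zeros \<subseteq> domain"
proof
  fix x assume "x \<in> raised_zeros"
  then show "x \<in> domain" using low_level[of x] B(2) levels(1)
    by (cases "\<phi>s (snd x) \<le> 2 * s0") (auto simp: raised_zeros_def domain_def)
qed

lemma level_in_box:
  assumes "x \<in> domain" "\<phi>s (snd x) \<le> 2 * s0"
  shows "x \<in> box \<alpha> \<rho>"
  using assms by (auto simp: domain_def box_def)

lemma homotopy_zero_before:
  assumes t: "0 \<le> t" "t \<le> 1" and x: "x \<in> domain" and zero: "homotopy t x = 0"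
  shows "x \<in> crossing_zeros"
proof -
  have s: "\<phi>s (snd x) = s0" and eq: "F x + ((1 - t) * ((fst x - l0) * s0 - \<omega> (F x))) *\<^sub>R L' \<phi>0 = 0"
    using zero t by (simp_all add: homotopy_def level_def shift_def zero_prod_def)
  have box: "x \<in> box \<alpha> \<rho>" using x s levels(1) by (intro level_in_box) auto
  have "F x = (- ((1 - t) * ((fst x - l0) * s0 - \<omega> (F x)))) *\<^sub>R L' \<phi>0" using eq by (simp add: eq_neg_iff_add_eq_0)
  then have "J (F x) = 0" by (metis J_L' blinfun.scaleR_right scaleR_zero_right)
  then have F_eq: "F x = \<omega> (F x) *\<^sub>R L' \<phi>0" by (rule in_complement)
  have "\<omega> (F x) + (1 - t) * ((fst x - l0) * s0 - \<omega> (F x)) = 0"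
    using arg_cong[OF eq, of \<omega>] by (simp add: blinfun.add_right blinfun.scaleR_right \<omega>_L')
  then have balance: "t * \<omega> (F x) = - ((1 - t) * s0 * (fst x - l0))" by (simp add: algebra_simps)
  have "\<omega> (F x) * (fst x - l0) \<le> 0"
  proof (cases "t = 0")
    case True
    then show ?thesis using balance levels(1) by simp
  next
    case False
    have "t * (\<omega> (F x) * (fst x - l0)) = - ((1 - t) * s0 * ((fst x - l0) * (fst x - l0)))"
      using arg_cong[OF balance, of "\<lambda>r. r * (fst x - l0)"] by (simp add: mult.assoc)
    also have "\<dots> \<le> 0" using t levels(1) by simp
    finally show ?thesis using False t(1) by (simp add: mult_le_0_iff)
  qed
  moreover have "\<bar>\<omega> (F x)\<bar> \<le> norm \<omega>"
    using norm_blinfun[of \<omega> "F x"] mult_left_mono[OF bounded_on_box[OF box] norm_ge_zero[of \<omega>]] by simp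
  then have "F x \<in> (\<lambda>a. a *\<^sub>R L' \<phi>0) ` {- norm \<omega>..norm \<omega>}"
    using F_eq by (intro image_eqI[of _ _ "\<omega> (F x)"]) auto
  ultimately show ?thesis using box s by (simp add: crossing_zeros_def)
qed

lemma homotopy_zero_after:
  assumes t: "1 \<le> t" "t \<le> 2" and x: "x \<in> domain" and zero: "homotopy t x = 0"
  shows "x \<in> raised_zeros"
proof -
  have "F x = 0" and "\<phi>s (snd x) = s0 + (t - 1) * (s1 - s0)"
    using zero t by (simp_all add: homotopy_def level_def shift_def zero_prod_def)
  moreover have "0 \<le> (t - 1) * (s1 - s0)" using t levels by (intro mult_nonneg_nonneg) auto
  moreover have "(t - 1) * (s1 - s0) \<le> 1 * (s1 - s0)" using t levels by (intro mult_right_mono) auto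
  ultimately show ?thesis using x zeros_in_B[of x] by (simp add: raised_zeros_def domain_def)
qed

lemma homotopy_start: "homotopy 0 x = (\<phi>s (snd x) - s0, F x + ((fst x - l0) * s0 - \<omega> (F x)) *\<^sub>R L' \<phi>0)"
  by (simp add: homotopy_def level_def shift_def)

lemma start_zero_exists:
  obtains z where "z \<in> domain" "homotopy 0 z = 0"
proof -
  define f where "f w = J (F (l0, s0 *\<^sub>R \<phi>0 + w))" for w
  have norm_le: "norm (s0 *\<^sub>R \<phi>0 + w) \<le> 2 * s0" if "w \<in> cball 0 s0" for w
    using norm_triangle_ineq[of "s0 *\<^sub>R \<phi>0" w] that norm_\<phi>0 levels(1) by simp
  have in_box: "(l0, s0 *\<^sub>R \<phi>0 + w) \<in> box \<alpha> \<rho>" if "w \<in> cball 0 s0" for w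
    using norm_le[OF that] levels size by (simp add: mem_box)
  have zero_box: "(l0, 0) \<in> box \<alpha> \<rho>" using size by (simp add: mem_box)
  obtain w where w: "w \<in> null_space \<phi>s" "norm w \<le> s0" "f w = 0"
  proof (rule perturbed_identity_zero[of "null_space \<phi>s" "1 / 8" s0 f])
    show "subspace (null_space \<phi>s)"
      by (auto simp: subspace_def null_space_def blinfun.add_right blinfun.scaleR_right)
    show "closed (null_space \<phi>s)"
      unfolding null_space_def by (intro closed_Collect_eq continuous_intros)
    show "f w \<in> null_space \<phi>s" for w by (simp add: f_def null_space_def \<phi>s_J)
    show "norm (f 0) \<le> (1 - 1 / 8) * s0"
      using split_on_box[unfolded split_within_def, rule_format, OF in_box[of 0] zero_box] levels(1)
      by (simp add: f_def trivial norm_Pair norm_\<phi>0 \<phi>s_\<phi>0 blinfun.scaleR_right)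
    show "norm (f x - f y - (x - y)) \<le> 1 / 8 * norm (x - y)"
      if x: "x \<in> null_space \<phi>s \<inter> cball 0 s0" and y: "y \<in> null_space \<phi>s \<inter> cball 0 s0" for x y
      using split_on_box[unfolded split_within_def, rule_format, OF in_box[of x] in_box[of y]] x y
      by (simp add: f_def null_space_def norm_Pair blinfun.diff_right)
  qed (use levels in auto)
  let ?z = "(l0, s0 *\<^sub>R \<phi>0 + w)"
  have level: "\<phi>s (snd ?z) = s0" using w(1) by (simp add: null_space_def blinfun.add_right blinfun.scaleR_right \<phi>s_\<phi>0)
  have "F ?z = \<omega> (F ?z) *\<^sub>R L' \<phi>0" using w(3) by (intro in_complement) (simp add: f_def)
  then have "homotopy 0 ?z = 0" using level by (simp add: homotopy_start zero_prod_def)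
  moreover have "norm (s0 *\<^sub>R \<phi>0 + w) < \<rho>" using norm_le[of w] w(2) levels by simp
  then have "?z \<in> domain" using in_box[of w] w(2) W(2) level size levels(1) by (auto simp: domain_def)
  ultimately show ?thesis using that by blast
qed

lemma start_expansion:
  assumes xy: "x \<in> box \<alpha> \<rho>" "y \<in> box \<alpha> \<rho>"
  shows "norm (x - y) \<le> 2 * (norm J + 1 + norm \<omega> / s0) * norm (homotopy 0 x - homotopy 0 y)"
proof -
  define a v where "a = fst x - fst y" and "v = snd x - snd y"
  define w where "w = (F x - F y) + (a * s0 - \<omega> (F x - F y)) *\<^sub>R L' \<phi>0"
  let ?G = "norm (homotopy 0 x - homotopy 0 y)"
  have diff: "homotopy 0 x - homotopy 0 y = (\<phi>s v, w)"
    by (simp add: homotopy_start a_def v_def w_def blinfun.diff_right algebra_simps)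
  have level_le: "\<bar>\<phi>s v\<bar> \<le> ?G" and w_le: "norm w \<le> ?G"
    using norm_fst_le[of "\<phi>s v" w] norm_snd_le[of w "\<phi>s v"] by (simp_all add: diff)
  have "\<omega> w = a * s0" by (simp add: w_def blinfun.add_right blinfun.scaleR_right \<omega>_L')
  then have "\<bar>a\<bar> * s0 \<le> norm \<omega> * ?G"
    using norm_blinfun[of \<omega> w] mult_left_mono[OF w_le norm_ge_zero[of \<omega>]] levels(1) by (simp add: abs_mult)
  then have a_le: "\<bar>a\<bar> \<le> norm \<omega> / s0 * ?G" using levels(1) by (simp add: pos_le_divide_eq)
  have "J w = J (F x - F y)" by (simp add: w_def blinfun.add_right blinfun.scaleR_right J_L')
  then have "norm (J w - (v - \<phi>s v *\<^sub>R \<phi>0)) \<le> 1 / 8 * norm (x - y)"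
    using split_on_box xy by (simp add: split_within_def v_def)
  moreover have "norm (J w) \<le> norm J * ?G"
    using norm_blinfun[of J w] mult_left_mono[OF w_le norm_ge_zero[of J]] by linarith
  moreover have "norm (v - \<phi>s v *\<^sub>R \<phi>0) \<le> norm (J w) + norm (J w - (v - \<phi>s v *\<^sub>R \<phi>0))"
    by (metis norm_minus_commute norm_triangle_sub)
  moreover have "norm v \<le> norm (v - \<phi>s v *\<^sub>R \<phi>0) + \<bar>\<phi>s v\<bar>"
    using norm_triangle_sub[of v "\<phi>s v *\<^sub>R \<phi>0"] norm_\<phi>0 by simp
  moreover have "norm (x - y) \<le> \<bar>a\<bar> + norm v"
    using norm_Pair_le[of "fst (x - y)" "snd (x - y)"] unfolding prod.collapse by (simp add: a_def v_def)
  moreover define C where "C = norm J * ?G + ?G + norm \<omega> / s0 * ?G"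
  ultimately have "norm (x - y) \<le> C + 1 / 8 * norm (x - y)"
    using level_le a_le by linarith
  then have "norm (x - y) \<le> 2 * C" using norm_ge_zero[of "x - y"] by linarith
  then show ?thesis by (simp add: C_def algebra_simps)
qed

lemma start_zero_unique:
  assumes z: "z \<in> domain" "homotopy 0 z = 0"
  shows "zeros_on domain (homotopy 0) = {z}"
proof -
  have "x \<in> box \<alpha> \<rho>" if "x \<in> domain" "homotopy 0 x = 0" for x
    using that levels(1) by (intro level_in_box) (auto simp: homotopy_start zero_prod_def)
  then have "x = z" if "x \<in> domain" "homotopy 0 x = 0" for x
    using start_expansion[of x z] that z by simp
  then show ?thesis using z unfolding zeros_on_def by blast
qed

lemma start_C1_map: "\<exists>h'. C1_map (homotopy 0) h'"
proof -
  define A :: "'v \<Rightarrow>\<^sub>L (real \<times> 'v)" where "A = Blinfun (\<lambda>v. (0, v - \<omega> v *\<^sub>R L' \<phi>0))"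
  define D :: "(real \<times> 'u) \<Rightarrow>\<^sub>L (real \<times> 'v)" where "D = Blinfun (\<lambda>x. (\<phi>s (snd x), (fst x * s0) *\<^sub>R L' \<phi>0))"
  have "bounded_linear (\<lambda>v :: 'v. (0 :: real, v - \<omega> v *\<^sub>R L' \<phi>0))"
    by (intro bounded_linear_Pair bounded_linear_zero bounded_linear_sub bounded_linear_ident
      bounded_linear_compose[OF bounded_linear_scaleR_left] blinfun.bounded_linear_right)
  then have A: "A v = (0, v - \<omega> v *\<^sub>R L' \<phi>0)" for v by (simp add: A_def bounded_linear_Blinfun_apply)
  have "bounded_linear (\<lambda>x :: real \<times> 'u. (\<phi>s (snd x), (fst x * s0) *\<^sub>R L' \<phi>0))"
    by (intro bounded_linear_Pair bounded_linear_compose[OF blinfun.bounded_linear_right] bounded_linear_snd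
      bounded_linear_compose[OF bounded_linear_scaleR_left] bounded_linear_compose[OF bounded_linear_mult_left bounded_linear_fst])
  then have D: "D x = (\<phi>s (snd x), (fst x * s0) *\<^sub>R L' \<phi>0)" for x by (simp add: D_def bounded_linear_Blinfun_apply)
  have eq: "homotopy 0 = (\<lambda>x. A (F x) + D x - (s0, (l0 * s0) *\<^sub>R L' \<phi>0))"
    by (auto simp: fun_eq_iff homotopy_start A D algebra_simps)
  have "C1_map (homotopy 0) (\<lambda>x. (A o\<^sub>L F' x) + D)"
  proof
    show "(homotopy 0 has_derivative (A o\<^sub>L F' x) + D) (at x)" for x
      unfolding eq by (auto intro!: derivative_eq_intros deriv simp: blinfun.add_left fun_eq_iff)
    show "continuous_on UNIV (\<lambda>x. (A o\<^sub>L F' x) + D)" by (intro continuous_intros continuous_deriv)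
  qed
  then show ?thesis by blast
qed

lemma start_regular:
  assumes z: "z \<in> domain" "homotopy 0 z = 0"
  shows "regular_zero domain (homotopy 0) z"
proof -
  let ?U = "domain \<inter> {x. \<phi>s (snd x) < 2 * s0}" and ?C = "2 * (norm J + 1 + norm \<omega> / s0)"
  have C: "0 < ?C" using levels(1) by (simp add: add_nonneg_pos add_pos_nonneg)
  have "open ?U" by (intro open_Int open_domain open_Collect_less continuous_intros)
  moreover have "z \<in> ?U" using z levels(1) by (simp add: homotopy_start zero_prod_def)
  ultimately obtain \<delta> where \<delta>: "\<delta> > 0" "ball z \<delta> \<subseteq> ?U" using open_contains_ball by meson
  have in_box: "x \<in> box \<alpha> \<rho>" if "x \<in> ball z \<delta>" for x
    using subsetD[OF \<delta>(2) that] by (intro level_in_box) auto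
  have "1 / ?C * norm (x - y) \<le> norm (homotopy 0 x - homotopy 0 y)" if "x \<in> ball z \<delta>" "y \<in> ball z \<delta>" for x y
    using start_expansion[OF in_box[OF that(1)] in_box[OF that(2)]] C by (simp add: divide_le_eq mult.commute)
  then have "bounded_below_near domain (homotopy 0) z"
    unfolding bounded_below_near_def using C \<delta>(1) by (intro exI[of _ "1 / ?C"] exI[of _ \<delta>] conjI) auto
  then show ?thesis using start_C1_map C1_map.strict_derivative unfolding regular_zero_def by blast
qed

theorem reaches_level: "\<exists>x\<in>W. F x = 0 \<and> \<phi>s (snd x) = s1"
proof -
  obtain z where z: "z \<in> domain" "homotopy 0 z = 0" using start_zero_exists .
  let ?K = "crossing_zeros \<union> raised_zeros"
  have K: "compact ?K" "?K \<subseteq> domain"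
    using compact_crossing_zeros compact_raised_zeros crossing_zeros_in_domain raised_zeros_in_domain by auto
  have zeros: "x \<in> ?K" if "t \<in> {0..2}" "x \<in> domain" "homotopy t x = 0" for t x
    using that homotopy_zero_before[of t x] homotopy_zero_after[of t x] by (cases "t \<le> 1") auto
  have "continuous_on ({0..2} \<times> domain) (\<lambda>(t, x). level t x)" "continuous_on ({0..2} \<times> domain) (\<lambda>(t, x). shift t x)"
    unfolding level_def shift_def split_beta
    by (intro continuous_intros continuous_on_compose2[OF continuous[of UNIV]] subset_UNIV)+
  from homotopy_along_vector_zero[OF open_domain K _ this, of "L' \<phi>0" z] zeros
    start_zero_unique[OF z] start_regular[OF z]
  have "\<exists>x\<in>domain. homotopy 2 x = 0" unfolding homotopy_def[abs_def] by simp
  then show ?thesis by (auto simp: domain_def homotopy_def level_def shift_def zero_prod_def)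
qed

end

lemma compact_closed_separation:
  fixes B T :: "'a::metric_space set"
  assumes B: "compact B" and T: "closed T" "B \<inter> T = {}"
  obtains W where "open W" "bounded W" "B \<subseteq> W" "closure W \<inter> T = {}"
proof -
  obtain U V where UV: "open U" "open V" "B \<subseteq> U" "T \<subseteq> V" "U \<inter> V = {}"
    using t4_space[OF compact_imp_closed[OF B] T] by blast
  obtain r where r: "B \<subseteq> ball undefined r"
    using bounded_subset_ballD[OF compact_imp_bounded[OF B]] by blast
  have "closure U \<subseteq> - V" using UV(2,5) by (intro closure_minimal) auto
  then have "closure (U \<inter> ball undefined r) \<inter> T = {}" using UV(4) closure_mono[of "U \<inter> ball undefined r" U] by blast
  then show ?thesis using UV(1,3) r by (intro that[of "U \<inter> ball undefined r"]) (auto intro: bounded_subset)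
qed

lemma compact_sublevel_subset:
  fixes f :: "'a::topological_space \<Rightarrow> real"
  assumes B: "compact B" and U: "open U" and f: "continuous_on B f" "\<And>x. x \<in> B - U \<Longrightarrow> 0 < f x"
  obtains m where "m > 0" "\<And>x. x \<in> B \<Longrightarrow> f x < m \<Longrightarrow> x \<in> U"
proof (cases "B - U = {}")
  case True
  then show ?thesis using that[of 1] by auto
next
  case False
  obtain b where b: "b \<in> B - U" "\<And>x. x \<in> B - U \<Longrightarrow> f b \<le> f x"
    using continuous_attains_inf[OF compact_diff[OF B U] False continuous_on_subset[OF f(1)]] by auto
  then show ?thesis using f(2)[OF b(1)] by (intro that[of "f b"]) fastforce+
qed

context simple_eigenvalue
begin

definition positive_solutions :: "(real \<times> 'u) set" where
  "positive_solutions = solutions \<inter> {x. 0 \<le> \<phi>s (snd x)}"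

theorem compact_open_part_meets_hyperplane:
  assumes B: "compact B" "B \<subseteq> positive_solutions" "closed (positive_solutions - B)" and p0: "p0 \<in> B"
  shows "\<exists>x\<in>B. x \<noteq> p0 \<and> \<phi>s (snd x) = 0"
proof (rule ccontr)
  assume "\<not> ?thesis"
  then have positive: "0 < \<phi>s (snd x)" if "x \<in> B" "x \<noteq> p0" for x
    using that B(2) by (force simp: positive_solutions_def)
  obtain W where W: "open W" "bounded W" "B \<subseteq> W" "closure W \<inter> (positive_solutions - B) = {}"
    using compact_closed_separation[OF B(1,3)] by blast
  obtain \<delta> where \<delta>: "\<delta> > 0" "ball p0 \<delta> \<subseteq> W" using open_contains_ball[THEN iffD1, OF W(1)] W(3) p0 by blast
  obtain J \<omega> where "transversal_splitting F F' l0 \<phi>0 L' \<phi>s J \<omega>" using transversal_splitting_exists .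
  then interpret transversal_splitting F F' l0 \<phi>0 L' \<phi>s J \<omega> .
  obtain \<alpha> \<rho> where box: "crossing_box F F' l0 \<phi>0 L' \<phi>s J \<omega> \<alpha> \<rho>" "box \<alpha> \<rho> \<subseteq> ball p0 \<delta>"
    using crossing_box_exists[OF \<delta>(1)] .
  interpret crossing_box F F' l0 \<phi>0 L' \<phi>s J \<omega> \<alpha> \<rho> by (rule box(1))
  obtain m where m: "m > 0" "\<And>x. x \<in> B \<Longrightarrow> \<phi>s (snd x) < m \<Longrightarrow> x \<in> ball l0 \<alpha> \<times> ball 0 \<rho>"
  proof (rule compact_sublevel_subset[OF B(1)])
    show "open (ball l0 \<alpha> \<times> ball (0 :: 'u) \<rho>)" by (intro open_Times open_ball)
    show "continuous_on B (\<lambda>x. \<phi>s (snd x))" by (intro continuous_intros)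
    show "0 < \<phi>s (snd x)" if "x \<in> B - ball l0 \<alpha> \<times> ball 0 \<rho>" for x
      using that size by (intro positive) auto
  qed (use that in blast)
  obtain R where R: "\<And>x. x \<in> W \<Longrightarrow> norm x \<le> R" using W(2) by (auto simp: bounded_iff)
  have below: "\<phi>s (snd x) < norm \<phi>s * R + 1" if "x \<in> W" for x
  proof -
    have "norm (snd x) \<le> R" using R[OF that] norm_snd_le[of "snd x" "fst x"] by simp
    then show ?thesis
      using norm_blinfun[of \<phi>s "snd x"] mult_left_mono[of "norm (snd x)" R "norm \<phi>s"] by (simp add: abs_le_iff)
  qed
  define s0 where "s0 = min (\<rho> / 3) (m / 3)"
  define s1 where "s1 = max s0 (norm \<phi>s * R + 1)"
  have s0: "0 < s0" "3 * s0 \<le> \<rho>" "2 * s0 < m" using size m(1) by (auto simp: s0_def)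
  have in_B: "x \<in> B" if "x \<in> W" "F x = 0" "s0 \<le> \<phi>s (snd x)" for x
  proof -
    have "snd x \<noteq> 0" using that(3) s0(1) by auto
    then have "x \<in> positive_solutions" using that s0(1) zero_solution by (simp add: positive_solutions_def)
    then show ?thesis using W(4) closure_subset[of W] that(1) by blast
  qed
  interpret continuation_domain F F' l0 \<phi>0 L' \<phi>s J \<omega> \<alpha> \<rho> W B s0 s1
    by unfold_locales (use W(1,3) B(1) box(2) \<delta>(2) in_B m(2) s0 in \<open>auto simp: s1_def\<close>)
  show False using reaches_level below unfolding s1_def by fastforce
qed

end

section \<open>Connected branches in metric spaces\<close>

definition boundedly_compact :: "'a::metric_space set \<Rightarrow> bool" where
  "boundedly_compact A \<longleftrightarrow> (\<forall>C\<subseteq>A. closed C \<and> bounded C \<longrightarrow> compact C)"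

definition compact_open_part :: "'a::metric_space set \<Rightarrow> 'a \<Rightarrow> 'a set \<Rightarrow> bool" where
  "compact_open_part A p B \<longleftrightarrow> compact B \<and> B \<subseteq> A \<and> closed (A - B) \<and> p \<in> B"

definition linked :: "'a::metric_space set \<Rightarrow> 'a \<Rightarrow> 'a set \<Rightarrow> bool" where
  "linked A p Y \<longleftrightarrow> closed A \<and> p \<in> A \<and> (\<forall>B. compact_open_part A p B \<longrightarrow> B \<inter> Y \<noteq> {})"

lemma linkedD:
  assumes "linked A p Y"
  shows "closed A" "p \<in> A" "compact_open_part A p B \<Longrightarrow> B \<inter> Y \<noteq> {}"
  using assms by (auto simp: linked_def)

lemma boundedly_compact_subset: "boundedly_compact A \<Longrightarrow> B \<subseteq> A \<Longrightarrow> boundedly_compact B"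
  by (auto simp: boundedly_compact_def)

lemma Inter_chain_meets:
  fixes \<A> :: "'a::topological_space set set"
  assumes chain: "\<And>A B. A \<in> \<A> \<Longrightarrow> B \<in> \<A> \<Longrightarrow> A \<subseteq> B \<or> B \<subseteq> A"
    and closed: "\<And>A. A \<in> \<A> \<Longrightarrow> closed A" and A0: "A0 \<in> \<A>" "compact (A0 \<inter> K)"
    and meets: "\<And>A. A \<in> \<A> \<Longrightarrow> A \<inter> K \<noteq> {}"
  shows "\<Inter>\<A> \<inter> K \<noteq> {}"
proof -
  have "A0 \<inter> K \<inter> \<Inter>\<F> \<noteq> {}" if \<F>: "finite \<F>" "\<F> \<subseteq> \<A>" for \<F>
  proof -
    have "\<exists>A\<in>insert A0 \<F>. \<forall>B\<in>insert A0 \<F>. B \<subseteq> A \<longrightarrow> A = B"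
      using \<F>(1) by (intro finite_has_minimal) auto
    then obtain A where A: "A \<in> insert A0 \<F>" "\<And>B. B \<in> insert A0 \<F> \<Longrightarrow> B \<subseteq> A \<Longrightarrow> A = B" by blast
    have "A \<in> \<A>" using A(1) A0(1) \<F>(2) by blast
    moreover have "A \<subseteq> B" if "B \<in> insert A0 \<F>" for B
    proof -
      have "B \<in> \<A>" using that A0(1) \<F>(2) by blast
      then show ?thesis using chain[OF \<open>A \<in> \<A>\<close>, of B] A(2)[OF that] by auto
    qed
    then have "A \<subseteq> A0 \<inter> \<Inter>\<F>" by (simp add: Inter_greatest)
    ultimately show ?thesis using meets[of A] by blast
  qed
  from compact_imp_fip[OF A0(2) closed this] show ?thesis using A0(1) by blast
qed

lemma linked_Inter_chain:
  assumes ne: "\<A> \<noteq> {}" and chain: "\<And>A B. A \<in> \<A> \<Longrightarrow> B \<in> \<A> \<Longrightarrow> A \<subseteq> B \<or> B \<subseteq> A"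
    and linked: "\<And>A. A \<in> \<A> \<Longrightarrow> linked A p Y" and compact: "\<And>A. A \<in> \<A> \<Longrightarrow> boundedly_compact A" and Y: "closed Y"
  shows "linked (\<Inter>\<A>) p Y"
  unfolding linked_def
proof (intro conjI allI impI)
  show "closed (\<Inter>\<A>)" "p \<in> \<Inter>\<A>" using linkedD(1,2)[OF linked] by auto
  fix B assume "compact_open_part (\<Inter>\<A>) p B"
  then have B: "compact B" "B \<subseteq> \<Inter>\<A>" "closed (\<Inter>\<A> - B)" "p \<in> B" by (auto simp: compact_open_part_def)
  show "B \<inter> Y \<noteq> {}"
  proof
    assume "B \<inter> Y = {}"
    then have "B \<inter> (\<Inter>\<A> - B \<union> Y) = {}" by blast
    then obtain W where W: "open W" "bounded W" "B \<subseteq> W" "closure W \<inter> (\<Inter>\<A> - B \<union> Y) = {}"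
      using compact_closed_separation[OF B(1) closed_Un[OF B(3) Y]] by blast
    have compact_part: "compact (A \<inter> C)" if "A \<in> \<A>" "closed C" "C \<subseteq> closure W" for A C
      using compact[OF that(1)] linkedD(1)[OF linked[OF that(1)]] that(2) bounded_subset[OF bounded_closure[OF W(2)] that(3)]
      by (auto simp: boundedly_compact_def intro: bounded_subset)
    have "\<exists>A\<in>\<A>. A \<inter> (closure W - W) = {}"
    proof (rule ccontr)
      assume meets: "\<not> ?thesis"
      obtain A0 where A0: "A0 \<in> \<A>" using ne by blast
      have "\<Inter>\<A> \<inter> (closure W - W) \<noteq> {}"
      proof (rule Inter_chain_meets[OF chain _ A0])
        show "compact (A0 \<inter> (closure W - W))" using A0 W(1) by (intro compact_part) auto
        show "closed A" "A \<inter> (closure W - W) \<noteq> {}" if "A \<in> \<A>" for A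
          using that linkedD(1)[OF linked] meets by blast+
      qed
      then show False using W(3,4) by blast
    qed
    then obtain A where A: "A \<in> \<A>" "A \<inter> (closure W - W) = {}" by blast
    have "A - A \<inter> closure W = A - W" using A(2) closure_subset[of W] by blast
    then have "closed (A - A \<inter> closure W)" using linkedD(1)[OF linked[OF A(1)]] W(1) by (simp add: closed_Diff)
    moreover have "p \<in> A \<inter> closure W" using A(1) B(2,4) W(3) closure_subset[of W] by blast
    ultimately have "compact_open_part A p (A \<inter> closure W)"
      using compact_part[OF A(1)] by (simp add: compact_open_part_def)
    from linkedD(3)[OF linked[OF A(1)] this] show False using W(4) by blast
  qed
qed

locale minimal_linked =
  fixes M Y :: "'a::metric_space set" and p :: 'a
  assumes linked: "linked M p Y" and minimal: "\<And>X. X \<subseteq> M \<Longrightarrow> linked X p Y \<Longrightarrow> X = M"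
    and compact: "boundedly_compact M" and Y: "closed Y" "p \<notin> Y"

lemma minimal_linked_exists:
  assumes A: "linked A p Y" "boundedly_compact A" and Y: "closed Y" "p \<notin> Y"
  obtains M where "M \<subseteq> A" "minimal_linked M Y p"
proof -
  let ?\<L> = "{X. X \<subseteq> A \<and> linked X p Y}"
  have "\<exists>M\<in>?\<L>. \<forall>X\<in>?\<L>. X \<subseteq> M \<longrightarrow> X = M"
  proof (rule predicate_Zorn[where P = "\<lambda>X Z. Z \<subseteq> X"])
    show "partial_order_on ?\<L> (relation_of (\<lambda>X Z. Z \<subseteq> X) ?\<L>)"
      by (rule partial_order_on_relation_ofI) auto
    fix \<C> assume "\<C> \<in> Chains (relation_of (\<lambda>X Z. Z \<subseteq> X) ?\<L>)"
    then have sub: "\<C> \<subseteq> ?\<L>" and chain: "\<And>X Z. X \<in> \<C> \<Longrightarrow> Z \<in> \<C> \<Longrightarrow> X \<subseteq> Z \<or> Z \<subseteq> X"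
      by (auto simp: Chains_def relation_of_def)
    show "\<exists>U\<in>?\<L>. \<forall>X\<in>\<C>. U \<subseteq> X"
    proof (cases "\<C> = {}")
      case True
      then show ?thesis using A(1) by blast
    next
      case False
      have "linked (\<Inter>\<C>) p Y"
      proof (rule linked_Inter_chain[OF False chain _ _ Y(1)])
        show "linked X p Y" "boundedly_compact X" if "X \<in> \<C>" for X
          using that sub boundedly_compact_subset[OF A(2)] by blast+
      qed
      then have "\<Inter>\<C> \<in> ?\<L>" using False sub by blast
      then show ?thesis by (intro bexI[of _ "\<Inter>\<C>"]) auto
    qed
  qed
  then obtain M where M: "M \<subseteq> A" "linked M p Y" "\<forall>X\<in>?\<L>. X \<subseteq> M \<longrightarrow> X = M" by auto
  have "minimal_linked M Y p"
  proof
    show "X = M" if "X \<subseteq> M" "linked X p Y" for X using that M(1,3) by simp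
  qed (use M(2) boundedly_compact_subset[OF A(2) M(1)] Y in auto)
  with M(1) show ?thesis by (rule that)
qed

context minimal_linked
begin

definition branch :: "'a set" where
  "branch = M - {p} - Y"

lemma branch_subset: "branch \<subseteq> M"
  by (auto simp: branch_def)

lemma closure_branch: "closure branch \<subseteq> branch \<union> {p} \<union> (M \<inter> Y)"
  using closure_minimal[OF branch_subset linkedD(1)[OF linked]] by (auto simp: branch_def)

text \<open>
  By minimality, removing a relatively open part \<open>Q\<close> of the branch creates a compact open part
  around \<open>p\<close>. The parts obtained from both sides of a separation of the branch would unite to one
  in \<open>M\<close>.
\<close>

lemma part_of_separation:
  assumes Q: "Q \<noteq> {}" "P \<union> Q = branch" "closure P \<inter> Q = {}"
  obtains B where "compact_open_part (P \<union> {p} \<union> (M \<inter> Y)) p B" "B \<inter> Y = {}"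
proof -
  let ?X = "P \<union> {p} \<union> (M \<inter> Y)"
  have "closure P \<subseteq> ?X" using closure_mono[of P branch] closure_branch Q(2,3) by blast
  then have "?X = closure P \<union> {p} \<union> (M \<inter> Y)" using closure_subset[of P] by blast
  moreover have "closed (closure P \<union> {p} \<union> (M \<inter> Y))"
    using linkedD(1)[OF linked] Y(1) by (intro closed_Un closed_Int) auto
  ultimately have "closed ?X" by (simp only:)
  moreover have "?X \<subseteq> M" using Q(2) branch_subset linkedD(2)[OF linked] by blast
  moreover have "?X \<noteq> M"
  proof
    assume "?X = M"
    moreover obtain q where "q \<in> Q" using Q(1) by blast
    ultimately have "q \<in> P" using Q(2) by (auto simp: branch_def)
    then show False using Q(3) \<open>q \<in> Q\<close> closure_subset[of P] by blast
  qed
  ultimately have "\<not> linked ?X p Y" using minimal by blast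
  then show ?thesis using \<open>closed ?X\<close> that by (auto simp: linked_def)
qed

lemma no_separation:
  assumes PQ: "P \<noteq> {}" "Q \<noteq> {}" "P \<union> Q = branch" "closure P \<inter> Q = {}" "closure Q \<inter> P = {}"
  shows False
proof -
  let ?X = "P \<union> {p} \<union> (M \<inter> Y)" and ?Z = "Q \<union> {p} \<union> (M \<inter> Y)"
  obtain B1 where B1: "compact_open_part ?X p B1" "B1 \<inter> Y = {}"
    using part_of_separation[OF PQ(2,3,4)] .
  obtain B2 where B2: "compact_open_part ?Z p B2" "B2 \<inter> Y = {}"
    using part_of_separation[of P Q] PQ by blast
  have parts: "B1 \<subseteq> ?X" "p \<in> B1" "B2 \<subseteq> ?Z" "p \<in> B2" using B1(1) B2(1) by (auto simp: compact_open_part_def)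
  have M: "?X \<subseteq> M" "?Z \<subseteq> M" "M \<subseteq> ?X \<union> ?Z" using PQ(3) linkedD(2)[OF linked] by (auto simp: branch_def)
  have "P \<inter> Q = {}" using PQ(4) closure_subset[of P] by blast
  then have "?X \<inter> ?Z \<subseteq> {p} \<union> Y" by blast
  then have "B1 \<inter> ?Z \<subseteq> {p}" "B2 \<inter> ?X \<subseteq> {p}" using parts(1,3) B1(2) B2(2) by blast+
  then have "M - (B1 \<union> B2) = (?X - B1) \<union> (?Z - B2)" using parts(2,4) M by blast
  moreover have "closed (?X - B1)" "closed (?Z - B2)" using B1(1) B2(1) by (simp_all only: compact_open_part_def)
  ultimately have "closed (M - (B1 \<union> B2))" by (simp only: closed_Un)
  moreover have "B1 \<union> B2 \<subseteq> M" using parts(1,3) M by blast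
  ultimately have "compact_open_part M p (B1 \<union> B2)" using B1(1) B2(1) by (simp add: compact_open_part_def compact_Un)
  from linkedD(3)[OF linked this] show False using B1(2) B2(2) by blast
qed

lemma connected_branch: "connected branch"
proof (rule ccontr)
  assume "\<not> ?thesis"
  then obtain P Q where PQ: "closed P" "closed Q" "branch \<subseteq> P \<union> Q" "P \<inter> Q \<inter> branch = {}" "P \<inter> branch \<noteq> {}" "Q \<inter> branch \<noteq> {}"
    unfolding connected_closed by blast
  have "closure (P \<inter> branch) \<subseteq> P" "closure (Q \<inter> branch) \<subseteq> Q" using PQ(1,2) by (simp_all add: closure_minimal)
  then have "closure (P \<inter> branch) \<inter> (Q \<inter> branch) = {}" "closure (Q \<inter> branch) \<inter> (P \<inter> branch) = {}" using PQ(4) by auto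
  moreover have "P \<inter> branch \<union> Q \<inter> branch = branch" using PQ(3) by auto
  ultimately show False using no_separation[OF PQ(5,6)] by simp
qed

lemma start_in_closure_branch: "p \<in> closure branch"
proof (rule ccontr)
  assume "p \<notin> closure branch"
  then have "M - {p} = closure branch \<union> (M \<inter> Y)" using closure_branch closure_subset[of branch] Y(2) by (auto simp: branch_def)
  then have "closed (M - {p})" using linkedD(1)[OF linked] Y(1) by (simp add: closed_Un closed_Int)
  then have "compact_open_part M p {p}" using linkedD(2)[OF linked] by (simp add: compact_open_part_def)
  from linkedD(3)[OF linked this] show False using Y(2) by simp
qed

lemma closure_bounded_branch_meets:
  assumes "bounded branch"
  shows "closure branch \<inter> Y \<noteq> {}"
proof
  assume "closure branch \<inter> Y = {}"
  then have "insert p branch = insert p (closure branch)" using closure_branch closure_subset[of branch] by blast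
  then have "closed (insert p branch)" by simp
  moreover have sub: "insert p branch \<subseteq> M" using branch_subset linkedD(2)[OF linked] by blast
  ultimately have "compact (insert p branch)" using compact assms by (auto simp: boundedly_compact_def)
  moreover have "M - insert p branch = M \<inter> Y" using Y(2) by (auto simp: branch_def)
  then have "closed (M - insert p branch)" using linkedD(1)[OF linked] Y(1) by (simp add: closed_Int)
  ultimately have "compact_open_part M p (insert p branch)" using sub by (simp add: compact_open_part_def)
  from linkedD(3)[OF linked this] show False using Y(2) by (auto simp: branch_def)
qed

end

lemma linked_cball:
  assumes M: "linked M p Y" and disjoint: "M \<inter> Y \<inter> cball p \<delta> = {}" and \<delta>: "0 < \<delta>"
  shows "linked (M \<inter> cball p \<delta>) p (M \<inter> sphere p \<delta>)"
  unfolding linked_def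
proof (intro conjI allI impI)
  show "closed (M \<inter> cball p \<delta>)" "p \<in> M \<inter> cball p \<delta>" using linkedD(1,2)[OF M] \<delta> by auto
  fix B assume B: "compact_open_part (M \<inter> cball p \<delta>) p B"
  show "B \<inter> (M \<inter> sphere p \<delta>) \<noteq> {}"
  proof
    assume off_sphere: "B \<inter> (M \<inter> sphere p \<delta>) = {}"
    have "B \<subseteq> ball p \<delta>"
    proof
      fix x assume "x \<in> B"
      then have "dist p x \<le> \<delta>" "dist p x \<noteq> \<delta>" using B off_sphere by (auto simp: compact_open_part_def)
      then show "x \<in> ball p \<delta>" by simp
    qed
    then have "M - B = (M \<inter> cball p \<delta> - B) \<union> (M - ball p \<delta>)" by auto
    moreover have "closed (M - ball p \<delta>)" using linkedD(1)[OF M] by (intro closed_Diff) auto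
    ultimately have "compact_open_part M p B" using B by (auto simp: compact_open_part_def closed_Un)
    from linkedD(3)[OF M this] show False using B disjoint by (auto simp: compact_open_part_def)
  qed
qed

definition links_to_sphere :: "'a::metric_space set \<Rightarrow> 'a \<Rightarrow> real \<Rightarrow> 'a set \<Rightarrow> bool" where
  "links_to_sphere S p \<delta> C \<longleftrightarrow> closed C \<and> connected C \<and> C \<subseteq> S \<inter> cball p \<delta> \<and> p \<in> C \<and> C \<inter> sphere p \<delta> \<noteq> {}"

lemma links_to_sphere_exists:
  assumes M: "linked M p Y" "boundedly_compact M" and \<delta>: "M \<inter> Y \<inter> cball p \<delta> = {}" "0 < \<delta>"
  obtains C where "links_to_sphere M p \<delta> C"
proof -
  have "closed (sphere p \<delta>)" unfolding sphere_def by (intro closed_Collect_eq continuous_intros)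
  then have "closed (M \<inter> sphere p \<delta>)" using linkedD(1)[OF M(1)] by (rule closed_Int[rotated])
  moreover have "boundedly_compact (M \<inter> cball p \<delta>)" by (rule boundedly_compact_subset[OF M(2)]) simp
  moreover have "p \<notin> M \<inter> sphere p \<delta>" using \<delta>(2) by simp
  ultimately obtain D where D: "D \<subseteq> M \<inter> cball p \<delta>" "minimal_linked D (M \<inter> sphere p \<delta>) p"
    using minimal_linked_exists[OF linked_cball[OF M(1) \<delta>]] by blast
  interpret minimal_linked D "M \<inter> sphere p \<delta>" p by (rule D(2))
  have "bounded branch" by (rule bounded_subset[OF bounded_cball[of p \<delta>]]) (use D(1) branch_subset in blast)
  moreover have "closure branch \<subseteq> D" by (rule closure_minimal[OF branch_subset linkedD(1)[OF linked]])
  ultimately have "links_to_sphere M p \<delta> (closure branch)"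
    using D(1) start_in_closure_branch closure_bounded_branch_meets connected_imp_connected_closure[OF connected_branch]
    by (auto simp: links_to_sphere_def)
  then show ?thesis by (rule that)
qed

section \<open>The bifurcating branches\<close>

instance prod :: (perfect_space, topological_space) perfect_space
proof
  show "\<not> open {x}" for x :: "'a \<times> 'b"
    using open_image_fst[of "{x}"] not_open_singleton[of "fst x"] by auto
qed

definition global_alternative :: "real \<Rightarrow> 'u::real_normed_vector set \<Rightarrow> (real \<times> 'u) set \<Rightarrow> bool" where
  "global_alternative l0 Z E \<longleftrightarrow>
     \<not> compact E \<or> (\<exists>l1. l1 \<noteq> l0 \<and> (l1, 0) \<in> E) \<or> (\<exists>l z. z \<in> Z - {0} \<and> (l, z) \<in> E)"

lemma links_to_sphere_component:
  assumes "links_to_sphere S p \<delta> C"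
  shows "links_to_sphere (connected_component_set S p) p \<delta> C"
  using assms connected_component_maximal[of p C S] by (auto simp: links_to_sphere_def)

context simple_eigenvalue
begin

definition hyperplane_solutions :: "(real \<times> 'u) set" where
  "hyperplane_solutions = solutions \<inter> {x. \<phi>s (snd x) = 0} - {p0}"

lemma closed_hyperplane_solutions: "closed hyperplane_solutions"
proof -
  obtain r where r: "r > 0" "\<And>x. x \<in> solutions \<Longrightarrow> x \<noteq> p0 \<Longrightarrow> dist p0 x < r \<Longrightarrow> 0 * norm (snd x) < \<bar>\<phi>s (snd x)\<bar>"
    using solutions_in_cone[OF zero_less_one] by blast
  have "x \<notin> hyperplane_solutions" if "x \<in> ball p0 r" for x
    using r(2)[of x] that by (auto simp: hyperplane_solutions_def)
  then have "hyperplane_solutions = solutions \<inter> {x. \<phi>s (snd x) = 0} - ball p0 r"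
    using r(1) by (auto simp: hyperplane_solutions_def)
  moreover have "closed {x :: real \<times> 'u. \<phi>s (snd x) = 0}" by (intro closed_Collect_eq continuous_intros)
  ultimately show ?thesis using closed_solutions by (simp add: closed_Diff closed_Int)
qed

lemma linked_positive_solutions: "linked positive_solutions p0 hyperplane_solutions"
  unfolding linked_def
proof (intro conjI allI impI)
  have "closed {x :: real \<times> 'u. 0 \<le> \<phi>s (snd x)}" by (intro closed_Collect_le continuous_intros)
  then show "closed positive_solutions" using closed_solutions by (simp add: positive_solutions_def closed_Int)
  show "p0 \<in> positive_solutions" using eigenvalue_solution by (simp add: positive_solutions_def)
  show "B \<inter> hyperplane_solutions \<noteq> {}" if "compact_open_part positive_solutions p0 B" for B
    using compact_open_part_meets_hyperplane[of B] that
    by (auto simp: compact_open_part_def hyperplane_solutions_def positive_solutions_def)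
qed

lemma boundedly_compact_solutions: "boundedly_compact solutions"
  using compact_solutions by (auto simp: boundedly_compact_def)

lemma global_alternative_if_meets_hyperplane:
  assumes "compact E \<Longrightarrow> E \<inter> hyperplane_solutions \<noteq> {}"
  shows "global_alternative l0 (null_space \<phi>s) E"
  unfolding global_alternative_def
proof (rule disjCI)
  assume "\<not> ((\<exists>l1. l1 \<noteq> l0 \<and> (l1, 0) \<in> E) \<or> (\<exists>l z. z \<in> null_space \<phi>s - {0} \<and> (l, z) \<in> E))"
  then have "E \<inter> hyperplane_solutions = {}" by (fastforce simp: hyperplane_solutions_def null_space_def)
  then show "\<not> compact E" using assms by blast
qed

theorem positive_branch:
  obtains D where "D \<in> components (solutions - {p0})" "global_alternative l0 (null_space \<phi>s) (D \<union> {p0})"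
    "\<And>\<delta>. 0 < \<delta> \<Longrightarrow> hyperplane_solutions \<inter> cball p0 \<delta> = {} \<Longrightarrow>
      \<exists>C. links_to_sphere solutions p0 \<delta> C \<and> C - {p0} \<subseteq> D \<inter> {x. 0 < \<phi>s (snd x)}"
proof -
  have sub: "positive_solutions \<subseteq> solutions" by (simp add: positive_solutions_def)
  obtain M where M: "M \<subseteq> positive_solutions" "minimal_linked M hyperplane_solutions p0"
    using minimal_linked_exists[OF linked_positive_solutions boundedly_compact_subset[OF boundedly_compact_solutions sub]
      closed_hyperplane_solutions] by (auto simp: hyperplane_solutions_def)
  interpret minimal_linked M hyperplane_solutions p0 by (rule M(2))
  have branch_sub: "branch \<subseteq> solutions - {p0}" using M(1) sub by (auto simp: branch_def)
  have "branch \<noteq> {}" using start_in_closure_branch by auto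
  then obtain D where D: "D \<in> components (solutions - {p0})" "branch \<subseteq> D"
    using exists_component_superset[OF branch_sub _ connected_branch] branch_sub by blast
  have "global_alternative l0 (null_space \<phi>s) (D \<union> {p0})"
  proof (rule global_alternative_if_meets_hyperplane)
    assume compact_D: "compact (D \<union> {p0})"
    have "bounded branch" by (rule bounded_subset[OF compact_imp_bounded[OF compact_D]]) (use D(2) in auto)
    then have "closure branch \<inter> hyperplane_solutions \<noteq> {}" by (rule closure_bounded_branch_meets)
    moreover have "closure branch \<subseteq> D \<union> {p0}"
      using D(2) by (intro closure_minimal compact_imp_closed[OF compact_D]) auto
    ultimately show "(D \<union> {p0}) \<inter> hyperplane_solutions \<noteq> {}" by blast
  qed
  moreover have "\<exists>C. links_to_sphere solutions p0 \<delta> C \<and> C - {p0} \<subseteq> D \<inter> {x. 0 < \<phi>s (snd x)}"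
    if \<delta>: "0 < \<delta>" "hyperplane_solutions \<inter> cball p0 \<delta> = {}" for \<delta>
  proof -
    have "M \<inter> hyperplane_solutions \<inter> cball p0 \<delta> = {}" using \<delta>(2) by blast
    then obtain C where C: "links_to_sphere M p0 \<delta> C" using links_to_sphere_exists[OF linked compact _ \<delta>(1)] by blast
    have C_sub: "C \<subseteq> M" "C \<subseteq> cball p0 \<delta>" using C by (auto simp: links_to_sphere_def)
    then have off: "C \<inter> hyperplane_solutions = {}" using \<delta>(2) by blast
    have "0 < \<phi>s (snd x)" if "x \<in> C - {p0}" for x
    proof -
      have "x \<in> positive_solutions" "x \<notin> hyperplane_solutions" using that off C_sub(1) M(1) by blast+
      then show ?thesis using that by (auto simp: positive_solutions_def hyperplane_solutions_def)
    qed
    moreover have "C - {p0} \<subseteq> D" using off C_sub(1) D(2) by (auto simp: branch_def)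
    moreover have "links_to_sphere solutions p0 \<delta> C" using C M(1) sub by (auto simp: links_to_sphere_def)
    ultimately show ?thesis by blast
  qed
  ultimately show ?thesis using D(1) that by blast
qed

lemma reflected: "simple_eigenvalue F F' l0 (- \<phi>0) L' (- \<phi>s)"
proof unfold_locales
  have "span {- \<phi>0} = span {\<phi>0}" by (auto simp: span_singleton intro: range_eqI[of _ _ "- _"])
  then show "null_space L0 = span {- \<phi>0}" using ker by simp
  show "L' (- \<phi>0) \<notin> range L0"
    using transversal subspace_neg[OF subspace_range_blinfun, of "L' (- \<phi>0)" L0] by (auto simp: blinfun.minus_right)
qed (simp_all add: trivial proper isolated norm_\<phi>0 deriv_L \<phi>s_\<phi>0 blinfun.minus_left blinfun.minus_right)

end

locale eigenvalue_cones = simple_eigenvalue F F' l0 \<phi>0 L' \<phi>s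
  for F :: "real \<times> 'u::banach \<Rightarrow> 'v::banach" and F' l0 \<phi>0 L' \<phi>s +
  fixes \<psi> :: "'u \<Rightarrow> real" and c2 \<eta> :: real
  assumes \<psi>: "\<And>u. 0 \<le> \<psi> u" "\<And>u. \<psi> u \<le> c2 * norm u" and \<eta>: "0 < \<eta>" "\<eta> * c2 < 1"
begin

abbreviation "component \<equiv> connected_component_set solutions p0"

abbreviation in_cone :: "real \<Rightarrow> real \<Rightarrow> bool" where
  "in_cone \<epsilon> \<delta> \<equiv> (solutions - {p0}) \<inter> cball p0 \<delta> \<subseteq> cone_Q l0 \<phi>s \<psi> \<epsilon> \<eta>"

lemma in_cone_near:
  assumes \<epsilon>: "0 < \<epsilon>"
  shows "\<exists>\<delta>0>0. \<forall>\<delta>\<in>{0<..<\<delta>0}. in_cone \<epsilon> \<delta>"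
proof -
  obtain r where r: "r > 0" "\<And>x. x \<in> solutions \<Longrightarrow> x \<noteq> p0 \<Longrightarrow> dist p0 x < r \<Longrightarrow> \<eta> * c2 * norm (snd x) < \<bar>\<phi>s (snd x)\<bar>"
    using solutions_in_cone[OF \<eta>(2)] by blast
  have "(l, u) \<in> cone_Q l0 \<phi>s \<psi> \<epsilon> \<eta>" if "(l, u) \<in> solutions" "(l, u) \<noteq> p0" "dist p0 (l, u) < min r \<epsilon>" for l u
  proof -
    have "\<eta> * \<psi> u \<le> \<eta> * (c2 * norm u)" using \<psi>(2) \<eta>(1) by (intro mult_left_mono) auto
    moreover have "dist l0 l \<le> dist p0 (l, u)" using dist_fst_le[of p0 "(l, u)"] by simp
    ultimately show ?thesis using r(2)[of "(l, u)"] that by (simp add: cone_Q_def dist_real_def abs_minus_commute)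
  qed
  then have "\<forall>\<delta>\<in>{0<..<min r \<epsilon>}. in_cone \<epsilon> \<delta>" by (force simp del: min_less_iff_conj)
  then show ?thesis using r(1) \<epsilon> by (intro exI[of _ "min r \<epsilon>"]) auto
qed

lemma in_cone_off_hyperplane:
  assumes "in_cone \<epsilon> \<delta>"
  shows "hyperplane_solutions \<inter> cball p0 \<delta> = {}"
proof -
  have "0 \<le> \<eta> * \<psi> u" for u using \<psi>(1) \<eta>(1) by simp
  then have "\<phi>s (snd x) \<noteq> 0" if "x \<in> cone_Q l0 \<phi>s \<psi> \<epsilon> \<eta>" for x
    using that by (fastforce simp: cone_Q_def not_less[symmetric])
  then show ?thesis using assms by (auto simp: hyperplane_solutions_def)
qed

lemma cones_disjoint: "cone_Qplus l0 \<phi>s \<psi> \<epsilon> \<eta> \<inter> cone_Qminus l0 \<phi>s \<psi> \<epsilon> \<eta> = {}"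
proof (rule equals0I)
  fix x assume "x \<in> cone_Qplus l0 \<phi>s \<psi> \<epsilon> \<eta> \<inter> cone_Qminus l0 \<phi>s \<psi> \<epsilon> \<eta>"
  moreover have "0 \<le> \<eta> * \<psi> (snd x)" using \<psi>(1) \<eta>(1) by simp
  ultimately show False by (auto simp: cone_Qplus_def cone_Qminus_def)
qed

lemma cone_Q_half:
  assumes "x \<in> cone_Q l0 \<phi>s \<psi> \<epsilon> \<eta>"
  shows "0 < \<phi>s (snd x) \<Longrightarrow> x \<in> cone_Qplus l0 \<phi>s \<psi> \<epsilon> \<eta>" "\<phi>s (snd x) < 0 \<Longrightarrow> x \<in> cone_Qminus l0 \<phi>s \<psi> \<epsilon> \<eta>"
  using assms by (auto simp: cone_Q_def cone_Qplus_def cone_Qminus_def)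

definition opposite_continua :: "real \<Rightarrow> real \<Rightarrow> (real \<times> 'u) set \<Rightarrow> (real \<times> 'u) set \<Rightarrow> bool" where
  "opposite_continua \<epsilon> \<delta> Cp Cm \<longleftrightarrow> links_to_sphere component p0 \<delta> Cp \<and> links_to_sphere component p0 \<delta> Cm \<and>
     Cp \<inter> Cm = {p0} \<and> Cp \<subseteq> cone_Qplus l0 \<phi>s \<psi> \<epsilon> \<eta> \<union> {p0} \<and> Cm \<subseteq> cone_Qminus l0 \<phi>s \<psi> \<epsilon> \<eta> \<union> {p0}"

theorem branches_in_cones:
  obtains Dp Dm where "Dp \<in> components (solutions - {p0})" "Dm \<in> components (solutions - {p0})"
    "\<forall>E\<in>{Dp \<union> {p0}, Dm \<union> {p0}}. global_alternative l0 (null_space \<phi>s) E"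
    "\<And>\<epsilon> \<delta>. 0 < \<delta> \<Longrightarrow> in_cone \<epsilon> \<delta> \<Longrightarrow> \<exists>Cp Cm. opposite_continua \<epsilon> \<delta> Cp Cm \<and> Cp - {p0} \<subseteq> Dp \<and> Cm - {p0} \<subseteq> Dm"
proof -
  interpret neg: simple_eigenvalue F F' l0 "- \<phi>0" L' "- \<phi>s" by (rule reflected)
  have neg: "null_space (- \<phi>s) = null_space \<phi>s" "neg.hyperplane_solutions = hyperplane_solutions"
    by (simp_all add: null_space_def hyperplane_solutions_def neg.hyperplane_solutions_def blinfun.minus_left)
  obtain Dp where Dp: "Dp \<in> components (solutions - {p0})" "global_alternative l0 (null_space \<phi>s) (Dp \<union> {p0})"
      "\<And>\<delta>. 0 < \<delta> \<Longrightarrow> hyperplane_solutions \<inter> cball p0 \<delta> = {} \<Longrightarrow>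
        \<exists>C. links_to_sphere solutions p0 \<delta> C \<and> C - {p0} \<subseteq> Dp \<inter> {x. 0 < \<phi>s (snd x)}"
    by (rule positive_branch) (rule that)
  obtain Dm where Dm: "Dm \<in> components (solutions - {p0})" "global_alternative l0 (null_space \<phi>s) (Dm \<union> {p0})"
      "\<And>\<delta>. 0 < \<delta> \<Longrightarrow> hyperplane_solutions \<inter> cball p0 \<delta> = {} \<Longrightarrow>
        \<exists>C. links_to_sphere solutions p0 \<delta> C \<and> C - {p0} \<subseteq> Dm \<inter> {x. 0 < (- \<phi>s) (snd x)}"
    by (rule neg.positive_branch[unfolded neg]) (rule that)
  show ?thesis
  proof (rule that[OF Dp(1) Dm(1)])
    show "\<forall>E\<in>{Dp \<union> {p0}, Dm \<union> {p0}}. global_alternative l0 (null_space \<phi>s) E" using Dp(2) Dm(2) by simp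
    fix \<epsilon> \<delta> :: real assume \<delta>: "0 < \<delta>" and cone: "in_cone \<epsilon> \<delta>"
    obtain Cp where Cp: "links_to_sphere solutions p0 \<delta> Cp" "Cp - {p0} \<subseteq> Dp \<inter> {x. 0 < \<phi>s (snd x)}"
      using Dp(3)[OF \<delta> in_cone_off_hyperplane[OF cone]] by blast
    obtain Cm where Cm: "links_to_sphere solutions p0 \<delta> Cm" "Cm - {p0} \<subseteq> Dm \<inter> {x. 0 < (- \<phi>s) (snd x)}"
      using Dm(3)[OF \<delta> in_cone_off_hyperplane[OF cone]] by blast
    have in_Q: "x \<in> cone_Q l0 \<phi>s \<psi> \<epsilon> \<eta>" if "links_to_sphere solutions p0 \<delta> C" "x \<in> C - {p0}" for x C
      using that cone unfolding links_to_sphere_def by blast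
    have plus: "x \<in> cone_Qplus l0 \<phi>s \<psi> \<epsilon> \<eta>" if "x \<in> Cp - {p0}" for x
      using cone_Q_half(1)[OF in_Q[OF Cp(1) that]] Cp(2) that by blast
    have minus: "x \<in> cone_Qminus l0 \<phi>s \<psi> \<epsilon> \<eta>" if "x \<in> Cm - {p0}" for x
      using cone_Q_half(2)[OF in_Q[OF Cm(1) that]] subsetD[OF Cm(2) that] by (simp add: blinfun.minus_left)
    have "p0 \<in> Cp" "p0 \<in> Cm" using Cp(1) Cm(1) by (simp_all add: links_to_sphere_def)
    moreover have "x = p0" if "x \<in> Cp" "x \<in> Cm" for x
      using plus[of x] minus[of x] cones_disjoint[of \<epsilon>] that by blast
    ultimately have "Cp \<inter> Cm = {p0}" by blast
    moreover have "Cp \<subseteq> cone_Qplus l0 \<phi>s \<psi> \<epsilon> \<eta> \<union> {p0}" "Cm \<subseteq> cone_Qminus l0 \<phi>s \<psi> \<epsilon> \<eta> \<union> {p0}"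
      using plus minus by blast+
    ultimately have "opposite_continua \<epsilon> \<delta> Cp Cm"
      using Cp(1) Cm(1) by (simp add: opposite_continua_def links_to_sphere_component)
    then show "\<exists>Cp Cm. opposite_continua \<epsilon> \<delta> Cp Cm \<and> Cp - {p0} \<subseteq> Dp \<and> Cm - {p0} \<subseteq> Dm"
      using Cp(2) Cm(2) by blast
  qed
qed

end

theorem theorem9p5:
  fixes F :: "real \<times> 'u::banach \<Rightarrow> 'v::banach"
    and l0 c1 c2 \<eta> :: real
    and \<phi>0 :: 'u
    and L' :: "'u \<Rightarrow>\<^sub>L 'v"
    and Z :: "'u set"
    and \<phi>s :: "'u \<Rightarrow>\<^sub>L real"
    and \<psi> :: "'u \<Rightarrow> real"
  assumes C1: "C1_on UNIV F"
    and F1: "\<And>l. F (l, 0) = 0"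
    and F2: "orientable F"
    and F3: "\<And>l u. D_u F (l, u) \<in> Fredholm0"
    and F4: "proper_on_closed_bounded F"
    and F5: "l0 isolated_in gen_spectrum (linearization F)"
      "null_space (linearization F l0) = span {\<phi>0}"
      "norm \<phi>0 = 1"
      "(linearization F has_vector_derivative L') (at l0)"
      "blinfun_apply L' \<phi>0 \<notin> range (blinfun_apply (linearization F l0))"
    and Z: "closed Z" "direct_sum_decomposition (null_space (linearization F l0)) Z"
    and \<phi>s: "Z = null_space \<phi>s" "blinfun_apply \<phi>s \<phi>0 = 1"
    and \<psi>: "continuous_on UNIV \<psi>" "0 < c1" "c1 < c2" "\<psi> 0 = 0"
      "\<And>u. c1 * norm u \<le> \<psi> u" "\<And>u. \<psi> u \<le> c2 * norm u"
    and \<psi>_C1: "C1_on (- {0}) \<psi>"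
    and \<eta>: "0 < \<eta>" "\<eta> < 1 / c2"
  shows "\<exists>C \<in> components (nontrivial_solutions F). (l0, 0) \<in> C \<and>
    (\<exists>\<epsilon>0>0. \<forall>\<epsilon>\<in>{0<..<\<epsilon>0}. \<exists>\<delta>0>0. \<forall>\<delta>\<in>{0<..<\<delta>0}.
       (nontrivial_solutions F - {(l0, 0)}) \<inter> cball (l0, 0) \<delta> \<subseteq> cone_Q l0 \<phi>s \<psi> \<epsilon> \<eta>) \<and>
    (\<forall>\<epsilon>>0. \<forall>\<delta>>0.
       (nontrivial_solutions F - {(l0, 0)}) \<inter> cball (l0, 0) \<delta> \<subseteq> cone_Q l0 \<phi>s \<psi> \<epsilon> \<eta> \<longrightarrow>
       (\<exists>Cp Cm.
          closed Cp \<and> connected Cp \<and> Cp \<subseteq> C \<inter> cball (l0, 0) \<delta> \<and>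
          closed Cm \<and> connected Cm \<and> Cm \<subseteq> C \<inter> cball (l0, 0) \<delta> \<and>
          Cp \<subseteq> cone_Qplus l0 \<phi>s \<psi> \<epsilon> \<eta> \<union> {(l0, 0)} \<and>
          Cm \<subseteq> cone_Qminus l0 \<phi>s \<psi> \<epsilon> \<eta> \<union> {(l0, 0)} \<and>
          Cp \<inter> Cm = {(l0, 0)} \<and>
          Cp \<inter> frontier (cball (l0, 0) \<delta>) \<noteq> {} \<and>
          Cm \<inter> frontier (cball (l0, 0) \<delta>) \<noteq> {} \<and>
          (\<exists>Dp \<in> components (nontrivial_solutions F - {(l0, 0)}).
           \<exists>Dm \<in> components (nontrivial_solutions F - {(l0, 0)}).
             Cp - {(l0, 0)} \<subseteq> Dp \<and> Cm - {(l0, 0)} \<subseteq> Dm \<and>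
             (\<forall>E \<in> {Dp \<union> {(l0, 0)}, Dm \<union> {(l0, 0)}}.
                \<not> compact E \<or>
                (\<exists>l1. l1 \<noteq> l0 \<and> (l1, 0) \<in> E) \<or>
                (\<exists>l z. z \<in> Z - {0} \<and> (l, z) \<in> E)))))"
proof -
  obtain F' where "C1_map F F'" using C1 by (auto simp: C1_on_def C1_map_def)
  moreover have "0 \<le> \<psi> u" for u using \<psi>(2) \<psi>(5)[of u] order_trans[OF mult_nonneg_nonneg[of c1 "norm u"]] by simp
  moreover have "\<eta> * c2 < 1" using \<eta> \<psi>(2,3) by (simp add: pos_less_divide_eq)
  ultimately interpret eigenvalue_cones F F' l0 \<phi>0 L' \<phi>s \<psi> c2 \<eta>
    using F1 F3 F4 F5 \<phi>s(2) \<psi>(6) \<eta>(1)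
    by (intro eigenvalue_cones.intro simple_eigenvalue.intro Fredholm_family.intro Fredholm_family_axioms.intro
      simple_eigenvalue_axioms.intro eigenvalue_cones_axioms.intro) auto
  obtain Dp Dm where D: "Dp \<in> components (solutions - {p0})" "Dm \<in> components (solutions - {p0})"
      "\<forall>E\<in>{Dp \<union> {p0}, Dm \<union> {p0}}. global_alternative l0 Z E"
    and local: "\<And>\<epsilon> \<delta>. 0 < \<delta> \<Longrightarrow> in_cone \<epsilon> \<delta> \<Longrightarrow> \<exists>Cp Cm. opposite_continua \<epsilon> \<delta> Cp Cm \<and> Cp - {p0} \<subseteq> Dp \<and> Cm - {p0} \<subseteq> Dm"
    by (rule branches_in_cones) (rule that[unfolded \<phi>s(1)])
  show ?thesis (is "\<exists>C\<in>_. _ \<and> ?cones \<and> (\<forall>\<epsilon>>0. \<forall>\<delta>>0. _ \<longrightarrow> ?local C \<epsilon> \<delta>)")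
  proof (intro bexI[of _ component] conjI allI impI)
    show "component \<in> components solutions" "p0 \<in> component" using eigenvalue_solution by (auto simp: components_def)
    show ?cones using in_cone_near by (intro exI[of _ 1]) simp
    fix \<epsilon> \<delta> :: real assume "0 < \<delta>" "in_cone \<epsilon> \<delta>"
    from local[OF this] obtain Cp Cm where "opposite_continua \<epsilon> \<delta> Cp Cm" "Cp - {p0} \<subseteq> Dp" "Cm - {p0} \<subseteq> Dm"
      by (elim exE conjE) (rule that)
    with D show "?local component \<epsilon> \<delta>"
      unfolding opposite_continua_def links_to_sphere_def global_alternative_def frontier_cball
      by (elim conjE) blast
  qed
qed

end
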